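(* Let $m\ge 0$ be an integer. If $m=0$, let $X$ be a compact metric space and $c\in C(X\times X)$; if $m\ge 1$, let $X$ be the closure of a bounded open set in $\mathbb{R}^d$ and $c\in C^{(m,m)}(X\times X)$. In both cases let $\varepsilon>0$ and assume that $c$ is symmetric, non-negative, and that $k_c=\exp(-c/\varepsilon)$ is a positive definite universal kernel on $X$. Let $\mu\in\mathcal{P}(X)$ and let $(\mu_t)_{t\in(-\tau,\tau)}$ (for some $\tau>0$) be a $C^m$-perturbation of $\mu=\mu_0$, with derivative $\dot\mu\in C^m(X)^*$ at $t=0$. Then $$\lim_{t\to 0}\frac{S_\varepsilon(\mu,\mu_t)}{t^2}=\frac{\varepsilon}{2}\left\langle \dot\mu,\,(\mathrm{id}-K_\mu^2)^{-1}H_\mu[\dot\mu]\right\rangle .$$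
   Context: Notation. $\mathcal{P}(X)$: Radon probability measures on $X$. $C^m(X)$ has norm $\|\phi\|_{C^m}=\sup_{|\alpha|\le m}\|\partial^\alpha\phi\|_\infty$ ($C^0(X)=C(X)$), with dual $C^m(X)^*$; $C^{(m,m)}(X\times X)$ is the space of functions all of whose mixed partial derivatives of order at most $m$ in the first variable and at most $m$ in the second variable are continuous. A kernel is universal if its reproducing kernel Hilbert space is dense in $C(X)$ for the supremum norm. Entropic optimal transport: $\mathrm{OT}_\varepsilon(\mu,\nu)=\inf_{\pi\in\Pi(\mu,\nu)}\iint c\,d\pi+\varepsilon\,\mathrm{KL}(\pi\,|\,\mu\otimes\nu)$, where $\Pi(\mu,\nu)$ is the set of couplings of $\mu,\nu$ and $\mathrm{KL}$ is the Kullback--Leibler divergence. Sinkhorn divergence: $S_\varepsilon(\mu,\nu)=\mathrm{OT}_\varepsilon(\mu,\nu)-\frac12\mathrm{OT}_\varepsilon(\mu,\mu)-\frac12\mathrm{OT}_\varepsilon(\nu,\nu)$. $C^m$-perturbation: a path $(\mu_t)_{t\in(-\tau,\tau)}$ in $\mathcal{P}(X)$ which is continuously differentiable in $C^m(X)^*$ endowed with the weak-$*$ topology: for any $\phi\in C^m(X)$ the map $t\mapsto\langle\mu_t,\phi\rangle$ is differentiable, its derivative, denoted $\langle\dot\mu_t,\phi\rangle$, is linear in $\phi$, and $(\phi,t)\mapsto\langle\dot\mu_t,\phi\rangle$ is jointly continuous from $C^m(X)\times(-\tau,\tau)$ to $\mathbb{R}$. One writes $\dot\mu=\dot\mu_0$.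 Self-transport potential and operators: $f_{\mu,\mu}\in C(X)$ is the unique function with $\int_X\exp\left(\frac1\varepsilon(f_{\mu,\mu}(x)+f_{\mu,\mu}(y)-c(x,y))\right)d\mu(x)=1$ for all $y\in X$; $k_\mu(x,y)=\exp\left(\frac1\varepsilon(f_{\mu,\mu}(x)+f_{\mu,\mu}(y)-c(x,y))\right)$, which is of class $C^{(m,m)}$; $K_\mu[\phi](y)=\int_X\phi(x)k_\mu(x,y)\,d\mu(x)$; $H_\mu:C^m(X)^*\to C^m(X)$, $H_\mu[\nu](y)=\langle\nu,k_\mu(\cdot,y)\rangle$. Meaning of the right-hand side: $K_\mu$ maps constants to themselves, so it acts on the quotient $C^m(X)/\mathbb{R}$ by constant functions; $\mathrm{id}-K_\mu^2$ is boundedly invertible on $C^m(X)/\mathbb{R}$, and since $\langle\dot\mu,1\rangle=0$ the pairing of $\dot\mu$ with an element of $C^m(X)/\mathbb{R}$ is well defined. *)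

theory Defs
  imports "HOL-Probability.Probability"
begin

section \<open>Conventions\<close>

text \<open>
  The space \<open>X\<close> is a set. A function on \<open>X\<close> is a total function of which only the values on \<open>X\<close>
  matter. A measure on \<open>X\<close> has \<open>X\<close> itself as its space, so that integrals ignore the values
  outside \<open>X\<close>.
\<close>

definition radon_probs :: "'a::metric_space set \<Rightarrow> 'a measure set" where
  "radon_probs X = {\<mu>. prob_space \<mu> \<and> sets \<mu> = sets (restrict_space borel X) \<and>
     (\<forall>A\<in>sets \<mu>. emeasure \<mu> A = (SUP K\<in>{K. compact K \<and> K \<subseteq> A}. emeasure \<mu> K))}"


section \<open>Function spaces\<close>

subsection \<open>Continuous functions\<close>

definition C0 :: "'a::metric_space set \<Rightarrow> ('a \<Rightarrow> real) set" where
  "C0 X = {\<phi>. continuous_on X \<phi>}"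

definition C0_norm :: "'a::metric_space set \<Rightarrow> ('a \<Rightarrow> real) \<Rightarrow> real" where
  "C0_norm X \<phi> = (SUP x\<in>X. \<bar>\<phi> x\<bar>)"

subsection \<open>Functions of class \<open>C^m\<close> on the closure of a bounded open set\<close>

text \<open>
  Iterated partial derivatives are indexed by words in the standard basis, rather than by
  multi-indices; by the symmetry of continuous mixed partials this gives the same derivatives.
  They are used only at points of the interior of \<open>X\<close>.
\<close>

definition partial :: "'a::euclidean_space \<Rightarrow> ('a \<Rightarrow> real) \<Rightarrow> 'a \<Rightarrow> real" where
  "partial b f x = deriv (\<lambda>t. f (x + t *\<^sub>R b)) 0"

definition partials :: "'a::euclidean_space list \<Rightarrow> ('a \<Rightarrow> real) \<Rightarrow> 'a \<Rightarrow> real" where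
  "partials w f = foldr partial w f"

text \<open>
  All partial derivatives indexed by the suffix-closed set of words \<open>W\<close> exist in the interior
  and have continuous extensions to \<open>X\<close>. As \<open>X\<close> is the closure of its interior, these extensions
  are unique, and they are what is meant by partial derivatives on \<open>X\<close>.
\<close>

definition continuous_partials ::
    "'a::euclidean_space list set \<Rightarrow> 'a set \<Rightarrow> ('a \<Rightarrow> real) \<Rightarrow> bool" where
  "continuous_partials W X f \<longleftrightarrow> continuous_on X f \<and>
     (\<forall>b w. b # w \<in> W \<longrightarrow>
        (\<forall>x\<in>interior X. (\<lambda>t. partials w f (x + t *\<^sub>R b)) field_differentiable at 0)) \<and>
     (\<forall>w\<in>W. \<exists>g. continuous_on X g \<and> (\<forall>x\<in>interior X. g x = partials w f x))"

definition Cm :: "nat \<Rightarrow> 'a::euclidean_space set \<Rightarrow> ('a \<Rightarrow> real) set" where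
  "Cm m X = {\<phi>. continuous_partials {w \<in> lists Basis. length w \<le> m} X \<phi>}"

text \<open>
  The supremum over the interior equals the supremum over \<open>X\<close> of the continuous extension.
\<close>

definition Cm_norm :: "nat \<Rightarrow> 'a::euclidean_space set \<Rightarrow> ('a \<Rightarrow> real) \<Rightarrow> real" where
  "Cm_norm m X \<phi> =
     (SUP (w, x) \<in> {w \<in> lists Basis. length w \<le> m} \<times> interior X. \<bar>partials w \<phi> x\<bar>)"

text \<open>
  The basis vectors of the product space are \<open>(b, 0)\<close> and \<open>(0, b)\<close>, so the two counts are the
  orders of differentiation in the first and in the second variable.
\<close>

definition Cmm :: "nat \<Rightarrow> 'a::euclidean_space set \<Rightarrow> ('a \<times> 'a \<Rightarrow> real) set" where
  "Cmm m X = {f. continuous_partials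
     {w \<in> lists Basis. length (filter (\<lambda>b. fst b \<noteq> 0) w) \<le> m \<and>
                       length (filter (\<lambda>b. snd b \<noteq> 0) w) \<le> m} (X \<times> X) f}"


section \<open>Universal kernels\<close>

definition positive_definite_kernel :: "'a set \<Rightarrow> ('a \<Rightarrow> 'a \<Rightarrow> real) \<Rightarrow> bool" where
  "positive_definite_kernel X k \<longleftrightarrow>
     (\<forall>x\<in>X. \<forall>y\<in>X. k x y = k y x) \<and>
     (\<forall>A a. finite A \<and> A \<subseteq> X \<longrightarrow> (\<Sum>x\<in>A. \<Sum>y\<in>A. a x * a y * k x y) \<ge> 0)"

text \<open>
  \<open>H\<close> with inner product \<open>ip\<close> is the Hilbert space of functions on \<open>X\<close> with reproducing
  kernel \<open>k\<close>. The elements of \<open>H\<close> are normalised to vanish outside \<open>X\<close>.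
\<close>

definition rkhs :: "'a set \<Rightarrow> ('a \<Rightarrow> 'a \<Rightarrow> real) \<Rightarrow> ('a \<Rightarrow> real) set \<Rightarrow>
    (('a \<Rightarrow> real) \<Rightarrow> ('a \<Rightarrow> real) \<Rightarrow> real) \<Rightarrow> bool" where
  "rkhs X k H ip \<longleftrightarrow>
     (\<forall>f\<in>H. \<forall>x. x \<notin> X \<longrightarrow> f x = 0) \<and>
     (\<lambda>x. 0) \<in> H \<and>
     (\<forall>f\<in>H. \<forall>g\<in>H. \<forall>a b. (\<lambda>x. a * f x + b * g x) \<in> H) \<and>
     (\<forall>f\<in>H. \<forall>g\<in>H. ip f g = ip g f) \<and>
     (\<forall>f\<in>H. \<forall>g\<in>H. \<forall>h\<in>H. \<forall>a b. ip (\<lambda>x. a * f x + b * g x) h = a * ip f h + b * ip g h) \<and>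
     (\<forall>f\<in>H. ip f f \<ge> 0 \<and> (ip f f = 0 \<longrightarrow> f = (\<lambda>x. 0))) \<and>
     (\<forall>u. (\<forall>n. u n \<in> H) \<and>
          (\<forall>e>0. \<exists>n0. \<forall>i\<ge>n0. \<forall>j\<ge>n0. ip (\<lambda>x. u i x - u j x) (\<lambda>x. u i x - u j x) < e) \<longrightarrow>
          (\<exists>f\<in>H. (\<lambda>n::nat. ip (\<lambda>x. u n x - f x) (\<lambda>x. u n x - f x)) \<longlonglongrightarrow> 0)) \<and>
     (\<forall>x\<in>X. (\<lambda>y. if y \<in> X then k x y else 0) \<in> H \<and>
          (\<forall>f\<in>H. ip f (\<lambda>y. if y \<in> X then k x y else 0) = f x))"

text \<open>
  By the Moore--Aronszajn theorem a positive definite kernel has exactly one reproducing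
  kernel Hilbert space, so the existential quantifier just names it.
\<close>

definition universal_kernel :: "'a::metric_space set \<Rightarrow> ('a \<Rightarrow> 'a \<Rightarrow> real) \<Rightarrow> bool" where
  "universal_kernel X k \<longleftrightarrow> (\<exists>H ip. rkhs X k H ip \<and> H \<subseteq> C0 X \<and>
     (\<forall>g\<in>C0 X. \<forall>e>0. \<exists>f\<in>H. \<forall>x\<in>X. \<bar>f x - g x\<bar> < e))"


section \<open>Entropic optimal transport\<close>

definition couplings :: "'a measure \<Rightarrow> 'a measure \<Rightarrow> ('a \<times> 'a) measure set" where
  "couplings \<mu> \<nu> = {\<pi>. prob_space \<pi> \<and> sets \<pi> = sets (\<mu> \<Otimes>\<^sub>M \<nu>) \<and>
     distr \<pi> \<mu> fst = \<mu> \<and> distr \<pi> \<nu> snd = \<nu>}"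

text \<open>
  \<open>KL \<pi> \<rho>\<close> is the divergence of \<open>\<pi>\<close> from \<open>\<rho>\<close>; the library constant takes the reference measure
  first and is meaningful only under the stated conditions. For probability measures with
  \<open>\<pi> \<lless> \<rho>\<close> the negative part of the log-density is always integrable, so integrability fails
  exactly when the divergence is infinite.
\<close>

definition KL :: "'a measure \<Rightarrow> 'a measure \<Rightarrow> ereal" where
  "KL \<pi> \<rho> = (if absolutely_continuous \<rho> \<pi> \<and> integrable \<pi> (entropy_density (exp 1) \<rho> \<pi>)
     then ereal (KL_divergence (exp 1) \<rho> \<pi>) else \<infinity>)"

definition OT :: "real \<Rightarrow> ('a \<Rightarrow> 'a \<Rightarrow> real) \<Rightarrow> 'a measure \<Rightarrow> 'a measure \<Rightarrow> ereal" where
  "OT \<epsilon> c \<mu> \<nu> = (INF \<pi>\<in>couplings \<mu> \<nu>.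
     ereal (\<integral>z. c (fst z) (snd z) \<partial>\<pi>) + ereal \<epsilon> * KL \<pi> (\<mu> \<Otimes>\<^sub>M \<nu>))"

text \<open>
  For a bounded cost \<open>OT\<close> is finite, since the product coupling has divergence \<open>0\<close>.
\<close>

definition sinkhorn_div :: "real \<Rightarrow> ('a \<Rightarrow> 'a \<Rightarrow> real) \<Rightarrow> 'a measure \<Rightarrow> 'a measure \<Rightarrow> real" where
  "sinkhorn_div \<epsilon> c \<mu> \<nu> = real_of_ereal (OT \<epsilon> c \<mu> \<nu>)
     - real_of_ereal (OT \<epsilon> c \<mu> \<mu>) / 2 - real_of_ereal (OT \<epsilon> c \<nu> \<nu>) / 2"

definition self_potential ::
    "'a::metric_space set \<Rightarrow> real \<Rightarrow> ('a \<Rightarrow> 'a \<Rightarrow> real) \<Rightarrow> 'a measure \<Rightarrow> 'a \<Rightarrow> real" where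
  "self_potential X \<epsilon> c \<mu> = (THE f. f \<in> C0 X \<and> (\<forall>x. x \<notin> X \<longrightarrow> f x = 0) \<and>
     (\<forall>y\<in>X. (\<integral>x. exp ((f x + f y - c x y) / \<epsilon>) \<partial>\<mu>) = 1))"

definition self_kernel ::
    "'a::metric_space set \<Rightarrow> real \<Rightarrow> ('a \<Rightarrow> 'a \<Rightarrow> real) \<Rightarrow> 'a measure \<Rightarrow> 'a \<Rightarrow> 'a \<Rightarrow> real" where
  "self_kernel X \<epsilon> c \<mu> x y =
     exp ((self_potential X \<epsilon> c \<mu> x + self_potential X \<epsilon> c \<mu> y - c x y) / \<epsilon>)"

definition K_op :: "'a::metric_space set \<Rightarrow> real \<Rightarrow> ('a \<Rightarrow> 'a \<Rightarrow> real) \<Rightarrow> 'a measure \<Rightarrow>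
    ('a \<Rightarrow> real) \<Rightarrow> 'a \<Rightarrow> real" where
  "K_op X \<epsilon> c \<mu> \<phi> = (\<lambda>y. \<integral>x. \<phi> x * self_kernel X \<epsilon> c \<mu> x y \<partial>\<mu>)"

definition H_op :: "'a::metric_space set \<Rightarrow> real \<Rightarrow> ('a \<Rightarrow> 'a \<Rightarrow> real) \<Rightarrow> 'a measure \<Rightarrow>
    (('a \<Rightarrow> real) \<Rightarrow> real) \<Rightarrow> 'a \<Rightarrow> real" where
  "H_op X \<epsilon> c \<mu> L = (\<lambda>y. L (\<lambda>x. self_kernel X \<epsilon> c \<mu> x y))"


section \<open>Perturbations\<close>

definition path_deriv :: "(real \<Rightarrow> 'a measure) \<Rightarrow> real \<Rightarrow> ('a \<Rightarrow> real) \<Rightarrow> real" where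
  "path_deriv M t \<phi> = deriv (\<lambda>s. \<integral>x. \<phi> x \<partial>M s) t"

text \<open>
  Below, \<open>F\<close> is the test-function space \<open>C^m(X)\<close> and \<open>N\<close> its norm.
\<close>

definition perturbation :: "'a::metric_space set \<Rightarrow> ('a \<Rightarrow> real) set \<Rightarrow> (('a \<Rightarrow> real) \<Rightarrow> real) \<Rightarrow>
    real \<Rightarrow> (real \<Rightarrow> 'a measure) \<Rightarrow> bool" where
  "perturbation X F N \<tau> M \<longleftrightarrow>
     (\<forall>t\<in>{-\<tau><..<\<tau>}. M t \<in> radon_probs X) \<and>
     (\<forall>\<phi>\<in>F. \<forall>t\<in>{-\<tau><..<\<tau>}. (\<lambda>s. \<integral>x. \<phi> x \<partial>M s) field_differentiable at t) \<and>
     (\<forall>t\<in>{-\<tau><..<\<tau>}. \<forall>\<phi>\<in>F. \<forall>\<psi>\<in>F. \<forall>a b.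
        path_deriv M t (\<lambda>x. a * \<phi> x + b * \<psi> x) = a * path_deriv M t \<phi> + b * path_deriv M t \<psi>) \<and>
     (\<forall>\<phi>\<in>F. \<forall>t\<in>{-\<tau><..<\<tau>}. \<forall>e>0. \<exists>d>0. \<forall>\<psi>\<in>F. \<forall>s\<in>{-\<tau><..<\<tau>}.
        N (\<lambda>x. \<psi> x - \<phi> x) < d \<and> \<bar>s - t\<bar> < d \<longrightarrow> \<bar>path_deriv M s \<psi> - path_deriv M t \<phi>\<bar> < e)"


section \<open>The quotient by constant functions\<close>

text \<open>
  The quotient space is \<open>F // const_rel X F\<close>. Functions that agree on \<open>X\<close> are identified as well.
\<close>

definition const_rel :: "'a set \<Rightarrow> ('a \<Rightarrow> real) set \<Rightarrow> (('a \<Rightarrow> real) \<times> ('a \<Rightarrow> real)) set" where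
  "const_rel X F = {(\<phi>, \<psi>). \<phi> \<in> F \<and> \<psi> \<in> F \<and> (\<exists>a. \<forall>x\<in>X. \<phi> x = \<psi> x + a)}"

definition quotient_op :: "'a set \<Rightarrow> ('a \<Rightarrow> real) set \<Rightarrow> (('a \<Rightarrow> real) \<Rightarrow> 'a \<Rightarrow> real) \<Rightarrow>
    ('a \<Rightarrow> real) set \<Rightarrow> ('a \<Rightarrow> real) set" where
  "quotient_op X F T A = (\<Union>\<phi>\<in>A. const_rel X F `` {T \<phi>})"

text \<open>
  The common value on a class of a functional that vanishes on constants.
\<close>

definition quotient_pairing :: "(('a \<Rightarrow> real) \<Rightarrow> real) \<Rightarrow> ('a \<Rightarrow> real) set \<Rightarrow> real" where
  "quotient_pairing L A = the_elem (L ` A)"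

text \<open>
  The pairing of \<open>L\<close> with the image of the class of \<open>H[L]\<close> under the inverse of \<open>id - K^2\<close> on the
  quotient of \<open>F\<close>.
\<close>

definition hessian_form :: "'a::metric_space set \<Rightarrow> ('a \<Rightarrow> real) set \<Rightarrow> real \<Rightarrow>
    ('a \<Rightarrow> 'a \<Rightarrow> real) \<Rightarrow> 'a measure \<Rightarrow> (('a \<Rightarrow> real) \<Rightarrow> real) \<Rightarrow> real" where
  "hessian_form X F \<epsilon> c \<mu> L = quotient_pairing L
     (the_inv_into (F // const_rel X F)
        (quotient_op X F (\<lambda>\<phi> y. \<phi> y - K_op X \<epsilon> c \<mu> (K_op X \<epsilon> c \<mu> \<phi>) y))
        (const_rel X F `` {H_op X \<epsilon> c \<mu> L}))"

definition admissible_cost :: "'a::metric_space set \<Rightarrow> real \<Rightarrow> ('a \<Rightarrow> 'a \<Rightarrow> real) \<Rightarrow> bool" where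
  "admissible_cost X \<epsilon> c \<longleftrightarrow>
     (\<forall>x\<in>X. \<forall>y\<in>X. c x y = c y x) \<and>
     (\<forall>x\<in>X. \<forall>y\<in>X. c x y \<ge> 0) \<and>
     positive_definite_kernel X (\<lambda>x y. exp (- c x y / \<epsilon>)) \<and>
     universal_kernel X (\<lambda>x y. exp (- c x y / \<epsilon>))"

end

theory Submission
  imports Defs
begin

text \<open>
  Absorbing the self-potential of \<open>\<mu>\<close> into the cost, the transport problem between \<open>\<mu>\<close> and itself
  has the Markov kernel \<open>k = k\<^sub>\<mu>\<close> as its optimal density. Each of \<open>OT(\<mu>, \<mu>\<^sub>t)\<close> and \<open>OT(\<mu>\<^sub>t, \<mu>\<^sub>t)\<close> is
  sandwiched between the dual value at trial potentials and the primal value of the coupling that is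
  obtained from the corresponding Gibbs density by subtracting its marginal errors; the gap is
  quadratic in these errors. Let \<open>w - K\<^sup>2 w = H[L]\<close> modulo constants, where \<open>L\<close> is the derivative of
  the path. With the trial potentials \<open>(-t w, t K w)\<close> for \<open>(\<mu>, \<mu>\<^sub>t)\<close> and \<open>t (K w - w)\<close> for
  \<open>(\<mu>\<^sub>t, \<mu>\<^sub>t)\<close>, the marginal errors are \<open>o(t)\<close>, so no derivative of the optimal potentials in \<open>t\<close> is
  needed, and expanding the dual values to second order gives \<open>L(K w) / 2\<close> and \<open>L(K w) - L(w)\<close>.
  Both the self-potential and \<open>w\<close> are fixed points of maps that contract the oscillation because the
  kernels are bounded below.
\<close>


section \<open>Integration on a compact metric space\<close>

text \<open>The trial potentials come from linearising the marginal equations. If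
  \<open>t * (\<phi> x + \<psi> y)\<close> is added to the exponent of \<open>k\<close>, the
  marginal errors divided by \<open>t\<close> tend to \<open>K \<phi> + \<psi> + H\<close> and
  \<open>K \<psi> + \<phi> + H'\<close>, where \<open>H\<close> and \<open>H'\<close> are
  \<open>H[L]\<close> for a moving marginal and 0 for a fixed one. With one fixed marginal,
  \<open>\<psi> = - K \<phi>\<close> can be eliminated, and \<open>\<phi> = - w\<close> remains. In
  the symmetric case the equation is \<open>h + K h = - H[L]\<close>, and \<open>h = K w - w\<close>
  solves it. Up to order t^2 each cost consists of the integrals of the self-potential against its
  two marginals, and these cancel in the Sinkhorn divergence. The delicate term is the integral of
  \<open>k\<close> against two copies of the moving measure. There the function tested along the
  path moves as well, so its difference quotients must converge in the norm of C^m before joint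
  continuity of the derivative applies. This, and the fact that \<open>w\<close> and
  \<open>H[L]\<close> must themselves be admissible test functions, is why so much is proved about
  C^(m,m) kernels: continuous functionals applied to their slices give C^m functions.\<close>

definition borel_prob :: "'a::metric_space set \<Rightarrow> 'a measure \<Rightarrow> bool" where
  "borel_prob X P \<longleftrightarrow> prob_space P \<and> sets P = sets (restrict_space borel X)"

lemma borel_prob_radon: "P \<in> radon_probs X \<Longrightarrow> borel_prob X P"
  by (simp add: radon_probs_def borel_prob_def)

lemma borel_prob_prob_space: "borel_prob X P \<Longrightarrow> prob_space P"
  by (simp add: borel_prob_def)

lemma borel_prob_sets: "borel_prob X P \<Longrightarrow> sets P = sets (restrict_space borel X)"
  by (simp add: borel_prob_def)

lemma borel_prob_space: "borel_prob X P \<Longrightarrow> space P = X"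
  using sets_eq_imp_space_eq[of P "restrict_space borel X"]
  by (simp add: borel_prob_def space_restrict_space)

text \<open>Total boundedness gives a step map that moves each point by less than \<open>e\<close>.
  It is split into a label in nat and a point for each label, because any function of two labels is
  measurable on the product, whatever the topology of the ambient space.\<close>

lemma compact_measurable_finite_approx:
  fixes X :: "'a::metric_space set"
  assumes "compact X" "e > 0"
  obtains p :: "'a \<Rightarrow> nat" and q :: "nat \<Rightarrow> 'a"
  where "p \<in> restrict_space borel X \<rightarrow>\<^sub>M count_space UNIV"
    and "\<And>x. x \<in> X \<Longrightarrow> q (p x) \<in> X \<and> dist (q (p x)) x < e"
proof -
  obtain k where k: "finite k" "k \<subseteq> X" "X \<subseteq> (\<Union>x\<in>k. ball x e)"
  proof (rule compactE_image[OF assms(1), of X "\<lambda>x. ball x e"])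
    show "X \<subseteq> (\<Union>x\<in>X. ball x e)" using assms(2) by force
  qed auto
  obtain q :: "nat \<Rightarrow> 'a" and n where q: "k = q ` {i. i < n}"
    using finite_imp_nat_seg_image_inj_on[OF k(1)] by metis
  \<comment> \<open>Taking the least label resolves the overlap of the balls in a measurable
    way.\<close>
  define p where "p x = (LEAST i. i < n \<and> dist (q i) x < e)" for x
  have p: "p x < n \<and> dist (q (p x)) x < e" if x: "x \<in> X" for x
  proof -
    obtain z where "z \<in> k" "dist z x < e" using k(3) x by auto
    then obtain i where "i < n \<and> dist (q i) x < e" using q by auto
    then show ?thesis unfolding p_def by (rule LeastI)
  qed
  have "p \<in> borel \<rightarrow>\<^sub>M count_space UNIV"
    unfolding p_def
  proof (rule measurable_Least)
    fix i
    have "ball (q i) e \<in> sets borel" by simp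
    moreover have "{x. dist (q i) x < e} = ball (q i) e" by auto
    ultimately have [measurable]: "Measurable.pred borel (\<lambda>x. dist (q i) x < e)"
      by (simp add: pred_def)
    show "Measurable.pred borel (\<lambda>x. i < n \<and> dist (q i) x < e)" by measurable
  qed
  then have "p \<in> restrict_space borel X \<rightarrow>\<^sub>M count_space UNIV"
    by (rule measurable_restrict_space1)
  moreover have "q (p x) \<in> X \<and> dist (q (p x)) x < e" if "x \<in> X" for x
  proof -
    have "q (p x) \<in> k" using p[OF that] q by simp
    then show ?thesis using p[OF that] k(2) by blast
  qed
  ultimately show ?thesis by (rule that)
qed

lemma borel_prob_measurable:
  assumes "borel_prob X P" "continuous_on X \<phi>"
  shows "\<phi> \<in> borel_measurable P"
  using borel_measurable_continuous_on_restrict[OF assms(2)]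
    measurable_cong_sets[OF borel_prob_sets[OF assms(1)] refl] by blast

text \<open>The ambient type need not be second countable, so the Borel sets of \<open>X \<times> X\<close> are compared
  with the product \<open>\<sigma>\<close>-algebra by approximation with step functions.\<close>

lemma borel_prob_measurable_pair:
  fixes G :: "'a::metric_space \<Rightarrow> 'a \<Rightarrow> real"
  assumes X: "compact X" and P: "borel_prob X P" and Q: "borel_prob X Q"
    and G: "continuous_on (X \<times> X) (\<lambda>(x, y). G x y)"
  shows "(\<lambda>(x, y). G x y) \<in> borel_measurable (P \<Otimes>\<^sub>M Q)"
proof -
  have "\<exists>p q. p \<in> restrict_space borel X \<rightarrow>\<^sub>M count_space (UNIV::nat set) \<and>
     (\<forall>x\<in>X. q (p x) \<in> X \<and> dist (q (p x)) x < 1 / Suc n)" for n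
    using compact_measurable_finite_approx[OF X, of "1 / Suc n"] by (metis of_nat_0_less_iff zero_less_Suc zero_less_divide_1_iff)
  then obtain p q where p: "\<And>n. p n \<in> restrict_space borel X \<rightarrow>\<^sub>M count_space (UNIV::nat set)"
    and q: "\<And>n x. x \<in> X \<Longrightarrow> q n (p n x) \<in> X \<and> dist (q n (p n x)) x < 1 / Suc n" by metis
  have pP [measurable]: "p n \<in> P \<rightarrow>\<^sub>M count_space UNIV" for n
    using p[of n] measurable_cong_sets[OF borel_prob_sets[OF P] refl] by blast
  have pQ [measurable]: "p n \<in> Q \<rightarrow>\<^sub>M count_space UNIV" for n
    using p[of n] measurable_cong_sets[OF borel_prob_sets[OF Q] refl] by blast
  have lim: "(\<lambda>n. q n (p n x)) \<longlonglongrightarrow> x" if "x \<in> X" for x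
  proof (rule tendsto_dist_iff[THEN iffD2], rule Lim_null_comparison)
    show "\<forall>\<^sub>F n in sequentially. norm (dist (q n (p n x)) x) \<le> inverse (real (Suc n))"
      using q[OF that] by (intro always_eventually allI) (simp add: less_imp_le inverse_eq_divide)
  qed (rule LIMSEQ_inverse_real_of_nat)
  show ?thesis
  proof (rule borel_measurable_LIMSEQ_real)
    fix z assume "z \<in> space (P \<Otimes>\<^sub>M Q)"
    then obtain x y where z: "z = (x, y)" "x \<in> X" "y \<in> X"
      by (auto simp: space_pair_measure borel_prob_space[OF P] borel_prob_space[OF Q])
    have "(\<lambda>n. (\<lambda>(x, y). G x y) (q n (p n x), q n (p n y))) \<longlonglongrightarrow> (\<lambda>(x, y). G x y) (x, y)"
      using z q by (intro continuous_on_tendsto_compose[OF G] tendsto_Pair lim) auto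
    then show "(\<lambda>n. G (q n (p n (fst z))) (q n (p n (snd z)))) \<longlonglongrightarrow> (case z of (x, y) \<Rightarrow> G x y)"
      by (simp add: z)
  next
    fix n
    \<comment> \<open>The approximant depends on \<open>z\<close> only through two labels in a
      countable discrete space, so it is measurable without any appeal to \<open>G\<close>.
      Continuity of \<open>G\<close> enters only in the limit.\<close>
    have "(\<lambda>z. (\<lambda>(i, j). G (q n i) (q n j)) (p n (fst z), p n (snd z))) \<in> borel_measurable (P \<Otimes>\<^sub>M Q)"
      by measurable
    then show "(\<lambda>z. G (q n (p n (fst z))) (q n (p n (snd z)))) \<in> borel_measurable (P \<Otimes>\<^sub>M Q)"
      by simp
  qed
qed

lemma compact_continuous_bound:
  fixes f :: "'a::topological_space \<Rightarrow> real"
  assumes "compact X" "continuous_on X f"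
  obtains B where "B > 0" "\<And>x. x \<in> X \<Longrightarrow> \<bar>f x\<bar> \<le> B"
proof -
  have "bounded (f ` X)"
    using assms compact_continuous_image compact_imp_bounded by blast
  then obtain B where "B > 0" "\<forall>z\<in>f ` X. norm z \<le> B"
    unfolding bounded_pos by blast
  then show ?thesis by (intro that[of B]) simp_all
qed

lemma compact_continuous_bound2:
  assumes "compact X" "continuous_on (X \<times> X) (\<lambda>(x, y). G x y :: real)"
  obtains B where "B > 0" "\<And>x y. x \<in> X \<Longrightarrow> y \<in> X \<Longrightarrow> \<bar>G x y\<bar> \<le> B"
proof -
  obtain B where B: "B > 0" "\<And>z. z \<in> X \<times> X \<Longrightarrow> \<bar>case z of (x, y) \<Rightarrow> G x y\<bar> \<le> B"
    using compact_continuous_bound[OF compact_Times[OF assms(1) assms(1)] assms(2)] by blast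
  show ?thesis
    by (rule that[OF B(1)]) (use B(2) in fastforce)
qed

lemma borel_prob_integrable:
  assumes "compact X" "borel_prob X P" "continuous_on X \<phi>"
  shows "integrable P (\<phi> :: _ \<Rightarrow> real)"
proof -
  interpret prob_space P using assms(2) by (rule borel_prob_prob_space)
  obtain B where "\<And>x. x \<in> X \<Longrightarrow> \<bar>\<phi> x\<bar> \<le> B"
    using compact_continuous_bound[OF assms(1,3)] by blast
  then show ?thesis
    by (intro integrable_const_bound[of _ B] AE_I2 borel_prob_measurable[OF assms(2,3)])
      (simp add: borel_prob_space[OF assms(2)])
qed

lemma borel_prob_integral_bounds:
  assumes "compact X" "borel_prob X P" "continuous_on X \<phi>"
  shows "(\<And>x. x \<in> X \<Longrightarrow> \<phi> x \<le> b) \<Longrightarrow> (\<integral>x. \<phi> x \<partial>P) \<le> (b::real)"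
    and "(\<And>x. x \<in> X \<Longrightarrow> b \<le> \<phi> x) \<Longrightarrow> b \<le> (\<integral>x. \<phi> x \<partial>P)"
    and "(\<And>x. x \<in> X \<Longrightarrow> \<bar>\<phi> x\<bar> \<le> b) \<Longrightarrow> \<bar>\<integral>x. \<phi> x \<partial>P\<bar> \<le> b"
proof -
  interpret prob_space P using assms(2) by (rule borel_prob_prob_space)
  note i = borel_prob_integrable[OF assms]
  show u: "(\<integral>x. \<phi> x \<partial>P) \<le> b" if "\<And>x. x \<in> X \<Longrightarrow> \<phi> x \<le> b" for b
    using integral_mono[OF i integrable_const[of b]] that prob_space
    by (simp add: borel_prob_space[OF assms(2)])
  show l: "b \<le> (\<integral>x. \<phi> x \<partial>P)" if "\<And>x. x \<in> X \<Longrightarrow> b \<le> \<phi> x" for b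
    using integral_mono[OF integrable_const[of b] i] that prob_space
    by (simp add: borel_prob_space[OF assms(2)])
  show "\<bar>\<integral>x. \<phi> x \<partial>P\<bar> \<le> b" if h: "\<And>x. x \<in> X \<Longrightarrow> \<bar>\<phi> x\<bar> \<le> b"
  proof (rule abs_leI)
    show "(\<integral>x. \<phi> x \<partial>P) \<le> b" using h by (intro u) (simp add: abs_le_iff)
    have "- b \<le> (\<integral>x. \<phi> x \<partial>P)" using h by (intro l) (simp add: abs_le_iff minus_le_iff)
    then show "- (\<integral>x. \<phi> x \<partial>P) \<le> b" by simp
  qed
qed

lemma borel_prob_cong:
  assumes "borel_prob X P" "\<And>x. x \<in> X \<Longrightarrow> \<phi> x = \<psi> x"
  shows "(\<integral>x. \<phi> x \<partial>P) = (\<integral>x. \<psi> x \<partial>P)"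
  using assms by (intro Bochner_Integration.integral_cong) (auto simp: borel_prob_space)

lemma continuous_on_slice1:
  "continuous_on (X \<times> X) (\<lambda>(x, y). G x y) \<Longrightarrow> y \<in> X \<Longrightarrow> continuous_on X (\<lambda>x. G x y)"
  using continuous_on_compose2[of "X \<times> X" "\<lambda>(x, y). G x y" X "\<lambda>x. (x, y)"]
  by (simp add: continuous_on_Pair image_subset_iff)

lemma continuous_on_slice2:
  "continuous_on (X \<times> X) (\<lambda>(x, y). G x y) \<Longrightarrow> x \<in> X \<Longrightarrow> continuous_on X (\<lambda>y. G x y)"
  using continuous_on_compose2[of "X \<times> X" "\<lambda>(x, y). G x y" X "\<lambda>y. (x, y)"]
  by (simp add: continuous_on_Pair image_subset_iff)

lemma continuous_on_swap2:
  assumes "continuous_on (X \<times> X) (\<lambda>(x, y). G x y)"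
  shows "continuous_on (X \<times> X) (\<lambda>(x, y). G y x)"
proof -
  have "continuous_on (X \<times> X) ((\<lambda>(x, y). G x y) \<circ> prod.swap)"
    by (intro continuous_on_compose continuous_on_swap) (simp add: product_swap assms)
  then show ?thesis by (simp add: o_def case_prod_unfold)
qed

lemma compact_slices_equicontinuous:
  fixes G :: "'a::metric_space \<Rightarrow> 'a \<Rightarrow> real"
  assumes "compact X" "continuous_on (X \<times> X) (\<lambda>(x, y). G x y)" "e > 0"
  obtains d where "d > 0"
    "\<And>x x' y y'. x \<in> X \<Longrightarrow> x' \<in> X \<Longrightarrow> y \<in> X \<Longrightarrow> y' \<in> X \<Longrightarrow> dist x x' < d \<Longrightarrow> dist y y' < d
       \<Longrightarrow> \<bar>G x y - G x' y'\<bar> < e"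
proof -
  have "uniformly_continuous_on (X \<times> X) (\<lambda>(x, y). G x y)"
    by (intro compact_uniformly_continuous compact_Times assms)
  then obtain d where d: "d > 0" "\<And>z z'. z \<in> X \<times> X \<Longrightarrow> z' \<in> X \<times> X \<Longrightarrow> dist z' z < d \<Longrightarrow>
      dist (case z' of (x, y) \<Rightarrow> G x y) (case z of (x, y) \<Rightarrow> G x y) < e"
    using assms(3) unfolding uniformly_continuous_on_def by metis
  show ?thesis
  proof (rule that[of "d/2"])
    fix x x' y y' assume h: "x \<in> X" "x' \<in> X" "y \<in> X" "y' \<in> X" "dist x x' < d/2" "dist y y' < d/2"
    have "dist (x, y) (x', y') \<le> dist x x' + dist y y'"
      unfolding dist_Pair_Pair by (rule sqrt_sum_squares_le_sum) auto
    then show "\<bar>G x y - G x' y'\<bar> < e"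
      using d(2)[of "(x', y')" "(x, y)"] h by (simp add: dist_real_def)
  qed (use d in simp)
qed

lemma continuous_on_integral_param:
  fixes G :: "'a::metric_space \<Rightarrow> 'a \<Rightarrow> real"
  assumes X: "compact X" and P: "borel_prob X P"
    and G: "continuous_on (X \<times> X) (\<lambda>(x, y). G x y)"
  shows "continuous_on X (\<lambda>y. \<integral>x. G x y \<partial>P)"
  unfolding continuous_on_iff
proof (intro ballI allI impI)
  fix y and e :: real assume y: "y \<in> X" and e: "e > 0"
  obtain d where d: "d > 0"
    "\<And>x x' y y'. x \<in> X \<Longrightarrow> x' \<in> X \<Longrightarrow> y \<in> X \<Longrightarrow> y' \<in> X \<Longrightarrow> dist x x' < d \<Longrightarrow> dist y y' < d
       \<Longrightarrow> \<bar>G x y - G x' y'\<bar> < e / 2"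
    using compact_slices_equicontinuous[OF X G, of "e / 2"] e by auto
  note i = borel_prob_integrable[OF X P continuous_on_slice1[OF G]]
  have "dist (\<integral>x. G x y' \<partial>P) (\<integral>x. G x y \<partial>P) < e" if y': "y' \<in> X" "dist y' y < d" for y'
  proof -
    have "\<bar>\<integral>x. G x y' - G x y \<partial>P\<bar> \<le> e / 2"
      using d y y' by (intro borel_prob_integral_bounds(3)[OF X P] continuous_intros
          continuous_on_slice1[OF G]) (auto intro!: less_imp_le)
    then show ?thesis using e by (simp add: dist_real_def i y y')
  qed
  then show "\<exists>d>0. \<forall>x'\<in>X. dist x' y < d \<longrightarrow> dist (\<integral>x. G x x' \<partial>P) (\<integral>x. G x y \<partial>P) < e"
    using d(1) by blast
qed

lemma borel_prob_integrable_pair: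
  assumes X: "compact X" and P: "borel_prob X P" and Q: "borel_prob X Q"
    and G: "continuous_on (X \<times> X) (\<lambda>(x, y). G x y :: real)"
  shows "integrable (P \<Otimes>\<^sub>M Q) (\<lambda>(x, y). G x y)"
proof -
  interpret P: prob_space P using P by (rule borel_prob_prob_space)
  interpret Q: prob_space Q using Q by (rule borel_prob_prob_space)
  interpret PQ: pair_prob_space P Q ..
  obtain B where "\<And>x y. x \<in> X \<Longrightarrow> y \<in> X \<Longrightarrow> \<bar>G x y\<bar> \<le> B"
    using compact_continuous_bound2[OF X G] by blast
  then show ?thesis
    by (intro PQ.integrable_const_bound[of _ B] AE_I2 borel_prob_measurable_pair[OF assms])
      (auto simp: borel_prob_space[OF P] borel_prob_space[OF Q] space_pair_measure)
qed

lemma borel_prob_Fubini: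
  assumes X: "compact X" and P: "borel_prob X P" and Q: "borel_prob X Q"
    and G: "continuous_on (X \<times> X) (\<lambda>(x, y). G x y :: real)"
  shows "(\<integral>z. G (fst z) (snd z) \<partial>(P \<Otimes>\<^sub>M Q)) = (\<integral>y. \<integral>x. G x y \<partial>P \<partial>Q)"
    and "(\<integral>y. \<integral>x. G x y \<partial>P \<partial>Q) = (\<integral>x. \<integral>y. G x y \<partial>Q \<partial>P)"
proof -
  interpret P: prob_space P using P by (rule borel_prob_prob_space)
  interpret Q: prob_space Q using Q by (rule borel_prob_prob_space)
  interpret PQ: pair_prob_space P Q ..
  show "(\<integral>z. G (fst z) (snd z) \<partial>(P \<Otimes>\<^sub>M Q)) = (\<integral>y. \<integral>x. G x y \<partial>P \<partial>Q)"
    using PQ.integral_snd[OF borel_prob_integrable_pair[OF assms]]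
    by (simp add: case_prod_unfold)
  show "(\<integral>y. \<integral>x. G x y \<partial>P \<partial>Q) = (\<integral>x. \<integral>y. G x y \<partial>Q \<partial>P)"
    by (rule PQ.Fubini_integral[OF borel_prob_integrable_pair[OF assms]])
qed

section \<open>Duality for entropic transport\<close>

lemma borel_prob_space_pair:
  "borel_prob X P \<Longrightarrow> borel_prob X Q \<Longrightarrow> space (P \<Otimes>\<^sub>M Q) = X \<times> X"
  by (simp add: space_pair_measure borel_prob_space)

lemma borel_prob_pair_prob_space:
  assumes "borel_prob X P" "borel_prob X Q"
  shows "pair_prob_space P Q"
  using assms[THEN borel_prob_prob_space]
  by (simp add: pair_prob_space_def pair_sigma_finite_def prob_space_imp_sigma_finite)

lemma borel_prob_integrable_pair':
  assumes "compact X" "borel_prob X P" "borel_prob X Q"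
    "continuous_on (X \<times> X) (\<lambda>(x, y). G x y :: real)"
  shows "integrable (P \<Otimes>\<^sub>M Q) (\<lambda>z. G (fst z) (snd z))"
  using borel_prob_integrable_pair[OF assms] by (simp add: case_prod_unfold)

lemma borel_prob_measurable_pair':
  assumes "compact X" "borel_prob X P" "borel_prob X Q"
    "continuous_on (X \<times> X) (\<lambda>(x, y). G x y :: real)"
  shows "(\<lambda>z. G (fst z) (snd z)) \<in> borel_measurable (P \<Otimes>\<^sub>M Q)"
  using borel_prob_measurable_pair[OF assms] by (simp add: case_prod_unfold)

text \<open>The density with respect to the product of the marginals that the potentials prescribe.
  It is the optimal plan exactly when its marginals are right.\<close>

definition gibbs :: "real \<Rightarrow> ('a \<Rightarrow> 'a \<Rightarrow> real) \<Rightarrow> ('a \<Rightarrow> real) \<Rightarrow> ('a \<Rightarrow> real) \<Rightarrow> 'a \<Rightarrow> 'a \<Rightarrow> real" where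
  "gibbs \<epsilon> c f g x y = exp ((f x + g y - c x y) / \<epsilon>)"

text \<open>The unconstrained form of the dual objective: the last term replaces a constraint on the
  potentials, so every pair of continuous functions is a legitimate trial.\<close>

definition dual_value ::
    "real \<Rightarrow> ('a \<Rightarrow> 'a \<Rightarrow> real) \<Rightarrow> 'a measure \<Rightarrow> 'a measure \<Rightarrow> ('a \<Rightarrow> real) \<Rightarrow> ('a \<Rightarrow> real) \<Rightarrow> real" where
  "dual_value \<epsilon> c \<alpha> \<beta> f g = (\<integral>x. f x \<partial>\<alpha>) + (\<integral>y. g y \<partial>\<beta>)
     - \<epsilon> * ((\<integral>z. gibbs \<epsilon> c f g (fst z) (snd z) \<partial>(\<alpha> \<Otimes>\<^sub>M \<beta>)) - 1)"

text \<open>The Fenchel-Young inequality behind weak duality: p ln p lies above its tangent at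
  \<open>q\<close>. The case p = 0 is included, where both terms on the right vanish.\<close>

lemma mult_ln_ge:
  assumes "p \<ge> 0" "q > (0::real)" shows "p - q \<le> p * ln p - p * ln q"
proof (cases "p = 0")
  case False
  then have p: "p > 0" using assms by simp
  have "ln (q / p) \<le> q / p - 1" using p assms by (intro ln_le_minus_one) simp
  then have "p * ln (q / p) \<le> p * (q / p - 1)" using p by (intro mult_left_mono) auto
  also have "\<dots> = q - p" using p by (simp add: field_simps)
  finally show ?thesis using p assms by (simp add: ln_div algebra_simps)
qed (use assms in simp)

lemma continuous_on_fst2: "continuous_on X f \<Longrightarrow> continuous_on (X \<times> Y) (\<lambda>(x, y). f x)"
  unfolding case_prod_unfold
  by (rule continuous_on_compose2[of X f]) (auto intro: continuous_on_fst continuous_on_id)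

lemma continuous_on_snd2: "continuous_on Y f \<Longrightarrow> continuous_on (X \<times> Y) (\<lambda>(x, y). f y)"
  unfolding case_prod_unfold
  by (rule continuous_on_compose2[of Y f]) (auto intro: continuous_on_snd continuous_on_id)

lemma continuous_on_gibbs:
  assumes "continuous_on (X \<times> X) (\<lambda>(x, y). c x y)" "continuous_on X f" "continuous_on X g"
  shows "continuous_on (X \<times> X) (\<lambda>(x, y). gibbs \<epsilon> c f g x y)"
  using assms(1) continuous_on_fst2[OF assms(2)] continuous_on_snd2[OF assms(3)]
  unfolding gibbs_def case_prod_unfold divide_inverse
  by (intro continuous_on_exp continuous_on_mult continuous_on_diff continuous_on_add continuous_on_const)

lemma ln_gibbs: "\<epsilon> > 0 \<Longrightarrow> \<epsilon> * ln (gibbs \<epsilon> c f g x y) = f x + g y - c x y"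
  by (simp add: gibbs_def)

text \<open>Weak duality. The cost is rewritten as \<open>f + g\<close> minus \<epsilon> times the
  logarithm of the Gibbs density; the marginals of the coupling turn \<open>f\<close> and
  \<open>g\<close> into integrals against \<alpha> and \<beta>, and the remaining entropy of the
  coupling relative to the Gibbs density is bounded below by \<open>mult_ln_ge\<close>.\<close>

lemma OT_ge_dual_value:
  assumes X: "compact X" and \<alpha>: "borel_prob X \<alpha>" and \<beta>: "borel_prob X \<beta>"
    and c: "continuous_on (X \<times> X) (\<lambda>(x, y). c x y)"
    and f: "continuous_on X f" and g: "continuous_on X g" and \<epsilon>: "\<epsilon> > 0"
  shows "ereal (dual_value \<epsilon> c \<alpha> \<beta> f g) \<le> OT \<epsilon> c \<alpha> \<beta>"
  unfolding OT_def
proof (rule INF_greatest)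
  fix \<pi> assume "\<pi> \<in> couplings \<alpha> \<beta>"
  then have \<pi>: "prob_space \<pi>" "sets \<pi> = sets (\<alpha> \<Otimes>\<^sub>M \<beta>)"
    "distr \<pi> \<alpha> fst = \<alpha>" "distr \<pi> \<beta> snd = \<beta>" by (auto simp: couplings_def)
  let ?P = "\<alpha> \<Otimes>\<^sub>M \<beta>"
  interpret P: pair_prob_space \<alpha> \<beta> by (rule borel_prob_pair_prob_space[OF \<alpha> \<beta>])
  interpret \<pi>: prob_space \<pi> by (rule \<pi>)
  show "ereal (dual_value \<epsilon> c \<alpha> \<beta> f g) \<le> ereal (\<integral>z. c (fst z) (snd z) \<partial>\<pi>) + ereal \<epsilon> * KL \<pi> ?P"
  proof (cases "absolutely_continuous ?P \<pi> \<and> integrable \<pi> (entropy_density (exp 1) ?P \<pi>)")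
    case False
    then have "KL \<pi> ?P = \<infinity>" by (simp only: KL_def if_False)
    then show ?thesis using \<epsilon> by simp
  next
    case True
    then have ac: "absolutely_continuous ?P \<pi>"
      and int: "integrable \<pi> (entropy_density (exp 1) ?P \<pi>)" by auto
    have "finite_measure \<pi>" by unfold_locales
    \<comment> \<open>A real, everywhere non-negative version of the density is needed in order to
      apply \<open>mult_ln_ge\<close> pointwise.\<close>
    from P.real_RN_deriv[OF this ac \<pi>(2)] obtain p
      where p: "p \<in> borel_measurable ?P" "AE x in ?P. RN_deriv ?P \<pi> x = ennreal (p x)"
        "AE x in \<pi>. 0 < p x" "\<And>x. 0 \<le> p x" by this auto
    have "\<pi> = density ?P (RN_deriv ?P \<pi>)"
      using ac \<pi>(2) by (rule P.density_RN_deriv[symmetric])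
    also have "\<dots> = density ?P p" using p by (auto intro!: density_cong)
    finally have N: "\<pi> = density ?P p" .
    have AEln: "AE x in \<pi>. entropy_density (exp 1) ?P \<pi> x = ln (p x)"
      using absolutely_continuous_AE[OF \<pi>(2) ac p(2)]
      by eventually_elim (simp add: entropy_density_def log_def p(4))
    have [measurable]: "entropy_density (exp 1) ?P \<pi> \<in> borel_measurable \<pi>"
      by (rule borel_measurable_integrable[OF int])
    have [measurable]: "p \<in> borel_measurable \<pi>"
      using p(1) measurable_cong_sets[OF \<pi>(2) refl] by blast
    have intln: "integrable \<pi> (\<lambda>z. ln (p z))"
      using AEln by (intro integrable_cong_AE[THEN iffD1, OF _ _ _ int]) auto
    have KL: "KL_divergence (exp 1) ?P \<pi> = (\<integral>z. ln (p z) \<partial>\<pi>)"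
      unfolding KL_divergence_def using AEln by (intro integral_cong_AE) auto
    let ?\<rho> = "\<lambda>z. gibbs \<epsilon> c f g (fst z) (snd z)"
    have meas: "(\<lambda>z. G (fst z) (snd z)) \<in> borel_measurable ?P"
      if "continuous_on (X \<times> X) (\<lambda>(x, y). G x y :: real)" for G
      by (rule borel_prob_measurable_pair'[OF X \<alpha> \<beta> that])
    have int\<pi>: "integrable \<pi> (\<lambda>z. G (fst z) (snd z))"
      if G: "continuous_on (X \<times> X) (\<lambda>(x, y). G x y :: real)" for G
    proof -
      obtain B where "\<And>x y. x \<in> X \<Longrightarrow> y \<in> X \<Longrightarrow> \<bar>G x y\<bar> \<le> B"
        using compact_continuous_bound2[OF X G] by blast
      moreover have "(\<lambda>z. G (fst z) (snd z)) \<in> borel_measurable \<pi>"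
        using meas[OF G] measurable_cong_sets[OF \<pi>(2) refl] by blast
      ultimately show ?thesis
        using sets_eq_imp_space_eq[OF \<pi>(2)] borel_prob_space_pair[OF \<alpha> \<beta>]
        by (intro \<pi>.integrable_const_bound[of _ B] AE_I2) auto
    qed
    note cc = continuous_on_fst2[OF f, of X] continuous_on_snd2[OF g, of X] c
    note i = int\<pi>[OF cc(1)] int\<pi>[OF cc(2)] int\<pi>[OF cc(3)]
    have fst: "fst \<in> \<pi> \<rightarrow>\<^sub>M \<alpha>" and snd: "snd \<in> \<pi> \<rightarrow>\<^sub>M \<beta>"
      using measurable_cong_sets[OF \<pi>(2) refl] by auto
    have ff: "(\<integral>x. f x \<partial>\<alpha>) = (\<integral>z. f (fst z) \<partial>\<pi>)"
      using integral_distr[OF fst borel_prob_measurable[OF \<alpha> f]] \<pi>(3) by simp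
    have gg: "(\<integral>x. g x \<partial>\<beta>) = (\<integral>z. g (snd z) \<partial>\<pi>)"
      using integral_distr[OF snd borel_prob_measurable[OF \<beta> g]] \<pi>(4) by simp
    have intp: "integrable ?P p"
      using integrable_density[of "\<lambda>z. 1::real" ?P p, folded N] p(1,4) by simp
    have intp1: "(\<integral>z. p z \<partial>?P) = 1"
      using integral_density[of "\<lambda>z. 1::real" ?P p, folded N] p(1,4) \<pi>.prob_space by simp
    have lnr: "ln (?\<rho> z) = (f (fst z) + g (snd z) - c (fst z) (snd z)) / \<epsilon>" for z
      by (simp add: gibbs_def)
    have intd: "integrable \<pi> (\<lambda>z. ln (p z) - ln (?\<rho> z))"
      unfolding lnr by (intro Bochner_Integration.integrable_diff integrable_divide_zero
          Bochner_Integration.integrable_add intln i)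
    have "1 - (\<integral>z. ?\<rho> z \<partial>?P) = (\<integral>z. p z - ?\<rho> z \<partial>?P)"
      using intp intp1 borel_prob_integrable_pair'[OF X \<alpha> \<beta> continuous_on_gibbs[OF c f g]] by simp
    \<comment> \<open>The pointwise inequality is integrated against the product measure, under
      which \<open>p\<close> has mass 1. This is why the mass of the Gibbs density minus 1 appears
      in \<open>dual_value\<close>.\<close>
    also have "\<dots> \<le> (\<integral>z. p z * (ln (p z) - ln (?\<rho> z)) \<partial>?P)"
    proof (rule integral_mono)
      show "integrable ?P (\<lambda>z. p z - ?\<rho> z)"
        by (intro Bochner_Integration.integrable_diff intp borel_prob_integrable_pair'[OF X \<alpha> \<beta> continuous_on_gibbs[OF c f g]])
      have "(\<lambda>z. ln (p z) - ln (?\<rho> z)) \<in> borel_measurable ?P"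
        using p(1) meas[OF continuous_on_gibbs[OF c f g]] by measurable
      then show "integrable ?P (\<lambda>z. p z * (ln (p z) - ln (?\<rho> z)))"
        using integrable_density[of "\<lambda>z. ln (p z) - ln (?\<rho> z)" ?P p, folded N] intd p(1,4) by simp
      show "p z - ?\<rho> z \<le> p z * (ln (p z) - ln (?\<rho> z))" for z
        using mult_ln_ge[OF p(4), of "?\<rho> z" z] by (simp add: gibbs_def algebra_simps)
    qed
    also have "\<dots> = (\<integral>z. ln (p z) - ln (?\<rho> z) \<partial>\<pi>)"
    proof -
      have "(\<lambda>z. ln (p z) - ln (?\<rho> z)) \<in> borel_measurable ?P"
        using p(1) meas[OF continuous_on_gibbs[OF c f g]] by measurable
      then show ?thesis using integral_density[of "\<lambda>z. ln (p z) - ln (?\<rho> z)" ?P p, folded N] p(1,4) by simp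
    qed
    also have "\<dots> = (\<integral>z. ln (p z) \<partial>\<pi>) -
       ((\<integral>z. f (fst z) \<partial>\<pi>) + (\<integral>z. g (snd z) \<partial>\<pi>) - (\<integral>z. c (fst z) (snd z) \<partial>\<pi>)) / \<epsilon>"
      unfolding lnr by (simp add: intln i)
    finally have fin: "\<epsilon> * (1 - (\<integral>z. ?\<rho> z \<partial>?P)) \<le> \<epsilon> * ((\<integral>z. ln (p z) \<partial>\<pi>) -
       ((\<integral>x. f x \<partial>\<alpha>) + (\<integral>x. g x \<partial>\<beta>) - (\<integral>z. c (fst z) (snd z) \<partial>\<pi>)) / \<epsilon>)"
      unfolding ff gg using \<epsilon> by (intro mult_left_mono) auto
    have eq: "\<epsilon> * (a - b / \<epsilon>) = \<epsilon> * a - b" for a b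
      using \<epsilon> by (simp add: right_diff_distrib)
    from fin[unfolded eq] have "dual_value \<epsilon> c \<alpha> \<beta> f g \<le> (\<integral>z. c (fst z) (snd z) \<partial>\<pi>) + \<epsilon> * (\<integral>z. ln (p z) \<partial>\<pi>)"
      by (simp add: dual_value_def right_diff_distrib)
    then show ?thesis using True by (simp add: KL_def KL)
  qed
qed

text \<open>A continuous positive density on a compact square has a bounded logarithm, so its
  entropy is finite and the infinite branch of \<open>KL\<close> is avoided.\<close>

lemma density_coupling:
  assumes X: "compact X" and \<alpha>: "borel_prob X \<alpha>" and \<beta>: "borel_prob X \<beta>"
    and p: "continuous_on (X \<times> X) (\<lambda>(x, y). p x y)"
    and p0: "\<And>x y. x \<in> X \<Longrightarrow> y \<in> X \<Longrightarrow> p x y > 0"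
    and m1: "\<And>x. x \<in> X \<Longrightarrow> (\<integral>y. p x y \<partial>\<beta>) = 1"
    and m2: "\<And>y. y \<in> X \<Longrightarrow> (\<integral>x. p x y \<partial>\<alpha>) = 1"
  defines "\<pi> \<equiv> density (\<alpha> \<Otimes>\<^sub>M \<beta>) (\<lambda>z. ennreal (p (fst z) (snd z)))"
  shows "\<pi> \<in> couplings \<alpha> \<beta>"
    and "KL \<pi> (\<alpha> \<Otimes>\<^sub>M \<beta>) = ereal (\<integral>z. p (fst z) (snd z) * ln (p (fst z) (snd z)) \<partial>(\<alpha> \<Otimes>\<^sub>M \<beta>))"
    and "continuous_on (X \<times> X) (\<lambda>(x, y). c x y) \<Longrightarrow>
      (\<integral>z. c (fst z) (snd z) \<partial>\<pi>) = (\<integral>z. p (fst z) (snd z) * c (fst z) (snd z) \<partial>(\<alpha> \<Otimes>\<^sub>M \<beta>))"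
proof -
  let ?P = "\<alpha> \<Otimes>\<^sub>M \<beta>" let ?p = "\<lambda>z. p (fst z) (snd z)"
  interpret P: pair_prob_space \<alpha> \<beta> by (rule borel_prob_pair_prob_space[OF \<alpha> \<beta>])
  note sp = borel_prob_space_pair[OF \<alpha> \<beta>] borel_prob_space[OF \<alpha>] borel_prob_space[OF \<beta>]
  have [measurable]: "?p \<in> borel_measurable ?P" by (rule borel_prob_measurable_pair'[OF X \<alpha> \<beta> p])
  have nn: "AE z in ?P. 0 \<le> ?p z" using p0 by (intro AE_I2) (auto simp: sp intro: less_imp_le)
  have n1: "(\<integral>\<^sup>+y. ennreal (p x y) \<partial>\<beta>) = 1" if "x \<in> X" for x
  proof -
    have "(\<integral>\<^sup>+y. ennreal (p x y) \<partial>\<beta>) = ennreal (\<integral>y. p x y \<partial>\<beta>)"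
      using that p0 by (intro nn_integral_eq_integral borel_prob_integrable[OF X \<beta>] continuous_on_slice2[OF p] AE_I2)
        (auto simp: sp intro: less_imp_le)
    then show ?thesis using m1[OF that] by simp
  qed
  have n2: "(\<integral>\<^sup>+x. ennreal (p x y) \<partial>\<alpha>) = 1" if "y \<in> X" for y
  proof -
    have "(\<integral>\<^sup>+x. ennreal (p x y) \<partial>\<alpha>) = ennreal (\<integral>x. p x y \<partial>\<alpha>)"
      using that p0 by (intro nn_integral_eq_integral borel_prob_integrable[OF X \<alpha>] continuous_on_slice1[OF p] AE_I2)
        (auto simp: sp intro: less_imp_le)
    then show ?thesis using m2[OF that] by simp
  qed
  have d1: "distr \<pi> \<alpha> fst = \<alpha>"
  proof (rule measure_eqI)
    fix A assume "A \<in> sets (distr \<pi> \<alpha> fst)"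
    then have A [measurable]: "A \<in> sets \<alpha>" by simp
    have "emeasure (distr \<pi> \<alpha> fst) A = emeasure \<pi> (A \<times> space \<beta>)"
      using sets.sets_into_space[OF A] unfolding \<pi>_def
      by (subst emeasure_distr) (auto simp: space_pair_measure intro!: arg_cong[where f="emeasure _"])
    also have "\<dots> = (\<integral>\<^sup>+z. ennreal (?p z) * indicator (A \<times> space \<beta>) z \<partial>?P)"
      unfolding \<pi>_def by (rule emeasure_density) auto
    also have "\<dots> = (\<integral>\<^sup>+x. \<integral>\<^sup>+y. ennreal (p x y) * indicator A x \<partial>\<beta> \<partial>\<alpha>)"
      by (subst P.M2.nn_integral_fst[symmetric])
        (auto intro!: nn_integral_cong simp: indicator_def)
    also have "\<dots> = (\<integral>\<^sup>+x. indicator A x \<partial>\<alpha>)"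
    proof (rule nn_integral_cong)
      fix x assume x: "x \<in> space \<alpha>"
      then have "(\<lambda>y. ennreal (p x y)) \<in> borel_measurable \<beta>"
        using borel_prob_measurable[OF \<beta> continuous_on_slice2[OF p, of x]] by (simp add: sp)
      then have "(\<integral>\<^sup>+y. ennreal (p x y) * indicator A x \<partial>\<beta>) = (\<integral>\<^sup>+y. ennreal (p x y) \<partial>\<beta>) * indicator A x"
        by (rule nn_integral_multc)
      then show "(\<integral>\<^sup>+y. ennreal (p x y) * indicator A x \<partial>\<beta>) = indicator A x"
        using n1[of x] x by (simp add: sp)
    qed
    finally show "emeasure (distr \<pi> \<alpha> fst) A = emeasure \<alpha> A" by simp
  qed simp
  have d2: "distr \<pi> \<beta> snd = \<beta>"
  proof (rule measure_eqI)
    fix A assume "A \<in> sets (distr \<pi> \<beta> snd)"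
    then have A [measurable]: "A \<in> sets \<beta>" by simp
    have "emeasure (distr \<pi> \<beta> snd) A = emeasure \<pi> (space \<alpha> \<times> A)"
      using sets.sets_into_space[OF A] unfolding \<pi>_def
      by (subst emeasure_distr) (auto simp: space_pair_measure intro!: arg_cong[where f="emeasure _"])
    also have "\<dots> = (\<integral>\<^sup>+z. ennreal (?p z) * indicator (space \<alpha> \<times> A) z \<partial>?P)"
      unfolding \<pi>_def by (rule emeasure_density) auto
    also have "\<dots> = (\<integral>\<^sup>+y. \<integral>\<^sup>+x. ennreal (p x y) * indicator A y \<partial>\<alpha> \<partial>\<beta>)"
      by (subst P.nn_integral_snd[symmetric])
        (auto intro!: nn_integral_cong simp: indicator_def)
    also have "\<dots> = (\<integral>\<^sup>+y. indicator A y \<partial>\<beta>)"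
    proof (rule nn_integral_cong)
      fix y assume y: "y \<in> space \<beta>"
      then have "(\<lambda>x. ennreal (p x y)) \<in> borel_measurable \<alpha>"
        using borel_prob_measurable[OF \<alpha> continuous_on_slice1[OF p, of y]] by (simp add: sp)
      then have "(\<integral>\<^sup>+x. ennreal (p x y) * indicator A y \<partial>\<alpha>) = (\<integral>\<^sup>+x. ennreal (p x y) \<partial>\<alpha>) * indicator A y"
        by (rule nn_integral_multc)
      then show "(\<integral>\<^sup>+x. ennreal (p x y) * indicator A y \<partial>\<alpha>) = indicator A y"
        using n2[of y] y by (simp add: sp)
    qed
    finally show "emeasure (distr \<pi> \<beta> snd) A = emeasure \<beta> A" by simp
  qed simp
  have s: "sets \<pi> = sets ?P" by (simp add: \<pi>_def)
  \<comment> \<open>Total mass 1 is read off from the marginal just identified.\<close>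
  have "prob_space (distr \<pi> \<alpha> fst)" unfolding d1 by (rule borel_prob_prob_space[OF \<alpha>])
  then have pr: "prob_space \<pi>"
    by (rule prob_space_distrD[rotated]) (simp add: measurable_cong_sets[OF s refl])
  show "\<pi> \<in> couplings \<alpha> \<beta>" using pr s d1 d2 by (simp add: couplings_def)
  show "(\<integral>z. c (fst z) (snd z) \<partial>\<pi>) = (\<integral>z. ?p z * c (fst z) (snd z) \<partial>?P)"
    if c: "continuous_on (X \<times> X) (\<lambda>(x, y). c x y)"
    unfolding \<pi>_def
    using integral_density[OF borel_prob_measurable_pair'[OF X \<alpha> \<beta> c], of ?p] nn by simp
  have ac: "absolutely_continuous ?P \<pi>"
    unfolding \<pi>_def by (rule absolutely_continuousI_density) measurable
  have "continuous_on (X \<times> X) (\<lambda>(x, y). ln (p x y))"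
    using p unfolding case_prod_unfold
    by (rule continuous_on_ln) (metis less_irrefl mem_Times_iff p0)
  then have lncont: "continuous_on (X \<times> X) (\<lambda>(x, y). p x y * ln (p x y))"
    using p unfolding case_prod_unfold by (intro continuous_on_mult)
  have lnint: "integrable ?P (\<lambda>z. ?p z * ln (?p z))"
    by (rule borel_prob_integrable_pair'[OF X \<alpha> \<beta> lncont])
  have AE1: "AE z in ?P. ennreal (?p z) = RN_deriv ?P \<pi> z"
    by (rule P.RN_deriv_unique) (auto simp: \<pi>_def)
  have "AE z in ?P. entropy_density (exp 1) ?P \<pi> z = ln (?p z)"
    using AE1 nn
  proof eventually_elim
    case (elim z)
    then show ?case by (simp add: entropy_density_def log_def elim(1)[symmetric])
  qed
  then have AE2: "AE z in \<pi>. entropy_density (exp 1) ?P \<pi> z = ln (?p z)"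
    by (rule absolutely_continuous_AE[OF s ac])
  have "integrable \<pi> (\<lambda>z. ln (?p z))"
    using lnint integrable_density[of "\<lambda>z. ln (?p z)" ?P ?p] nn unfolding \<pi>_def by simp
  then have ie: "integrable \<pi> (entropy_density (exp 1) ?P \<pi>)"
    using AE2 s by (intro integrable_cong_AE[THEN iffD2, OF _ _ AE2])
      (auto simp: measurable_cong_sets[OF s refl])
  have "KL_divergence (exp 1) ?P \<pi> = (\<integral>z. ?p z * log (exp 1) (?p z) \<partial>?P)"
    unfolding \<pi>_def by (rule P.KL_density) (use nn in auto)
  then show "KL \<pi> ?P = ereal (\<integral>z. ?p z * ln (?p z) \<partial>?P)"
    using ac ie by (simp add: KL_def log_def)
qed


text \<open>The counterpart of \<open>mult_ln_ge\<close>, with the same linear term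
  \<open>p - q\<close>. The lower and upper bounds for the transport cost therefore differ only by
  the integrated chi-square term.\<close>

lemma mult_ln_le:
  assumes "p > 0" "q > (0::real)"
  shows "p * ln p - p * ln q \<le> (p - q) + (p - q)\<^sup>2 / q"
proof -
  have "ln (p / q) \<le> p / q - 1" using assms by (intro ln_le_minus_one) simp
  then have "p * ln (p / q) \<le> p * (p / q - 1)" using assms by (intro mult_left_mono) auto
  also have "\<dots> = (p - q) + (p - q)\<^sup>2 / q" using assms by (simp add: field_simps power2_eq_square)
  finally show ?thesis using assms by (simp add: ln_div algebra_simps)
qed

text \<open>The Gibbs density is turned into a coupling by subtracting its marginal errors, which costs
  only their square.\<close>

lemma OT_le_dual_value:
  assumes X: "compact X" and \<alpha>: "borel_prob X \<alpha>" and \<beta>: "borel_prob X \<beta>"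
    and c: "continuous_on (X \<times> X) (\<lambda>(x, y). c x y)"
    and f: "continuous_on X f" and g: "continuous_on X g" and \<epsilon>: "\<epsilon> > 0"
    and r1: "\<And>x. x \<in> X \<Longrightarrow> \<bar>(\<integral>y. gibbs \<epsilon> c f g x y \<partial>\<beta>) - 1\<bar> \<le> r"
    and r2: "\<And>y. y \<in> X \<Longrightarrow> \<bar>(\<integral>x. gibbs \<epsilon> c f g x y \<partial>\<alpha>) - 1\<bar> \<le> r"
    and \<delta>: "\<And>x y. x \<in> X \<Longrightarrow> y \<in> X \<Longrightarrow> gibbs \<epsilon> c f g x y \<ge> \<delta>" "3 * r < \<delta>"
  shows "OT \<epsilon> c \<alpha> \<beta> \<le> ereal (dual_value \<epsilon> c \<alpha> \<beta> f g + \<epsilon> * (9 * r\<^sup>2 / \<delta>))"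
proof -
  let ?P = "\<alpha> \<Otimes>\<^sub>M \<beta>"
  interpret P: pair_prob_space \<alpha> \<beta> by (rule borel_prob_pair_prob_space[OF \<alpha> \<beta>])
  note sp = borel_prob_space_pair[OF \<alpha> \<beta>] borel_prob_space[OF \<alpha>] borel_prob_space[OF \<beta>]
  define \<rho> where "\<rho> = gibbs \<epsilon> c f g"
  have \<rho>: "continuous_on (X \<times> X) (\<lambda>(x, y). \<rho> x y)"
    unfolding \<rho>_def by (rule continuous_on_gibbs[OF c f g])
  define \<eta> where "\<eta> x = (\<integral>y. \<rho> x y \<partial>\<beta>) - 1" for x
  define \<theta> where "\<theta> y = (\<integral>x. \<rho> x y \<partial>\<alpha>) - 1" for y
  define C where "C = (\<integral>x. \<eta> x \<partial>\<alpha>)"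
  \<comment> \<open>Subtracting both marginal errors removes the error of the total mass twice, so
    \<open>C\<close> is added back once.\<close>
  define p where "p x y = \<rho> x y - \<eta> x - \<theta> y + C" for x y
  have \<eta>: "continuous_on X \<eta>" unfolding \<eta>_def
    using continuous_on_integral_param[OF X \<beta> continuous_on_swap2[OF \<rho>]]
    by (intro continuous_on_diff continuous_on_const) simp
  have \<theta>: "continuous_on X \<theta>" unfolding \<theta>_def
    using continuous_on_integral_param[OF X \<alpha> \<rho>]
    by (intro continuous_on_diff continuous_on_const) simp
  have \<eta>r: "\<bar>\<eta> x\<bar> \<le> r" if "x \<in> X" for x using r1[OF that] by (simp add: \<eta>_def \<rho>_def)
  have \<theta>r: "\<bar>\<theta> x\<bar> \<le> r" if "x \<in> X" for x using r2[OF that] by (simp add: \<theta>_def \<rho>_def)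
  have Cr: "\<bar>C\<bar> \<le> r" unfolding C_def by (rule borel_prob_integral_bounds(3)[OF X \<alpha> \<eta> \<eta>r])
  note i\<eta> = borel_prob_integrable[OF X \<alpha> \<eta>] and i\<theta> = borel_prob_integrable[OF X \<beta> \<theta>]
  have int\<rho>: "(\<integral>x. \<integral>y. \<rho> x y \<partial>\<beta> \<partial>\<alpha>) = 1 + C"
  proof -
    have "(\<integral>x. \<integral>y. \<rho> x y \<partial>\<beta> \<partial>\<alpha>) = (\<integral>x. 1 + \<eta> x \<partial>\<alpha>)" by (simp add: \<eta>_def)
    then show ?thesis using i\<eta> by (simp add: C_def P.M1.prob_space)
  qed
  \<comment> \<open>Both marginal errors integrate to the error of the total mass, by Fubini;
    without this the corrected density would have only one correct marginal.\<close>
  have C2: "C = (\<integral>y. \<theta> y \<partial>\<beta>)"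
  proof -
    have "(\<integral>y. \<integral>x. \<rho> x y \<partial>\<alpha> \<partial>\<beta>) = (\<integral>y. 1 + \<theta> y \<partial>\<beta>)" by (simp add: \<theta>_def)
    then show ?thesis using i\<theta> borel_prob_Fubini(2)[OF X \<alpha> \<beta> \<rho>] int\<rho> by (simp add: P.M2.prob_space)
  qed
  have p: "continuous_on (X \<times> X) (\<lambda>(x, y). p x y)"
    using \<rho> continuous_on_fst2[OF \<eta>, of X] continuous_on_snd2[OF \<theta>, of X]
    unfolding p_def case_prod_unfold
    by (intro continuous_on_add continuous_on_diff continuous_on_const)
  \<comment> \<open>There are three corrections of size at most \<open>r\<close>. This is the origin
    of \<open>3 * r\<close> in the hypothesis, which keeps \<open>p\<close> positive, and of the
    constant 9 in the conclusion.\<close>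
  have p\<rho>: "\<bar>p x y - \<rho> x y\<bar> \<le> 3 * r" if "x \<in> X" "y \<in> X" for x y
    using \<eta>r[OF that(1)] \<theta>r[OF that(2)] Cr by (simp add: p_def)
  have \<rho>\<delta>: "\<rho> x y \<ge> \<delta>" if "x \<in> X" "y \<in> X" for x y using \<delta>(1)[OF that] by (simp add: \<rho>_def)
  have p0: "p x y > 0" if "x \<in> X" "y \<in> X" for x y
    using p\<rho>[OF that] \<rho>\<delta>[OF that] \<delta>(2) by linarith
  have \<rho>0: "\<rho> x y > 0" for x y by (simp add: \<rho>_def gibbs_def)
  have m1: "(\<integral>y. p x y \<partial>\<beta>) = 1" if "x \<in> X" for x
  proof -
    note i = borel_prob_integrable[OF X \<beta> continuous_on_slice2[OF \<rho> that]]
    have "(\<integral>y. p x y \<partial>\<beta>) = (\<integral>y. \<rho> x y \<partial>\<beta>) - \<eta> x - (\<integral>y. \<theta> y \<partial>\<beta>) + C"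
      unfolding p_def using i i\<theta> by (simp add: P.M2.prob_space)
    then show ?thesis using C2 by (simp add: \<eta>_def)
  qed
  have m2: "(\<integral>x. p x y \<partial>\<alpha>) = 1" if "y \<in> X" for y
  proof -
    note i = borel_prob_integrable[OF X \<alpha> continuous_on_slice1[OF \<rho> that]]
    have "(\<integral>x. p x y \<partial>\<alpha>) = (\<integral>x. \<rho> x y \<partial>\<alpha>) - (\<integral>x. \<eta> x \<partial>\<alpha>) - \<theta> y + C"
      unfolding p_def using i i\<eta> by (simp add: P.M1.prob_space)
    then show ?thesis by (simp add: \<theta>_def C_def)
  qed
  let ?\<pi> = "density ?P (\<lambda>z. ennreal (p (fst z) (snd z)))"
  have \<pi>1: "?\<pi> \<in> couplings \<alpha> \<beta>"
    by (rule density_coupling(1)[OF X \<alpha> \<beta> p]) (use p0 m1 m2 in simp_all)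
  have \<pi>2: "KL ?\<pi> ?P = ereal (\<integral>z. p (fst z) (snd z) * ln (p (fst z) (snd z)) \<partial>?P)"
    by (rule density_coupling(2)[OF X \<alpha> \<beta> p]) (use p0 m1 m2 in simp_all)
  have \<pi>3: "(\<integral>z. c (fst z) (snd z) \<partial>?\<pi>) = (\<integral>z. p (fst z) (snd z) * c (fst z) (snd z) \<partial>?P)"
    by (rule density_coupling(3)[OF X \<alpha> \<beta> p _ _ _ c]) (use p0 m1 m2 in simp_all)
  let ?p = "\<lambda>z. p (fst z) (snd z)" and ?\<rho> = "\<lambda>z. \<rho> (fst z) (snd z)" and ?c = "\<lambda>z. c (fst z) (snd z)"
  have int: "integrable ?P (\<lambda>z. G (fst z) (snd z))"
    if "continuous_on (X \<times> X) (\<lambda>(x, y). G x y :: real)" for G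
    by (rule borel_prob_integrable_pair'[OF X \<alpha> \<beta> that])
  have pc: "continuous_on (X \<times> X) (\<lambda>(x, y). p x y * c x y)"
    using p c unfolding case_prod_unfold by (intro continuous_on_mult)
  have "continuous_on (X \<times> X) (\<lambda>(x, y). ln (p x y))"
    using p unfolding case_prod_unfold
    by (rule continuous_on_ln) (metis less_irrefl mem_Times_iff p0)
  then have plnp: "continuous_on (X \<times> X) (\<lambda>(x, y). p x y * ln (p x y))"
    using p unfolding case_prod_unfold by (intro continuous_on_mult)
  have pf: "continuous_on (X \<times> X) (\<lambda>(x, y). p x y * f x)"
    using p continuous_on_fst2[OF f, of X] unfolding case_prod_unfold by (intro continuous_on_mult)
  have pg: "continuous_on (X \<times> X) (\<lambda>(x, y). p x y * g y)"
    using p continuous_on_snd2[OF g, of X] unfolding case_prod_unfold by (intro continuous_on_mult)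
  have "(\<integral>z. ?p z * ?c z \<partial>?P) + \<epsilon> * (\<integral>z. ?p z * ln (?p z) \<partial>?P)
    = (\<integral>z. ?p z * ?c z + \<epsilon> * (?p z * ln (?p z)) \<partial>?P)"
    using int[OF pc] int[OF plnp] by simp
  also have "\<dots> \<le> (\<integral>z. ?p z * f (fst z) + ?p z * g (snd z) + \<epsilon> * (?p z - ?\<rho> z) + \<epsilon> * (9 * r\<^sup>2 / \<delta>) \<partial>?P)"
  proof (rule integral_mono)
    show "integrable ?P (\<lambda>z. ?p z * ?c z + \<epsilon> * (?p z * ln (?p z)))"
      using int[OF pc] int[OF plnp] by simp
    show "integrable ?P (\<lambda>z. ?p z * f (fst z) + ?p z * g (snd z) + \<epsilon> * (?p z - ?\<rho> z) + \<epsilon> * (9 * r\<^sup>2 / \<delta>))"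
      using int[OF pf] int[OF pg] int[OF p] int[OF \<rho>] by simp
    fix z assume "z \<in> space ?P"
    then have z: "fst z \<in> X" "snd z \<in> X" by (auto simp: sp)
    \<comment> \<open>Expressing the cost by the Gibbs density turns cost plus entropy into linear
      terms, which the exact marginals of \<open>p\<close> evaluate, plus an entropy relative to
      \<rho>.\<close>
    have cz: "?c z = f (fst z) + g (snd z) - \<epsilon> * ln (?\<rho> z)"
      using ln_gibbs[OF \<epsilon>, of c f g "fst z" "snd z"] by (simp add: \<rho>_def)
    have "(?p z - ?\<rho> z)\<^sup>2 \<le> (3 * r)\<^sup>2"
      using p\<rho>[OF z] by (metis abs_ge_zero power2_abs power_mono)
    moreover have "\<delta> > 0" using \<delta>(2) Cr by linarith
    ultimately have "(?p z - ?\<rho> z)\<^sup>2 / ?\<rho> z \<le> (3 * r)\<^sup>2 / \<delta>"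
      using \<rho>\<delta>[OF z] by (intro frac_le) auto
    then have "?p z * ln (?p z) - ?p z * ln (?\<rho> z) \<le> (?p z - ?\<rho> z) + 9 * r\<^sup>2 / \<delta>"
      using mult_ln_le[OF p0[OF z] \<rho>0[of "fst z" "snd z"]] by (simp add: power_mult_distrib)
    then have "\<epsilon> * (?p z * ln (?p z) - ?p z * ln (?\<rho> z)) \<le> \<epsilon> * ((?p z - ?\<rho> z) + 9 * r\<^sup>2 / \<delta>)"
      using \<epsilon> by (intro mult_left_mono) auto
    then show "?p z * ?c z + \<epsilon> * (?p z * ln (?p z)) \<le>
      ?p z * f (fst z) + ?p z * g (snd z) + \<epsilon> * (?p z - ?\<rho> z) + \<epsilon> * (9 * r\<^sup>2 / \<delta>)"
      unfolding cz by (simp add: algebra_simps)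
  qed
  also have "\<dots> = (\<integral>z. ?p z * f (fst z) \<partial>?P) + (\<integral>z. ?p z * g (snd z) \<partial>?P)
      + \<epsilon> * ((\<integral>z. ?p z \<partial>?P) - (\<integral>z. ?\<rho> z \<partial>?P)) + \<epsilon> * (9 * r\<^sup>2 / \<delta>)"
    using int[OF pf] int[OF pg] int[OF p] int[OF \<rho>] P.prob_space by simp
  also have "(\<integral>z. ?p z * f (fst z) \<partial>?P) = (\<integral>x. f x \<partial>\<alpha>)"
    unfolding borel_prob_Fubini[OF X \<alpha> \<beta> pf] using m1 by (intro borel_prob_cong[OF \<alpha>]) simp
  also have "(\<integral>z. ?p z * g (snd z) \<partial>?P) = (\<integral>x. g x \<partial>\<beta>)"
    unfolding borel_prob_Fubini(1)[OF X \<alpha> \<beta> pg] using m2 by (intro borel_prob_cong[OF \<beta>]) simp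
  also have "(\<integral>z. ?p z \<partial>?P) = 1"
    unfolding borel_prob_Fubini[OF X \<alpha> \<beta> p] using borel_prob_cong[OF \<alpha> m1] P.M1.prob_space by simp
  also have "(\<integral>x. f x \<partial>\<alpha>) + (\<integral>x. g x \<partial>\<beta>) + \<epsilon> * (1 - (\<integral>z. ?\<rho> z \<partial>?P)) + \<epsilon> * (9 * r\<^sup>2 / \<delta>)
    = dual_value \<epsilon> c \<alpha> \<beta> f g + \<epsilon> * (9 * r\<^sup>2 / \<delta>)"
    by (simp add: dual_value_def \<rho>_def algebra_simps)
  finally have "ereal (\<integral>z. ?c z \<partial>?\<pi>) + ereal \<epsilon> * KL ?\<pi> ?P \<le> ereal (dual_value \<epsilon> c \<alpha> \<beta> f g + \<epsilon> * (9 * r\<^sup>2 / \<delta>))"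
    unfolding \<pi>2 \<pi>3 by simp
  then show ?thesis unfolding OT_def by (rule INF_lower2[OF \<pi>1])
qed

section \<open>Oscillation contractions and self-potentials\<close>

text \<open>Banach's fixed point argument modulo constants. Contraction of the oscillation says
  nothing about constants, so only a fixed point up to an additive \<open>a\<close> can be expected.
  The predicate \<open>S\<close> is a closed invariant domain; it is needed when the contraction
  rate is available only for functions of bounded oscillation.\<close>

lemma oscillation_contraction_fixpoint:
  fixes T :: "('a::metric_space \<Rightarrow> real) \<Rightarrow> 'a \<Rightarrow> real"
  assumes X: "compact X" "x0 \<in> X" and f0: "S f0"
    and cont: "\<And>f. S f \<Longrightarrow> continuous_on X f"
    and inv: "\<And>f. S f \<Longrightarrow> S (T f)"
    and shift: "\<And>f a. S f \<Longrightarrow> S (\<lambda>x. f x + a)"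
    and closed: "\<And>u f. (\<And>n. S (u n)) \<Longrightarrow> uniform_limit X u f sequentially \<Longrightarrow> S f"
    and contr: "\<And>f g D. S f \<Longrightarrow> S g \<Longrightarrow> (\<And>x y. x \<in> X \<Longrightarrow> y \<in> X \<Longrightarrow> \<bar>(f x - g x) - (f y - g y)\<bar> \<le> D)
      \<Longrightarrow> (\<And>x y. x \<in> X \<Longrightarrow> y \<in> X \<Longrightarrow> \<bar>(T f x - T g x) - (T f y - T g y)\<bar> \<le> \<kappa> * D)"
    and \<kappa>: "0 \<le> \<kappa>" "\<kappa> < 1"
  obtains g a where "S g" "\<And>x. x \<in> X \<Longrightarrow> T g x = g x + a"
proof -
  define u where "u n = (T ^^ n) f0" for n
  have Su: "S (u n)" for n by (induction n) (simp_all add: u_def f0 inv)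
  have uS: "u (Suc n) = T (u n)" for n by (simp add: u_def)
  \<comment> \<open>Normalising at \<open>x0\<close> chooses a representative modulo constants, for
    which the oscillation of an increment bounds its supremum. The increments are then dominated by
    a geometric series.\<close>
  define v where "v n x = u n x - u n x0" for n x
  have Sv: "S (v n)" for n using shift[OF Su[of n], of "- u n x0"] by (simp add: v_def[abs_def])
  have "continuous_on X (\<lambda>x. u 1 x - u 0 x)" by (intro continuous_on_diff cont Su)
  then obtain B where B: "B > 0" "\<And>x. x \<in> X \<Longrightarrow> \<bar>u 1 x - u 0 x\<bar> \<le> B"
    using compact_continuous_bound[OF X(1)] by blast
  have D: "\<bar>(u (Suc n) x - u n x) - (u (Suc n) y - u n y)\<bar> \<le> \<kappa> ^ n * (2 * B)"
    if "x \<in> X" "y \<in> X" for n x y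
    using that
  proof (induction n arbitrary: x y)
    case 0
    then show ?case using B(2)[of x] B(2)[of y] by simp
  next
    case (Suc n)
    show ?case
      using contr[OF Su[of "Suc n"] Su[of n] Suc.IH Suc.prems] by (simp add: uS mult.assoc)
  qed
  define d where "d n x = v (Suc n) x - v n x" for n x
  have "uniform_limit X (\<lambda>n x. \<Sum>i<n. d i x) (\<lambda>x. suminf (\<lambda>i. d i x)) sequentially"
  proof (rule Weierstrass_m_test)
    show "norm (d n x) \<le> \<kappa> ^ n * (2 * B)" if "x \<in> X" for n x
      using D[OF that X(2), of n] by (simp add: d_def v_def)
    show "summable (\<lambda>n. \<kappa> ^ n * (2 * B))" using \<kappa> by (intro summable_mult2 summable_geometric) simp
  qed
  then have "uniform_limit X (\<lambda>n x. v 0 x + (\<Sum>i<n. d i x)) (\<lambda>x. v 0 x + suminf (\<lambda>i. d i x)) sequentially"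
    by (intro uniform_limit_add uniform_limit_const)
  moreover have "v 0 x + (\<Sum>i<n. d i x) = v n x" for n x
    using sum_lessThan_telescope[of "\<lambda>n. v n x" n] by (simp add: d_def)
  ultimately obtain g where g: "uniform_limit X v g sequentially" by auto
  have Sg: "S g" by (rule closed[OF Sv g])
  \<comment> \<open>The contraction with \<open>D = 0\<close>: functions that differ by a constant
    have images that differ by a constant, even though \<open>T\<close> is not assumed
    linear.\<close>
  have Tv: "T (v n) x - T (v n) x0 = v (Suc n) x" if x: "x \<in> X" for n x
    using contr[OF Sv[of n] Su[of n], of 0 x x0] x X(2) by (simp add: uS v_def)
  have "T g x = g x + T g x0" if x: "x \<in> X" for x
  proof -
    have "\<bar>T g x - T g x0 - g x\<bar> \<le> e" if e: "e > 0" for e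
    proof -
      have "\<forall>\<^sub>F n in sequentially. \<forall>x\<in>X. dist (v n x) (g x) < e / 4"
        using uniform_limitD[OF g, of "e/4"] e by simp
      then obtain n where "\<forall>i\<ge>n. \<forall>x\<in>X. dist (v i x) (g x) < e / 4"
        unfolding eventually_sequentially by blast
      then have n: "\<And>x. x \<in> X \<Longrightarrow> dist (v n x) (g x) < e / 4" "\<And>x. x \<in> X \<Longrightarrow> dist (v (Suc n) x) (g x) < e / 4"
        by (simp_all add: le_SucI)
      have "\<bar>(g z - v n z) - (g y - v n y)\<bar> \<le> e / 2" if "z \<in> X" "y \<in> X" for z y
        using n(1)[OF that(1)] n(1)[OF that(2)] unfolding dist_real_def by linarith
      then have "\<bar>(T g x - T (v n) x) - (T g x0 - T (v n) x0)\<bar> \<le> \<kappa> * (e / 2)"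
        by (rule contr[OF Sg Sv _ x X(2)])
      also have "\<dots> \<le> e / 2" using \<kappa> e by (simp add: mult_left_le_one_le)
      finally show ?thesis using Tv[OF x, of n] n(2)[OF x] unfolding dist_real_def by linarith
    qed
    then have "\<bar>T g x - T g x0 - g x\<bar> \<le> 0" by (rule field_le_epsilon) simp
    then show ?thesis by simp
  qed
  then show ?thesis by (rule that[OF Sg])
qed

text \<open>Because \<open>T\<close> changes \<open>f\<close> and \<open>g\<close> only by
  constants, the estimate can be applied to the same pair again and again, and the oscillation of
  their difference is below every power of the rate.\<close>

lemma oscillation_contraction_unique:
  fixes T :: "('a::metric_space \<Rightarrow> real) \<Rightarrow> 'a \<Rightarrow> real"
  assumes X: "compact X" "x0 \<in> X" and S: "S f" "S g"
    and cont: "continuous_on X f" "continuous_on X g"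
    and contr: "\<And>D. (\<And>x y. x \<in> X \<Longrightarrow> y \<in> X \<Longrightarrow> \<bar>(f x - g x) - (f y - g y)\<bar> \<le> D)
      \<Longrightarrow> (\<And>x y. x \<in> X \<Longrightarrow> y \<in> X \<Longrightarrow> \<bar>(T f x - T g x) - (T f y - T g y)\<bar> \<le> \<kappa> * D)"
    and \<kappa>: "0 \<le> \<kappa>" "\<kappa> < 1"
    and T: "\<And>x. x \<in> X \<Longrightarrow> T f x = f x + a" "\<And>x. x \<in> X \<Longrightarrow> T g x = g x + b"
  obtains r where "\<And>x. x \<in> X \<Longrightarrow> f x = g x + r"
proof -
  have "continuous_on X (\<lambda>x. f x - g x)" by (intro continuous_on_diff cont)
  then obtain B where B: "B > 0" "\<And>x. x \<in> X \<Longrightarrow> \<bar>f x - g x\<bar> \<le> B"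
    using compact_continuous_bound[OF X(1)] by blast
  have *: "\<bar>(f x - g x) - (f y - g y)\<bar> \<le> \<kappa> ^ n * (2 * B)" if "x \<in> X" "y \<in> X" for n x y
    using that
  proof (induction n arbitrary: x y)
    case 0
    then show ?case using B(2)[of x] B(2)[of y] by simp
  next
    case (Suc n)
    show ?case using contr[OF Suc.IH Suc.prems] Suc.prems by (simp add: T mult.assoc)
  qed
  have "f x = g x + (f x0 - g x0)" if x: "x \<in> X" for x
  proof -
    have "(\<lambda>n. \<kappa> ^ n * (2 * B)) \<longlonglongrightarrow> 0 * (2 * B)"
      using \<kappa> by (intro tendsto_mult tendsto_const LIMSEQ_realpow_zero) auto
    then have "\<bar>(f x - g x) - (f x0 - g x0)\<bar> \<le> 0"
      using *[OF x X(2)] by (intro tendsto_lowerbound[of _ 0 sequentially]) auto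
    then show ?thesis by simp
  qed
  then show ?thesis by (rule that)
qed

text \<open>Doeblin's argument.\<close>

lemma markov_kernel_oscillation:
  assumes X: "compact X" and \<mu>: "borel_prob X \<mu>"
    and k: "continuous_on (X \<times> X) (\<lambda>(x, y). k x y :: real)"
    and \<delta>: "\<And>x y. x \<in> X \<Longrightarrow> y \<in> X \<Longrightarrow> \<delta> \<le> k x y"
    and k1: "\<And>y. y \<in> X \<Longrightarrow> (\<integral>x. k x y \<partial>\<mu>) = 1"
    and \<phi>: "continuous_on X \<phi>" and D: "\<And>x y. x \<in> X \<Longrightarrow> y \<in> X \<Longrightarrow> \<bar>\<phi> x - \<phi> y\<bar> \<le> D"
    and y: "y \<in> X" "y' \<in> X"
  shows "\<bar>(\<integral>x. \<phi> x * k x y \<partial>\<mu>) - (\<integral>x. \<phi> x * k x y' \<partial>\<mu>)\<bar> \<le> (1 - \<delta>) * D"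
proof -
  interpret prob_space \<mu> by (rule borel_prob_prob_space[OF \<mu>])
  obtain xm where xm: "xm \<in> X" "\<And>x. x \<in> X \<Longrightarrow> \<phi> xm \<le> \<phi> x"
    using continuous_attains_inf[OF X _ \<phi>] y(1) by blast
  \<comment> \<open>Measured from its minimum, the function lies between 0 and
    \<open>D\<close>.\<close>
  define \<psi> where "\<psi> x = \<phi> x - \<phi> xm" for x
  have \<psi>: "0 \<le> \<psi> x" "\<psi> x \<le> D" if "x \<in> X" for x
    using xm(2)[OF that] D[OF that xm(1)] by (auto simp: \<psi>_def)
  have c\<psi>: "continuous_on X \<psi>" unfolding \<psi>_def by (intro continuous_on_diff \<phi> continuous_on_const)
  note i\<psi> = borel_prob_integrable[OF X \<mu> c\<psi>]
  \<comment> \<open>The kernel is split into the constant part \<delta>, whose contribution is the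
    same for every \<open>y\<close>, and a non-negative rest of mass \<open>1 - \<delta>\<close>.
    All integrals thus lie in one interval of length \<open>(1 - \<delta>) * D\<close>.\<close>
  have *: "0 \<le> (\<integral>x. \<phi> x * k x y \<partial>\<mu>) - (\<phi> xm + \<delta> * (\<integral>x. \<psi> x \<partial>\<mu>)) \<and>
     (\<integral>x. \<phi> x * k x y \<partial>\<mu>) - (\<phi> xm + \<delta> * (\<integral>x. \<psi> x \<partial>\<mu>)) \<le> (1 - \<delta>) * D" if y: "y \<in> X" for y
  proof -
    note ck = continuous_on_slice1[OF k y]
    note ik = borel_prob_integrable[OF X \<mu> ck]
    have c: "continuous_on X (\<lambda>x. \<psi> x * (k x y - \<delta>))"
      by (intro continuous_on_mult c\<psi> continuous_on_diff ck continuous_on_const)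
    note i = borel_prob_integrable[OF X \<mu> c]
    have "\<phi> x * k x y = \<phi> xm * k x y + \<delta> * \<psi> x + \<psi> x * (k x y - \<delta>)" for x
      by (simp add: \<psi>_def algebra_simps)
    then have "(\<integral>x. \<phi> x * k x y \<partial>\<mu>) = \<phi> xm + \<delta> * (\<integral>x. \<psi> x \<partial>\<mu>) + (\<integral>x. \<psi> x * (k x y - \<delta>) \<partial>\<mu>)"
      using ik i i\<psi> k1[OF y] by simp
    moreover have "0 \<le> (\<integral>x. \<psi> x * (k x y - \<delta>) \<partial>\<mu>)"
      using \<psi> \<delta> y by (intro borel_prob_integral_bounds(2)[OF X \<mu> c] mult_nonneg_nonneg) auto
    moreover have "0 \<le> (\<integral>x. (D - \<psi> x) * (k x y - \<delta>) \<partial>\<mu>)"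
      using \<psi> \<delta> y by (intro borel_prob_integral_bounds(2)[OF X \<mu>] mult_nonneg_nonneg
         continuous_on_mult continuous_on_diff c\<psi> ck continuous_on_const) auto
    moreover have "(\<integral>x. (D - \<psi> x) * (k x y - \<delta>) \<partial>\<mu>) = D * (1 - \<delta>) - (\<integral>x. \<psi> x * (k x y - \<delta>) \<partial>\<mu>)"
    proof -
      have eq: "(D - \<psi> x) * (k x y - \<delta>) = D * k x y - D * \<delta> - \<psi> x * (k x y - \<delta>)" for x
        by (simp add: algebra_simps)
      show ?thesis unfolding eq using ik i k1[OF y] prob_space by (simp add: right_diff_distrib del: right_diff_distrib_numeral)
    qed
    ultimately show ?thesis by (simp add: mult.commute)
  qed
  show ?thesis using *[OF y(1)] *[OF y(2)] by linarith
qed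

lemma continuous_on_kernel_integral:
  assumes X: "compact X" and \<mu>: "borel_prob X \<mu>"
    and k: "continuous_on (X \<times> X) (\<lambda>(x, y). k x y :: real)" and \<phi>: "continuous_on X \<phi>"
  shows "continuous_on X (\<lambda>y. \<integral>x. \<phi> x * k x y \<partial>\<mu>)"
  using continuous_on_fst2[OF \<phi>, of X] k unfolding case_prod_unfold
  by (intro continuous_on_integral_param[OF X \<mu>]) (simp add: case_prod_unfold continuous_on_mult)

text \<open>Taking logarithms, the left side is
  \<open>d + ln (1 - \<delta> * (1 - exp (- d)))\<close>, hence at most
  \<open>d - \<delta> * (1 - exp (- d))\<close>; and \<open>1 - exp (- d)\<close> is at least
  \<open>d * exp (- d)\<close>. The bound \<open>b\<close> on \<open>d\<close> makes the resulting
  rate independent of \<open>d\<close>.\<close>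

lemma exp_convex_combination_le:
  fixes d :: real
  assumes "0 \<le> d" "d \<le> b" "0 \<le> \<delta>"
  shows "\<delta> + (1 - \<delta>) * exp d \<le> exp ((1 - \<delta> * exp (- b)) * d)"
proof -
  have "\<delta> * exp (- b) * d \<le> \<delta> * (1 - exp (- d))"
  proof -
    have "exp (- b) * d \<le> exp (- d) * d" using assms by (intro mult_right_mono) auto
    also have "\<dots> \<le> exp (- d) * (exp d - 1)"
    proof (rule mult_left_mono)
      show "d \<le> exp d - 1" using exp_ge_add_one_self[of d] by linarith
    qed simp
    also have "\<dots> = 1 - exp (- d)" by (simp add: right_diff_distrib flip: exp_add)
    finally show ?thesis using assms(3) by (simp add: mult.assoc mult_left_mono)
  qed
  then have le: "d - \<delta> * (1 - exp (- d)) \<le> (1 - \<delta> * exp (- b)) * d" by (simp add: left_diff_distrib)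
  have "\<delta> + (1 - \<delta>) * exp d = exp d * (1 + - (\<delta> * (1 - exp (- d))))"
    by (simp add: algebra_simps flip: exp_add)
  also have "\<dots> \<le> exp d * exp (- (\<delta> * (1 - exp (- d))))"
    by (intro mult_left_mono exp_ge_add_one_self) auto
  also have "\<dots> = exp (d - \<delta> * (1 - exp (- d)))" by (simp flip: exp_add)
  also have "\<dots> \<le> exp ((1 - \<delta> * exp (- b)) * d)" using le by simp
  finally show ?thesis .
qed

text \<open>Doeblin's argument for a nonlinear map. The quotient of the two integrals at
  \<open>y\<close> is the mean of \<open>exp (\<phi> - \<psi>)\<close> under the probability density
  proportional to \<open>exp (\<psi> - b)\<close> at \<open>y\<close>, and these densities for
  different \<open>y\<close> dominate a fixed multiple of each other. Comparing the means at
  \<open>y\<close> and \<open>y'\<close> gives a convex combination, which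
  \<open>exp_convex_combination_le\<close> converts to a rate for the logarithms. The one-sided
  estimate suffices since \<open>y\<close> and \<open>y'\<close> can be exchanged.\<close>

lemma softmin_oscillation_contraction:
  assumes X: "compact X" and \<mu>: "borel_prob X \<mu>"
    and b: "continuous_on (X \<times> X) (\<lambda>(x, y). b x y :: real)"
    and B: "\<And>x y. x \<in> X \<Longrightarrow> y \<in> X \<Longrightarrow> \<bar>b x y\<bar> \<le> B / 2"
    and \<phi>: "continuous_on X \<phi>" and \<psi>: "continuous_on X \<psi>"
    and D: "\<And>x y. x \<in> X \<Longrightarrow> y \<in> X \<Longrightarrow> \<bar>(\<phi> x - \<psi> x) - (\<phi> y - \<psi> y)\<bar> \<le> D" and DB: "D \<le> 2 * B"
    and y: "y \<in> X" "y' \<in> X"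
  shows "ln (\<integral>x. exp (\<phi> x - b x y) \<partial>\<mu>) - ln (\<integral>x. exp (\<psi> x - b x y) \<partial>\<mu>)
    - (ln (\<integral>x. exp (\<phi> x - b x y') \<partial>\<mu>) - ln (\<integral>x. exp (\<psi> x - b x y') \<partial>\<mu>))
    \<le> (1 - exp (- (2 * B)) * exp (- (2 * B))) * D"
proof -
  interpret prob_space \<mu> by (rule borel_prob_prob_space[OF \<mu>])
  have D0: "D \<ge> 0" using D[OF y(1) y(1)] by simp
  have B0: "B \<ge> 0" using B[OF y(1) y(1)] abs_ge_zero[of "b y y"] by linarith
  have cu: "continuous_on X (\<lambda>x. \<phi> x - \<psi> x)" by (intro continuous_on_diff \<phi> \<psi>)
  obtain xm where xm: "xm \<in> X" "\<And>x. x \<in> X \<Longrightarrow> \<phi> x - \<psi> x \<le> \<phi> xm - \<psi> xm"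
    using continuous_attains_sup[OF X _ cu] y(1) by blast
  define E where "E = exp (\<phi> xm - \<psi> xm)"
  have cq: "continuous_on X (\<lambda>x. exp (\<psi> x - b x z))" if "z \<in> X" for z
    by (intro continuous_on_exp continuous_on_diff \<psi> continuous_on_slice1[OF b that])
  have cp: "continuous_on X (\<lambda>x. exp (\<phi> x - b x z))" if "z \<in> X" for z
    by (intro continuous_on_exp continuous_on_diff \<phi> continuous_on_slice1[OF b that])
  note iq = borel_prob_integrable[OF X \<mu> cq] and ip = borel_prob_integrable[OF X \<mu> cp]
  define Z where "Z z = (\<integral>x. exp (\<psi> x - b x z) \<partial>\<mu>)" for z
  define R where "R z = (\<integral>x. exp (\<phi> x - b x z) \<partial>\<mu>)" for z
  have pos: "(\<integral>x. exp (\<xi> x - b x z) \<partial>\<mu>) > 0" if \<xi>: "continuous_on X \<xi>" and z: "z \<in> X" for \<xi> z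
  proof -
    have c: "continuous_on X (\<lambda>x. exp (\<xi> x - b x z))"
      by (intro continuous_on_exp continuous_on_diff \<xi> continuous_on_slice1[OF b z])
    obtain x1 where x1: "x1 \<in> X" "\<And>x. x \<in> X \<Longrightarrow> exp (\<xi> x1 - b x1 z) \<le> exp (\<xi> x - b x z)"
      using continuous_attains_inf[OF X _ c] z by blast
    have "exp (\<xi> x1 - b x1 z) \<le> (\<integral>x. exp (\<xi> x - b x z) \<partial>\<mu>)"
      by (rule borel_prob_integral_bounds(2)[OF X \<mu> c x1(2)])
    then show ?thesis by (rule less_le_trans[OF exp_gt_zero])
  qed
  have Z0: "Z z > 0" if "z \<in> X" for z unfolding Z_def by (rule pos[OF \<psi> that])
  have R0: "R z > 0" if "z \<in> X" for z unfolding R_def by (rule pos[OF \<phi> that])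
  have q: "exp (\<psi> x - b x z') \<le> exp B * exp (\<psi> x - b x z)" if "x \<in> X" "z \<in> X" "z' \<in> X" for x z z'
  proof -
    have "\<psi> x - b x z' \<le> B + (\<psi> x - b x z)" using B[OF that(1,2)] B[OF that(1,3)] by linarith
    then show ?thesis by (simp flip: exp_add)
  qed
  have ZZ: "Z z' \<le> exp B * Z z" if "z \<in> X" "z' \<in> X" for z z'
  proof -
    have "(\<integral>x. exp (\<psi> x - b x z') \<partial>\<mu>) \<le> (\<integral>x. exp B * exp (\<psi> x - b x z) \<partial>\<mu>)"
      using q[OF _ that] that by (intro integral_mono integrable_mult_right iq) (auto simp: borel_prob_space[OF \<mu>])
    then show ?thesis by (simp add: Z_def)
  qed
  \<comment> \<open>Replacing \<open>y'\<close> by \<open>y\<close> changes the unnormalised density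
    and its mass by a factor of at most \<open>exp B\<close> each, so the normalised densities
    compare with constant \<open>exp (- (2 * B))\<close>.\<close>
  define \<delta> where "\<delta> = exp (- (2 * B))"
  define w where "w x = exp (\<psi> x - b x y) / Z y - \<delta> * (exp (\<psi> x - b x y') / Z y')" for x
  have w0: "w x \<ge> 0" if x: "x \<in> X" for x
  proof -
    have \<delta>B: "\<delta> * (exp B * exp B) = 1" by (simp add: \<delta>_def flip: exp_add)
    have "exp (\<psi> x - b x y') * Z y \<le> (exp B * exp (\<psi> x - b x y)) * (exp B * Z y')"
      using q[OF x y] ZZ[OF y(2,1)] Z0[OF y(1)] by (intro mult_mono) auto
    then have "\<delta> * (exp (\<psi> x - b x y') * Z y) \<le> \<delta> * ((exp B * exp (\<psi> x - b x y)) * (exp B * Z y'))"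
      by (intro mult_left_mono) (auto simp: \<delta>_def)
    also have "\<dots> = (\<delta> * (exp B * exp B)) * (exp (\<psi> x - b x y) * Z y')" by (simp only: ac_simps)
    finally have "\<delta> * (exp (\<psi> x - b x y') * Z y) \<le> exp (\<psi> x - b x y) * Z y'"
      by (simp only: \<delta>B mult_1_left)
    then show ?thesis using Z0 y by (simp add: w_def field_simps)
  qed
  have cw: "continuous_on X w" unfolding w_def divide_inverse
    by (intro continuous_on_diff continuous_on_mult continuous_on_const cq y)
  have iw: "(\<integral>x. w x \<partial>\<mu>) = 1 - \<delta>"
  proof -
    have "(\<integral>x. w x \<partial>\<mu>) = Z y / Z y - \<delta> * (Z y' / Z y')"
      unfolding w_def using iq[OF y(1)] iq[OF y(2)] by (simp add: Z_def)
    then show ?thesis using Z0[OF y(1)] Z0[OF y(2)] by simp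
  qed
  have e\<phi>: "exp (\<phi> x - b x z) = exp (\<phi> x - \<psi> x) * exp (\<psi> x - b x z)" for x z by (simp flip: exp_add)
  have "R y / Z y - \<delta> * (R y' / Z y') = (\<integral>x. exp (\<phi> x - \<psi> x) * w x \<partial>\<mu>)"
  proof -
    have "exp (\<phi> x - \<psi> x) * w x = exp (\<phi> x - b x y) / Z y - \<delta> * (exp (\<phi> x - b x y') / Z y')" for x
      unfolding w_def e\<phi>[of x y] e\<phi>[of x y'] by (simp add: algebra_simps)
    then show ?thesis using ip[OF y(1)] ip[OF y(2)] by (simp add: R_def)
  qed
  also have "\<dots> \<le> (\<integral>x. E * w x \<partial>\<mu>)"
    using w0 xm(2) by (intro integral_mono borel_prob_integrable[OF X \<mu>] continuous_on_mult continuous_on_exp cu cw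
      continuous_on_const mult_right_mono) (auto simp: E_def borel_prob_space[OF \<mu>])
  also have "\<dots> = E * (1 - \<delta>)" using iw by simp
  finally have 1: "R y / Z y \<le> \<delta> * (R y' / Z y') + (1 - \<delta>) * E" by (simp add: mult.commute)
  \<comment> \<open>The difference \<open>\<phi> - \<psi>\<close> stays within \<open>D\<close> of
    its maximum, so the mean at \<open>y'\<close> controls \<open>E\<close> at the price of a factor
    \<open>exp D\<close>.\<close>
  have 2: "E * exp (- D) \<le> R y' / Z y'"
  proof -
    have "(\<integral>x. E * exp (- D) * exp (\<psi> x - b x y') \<partial>\<mu>) \<le> (\<integral>x. exp (\<phi> x - b x y') \<partial>\<mu>)"
    proof (intro integral_mono integrable_mult_right iq ip y)
      fix x assume "x \<in> space \<mu>"
      then have "\<phi> xm - \<psi> xm - D + (\<psi> x - b x y') \<le> \<phi> x - b x y'"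
        using D[OF xm(1), of x] by (simp add: borel_prob_space[OF \<mu>])
      then show "E * exp (- D) * exp (\<psi> x - b x y') \<le> exp (\<phi> x - b x y')"
        by (simp add: E_def flip: exp_add)
    qed
    then have "E * exp (- D) * Z y' \<le> R y'" by (simp add: Z_def R_def)
    then show ?thesis using Z0[OF y(2)] by (simp add: pos_le_divide_eq)
  qed
  have \<delta>1: "0 \<le> \<delta>" "\<delta> \<le> 1" using B0 by (auto simp: \<delta>_def)
  have "E \<le> exp D * (R y' / Z y')"
  proof -
    have "exp D * (E * exp (- D)) = E" by (simp add: exp_minus)
    moreover have "exp D * (E * exp (- D)) \<le> exp D * (R y' / Z y')"
      by (rule mult_left_mono[OF 2]) simp
    ultimately show ?thesis by (simp only:)
  qed
  then have "(1 - \<delta>) * E \<le> (1 - \<delta>) * (exp D * (R y' / Z y'))" using \<delta>1 by (intro mult_left_mono) auto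
  with 1 have "R y / Z y \<le> \<delta> * (R y' / Z y') + (1 - \<delta>) * (exp D * (R y' / Z y'))" by linarith
  also have "\<dots> = (\<delta> + (1 - \<delta>) * exp D) * (R y' / Z y')" by (simp only: distrib_right mult.assoc)
  also have "\<dots> \<le> exp ((1 - \<delta> * exp (- (2 * B))) * D) * (R y' / Z y')"
    using R0[OF y(2)] Z0[OF y(2)] exp_convex_combination_le[OF D0 DB \<delta>1(1)]
    by (intro mult_right_mono) auto
  finally have "ln (R y / Z y) \<le> ln (exp ((1 - \<delta> * exp (- (2 * B))) * D) * (R y' / Z y'))"
    using R0 Z0 y by (intro ln_mono) auto
  then have "ln (R y) - ln (Z y) \<le> (1 - \<delta> * exp (- (2 * B))) * D + (ln (R y') - ln (Z y'))"
    using R0[OF y(1)] R0[OF y(2)] Z0[OF y(1)] Z0[OF y(2)]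
    by (simp add: ln_mult_pos ln_div del: ln_mult)
  then show ?thesis by (simp add: R_def Z_def \<delta>_def)
qed


text \<open>Invertibility of id - K^2 modulo constants. The continuous kernel attains a positive
  minimum \<delta>, which is at most 1 because the kernel integrates to 1; each application of
  \<open>K\<close> then shrinks oscillations by \<open>1 - \<delta>\<close>, and a solution is a
  fixed point of \<open>K (K w) + h\<close> up to a constant.\<close>

lemma kernel_resolvent:
  assumes X: "compact X" "x0 \<in> X" and \<mu>: "borel_prob X \<mu>"
    and k: "continuous_on (X \<times> X) (\<lambda>(x, y). k x y :: real)"
    and kpos: "\<And>x y. x \<in> X \<Longrightarrow> y \<in> X \<Longrightarrow> 0 < k x y"
    and k1: "\<And>y. y \<in> X \<Longrightarrow> (\<integral>x. k x y \<partial>\<mu>) = 1"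
  defines "K \<equiv> \<lambda>\<phi> y. \<integral>x. \<phi> x * k x y \<partial>\<mu>"
  shows "continuous_on X h \<Longrightarrow> \<exists>w a. continuous_on X w \<and> (\<forall>y\<in>X. w y - K (K w) y = h y + a)"
    and "continuous_on X \<phi> \<Longrightarrow> continuous_on X \<psi> \<Longrightarrow>
      (\<And>y. y \<in> X \<Longrightarrow> \<phi> y - K (K \<phi>) y = \<psi> y - K (K \<psi>) y + a) \<Longrightarrow> \<exists>r. \<forall>y\<in>X. \<phi> y = \<psi> y + r"
proof -
  interpret prob_space \<mu> by (rule borel_prob_prob_space[OF \<mu>])
  obtain z where z: "z \<in> X \<times> X" "\<And>z'. z' \<in> X \<times> X \<Longrightarrow> (case z of (x, y) \<Rightarrow> k x y) \<le> (case z' of (x, y) \<Rightarrow> k x y)"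
    using continuous_attains_inf[OF compact_Times[OF X(1) X(1)] _ k] X(2) by blast
  define \<delta> where "\<delta> = (case z of (x, y) \<Rightarrow> k x y)"
  have \<delta>: "\<delta> \<le> k x y" if "x \<in> X" "y \<in> X" for x y using z(2)[of "(x, y)"] that by (simp add: \<delta>_def)
  have \<delta>0: "\<delta> > 0" using z(1) kpos by (auto simp: \<delta>_def)
  have \<delta>1: "\<delta> \<le> 1"
    using borel_prob_integral_bounds(2)[OF X(1) \<mu> continuous_on_slice1[OF k X(2)], of \<delta>] k1[OF X(2)] \<delta> X(2) by simp
  have cK: "continuous_on X (K \<phi>)" if "continuous_on X \<phi>" for \<phi>
    unfolding K_def by (rule continuous_on_kernel_integral[OF X(1) \<mu> k that])
  have Kdiff: "K \<phi> y - K \<psi> y = K (\<lambda>x. \<phi> x - \<psi> x) y"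
    if "continuous_on X \<phi>" "continuous_on X \<psi>" "y \<in> X" for \<phi> \<psi> y
    using borel_prob_integrable[OF X(1) \<mu> continuous_on_mult[OF that(1) continuous_on_slice1[OF k that(3)]]]
      borel_prob_integrable[OF X(1) \<mu> continuous_on_mult[OF that(2) continuous_on_slice1[OF k that(3)]]]
    by (simp add: K_def left_diff_distrib)
  have contr1: "\<bar>(K \<phi> x - K \<psi> x) - (K \<phi> y - K \<psi> y)\<bar> \<le> (1 - \<delta>) * D"
    if c: "continuous_on X \<phi>" "continuous_on X \<psi>" and x: "x \<in> X" "y \<in> X"
      and D: "\<And>x y. x \<in> X \<Longrightarrow> y \<in> X \<Longrightarrow> \<bar>(\<phi> x - \<psi> x) - (\<phi> y - \<psi> y)\<bar> \<le> D" for \<phi> \<psi> x y D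
    unfolding Kdiff[OF c x(1)] Kdiff[OF c x(2)] unfolding K_def
    by (rule markov_kernel_oscillation[OF X(1) \<mu> k \<delta> k1 continuous_on_diff[OF c] D x])
  have contr: "\<bar>(K (K \<phi>) x + h x - (K (K \<psi>) x + h x)) - (K (K \<phi>) y + h y - (K (K \<psi>) y + h y))\<bar> \<le> (1 - \<delta>) * (1 - \<delta>) * D"
    if c: "continuous_on X \<phi>" "continuous_on X \<psi>" and x: "x \<in> X" "y \<in> X"
      and D: "\<And>x y. x \<in> X \<Longrightarrow> y \<in> X \<Longrightarrow> \<bar>(\<phi> x - \<psi> x) - (\<phi> y - \<psi> y)\<bar> \<le> D" for \<phi> \<psi> x y D and h :: "'a \<Rightarrow> real"
    using contr1[OF cK[OF c(1)] cK[OF c(2)] x contr1[OF c _ _ D]] by (simp add: mult.assoc)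
  have \<kappa>: "0 \<le> (1 - \<delta>) * (1 - \<delta>)" "(1 - \<delta>) * (1 - \<delta>) < 1"
    using \<delta>0 \<delta>1 mult_le_one[of "1 - \<delta>" "1 - \<delta>"] by (simp_all add: mult_left_le_one_le)
     (smt (verit, best) mult_left_le)
  show "\<exists>w a. continuous_on X w \<and> (\<forall>y\<in>X. w y - K (K w) y = h y + a)" if h: "continuous_on X h"
  proof -
    obtain w a where w: "continuous_on X w" and a: "\<And>x. x \<in> X \<Longrightarrow> K (K w) x + h x = w x + a"
    proof (rule oscillation_contraction_fixpoint[of X x0 "continuous_on X" "\<lambda>x. 0" "\<lambda>\<phi> x. K (K \<phi>) x + h x", OF X _ _ _ _ _ _ \<kappa>])
      show "continuous_on X f" if "\<And>n. continuous_on X (u n)" "uniform_limit X u f sequentially" for u f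
        by (rule uniform_limit_theorem[OF _ that(2)]) (use that(1) in auto)
    qed (use h cK contr in \<open>auto intro!: continuous_on_add continuous_on_const\<close>)
    then show ?thesis by (intro exI[of _ w] exI[of _ "- a"]) (auto simp: algebra_simps)
  qed
  show "\<exists>r. \<forall>y\<in>X. \<phi> y = \<psi> y + r" if c: "continuous_on X \<phi>" "continuous_on X \<psi>"
    and eq: "\<And>y. y \<in> X \<Longrightarrow> \<phi> y - K (K \<phi>) y = \<psi> y - K (K \<psi>) y + a"
  proof -
    \<comment> \<open>The inhomogeneity is chosen so that \<phi> is fixed exactly; the hypothesis
      says that \<psi> is fixed up to \<open>a\<close>.\<close>
    define T where "T f x = K (K f) x + (\<phi> x - K (K \<phi>) x)" for f x
    have T1: "T \<phi> x = \<phi> x + 0" if "x \<in> X" for x by (simp add: T_def)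
    have T2: "T \<psi> x = \<psi> x + a" if "x \<in> X" for x using eq[OF that] by (simp add: T_def)
    obtain r where "\<And>x. x \<in> X \<Longrightarrow> \<phi> x = \<psi> x + r"
      by (rule oscillation_contraction_unique[of X x0 "continuous_on X" \<phi> \<psi> T, OF X c c _ \<kappa> T1 T2])
        (use contr[OF c] in \<open>auto simp: T_def\<close>)
    then show ?thesis by blast
  qed
qed

text \<open>The equation is \<open>T \<phi> = \<phi>\<close> for the negative logarithm
  \<open>T\<close> of the integral. The softmin estimate contracts oscillations, and
  \<open>T (\<phi> + r) = T \<phi> - r\<close> settles the constants: it turns a fixed point modulo
  constants into a true one and leaves no freedom in it.\<close>

lemma self_potential_exists_unique:
  assumes X: "compact X" "x0 \<in> X" and \<mu>: "borel_prob X \<mu>"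
    and b: "continuous_on (X \<times> X) (\<lambda>(x, y). b x y :: real)"
  shows "\<exists>\<phi>. continuous_on X \<phi> \<and> (\<forall>y\<in>X. (\<integral>x. exp (\<phi> x + \<phi> y - b x y) \<partial>\<mu>) = 1)"
    and "continuous_on X \<phi> \<Longrightarrow> continuous_on X \<psi> \<Longrightarrow>
      (\<And>y. y \<in> X \<Longrightarrow> (\<integral>x. exp (\<phi> x + \<phi> y - b x y) \<partial>\<mu>) = 1) \<Longrightarrow>
      (\<And>y. y \<in> X \<Longrightarrow> (\<integral>x. exp (\<psi> x + \<psi> y - b x y) \<partial>\<mu>) = 1) \<Longrightarrow> x \<in> X \<Longrightarrow> \<phi> x = \<psi> x"
proof -
  interpret prob_space \<mu> by (rule borel_prob_prob_space[OF \<mu>])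
  obtain B' where B': "B' > 0" "\<And>x y. x \<in> X \<Longrightarrow> y \<in> X \<Longrightarrow> \<bar>b x y\<bar> \<le> B'"
    using compact_continuous_bound2[OF X(1) b] by blast
  \<comment> \<open>Doubled so that changing \<open>y\<close> alters \<open>b x y\<close> by at most
    \<open>B\<close>.\<close>
  define B where "B = 2 * B'"
  have B: "B > 0" "\<And>x y. x \<in> X \<Longrightarrow> y \<in> X \<Longrightarrow> \<bar>b x y\<bar> \<le> B / 2" using B' by (auto simp: B_def)
  define I where "I \<phi> y = (\<integral>x. exp (\<phi> x - b x y) \<partial>\<mu>)" for \<phi> y
  define T where "T \<phi> y = - ln (I \<phi> y)" for \<phi> y
  \<comment> \<open>The contraction rate depends on a bound for oscillations. \<open>T\<close> sends
    every continuous function into this set, so nothing is lost by working in it.\<close>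
  define S where "S \<phi> \<longleftrightarrow> continuous_on X \<phi> \<and> (\<forall>x\<in>X. \<forall>y\<in>X. \<bar>\<phi> x - \<phi> y\<bar> \<le> B)" for \<phi>
  define \<kappa> where "\<kappa> = 1 - exp (- (2 * B)) * exp (- (2 * B))"
  have \<kappa>: "0 \<le> \<kappa>" "\<kappa> < 1" using B(1) by (auto simp: \<kappa>_def mult_le_one)
  have c2: "continuous_on (X \<times> X) (\<lambda>(x, y). exp (\<phi> x - b x y))" if "continuous_on X \<phi>" for \<phi>
    using continuous_on_fst2[OF that, of X] b unfolding case_prod_unfold
    by (intro continuous_on_exp continuous_on_diff)
  have cI: "continuous_on X (I \<phi>)" if "continuous_on X \<phi>" for \<phi>
    unfolding I_def by (rule continuous_on_integral_param[OF X(1) \<mu> c2[OF that]])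
  note c1 = continuous_on_slice1[OF c2]
  have I0: "I \<phi> y > 0" if \<phi>: "continuous_on X \<phi>" and y: "y \<in> X" for \<phi> y
  proof -
    obtain x1 where x1: "x1 \<in> X" "\<And>x. x \<in> X \<Longrightarrow> exp (\<phi> x1 - b x1 y) \<le> exp (\<phi> x - b x y)"
      using continuous_attains_inf[OF X(1) _ c1[OF \<phi> y]] y by blast
    have "exp (\<phi> x1 - b x1 y) \<le> I \<phi> y"
      unfolding I_def by (rule borel_prob_integral_bounds(2)[OF X(1) \<mu> c1[OF \<phi> y] x1(2)])
    then show ?thesis by (rule less_le_trans[OF exp_gt_zero])
  qed
  have cT: "continuous_on X (T \<phi>)" if "continuous_on X \<phi>" for \<phi>
    unfolding T_def using I0[OF that]
    by (intro continuous_on_minus continuous_on_ln cI that) (metis less_irrefl)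
  have T_shift: "T (\<lambda>x. \<phi> x + r) y = T \<phi> y - r" if "continuous_on X \<phi>" "y \<in> X" for \<phi> y r
  proof -
    have "exp (\<phi> x + r - b x y) = exp r * exp (\<phi> x - b x y)" for x by (simp flip: exp_add)
    then have "I (\<lambda>x. \<phi> x + r) y = exp r * I \<phi> y" by (simp add: I_def)
    then show ?thesis using I0[OF that] by (simp add: T_def ln_mult)
  qed
  have oscT: "T \<phi> x - T \<phi> y \<le> B" if \<phi>: "continuous_on X \<phi>" and x: "x \<in> X" "y \<in> X" for \<phi> x y
  proof -
    have "I \<phi> y \<le> (\<integral>z. exp B * exp (\<phi> z - b z x) \<partial>\<mu>)" unfolding I_def
    proof (intro integral_mono integrable_mult_right borel_prob_integrable[OF X(1) \<mu>] c1[OF \<phi>] x)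
      fix z assume "z \<in> space \<mu>"
      then have "\<phi> z - b z y \<le> B + (\<phi> z - b z x)"
        using B(2)[of z x] B(2)[of z y] x by (simp add: borel_prob_space[OF \<mu>] abs_le_iff)
      then show "exp (\<phi> z - b z y) \<le> exp B * exp (\<phi> z - b z x)" by (simp flip: exp_add)
    qed
    also have "\<dots> = exp B * I \<phi> x" by (simp add: I_def)
    finally have "ln (I \<phi> y) \<le> ln (exp B * I \<phi> x)" using I0[OF \<phi>] x by (intro ln_mono) auto
    then show ?thesis using I0[OF \<phi> x(1)] by (simp add: T_def ln_mult)
  qed
  have ST: "S (T \<phi>)" if "continuous_on X \<phi>" for \<phi>
    using cT[OF that] oscT[OF that] by (auto simp: S_def abs_le_iff)
  have Scont: "continuous_on X \<phi>" if "S \<phi>" for \<phi> using that by (simp add: S_def)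
  have contr: "\<bar>(T \<phi> x - T \<psi> x) - (T \<phi> y - T \<psi> y)\<bar> \<le> \<kappa> * D"
    if S: "S \<phi>" "S \<psi>" and x: "x \<in> X" "y \<in> X"
      and D: "\<And>x y. x \<in> X \<Longrightarrow> y \<in> X \<Longrightarrow> \<bar>(\<phi> x - \<psi> x) - (\<phi> y - \<psi> y)\<bar> \<le> D" for \<phi> \<psi> x y D
  proof -
    \<comment> \<open>Two elements of \<open>S\<close> always differ by a function of oscillation at
      most \<open>2 * B\<close>, so a larger \<open>D\<close> may be cut down to the range in which
      the softmin estimate holds.\<close>
    define D' where "D' = min D (2 * B)"
    have D': "\<bar>(\<phi> x - \<psi> x) - (\<phi> y - \<psi> y)\<bar> \<le> D'" if "x \<in> X" "y \<in> X" for x y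
    proof -
      have "\<bar>\<phi> x - \<phi> y\<bar> \<le> B" "\<bar>\<psi> x - \<psi> y\<bar> \<le> B" using S that by (auto simp: S_def)
      then show ?thesis using D[OF that] unfolding D'_def by linarith
    qed
    have D'B: "D' \<le> 2 * B" by (simp add: D'_def)
    have sm: "ln (I \<phi> y) - ln (I \<psi> y) - (ln (I \<phi> y') - ln (I \<psi> y')) \<le> \<kappa> * D'" if "y \<in> X" "y' \<in> X" for y y'
      unfolding I_def \<kappa>_def
      by (rule softmin_oscillation_contraction[OF X(1) \<mu> b _ Scont[OF S(1)] Scont[OF S(2)] _ D'B that])
        (use B(2) D' in auto)
    have "\<bar>(T \<phi> x - T \<psi> x) - (T \<phi> y - T \<psi> y)\<bar> \<le> \<kappa> * D'"
      using sm[OF x] sm[OF x(2,1)] by (simp add: T_def abs_le_iff)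
    also have "\<dots> \<le> \<kappa> * D" using \<kappa>(1) by (intro mult_left_mono) (auto simp: D'_def)
    finally show ?thesis .
  qed
  show "\<exists>\<phi>. continuous_on X \<phi> \<and> (\<forall>y\<in>X. (\<integral>x. exp (\<phi> x + \<phi> y - b x y) \<partial>\<mu>) = 1)"
  proof -
    obtain g a where g: "S g" and a: "\<And>x. x \<in> X \<Longrightarrow> T g x = g x + a"
    proof (rule oscillation_contraction_fixpoint[of X x0 S "\<lambda>x. 0" T, OF X _ Scont _ _ _ contr \<kappa>])
      show "S (\<lambda>x. 0)" using B(1) by (simp add: S_def)
      show "S f" if u: "\<And>n. S (u n)" "uniform_limit X u f sequentially" for u f
      proof -
        have "continuous_on X f"
          by (rule uniform_limit_theorem[OF _ u(2)]) (use u(1) in \<open>auto simp: S_def\<close>)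
        moreover have "\<bar>f x - f y\<bar> \<le> B" if "x \<in> X" "y \<in> X" for x y
        proof -
          have "(\<lambda>n. \<bar>u n x - u n y\<bar>) \<longlonglongrightarrow> \<bar>f x - f y\<bar>"
            using tendsto_uniform_limitI[OF u(2)] that by (intro tendsto_intros) auto
          then show ?thesis
            by (rule tendsto_upperbound) (use u(1) that in \<open>auto simp: S_def\<close>)
        qed
        ultimately show ?thesis by (simp add: S_def)
      qed
    qed (use ST Scont in \<open>auto simp: S_def intro!: continuous_on_add continuous_on_const\<close>)
    \<comment> \<open>Adding \<open>a / 2\<close> raises the argument and lowers the image by the
      same amount, which closes the gap \<open>a\<close>.\<close>
    define \<phi> where "\<phi> x = g x + a / 2" for x
    have c: "continuous_on X \<phi>" unfolding \<phi>_def by (intro continuous_on_add continuous_on_const Scont g)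
    have "(\<integral>x. exp (\<phi> x + \<phi> y - b x y) \<partial>\<mu>) = 1" if y: "y \<in> X" for y
    proof -
      have "T \<phi> y = \<phi> y" using T_shift[OF Scont[OF g] y, of "a / 2"] a[OF y] by (simp add: \<phi>_def[abs_def])
      then have "exp (\<phi> y) * I \<phi> y = 1" using I0[OF c y] by (simp add: T_def exp_minus flip: \<open>T \<phi> y = \<phi> y\<close>)
      moreover have "exp (\<phi> x + \<phi> y - b x y) = exp (\<phi> y) * exp (\<phi> x - b x y)" for x by (simp flip: exp_add)
      ultimately show ?thesis by (simp add: I_def)
    qed
    then show ?thesis using c by blast
  qed
  have Tfix: "T \<phi> y = \<phi> y"
    if c: "continuous_on X \<phi>" and eq: "\<And>y. y \<in> X \<Longrightarrow> (\<integral>x. exp (\<phi> x + \<phi> y - b x y) \<partial>\<mu>) = 1" and y: "y \<in> X" for \<phi> y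
  proof -
    have "exp (\<phi> x + \<phi> y - b x y) = exp (\<phi> y) * exp (\<phi> x - b x y)" for x by (simp flip: exp_add)
    then have "exp (\<phi> y) * I \<phi> y = 1" using eq[OF y] by (simp add: I_def)
    then have "ln (exp (\<phi> y) * I \<phi> y) = 0" by simp
    then show ?thesis using I0[OF c y] by (simp add: T_def ln_mult)
  qed
  show "\<phi> x = \<psi> x" if c: "continuous_on X \<phi>" "continuous_on X \<psi>"
    and e: "\<And>y. y \<in> X \<Longrightarrow> (\<integral>x. exp (\<phi> x + \<phi> y - b x y) \<partial>\<mu>) = 1"
      "\<And>y. y \<in> X \<Longrightarrow> (\<integral>x. exp (\<psi> x + \<psi> y - b x y) \<partial>\<mu>) = 1" and x: "x \<in> X"
  proof -
    have f: "T \<phi> y = \<phi> y" "T \<psi> y = \<psi> y" if "y \<in> X" for y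
      using Tfix[OF c(1) _ that] Tfix[OF c(2) _ that] e by auto
    \<comment> \<open>A fixed point is in the range of \<open>T\<close>, hence in
      \<open>S\<close>.\<close>
    have S: "S \<phi>" "S \<psi>" using ST[OF c(1)] ST[OF c(2)] c f by (auto simp: S_def)
    obtain r where r: "\<And>x. x \<in> X \<Longrightarrow> \<phi> x = \<psi> x + r"
      by (rule oscillation_contraction_unique[of X x0 S \<phi> \<psi> T \<kappa> 0 0, OF X S c _ \<kappa>])
        (use contr[OF S] f in auto)
    have "I \<phi> x0 = I (\<lambda>x. \<psi> x + r) x0"
      unfolding I_def by (rule borel_prob_cong[OF \<mu>]) (simp add: r)
    then have "T \<phi> x0 = T \<psi> x0 - r" using T_shift[OF c(2) X(2), of r] by (simp add: T_def)
    \<comment> \<open>A shift by \<open>r\<close> lowers the image by \<open>r\<close> but would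
      have to raise the fixed point by \<open>r\<close>.\<close>
    then have "r = 0" using f[OF X(2)] r[OF X(2)] by simp
    then show ?thesis using r[OF x] by simp
  qed
qed

lemma self_potential:
  assumes X: "compact X" "x0 \<in> X" and \<mu>: "borel_prob X \<mu>"
    and c: "continuous_on (X \<times> X) (\<lambda>(x, y). c x y)" and \<epsilon>: "\<epsilon> > 0"
  shows "continuous_on X (self_potential X \<epsilon> c \<mu>)"
    and "y \<in> X \<Longrightarrow> (\<integral>x. self_kernel X \<epsilon> c \<mu> x y \<partial>\<mu>) = 1"
proof -
  define b where "b x y = c x y / \<epsilon>" for x y
  have b: "continuous_on (X \<times> X) (\<lambda>(x, y). b x y)"
    using c \<epsilon> unfolding b_def case_prod_unfold by (intro continuous_on_divide continuous_on_const) auto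
  have e: "(f x + f y - c x y) / \<epsilon> = f x / \<epsilon> + f y / \<epsilon> - b x y" for f x y
    by (simp add: b_def add_divide_distrib diff_divide_distrib)
  define Q where "Q f \<longleftrightarrow> f \<in> C0 X \<and> (\<forall>x. x \<notin> X \<longrightarrow> f x = 0) \<and>
     (\<forall>y\<in>X. (\<integral>x. exp ((f x + f y - c x y) / \<epsilon>) \<partial>\<mu>) = 1)" for f
  have "\<exists>!f. Q f"
  proof (rule ex_ex1I)
    obtain \<phi> where \<phi>: "continuous_on X \<phi>" "\<forall>y\<in>X. (\<integral>x. exp (\<phi> x + \<phi> y - b x y) \<partial>\<mu>) = 1"
      using self_potential_exists_unique(1)[OF X \<mu> b] by blast
    \<comment> \<open>The potential is measured in units of \<epsilon>. The value 0 off
      \<open>X\<close> singles out one total function, as the definite description in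
      \<open>self_potential\<close> demands.\<close>
    define f where "f x = (if x \<in> X then \<epsilon> * \<phi> x else 0)" for x
    have "continuous_on X f"
      using continuous_on_mult[OF continuous_on_const \<phi>(1), of \<epsilon>]
      by (rule continuous_on_cong[THEN iffD1, rotated -1]) (auto simp: f_def)
    moreover have "(\<integral>x. exp ((f x + f y - c x y) / \<epsilon>) \<partial>\<mu>) = 1" if y: "y \<in> X" for y
    proof -
      have "(\<integral>x. exp ((f x + f y - c x y) / \<epsilon>) \<partial>\<mu>) = (\<integral>x. exp (\<phi> x + \<phi> y - b x y) \<partial>\<mu>)"
        unfolding e using \<epsilon> y by (intro borel_prob_cong[OF \<mu>]) (simp add: f_def)
      then show ?thesis using \<phi>(2) y by simp
    qed
    ultimately show "\<exists>f. Q f" by (intro exI[of _ f]) (auto simp: Q_def C0_def f_def)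
  next
    fix f g assume Q: "Q f" "Q g"
    have c: "continuous_on X (\<lambda>x. f x / \<epsilon>)" "continuous_on X (\<lambda>x. g x / \<epsilon>)"
      using Q \<epsilon> by (auto simp: Q_def C0_def intro!: continuous_on_divide continuous_on_const)
    have "f x / \<epsilon> = g x / \<epsilon>" if "x \<in> X" for x
      by (rule self_potential_exists_unique(2)[OF X \<mu> b c _ _ that]) (use Q in \<open>auto simp: Q_def e\<close>)
    then have "f x = g x" for x
      using Q \<epsilon> by (cases "x \<in> X") (auto simp: Q_def)
    then show "f = g" by blast
  qed
  then have "Q (THE f. Q f)" by (rule theI')
  moreover have "self_potential X \<epsilon> c \<mu> = (THE f. Q f)" unfolding self_potential_def Q_def ..
  ultimately have "Q (self_potential X \<epsilon> c \<mu>)" by simp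
  then show "continuous_on X (self_potential X \<epsilon> c \<mu>)"
    and "y \<in> X \<Longrightarrow> (\<integral>x. self_kernel X \<epsilon> c \<mu> x y \<partial>\<mu>) = 1"
    by (auto simp: Q_def C0_def self_kernel_def)
qed

section \<open>Iterated partial derivatives\<close>

text \<open>Interchange of limit and derivative at one point, by the mean value inequality for
  \<open>f i s - c * s\<close>. The general filter \<open>F\<close> serves both sequences of points
  approaching the boundary and difference quotients whose step tends to 0.\<close>

lemma has_field_derivative_limit:
  fixes f :: "'i \<Rightarrow> real \<Rightarrow> real"
  assumes F: "F \<noteq> bot"
    and der: "\<And>e. e > 0 \<Longrightarrow> \<exists>d>0. \<forall>\<^sub>F i in F. \<forall>s. \<bar>s\<bar> < d \<longrightarrow>
      (f i has_field_derivative f' i s) (at s) \<and> \<bar>f' i s - c\<bar> \<le> e"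
    and r: "r > 0" and lim: "\<And>s. \<bar>s\<bar> < r \<Longrightarrow> ((\<lambda>i. f i s) \<longlongrightarrow> g s) F"
  shows "(g has_field_derivative c) (at 0)"
proof -
  have "(\<lambda>h. (g (0 + h) - g 0) / h) \<midarrow>0\<rightarrow> c"
  proof (rule LIM_I)
    fix e :: real assume e: "e > 0"
    then obtain d where d: "d > 0" and ev: "\<forall>\<^sub>F i in F. \<forall>s. \<bar>s\<bar> < d \<longrightarrow>
      (f i has_field_derivative f' i s) (at s) \<and> \<bar>f' i s - c\<bar> \<le> e / 2"
      using der[of "e / 2"] by auto
    have "norm ((g (0 + h) - g 0) / h - c) < e" if h: "h \<noteq> 0" "\<bar>h\<bar> < min d r" for h
    proof -
      have bd: "\<forall>\<^sub>F i in F. \<bar>f i h - f i 0 - c * h\<bar> \<le> e / 2 * \<bar>h\<bar>"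
        using ev
      proof eventually_elim
        case (elim i)
        have "norm ((f i h - c * h) - (f i 0 - c * 0)) \<le> e / 2 * norm (h - 0)"
        proof (rule field_differentiable_bound[where S="{-\<bar>h\<bar>..\<bar>h\<bar>}" and f'="\<lambda>s. f' i s - c"])
          fix s assume "s \<in> {-\<bar>h\<bar>..\<bar>h\<bar>}"
          then have s: "\<bar>s\<bar> < d" using h(2) by auto
          show "((\<lambda>s. f i s - c * s) has_field_derivative f' i s - c) (at s within {-\<bar>h\<bar>..\<bar>h\<bar>})"
            using DERIV_diff[OF elim[rule_format, OF s, THEN conjunct1] DERIV_cmult_Id]
            by (rule has_field_derivative_at_within)
          show "norm (f' i s - c) \<le> e / 2" using elim s by simp
        qed auto
        moreover have "f i h - c * h - (f i 0 - c * 0) = f i h - f i 0 - c * h" by simp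
        ultimately show ?case by (simp only: real_norm_def diff_zero)
      qed
      have tl: "((\<lambda>i. \<bar>f i h - f i 0 - c * h\<bar>) \<longlongrightarrow> \<bar>g h - g 0 - c * h\<bar>) F"
        using h r by (intro tendsto_rabs tendsto_diff tendsto_const lim) simp_all
      have "\<bar>g h - g 0 - c * h\<bar> \<le> e / 2 * \<bar>h\<bar>"
        by (rule tendsto_upperbound[OF tl bd F])
      then have "\<bar>(g h - g 0 - c * h) / h\<bar> \<le> e / 2" using h(1) by (simp add: abs_divide pos_divide_le_eq)
      then show ?thesis using e h(1) by (simp add: diff_divide_distrib)
    qed
    then show "\<exists>s>0. \<forall>x. x \<noteq> 0 \<and> norm (x - 0) < s \<longrightarrow> norm ((g (0 + x) - g 0) / x - c) < e"
    proof (intro exI conjI allI impI)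
      show "0 < min d r" using d r by simp
    qed auto
  qed
  then show ?thesis by (simp add: DERIV_def)
qed

text \<open>
  The second variable ranges over all of \<open>X\<close>, not only over its interior, so that slices at boundary
  points are again of class \<open>C^m\<close>.
\<close>

definition fst_deriv :: "'b::euclidean_space set \<Rightarrow> 'b \<Rightarrow> ('b \<Rightarrow> 'b \<Rightarrow> real) \<Rightarrow> ('b \<Rightarrow> 'b \<Rightarrow> real) \<Rightarrow> bool" where
  "fst_deriv X a G A \<longleftrightarrow> (\<forall>x\<in>interior X. \<forall>y\<in>X. ((\<lambda>t. G (x + t *\<^sub>R a) y) has_field_derivative A x y) (at 0))"

abbreviation (input) swap2 :: "('b \<Rightarrow> 'b \<Rightarrow> real) \<Rightarrow> 'b \<Rightarrow> 'b \<Rightarrow> real" where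
  "swap2 G \<equiv> \<lambda>x y. G y x"

text \<open>The class C^(m,n), with derivatives carried as witnesses that are continuous on all of
  \<open>X \<times> X\<close>. Compared with words of partial derivatives, this recursion makes
  closure under sums, products, exponentials and inverses a plain induction on \<open>m + n\<close>,
  and it allows the derivatives in the two variables to be taken in any order.\<close>

function iter_diff2 :: "'b::euclidean_space set \<Rightarrow> nat \<Rightarrow> nat \<Rightarrow> ('b \<Rightarrow> 'b \<Rightarrow> real) \<Rightarrow> bool" where
  "iter_diff2 X m n G \<longleftrightarrow> continuous_on (X \<times> X) (\<lambda>(x, y). G x y) \<and>
    (m \<noteq> 0 \<longrightarrow> (\<forall>a\<in>Basis. \<exists>A. fst_deriv X a G A \<and> iter_diff2 X (m - 1) n A)) \<and>
    (n \<noteq> 0 \<longrightarrow> (\<forall>b\<in>Basis. \<exists>B. fst_deriv X b (swap2 G) (swap2 B) \<and> iter_diff2 X m (n - 1) B))"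
  by pat_completeness auto
termination
  by (relation "Wellfounded.measure (\<lambda>(X, m, n, G). m + n)") auto

declare iter_diff2.simps [simp del]

lemma diff2I:
  assumes "continuous_on (X \<times> X) (\<lambda>(x, y). G x y)"
    and "\<And>m' a. m = Suc m' \<Longrightarrow> a \<in> Basis \<Longrightarrow> \<exists>A. fst_deriv X a G A \<and> iter_diff2 X m' n A"
    and "\<And>n' b. n = Suc n' \<Longrightarrow> b \<in> Basis \<Longrightarrow> \<exists>B. fst_deriv X b (swap2 G) (swap2 B) \<and> iter_diff2 X m n' B"
  shows "iter_diff2 X m n G"
  unfolding iter_diff2.simps[of X m n G]
proof (intro conjI impI ballI assms(1))
  fix a :: 'a assume "m \<noteq> 0" "a \<in> Basis"
  then show "\<exists>A. fst_deriv X a G A \<and> iter_diff2 X (m - 1) n A" by (intro assms(2)) simp_all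
next
  fix b :: 'a assume "n \<noteq> 0" "b \<in> Basis"
  then show "\<exists>B. fst_deriv X b (swap2 G) (swap2 B) \<and> iter_diff2 X m (n - 1) B" by (intro assms(3)) simp_all
qed

lemma iter_diff2_continuous: "iter_diff2 X m n G \<Longrightarrow> continuous_on (X \<times> X) (\<lambda>(x, y). G x y)"
  by (subst (asm) iter_diff2.simps) (elim conjE)

lemma iter_diff2_dx:
  assumes "iter_diff2 X (Suc m) n G" "a \<in> Basis"
  obtains A where "fst_deriv X a G A" "iter_diff2 X m n A"
proof -
  have "\<exists>A. fst_deriv X a G A \<and> iter_diff2 X m n A"
    using iter_diff2.simps[THEN iffD1, OF assms(1), THEN conjunct2, THEN conjunct1] assms(2) by simp
  then show ?thesis by (elim exE conjE) (rule that)
qed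

lemma iter_diff2_dy:
  assumes "iter_diff2 X m (Suc n) G" "b \<in> Basis"
  obtains B where "fst_deriv X b (swap2 G) (swap2 B)" "iter_diff2 X m n B"
proof -
  have "\<exists>B. fst_deriv X b (swap2 G) (swap2 B) \<and> iter_diff2 X m n B"
    using iter_diff2.simps[THEN iffD1, OF assms(1), THEN conjunct2, THEN conjunct2] assms(2) by simp
  then show ?thesis by (elim exE conjE) (rule that)
qed

lemma iter_diff2_swap: "iter_diff2 X m n G \<Longrightarrow> iter_diff2 X n m (swap2 G)"
proof (induction "m + n" arbitrary: m n G rule: less_induct)
  case less
  show ?case
  proof (rule diff2I)
    show "continuous_on (X \<times> X) (\<lambda>(x, y). G y x)" by (rule continuous_on_swap2[OF iter_diff2_continuous[OF less.prems]])
  next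
    fix n' b assume m: "n = Suc n'" "b \<in> (Basis :: 'a set)"
    obtain B where B: "fst_deriv X b (swap2 G) (swap2 B)" "iter_diff2 X m n' B" by (rule iter_diff2_dy[OF less.prems[unfolded m(1)] m(2)])
    have "iter_diff2 X n' m (swap2 B)" by (rule less.hyps[OF _ B(2)]) (simp add: m)
    with B(1) show "\<exists>A. fst_deriv X b (swap2 G) A \<and> iter_diff2 X n' m A" by (intro exI[of _ "swap2 B"] conjI)
  next
    fix m' a assume m: "m = Suc m'" "a \<in> (Basis :: 'a set)"
    obtain A where A: "fst_deriv X a G A" "iter_diff2 X m' n A" by (rule iter_diff2_dx[OF less.prems[unfolded m(1)] m(2)])
    have "iter_diff2 X n m' (swap2 A)" by (rule less.hyps[OF _ A(2)]) (simp add: m)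
    with A(1) show "\<exists>B. fst_deriv X a (swap2 (swap2 G)) (swap2 B) \<and> iter_diff2 X n m' B"
      by (intro exI[of _ "swap2 A"] conjI)
  qed
qed

lemma iter_diff2_mono: "iter_diff2 X m n G \<Longrightarrow> m1 \<le> m \<Longrightarrow> n1 \<le> n \<Longrightarrow> iter_diff2 X m1 n1 G"
proof (induction "m1 + n1" arbitrary: m n m1 n1 G rule: less_induct)
  case less
  show ?case
  proof (rule diff2I[OF iter_diff2_continuous[OF less.prems(1)]])
    fix m' a assume m: "m1 = Suc m'" and a: "a \<in> (Basis :: 'a set)"
    obtain m'' where m'': "m = Suc m''" "m' \<le> m''" using less.prems(2) unfolding m by (cases m) simp_all
    obtain A where A: "fst_deriv X a G A" "iter_diff2 X m'' n A" by (rule iter_diff2_dx[OF less.prems(1)[unfolded m''(1)] a])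
    have "iter_diff2 X m' n1 A" by (rule less.hyps[OF _ A(2) m''(2) less.prems(3)]) (simp add: m)
    with A(1) show "\<exists>A. fst_deriv X a G A \<and> iter_diff2 X m' n1 A" by (intro exI[of _ A] conjI)
  next
    fix n' b assume n: "n1 = Suc n'" and b: "b \<in> (Basis :: 'a set)"
    obtain n'' where n'': "n = Suc n''" "n' \<le> n''" using less.prems(3) unfolding n by (cases n) simp_all
    obtain B where B: "fst_deriv X b (swap2 G) (swap2 B)" "iter_diff2 X m n'' B" by (rule iter_diff2_dy[OF less.prems(1)[unfolded n''(1)] b])
    have "iter_diff2 X m1 n' B" by (rule less.hyps[OF _ B(2) less.prems(2) n''(2)]) (simp add: n)
    with B(1) show "\<exists>B. fst_deriv X b (swap2 G) (swap2 B) \<and> iter_diff2 X m1 n' B" by (intro exI[of _ B] conjI)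
  qed
qed

lemma fst_deriv_const: "fst_deriv X a (\<lambda>x y. r) (\<lambda>x y. 0)"
  by (simp add: fst_deriv_def)

lemma iter_diff2_const: "iter_diff2 X m n (\<lambda>x y. r)"
proof (induction "m + n" arbitrary: m n r rule: less_induct)
  case less
  have IH: "iter_diff2 X m' n' (\<lambda>x y. 0)" if "m' + n' < m + n" for m' n'
    by (rule less.hyps[OF that])
  show ?case
  proof (rule diff2I)
    fix m' a assume "m = Suc m'"
    then have "iter_diff2 X m' n (\<lambda>x y. 0)" by (intro IH) simp
    then show "\<exists>A. fst_deriv X a (\<lambda>x y. r) A \<and> iter_diff2 X m' n A" by (intro exI[of _ "\<lambda>x y. 0"] conjI fst_deriv_const)
  next
    fix n' a assume "n = Suc n'"
    then have "iter_diff2 X m n' (\<lambda>x y. 0)" by (intro IH) simp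
    then show "\<exists>A. fst_deriv X a (\<lambda>x y. r) (swap2 A) \<and> iter_diff2 X m n' A"
      by (intro exI[of _ "\<lambda>x y. 0"] conjI fst_deriv_const)
  qed (simp add: case_prod_unfold)
qed

lemma iter_diff2_slice: "iter_diff2 X m n G \<Longrightarrow> y \<in> X \<Longrightarrow> iter_diff2 X m 0 (\<lambda>x _. G x y)"
proof (induction m arbitrary: G)
  case 0
  show ?case
    by (rule diff2I[OF continuous_on_fst2[OF continuous_on_slice1[OF iter_diff2_continuous[OF 0(1)] 0(2)]]]) simp_all
next
  case (Suc m)
  show ?case
  proof (rule diff2I)
    show "continuous_on (X \<times> X) (\<lambda>(x, y'). G x y)"
      by (rule continuous_on_fst2[OF continuous_on_slice1[OF iter_diff2_continuous[OF Suc.prems(1)] Suc.prems(2)]])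
    fix m' a assume m: "Suc m = Suc m'" and a: "a \<in> (Basis :: 'a set)"
    obtain A where A: "fst_deriv X a G A" "iter_diff2 X m n A" by (rule iter_diff2_dx[OF Suc.prems(1) a])
    have "fst_deriv X a (\<lambda>x _. G x y) (\<lambda>x _. A x y)" using A(1) Suc.prems(2) by (simp add: fst_deriv_def)
    with Suc.IH[OF A(2) Suc.prems(2)] m show "\<exists>A. fst_deriv X a (\<lambda>x _. G x y) A \<and> iter_diff2 X m' 0 A"
      by (intro exI[of _ "\<lambda>x _. A x y"] conjI) simp_all
  qed simp
qed

lemma eventually_line_in_interior:
  fixes x a :: "'b::real_normed_vector"
  assumes "x \<in> interior X"
  shows "\<forall>\<^sub>F t in nhds 0. x + t *\<^sub>R a \<in> interior X"
proof -
  have "((\<lambda>t. x + t *\<^sub>R a) \<longlongrightarrow> x + 0 *\<^sub>R a) (nhds 0)"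
    by (intro tendsto_add tendsto_const tendsto_scaleR filterlim_ident)
  then show ?thesis
    by (rule topological_tendstoD) (simp_all add: assms)
qed

text \<open>A line through an interior point stays in \<open>X\<close> for small parameters, so
  values off \<open>X\<close> do not enter the derivative.\<close>

lemma fst_deriv_cong:
  assumes "fst_deriv X a G A" "\<And>x y. x \<in> X \<Longrightarrow> y \<in> X \<Longrightarrow> G x y = H x y"
  shows "fst_deriv X a H A"
  unfolding fst_deriv_def
proof (intro ballI)
  fix x y assume x: "x \<in> interior X" and y: "y \<in> X"
  have ev: "\<forall>\<^sub>F t in nhds 0. G (x + t *\<^sub>R a) y = H (x + t *\<^sub>R a) y"
    using eventually_line_in_interior[OF x, of a]
    by (rule eventually_mono) (use assms(2) y interior_subset in blast)
  have "((\<lambda>t. G (x + t *\<^sub>R a) y) has_field_derivative A x y) (at 0)"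
    using assms(1) x y by (simp add: fst_deriv_def)
  then show "((\<lambda>t. H (x + t *\<^sub>R a) y) has_field_derivative A x y) (at 0)"
    using DERIV_cong_ev[OF refl ev refl] by (rule iffD1[rotated])
qed

lemma iter_diff2_cong:
  assumes "iter_diff2 X m n G" "\<And>x y. x \<in> X \<Longrightarrow> y \<in> X \<Longrightarrow> G x y = H x y"
  shows "iter_diff2 X m n H"
proof (rule diff2I)
  show "continuous_on (X \<times> X) (\<lambda>(x, y). H x y)"
    using iter_diff2_continuous[OF assms(1)]
    by (rule continuous_on_cong[THEN iffD1, rotated -1]) (auto simp: assms(2))
next
  fix m' a assume m: "m = Suc m'" "a \<in> (Basis :: 'a set)"
  obtain A where "fst_deriv X a G A" "iter_diff2 X m' n A" by (rule iter_diff2_dx[OF assms(1)[unfolded m(1)] m(2)])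
  then show "\<exists>A. fst_deriv X a H A \<and> iter_diff2 X m' n A" using fst_deriv_cong[OF _ assms(2)] by (intro exI[of _ A] conjI)
next
  fix n' b assume m: "n = Suc n'" "b \<in> (Basis :: 'a set)"
  obtain B where B: "fst_deriv X b (swap2 G) (swap2 B)" "iter_diff2 X m n' B" by (rule iter_diff2_dy[OF assms(1)[unfolded m(1)] m(2)])
  have "fst_deriv X b (swap2 H) (swap2 B)" by (rule fst_deriv_cong[OF B(1)]) (simp add: assms(2))
  then show "\<exists>B. fst_deriv X b (swap2 H) (swap2 B) \<and> iter_diff2 X m n' B" using B(2) by (intro exI[of _ B] conjI)
qed

lemma fst_deriv_add: "fst_deriv X a G A \<Longrightarrow> fst_deriv X a H B \<Longrightarrow> fst_deriv X a (\<lambda>x y. G x y + H x y) (\<lambda>x y. A x y + B x y)"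
  by (auto simp: fst_deriv_def intro!: DERIV_add)

lemma fst_deriv_mult:
  assumes "fst_deriv X a G A" "fst_deriv X a H B"
  shows "fst_deriv X a (\<lambda>x y. G x y * H x y) (\<lambda>x y. A x y * H x y + B x y * G x y)"
  unfolding fst_deriv_def
proof (intro ballI)
  fix x y assume xy: "x \<in> interior X" "y \<in> X"
  have "((\<lambda>t. G (x + t *\<^sub>R a) y) has_field_derivative A x y) (at 0)"
    "((\<lambda>t. H (x + t *\<^sub>R a) y) has_field_derivative B x y) (at 0)"
    using assms xy by (auto simp: fst_deriv_def)
  from DERIV_mult[OF this]
  show "((\<lambda>t. G (x + t *\<^sub>R a) y * H (x + t *\<^sub>R a) y) has_field_derivative
    A x y * H x y + B x y * G x y) (at 0)" by simp
qed

lemma iter_diff2_add: "iter_diff2 X m n G \<Longrightarrow> iter_diff2 X m n H \<Longrightarrow> iter_diff2 X m n (\<lambda>x y. G x y + H x y)"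
proof (induction "m + n" arbitrary: m n G H rule: less_induct)
  case less
  show ?case
  proof (rule diff2I)
    show "continuous_on (X \<times> X) (\<lambda>(x, y). G x y + H x y)"
      using less.prems[THEN iter_diff2_continuous] unfolding case_prod_unfold by (rule continuous_on_add)
  next
    fix m' a assume m: "m = Suc m'" "a \<in> (Basis :: 'a set)"
    obtain A where A: "fst_deriv X a G A" "iter_diff2 X m' n A" by (rule iter_diff2_dx[OF less.prems(1)[unfolded m(1)] m(2)])
    obtain B where B: "fst_deriv X a H B" "iter_diff2 X m' n B" by (rule iter_diff2_dx[OF less.prems(2)[unfolded m(1)] m(2)])
    show "\<exists>A. fst_deriv X a (\<lambda>x y. G x y + H x y) A \<and> iter_diff2 X m' n A"
      using m by (intro exI[of _ "\<lambda>x y. A x y + B x y"]) (use fst_deriv_add[OF A(1) B(1)] less.hyps[OF _ A(2) B(2)] in auto)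
  next
    fix n' a assume m: "n = Suc n'" "a \<in> (Basis :: 'a set)"
    obtain A where A: "fst_deriv X a (swap2 G) (swap2 A)" "iter_diff2 X m n' A" by (rule iter_diff2_dy[OF less.prems(1)[unfolded m(1)] m(2)])
    obtain B where B: "fst_deriv X a (swap2 H) (swap2 B)" "iter_diff2 X m n' B" by (rule iter_diff2_dy[OF less.prems(2)[unfolded m(1)] m(2)])
    show "\<exists>A. fst_deriv X a (\<lambda>x y. G y x + H y x) (swap2 A) \<and> iter_diff2 X m n' A"
      using m by (intro exI[of _ "\<lambda>x y. A x y + B x y"]) (use fst_deriv_add[OF A(1) B(1)] less.hyps[OF _ A(2) B(2)] in auto)
  qed
qed

text \<open>The induction varies both factors: the product rule pairs a derivative of one with the
  other itself, which has the lower order by \<open>iter_diff2_mono\<close>.\<close>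

lemma iter_diff2_mult: "iter_diff2 X m n G \<Longrightarrow> iter_diff2 X m n H \<Longrightarrow> iter_diff2 X m n (\<lambda>x y. G x y * H x y)"
proof (induction "m + n" arbitrary: m n G H rule: less_induct)
  case less
  show ?case
  proof (rule diff2I)
    show "continuous_on (X \<times> X) (\<lambda>(x, y). G x y * H x y)"
      using less.prems[THEN iter_diff2_continuous] unfolding case_prod_unfold by (rule continuous_on_mult)
  next
    fix m' a assume m: "m = Suc m'" "a \<in> (Basis :: 'a set)"
    obtain A where A: "fst_deriv X a G A" "iter_diff2 X m' n A" by (rule iter_diff2_dx[OF less.prems(1)[unfolded m(1)] m(2)])
    obtain B where B: "fst_deriv X a H B" "iter_diff2 X m' n B" by (rule iter_diff2_dx[OF less.prems(2)[unfolded m(1)] m(2)])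
    have G: "iter_diff2 X m' n G" "iter_diff2 X m' n H" using less.prems m by (auto intro: iter_diff2_mono)
    show "\<exists>A. fst_deriv X a (\<lambda>x y. G x y * H x y) A \<and> iter_diff2 X m' n A"
      using m fst_deriv_mult[OF A(1) B(1)] less.hyps[OF _ A(2) G(2)] less.hyps[OF _ B(2) G(1)]
      by (intro exI[of _ "\<lambda>x y. A x y * H x y + B x y * G x y"]) (auto intro!: iter_diff2_add)
  next
    fix n' a assume m: "n = Suc n'" "a \<in> (Basis :: 'a set)"
    obtain A where A: "fst_deriv X a (swap2 G) (swap2 A)" "iter_diff2 X m n' A" by (rule iter_diff2_dy[OF less.prems(1)[unfolded m(1)] m(2)])
    obtain B where B: "fst_deriv X a (swap2 H) (swap2 B)" "iter_diff2 X m n' B" by (rule iter_diff2_dy[OF less.prems(2)[unfolded m(1)] m(2)])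
    have G: "iter_diff2 X m n' G" "iter_diff2 X m n' H" using less.prems m by (auto intro: iter_diff2_mono)
    show "\<exists>A. fst_deriv X a (\<lambda>x y. G y x * H y x) (swap2 A) \<and> iter_diff2 X m n' A"
      using m fst_deriv_mult[OF A(1) B(1)] less.hyps[OF _ A(2) G(2)] less.hyps[OF _ B(2) G(1)]
      by (intro exI[of _ "\<lambda>x y. A x y * H x y + B x y * G x y"]) (auto intro!: iter_diff2_add)
  qed
qed

lemma iter_diff2_scale: "iter_diff2 X m n G \<Longrightarrow> iter_diff2 X m n (\<lambda>x y. r * G x y)"
  by (rule iter_diff2_mult[OF iter_diff2_const])

lemma fst_deriv_exp:
  assumes "fst_deriv X a G A"
  shows "fst_deriv X a (\<lambda>x y. exp (G x y)) (\<lambda>x y. exp (G x y) * A x y)"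
  unfolding fst_deriv_def
proof (intro ballI)
  fix x y assume xy: "x \<in> interior X" "y \<in> X"
  have "((\<lambda>t. G (x + t *\<^sub>R a) y) has_field_derivative A x y) (at 0)"
    using assms xy by (auto simp: fst_deriv_def)
  from DERIV_fun_exp[OF this]
  show "((\<lambda>t. exp (G (x + t *\<^sub>R a) y)) has_field_derivative exp (G x y) * A x y) (at 0)" by simp
qed

text \<open>The derivative is the same exponential times a derivative of \<open>G\<close>, so
  \<open>G\<close> stays fixed in the induction and only the orders decrease.\<close>

lemma iter_diff2_exp: "iter_diff2 X m n G \<Longrightarrow> iter_diff2 X m n (\<lambda>x y. exp (G x y))"
proof (induction "m + n" arbitrary: m n rule: less_induct)
  case less
  show ?case
  proof (rule diff2I)
    show "continuous_on (X \<times> X) (\<lambda>(x, y). exp (G x y))"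
      using less.prems[THEN iter_diff2_continuous] unfolding case_prod_unfold by (rule continuous_on_exp)
  next
    fix m' a assume m: "m = Suc m'" "a \<in> (Basis :: 'a set)"
    obtain A where A: "fst_deriv X a G A" "iter_diff2 X m' n A" by (rule iter_diff2_dx[OF less.prems(1)[unfolded m(1)] m(2)])
    have G: "iter_diff2 X m' n G" using less.prems m by (auto intro: iter_diff2_mono)
    show "\<exists>A. fst_deriv X a (\<lambda>x y. exp (G x y)) A \<and> iter_diff2 X m' n A"
      using m fst_deriv_exp[OF A(1)] iter_diff2_mult[OF less.hyps[OF _ G] A(2)] by auto
  next
    fix n' a assume m: "n = Suc n'" "a \<in> (Basis :: 'a set)"
    obtain A where A: "fst_deriv X a (swap2 G) (swap2 A)" "iter_diff2 X m n' A" by (rule iter_diff2_dy[OF less.prems(1)[unfolded m(1)] m(2)])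
    have G: "iter_diff2 X m n' G" using less.prems m by (auto intro: iter_diff2_mono)
    show "\<exists>A. fst_deriv X a (\<lambda>x y. exp (G y x)) (swap2 A) \<and> iter_diff2 X m n' A"
      using m fst_deriv_exp[OF A(1)] iter_diff2_mult[OF less.hyps[OF _ G] A(2)]
      by (intro exI[of _ "\<lambda>x y. exp (G x y) * A x y"]) auto
  qed
qed

text \<open>The derivative is written as nested products so that the closure of
  \<open>iter_diff2\<close> under products and scaling applies to it literally.\<close>

lemma fst_deriv_inverse:
  assumes "fst_deriv X a G A" "\<And>x y. x \<in> X \<Longrightarrow> y \<in> X \<Longrightarrow> G x y \<noteq> 0"
  shows "fst_deriv X a (\<lambda>x y. inverse (G x y)) (\<lambda>x y. - 1 * (inverse (G x y) * (inverse (G x y) * A x y)))"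
  unfolding fst_deriv_def
proof (intro ballI)
  fix x y assume x: "x \<in> interior X" and y: "y \<in> X"
  then have "((\<lambda>t. G (x + t *\<^sub>R a) y) has_field_derivative A x y) (at 0)" "G x y \<noteq> 0"
    using assms interior_subset[of X] by (auto simp: fst_deriv_def)
  then show "((\<lambda>t. inverse (G (x + t *\<^sub>R a) y)) has_field_derivative
    - 1 * (inverse (G x y) * (inverse (G x y) * A x y))) (at 0)"
    using DERIV_inverse_fun[of "\<lambda>t. G (x + t *\<^sub>R a) y" "A x y" 0 UNIV] by (simp add: ac_simps)
qed

lemma iter_diff2_inverse:
  "iter_diff2 X m n G \<Longrightarrow> (\<And>x y. x \<in> X \<Longrightarrow> y \<in> X \<Longrightarrow> G x y \<noteq> 0) \<Longrightarrow> iter_diff2 X m n (\<lambda>x y. inverse (G x y))"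
proof (induction "m + n" arbitrary: m n rule: less_induct)
  case less
  show ?case
  proof (rule diff2I)
    show "continuous_on (X \<times> X) (\<lambda>(x, y). inverse (G x y))"
      using iter_diff2_continuous[OF less.prems(1)] less.prems(2) unfolding case_prod_unfold
      by (intro continuous_on_inverse) auto
  next
    fix m' a assume m: "m = Suc m'" "a \<in> (Basis :: 'a set)"
    obtain A where A: "fst_deriv X a G A" "iter_diff2 X m' n A" by (rule iter_diff2_dx[OF less.prems(1)[unfolded m(1)] m(2)])
    have G: "iter_diff2 X m' n G" using less.prems m by (auto intro: iter_diff2_mono)
    have I: "iter_diff2 X m' n (\<lambda>x y. inverse (G x y))" using m less.prems(2) by (intro less.hyps[OF _ G]) auto
    show "\<exists>A. fst_deriv X a (\<lambda>x y. inverse (G x y)) A \<and> iter_diff2 X m' n A"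
      using fst_deriv_inverse[OF A(1) less.prems(2)] iter_diff2_scale[OF iter_diff2_mult[OF I iter_diff2_mult[OF I A(2)]]] by blast
  next
    fix n' a assume m: "n = Suc n'" "a \<in> (Basis :: 'a set)"
    obtain A where A: "fst_deriv X a (swap2 G) (swap2 A)" "iter_diff2 X m n' A" by (rule iter_diff2_dy[OF less.prems(1)[unfolded m(1)] m(2)])
    have G: "iter_diff2 X m n' G" using less.prems m by (auto intro: iter_diff2_mono)
    have I: "iter_diff2 X m n' (\<lambda>x y. inverse (G x y))" using m less.prems(2) by (intro less.hyps[OF _ G]) auto
    show "\<exists>A. fst_deriv X a (\<lambda>x y. inverse (G y x)) (swap2 A) \<and> iter_diff2 X m n' A"
      using fst_deriv_inverse[OF A(1)] less.prems(2) iter_diff2_scale[OF iter_diff2_mult[OF I iter_diff2_mult[OF I A(2)]], of "-1"]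
      by (intro exI[of _ "\<lambda>x y. - 1 * (inverse (G x y) * (inverse (G x y) * A x y))"]) auto
  qed
qed

section \<open>Functions of one variable and words of partial derivatives\<close>

definition dir_deriv :: "'b::euclidean_space set \<Rightarrow> 'b \<Rightarrow> ('b \<Rightarrow> real) \<Rightarrow> ('b \<Rightarrow> real) \<Rightarrow> bool" where
  "dir_deriv X a \<phi> \<psi> \<longleftrightarrow> (\<forall>x\<in>interior X. ((\<lambda>t. \<phi> (x + t *\<^sub>R a)) has_field_derivative \<psi> x) (at 0))"

text \<open>The ball of radius \<open>e\<close> in C^m, described by recursion over derivative
  witnesses instead of a supremum over words. Smallness can then be proved one derivative at a time;
  \<open>Cm_le_norm\<close> translates it to the norm.\<close>

primrec Cm_le :: "nat \<Rightarrow> 'b::euclidean_space set \<Rightarrow> real \<Rightarrow> ('b \<Rightarrow> real) \<Rightarrow> bool" where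
  "Cm_le 0 X e \<phi> \<longleftrightarrow> (\<forall>x\<in>interior X. \<bar>\<phi> x\<bar> \<le> e)"
| "Cm_le (Suc m) X e \<phi> \<longleftrightarrow> (\<forall>x\<in>interior X. \<bar>\<phi> x\<bar> \<le> e) \<and>
     (\<forall>a\<in>Basis. \<exists>\<psi>. dir_deriv X a \<phi> \<psi> \<and> Cm_le m X e \<psi>)"

lemma Cm_le_bound: "Cm_le m X e \<phi> \<Longrightarrow> x \<in> interior X \<Longrightarrow> \<bar>\<phi> x\<bar> \<le> e"
  by (cases m) auto

lemma partials_Nil [simp]: "partials [] f = f"
  by (simp add: partials_def)

lemma partials_Cons: "partials (b # w) f = partial b (partials w f)"
  by (simp add: partials_def)

text \<open>The fold applies the last letter of a word first. Since the recursive classes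
  differentiate the function itself first, words are always taken apart at their right end.\<close>

lemma partials_snoc: "partials (w @ [b]) f = partials w (partial b f)"
  by (simp add: partials_def)

lemma eventually_line_eq:
  fixes x a :: "'b::real_normed_vector"
  assumes "\<And>x. x \<in> interior X \<Longrightarrow> f x = g x" "x \<in> interior X"
  shows "\<forall>\<^sub>F t in nhds 0. f (x + t *\<^sub>R a) = g (x + t *\<^sub>R a)"
  using eventually_line_in_interior[OF assms(2), of a] by (rule eventually_mono) (rule assms(1))

lemma partials_cong:
  assumes "\<And>x. x \<in> interior X \<Longrightarrow> f x = g x" "x \<in> interior X"
  shows "partials w f x = partials w g x"
  using assms(2)
proof (induction w arbitrary: x)
  case Nil
  then show ?case using assms(1) by simp
next
  case (Cons b w)
  show ?case unfolding partials_Cons partial_def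
    by (rule deriv_cong_ev[OF eventually_line_eq[OF Cons.IH Cons.prems] refl])
qed

lemma field_differentiable_line_cong:
  fixes x a :: "'b::real_normed_vector"
  assumes "\<And>x. x \<in> interior X \<Longrightarrow> f x = g x" "x \<in> interior X"
    and "(\<lambda>t. f (x + t *\<^sub>R a)) field_differentiable at 0"
  shows "(\<lambda>t. g (x + t *\<^sub>R a) :: real) field_differentiable at (0::real)"
proof -
  obtain d where d: "((\<lambda>t. f (x + t *\<^sub>R a)) has_field_derivative d) (at 0)"
    using assms(3) unfolding field_differentiable_def by (elim exE)
  have "((\<lambda>t. g (x + t *\<^sub>R a)) has_field_derivative d) (at 0)"
    using DERIV_cong_ev[OF refl eventually_line_eq[OF assms(1,2), where a=a] refl] d by (rule iffD1)
  then show ?thesis unfolding field_differentiable_def by (rule exI)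
qed

lemma dir_deriv_partial: "dir_deriv X a \<phi> \<psi> \<Longrightarrow> x \<in> interior X \<Longrightarrow> partial a \<phi> x = \<psi> x"
  unfolding partial_def dir_deriv_def by (intro DERIV_imp_deriv) simp

lemma dir_deriv_partials: "dir_deriv X a \<phi> \<psi> \<Longrightarrow> x \<in> interior X \<Longrightarrow> partials (w @ [a]) \<phi> x = partials w \<psi> x"
  unfolding partials_snoc by (rule partials_cong[of X]) (simp_all add: dir_deriv_partial)

lemma Cm_le_partials:
  "Cm_le m X e \<phi> \<Longrightarrow> w \<in> lists Basis \<Longrightarrow> length w \<le> m \<Longrightarrow> x \<in> interior X \<Longrightarrow> \<bar>partials w \<phi> x\<bar> \<le> e"
proof (induction m arbitrary: \<phi> w)
  case 0
  then show ?case by simp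
next
  case (Suc m)
  show ?case
  proof (cases w rule: rev_cases)
    case Nil
    then show ?thesis using Cm_le_bound[OF Suc.prems(1,4)] by simp
  next
    case (snoc w' a)
    then have a: "a \<in> Basis" and w': "w' \<in> lists Basis" "length w' \<le> m" using Suc.prems(2,3) by auto
    have "\<forall>a\<in>Basis. \<exists>\<psi>. dir_deriv X a \<phi> \<psi> \<and> Cm_le m X e \<psi>" using Suc.prems(1) by simp
    from bspec[OF this a] obtain \<psi> where \<psi>: "dir_deriv X a \<phi> \<psi>" "Cm_le m X e \<psi>" by (elim exE conjE)
    show ?thesis using Suc.IH[OF \<psi>(2) w' Suc.prems(4)] dir_deriv_partials[OF \<psi>(1) Suc.prems(4)] snoc by simp
  qed
qed

text \<open>The interior must be non-empty because a real supremum over the empty set has no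
  prescribed value.\<close>

lemma Cm_le_norm:
  fixes X :: "'b::euclidean_space set"
  assumes "Cm_le m X e \<phi>" "interior X \<noteq> {}"
  shows "Cm_norm m X \<phi> \<le> e"
  unfolding Cm_norm_def
proof (rule cSUP_least)
  obtain x where "x \<in> interior X" using assms(2) by (metis ex_in_conv)
  then have "([], x) \<in> {w \<in> lists Basis. length w \<le> m} \<times> interior X" by simp
  then show "{w \<in> lists Basis. length w \<le> m} \<times> interior X \<noteq> {}" by (metis empty_iff)
next
  fix z :: "'b list \<times> 'b" assume z: "z \<in> {w \<in> lists Basis. length w \<le> m} \<times> interior X"
  then show "(case z of (w, x) \<Rightarrow> \<bar>partials w \<phi> x\<bar>) \<le> e"
    using Cm_le_partials[OF assms(1), of "fst z" "snd z"] by (simp add: case_prod_unfold mem_Times_iff)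
qed

text \<open>Encoded as the two-variable class of order 0 in the second variable, so that its algebra
  need not be developed twice.\<close>

definition iter_diff :: "'b::euclidean_space set \<Rightarrow> nat \<Rightarrow> ('b \<Rightarrow> real) \<Rightarrow> bool" where
  "iter_diff X m \<phi> \<longleftrightarrow> iter_diff2 X m 0 (\<lambda>x _. \<phi> x)"

lemma iter_diff_continuous:
  assumes "iter_diff X m \<phi>"
  shows "continuous_on X \<phi>"
proof (cases "X = {}")
  case False
  then obtain y where "y \<in> X" by auto
  then show ?thesis
    by (rule continuous_on_slice1[OF iter_diff2_continuous[OF assms[unfolded iter_diff_def]]])
qed simp

lemma iter_diff_slice: "iter_diff2 X m n G \<Longrightarrow> y \<in> X \<Longrightarrow> iter_diff X m (\<lambda>x. G x y)"
  unfolding iter_diff_def by (rule iter_diff2_slice)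

lemma iter_diff_Suc:
  assumes "iter_diff X (Suc m) \<phi>" "a \<in> Basis" "X \<noteq> {}"
  obtains \<psi> where "dir_deriv X a \<phi> \<psi>" "iter_diff X m \<psi>"
proof -
  \<comment> \<open>The derivative witness could formally depend on the dummy variable; freezing
    that variable removes the dependence.\<close>
  obtain y where y: "y \<in> X" using assms(3) by auto
  obtain A where A: "fst_deriv X a (\<lambda>x _. \<phi> x) A" "iter_diff2 X m 0 A"
    by (rule iter_diff2_dx[OF assms(1)[unfolded iter_diff_def] assms(2)])
  show ?thesis
  proof (rule that)
    show "dir_deriv X a \<phi> (\<lambda>x. A x y)" using A(1) y by (simp add: fst_deriv_def dir_deriv_def)
    show "iter_diff X m (\<lambda>x. A x y)" by (rule iter_diff_slice[OF A(2) y])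
  qed
qed

lemma iter_diff_I:
  assumes "continuous_on X \<phi>" "\<And>m' a. m = Suc m' \<Longrightarrow> a \<in> Basis \<Longrightarrow> \<exists>\<psi>. dir_deriv X a \<phi> \<psi> \<and> iter_diff X m' \<psi>"
  shows "iter_diff X m \<phi>"
  unfolding iter_diff_def
proof (rule diff2I[OF continuous_on_fst2[OF assms(1)]])
  fix m' a assume "m = Suc m'" "a \<in> (Basis :: 'a set)"
  from assms(2)[OF this] obtain \<psi> where "dir_deriv X a \<phi> \<psi>" "iter_diff X m' \<psi>" by (elim exE conjE)
  then show "\<exists>A. fst_deriv X a (\<lambda>x _. \<phi> x) A \<and> iter_diff2 X m' 0 A"
    by (intro exI[of _ "\<lambda>x _. \<psi> x"]) (simp add: fst_deriv_def dir_deriv_def iter_diff_def)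
qed simp

lemma iter_diff_lift: "iter_diff X m \<phi> \<Longrightarrow> X \<noteq> {} \<Longrightarrow> iter_diff2 X m n (\<lambda>x y. \<phi> x)"
proof (induction m arbitrary: \<phi> n)
  case 0
  have c: "continuous_on (X \<times> X) (\<lambda>(x, y). \<phi> x)" by (rule continuous_on_fst2[OF iter_diff_continuous[OF 0(1)]])
  show ?case
  proof (rule diff2I[OF c])
    fix n' b assume "n = Suc n'" "b \<in> (Basis :: 'a set)"
    show "\<exists>B. fst_deriv X b (\<lambda>x y. \<phi> y) (\<lambda>x y. B y x) \<and> iter_diff2 X 0 n' B"
      by (intro exI[of _ "\<lambda>x y. 0"] conjI iter_diff2_const) (simp add: fst_deriv_def)
  qed simp
next
  case (Suc m)
  have c: "continuous_on (X \<times> X) (\<lambda>(x, y). \<phi> x)" by (rule continuous_on_fst2[OF iter_diff_continuous[OF Suc.prems(1)]])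
  show ?case
  proof (rule diff2I[OF c])
    fix m' a assume m: "Suc m = Suc m'" and a: "a \<in> (Basis :: 'a set)"
    obtain \<psi> where \<psi>: "dir_deriv X a \<phi> \<psi>" "iter_diff X m \<psi>" by (rule iter_diff_Suc[OF Suc.prems(1) a Suc.prems(2)])
    show "\<exists>A. fst_deriv X a (\<lambda>x y. \<phi> x) A \<and> iter_diff2 X m' n A"
      using \<psi>(1) Suc.IH[OF \<psi>(2) Suc.prems(2), of n] m
      by (intro exI[of _ "\<lambda>x y. \<psi> x"]) (simp add: fst_deriv_def dir_deriv_def)
  next
    fix n' b assume "n = Suc n'" "b \<in> (Basis :: 'a set)"
    show "\<exists>B. fst_deriv X b (\<lambda>x y. \<phi> y) (\<lambda>x y. B y x) \<and> iter_diff2 X (Suc m) n' B"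
      by (intro exI[of _ "\<lambda>x y. 0"] conjI iter_diff2_const) (simp add: fst_deriv_def)
  qed
qed

text \<open>Translates derivative witnesses back to iterated \<open>deriv\<close>: on the interior
  the two agree, and the witness supplies the continuous extension to \<open>X\<close>.\<close>

lemma iter_diff_partials:
  fixes X :: "'b::euclidean_space set"
  assumes "X \<noteq> {}"
  shows "iter_diff X m \<phi> \<Longrightarrow> w \<in> lists Basis \<Longrightarrow> length w \<le> m \<Longrightarrow>
      \<exists>g. continuous_on X g \<and> (\<forall>x\<in>interior X. g x = partials w \<phi> x)"
    and "iter_diff X m \<phi> \<Longrightarrow> w \<in> lists Basis \<Longrightarrow> b \<in> Basis \<Longrightarrow> length w < m \<Longrightarrow> x \<in> interior X \<Longrightarrow>
      (\<lambda>t. partials w \<phi> (x + t *\<^sub>R b)) field_differentiable at 0"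
proof (induction m arbitrary: \<phi> w)
  case 0
  { case 1
    then show ?case using iter_diff_continuous[OF 1(1)] by auto
  next
    case 2
    then show ?case by simp }
next
  case (Suc m)
  { case 1
    show ?case
    proof (cases w rule: rev_cases)
      case Nil
      then show ?thesis using iter_diff_continuous[OF 1(1)] by auto
    next
      case (snoc w' a)
      then have a: "a \<in> Basis" and w': "w' \<in> lists Basis" "length w' \<le> m" using 1 by auto
      obtain \<psi> where \<psi>: "dir_deriv X a \<phi> \<psi>" "iter_diff X m \<psi>" by (rule iter_diff_Suc[OF 1(1) a assms])
      obtain g where g: "continuous_on X g" "\<forall>x\<in>interior X. g x = partials w' \<psi> x"
        using Suc.IH(1)[OF \<psi>(2) w'] by (elim exE conjE)
      have "\<forall>x\<in>interior X. g x = partials w \<phi> x"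
        using g(2) dir_deriv_partials[OF \<psi>(1)] snoc by simp
      then show ?thesis using g(1) by (intro exI[of _ g] conjI)
    qed
  next
    case 2
    show ?case
    proof (cases w rule: rev_cases)
      case Nil
      obtain \<psi> where \<psi>: "dir_deriv X b \<phi> \<psi>" "iter_diff X m \<psi>" by (rule iter_diff_Suc[OF 2(1,3) assms])
      have "((\<lambda>t. \<phi> (x + t *\<^sub>R b)) has_field_derivative \<psi> x) (at 0)" using \<psi>(1) 2(5) by (simp add: dir_deriv_def)
      then show ?thesis unfolding Nil partials_Nil field_differentiable_def by (rule exI)
    next
      case (snoc w' a)
      then have a: "a \<in> Basis" and w': "w' \<in> lists Basis" "length w' < m" using 2 by auto
      obtain \<psi> where \<psi>: "dir_deriv X a \<phi> \<psi>" "iter_diff X m \<psi>" by (rule iter_diff_Suc[OF 2(1) a assms])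
      show ?thesis
        by (rule field_differentiable_line_cong[OF _ 2(5) Suc.IH(2)[OF \<psi>(2) w'(1) 2(3) w'(2) 2(5)]])
          (simp add: snoc dir_deriv_partials[OF \<psi>(1)])
    qed }
qed

lemma iter_diff_in_Cm:
  fixes X :: "'b::euclidean_space set"
  assumes "iter_diff X m \<phi>" "X \<noteq> {}"
  shows "\<phi> \<in> Cm m X"
  unfolding Cm_def continuous_partials_def
proof (rule CollectI, intro conjI allI impI ballI)
  show "continuous_on X \<phi>" by (rule iter_diff_continuous[OF assms(1)])
next
  fix b x :: 'b and w assume "b # w \<in> {w \<in> lists Basis. length w \<le> m}" "x \<in> interior X"
  then have "b # w \<in> lists Basis \<and> length (b # w) \<le> m" "x \<in> interior X" by auto
  then show "(\<lambda>t. partials w \<phi> (x + t *\<^sub>R b)) field_differentiable at 0"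
    by (intro iter_diff_partials(2)[OF assms(2,1)]) auto
next
  fix w :: "'b list" assume "w \<in> {w \<in> lists Basis. length w \<le> m}"
  then show "\<exists>g. continuous_on X g \<and> (\<forall>x\<in>interior X. g x = partials w \<phi> x)"
    by (intro iter_diff_partials(1)[OF assms(2,1)]) auto
qed

text \<open>One step from words to the recursive classes. The derivative in direction
  \<open>b\<close> is represented by its continuous extension \<open>g\<close>, and the words still
  available for \<open>g\<close> are those that could be followed by \<open>b\<close>.\<close>

lemma continuous_partials_step:
  assumes f: "continuous_partials W Z f" and b: "[b] \<in> W"
  obtains g where "continuous_on Z g" "dir_deriv Z b f g" "continuous_partials {w. w @ [b] \<in> W} Z g"
proof -
  have diff: "(\<lambda>t. partials w f (z + t *\<^sub>R b')) field_differentiable at 0"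
    if "b' # w \<in> W" "z \<in> interior Z" for b' w z
    using f that unfolding continuous_partials_def by simp
  have ext: "\<exists>g. continuous_on Z g \<and> (\<forall>x\<in>interior Z. g x = partials w f x)" if "w \<in> W" for w
    using f that unfolding continuous_partials_def by simp
  obtain g where g: "continuous_on Z g" and g': "\<forall>x\<in>interior Z. g x = partials [b] f x"
    using ext[OF b] by (elim exE conjE)
  have gb: "g x = partial b f x" if "x \<in> interior Z" for x
    using g' that by (simp add: partials_Cons)
  have dir_deriv: "dir_deriv Z b f g"
    unfolding dir_deriv_def
  proof
    fix x assume x: "x \<in> interior Z"
    have "((\<lambda>t. f (x + t *\<^sub>R b)) has_field_derivative deriv (\<lambda>t. f (x + t *\<^sub>R b)) 0) (at 0)"
      using diff[of b "[]", OF b x] by (simp add: DERIV_deriv_iff_field_differentiable)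
    then show "((\<lambda>t. f (x + t *\<^sub>R b)) has_field_derivative g x) (at 0)"
      using gb[OF x] by (simp add: partial_def)
  qed
  have pg: "partials w g x = partials (w @ [b]) f x" if "x \<in> interior Z" for w x
    using dir_deriv_partials[OF dir_deriv that] by simp
  have "continuous_partials {w. w @ [b] \<in> W} Z g"
    unfolding continuous_partials_def
  proof (intro conjI allI impI ballI)
    show "continuous_on Z g" by (rule g)
  next
    fix b' w x assume w: "b' # w \<in> {w. w @ [b] \<in> W}" and x: "x \<in> interior Z"
    have "(\<lambda>t. partials (w @ [b]) f (x + t *\<^sub>R b')) field_differentiable at 0"
      using w x by (intro diff) auto
    then show "(\<lambda>t. partials w g (x + t *\<^sub>R b')) field_differentiable at 0"
      by (rule field_differentiable_line_cong[rotated 2]) (use x pg in simp_all)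
  next
    fix w assume w: "w \<in> {w. w @ [b] \<in> W}"
    then obtain h where h: "continuous_on Z h" "\<forall>x\<in>interior Z. h x = partials (w @ [b]) f x"
      using ext[of "w @ [b]"] by auto
    then show "\<exists>g'. continuous_on Z g' \<and> (\<forall>x\<in>interior Z. g' x = partials w g x)"
      using pg by (intro exI[of _ h]) simp
  qed
  then show ?thesis by (rule that[OF g dir_deriv])
qed

section \<open>Derivatives at boundary values of the second variable\<close>

lemma line_in_interior:
  fixes x a :: "'b::real_normed_vector"
  assumes "x \<in> interior X"
  obtains r where "r > 0" "\<And>s. \<bar>s\<bar> < r \<Longrightarrow> x + s *\<^sub>R a \<in> interior X"
proof -
  obtain r where "r > 0" "\<forall>s. dist s (0::real) < r \<longrightarrow> x + s *\<^sub>R a \<in> interior X"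
    using eventually_line_in_interior[OF assms, of a] unfolding eventually_nhds_metric by (elim exE conjE)
  then show ?thesis by (intro that[of r]) simp_all
qed

lemma eventually_at_line_in:
  fixes x a :: "'b::real_normed_vector"
  assumes "x \<in> interior X"
  shows "\<forall>\<^sub>F t in at 0. x + t *\<^sub>R a \<in> X"
proof -
  have "\<forall>\<^sub>F t in at 0. x + t *\<^sub>R a \<in> interior X"
    using eventually_line_in_interior[OF assms, of a] by (simp add: eventually_at_filter eventually_mono)
  then show ?thesis by (rule eventually_mono) (rule interior_subset[THEN subsetD])
qed

lemma line_derivative_shift:
  fixes x a :: "'b::real_normed_vector"
  assumes "((\<lambda>t. \<phi> ((x + s *\<^sub>R a) + t *\<^sub>R a)) has_field_derivative c) (at (0::real))"
  shows "((\<lambda>u. \<phi> (x + u *\<^sub>R a)) has_field_derivative c) (at s)"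
proof -
  have "(\<lambda>t. \<phi> ((x + s *\<^sub>R a) + t *\<^sub>R a)) = (\<lambda>t. \<phi> (x + (t + s) *\<^sub>R a))"
    by (simp add: scaleR_add_left add.assoc add.commute[of "s *\<^sub>R a"])
  then show ?thesis using assms DERIV_shift[of "\<lambda>u. \<phi> (x + u *\<^sub>R a)" c 0 s] by simp
qed

lemma dist_line_less:
  fixes x a :: "'b::real_normed_vector"
  assumes "\<bar>s\<bar> < d / (norm a + 1)" "d > 0"
  shows "dist (x + s *\<^sub>R a) x < d"
proof -
  have p: "norm a + 1 > 0" using norm_ge_zero[of a] by linarith
  have "\<bar>s\<bar> * norm a \<le> \<bar>s\<bar> * (norm a + 1)" by (intro mult_left_mono) auto
  also have "\<dots> < d" using assms p by (simp add: pos_less_divide_eq)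
  finally show ?thesis by (simp add: dist_norm)
qed

text \<open>A boundary point \<open>y\<close> is the limit of interior points. Uniform continuity of
  \<open>A\<close> makes the derivatives along these points close to \<open>A x y\<close> near
  \<open>x\<close>, uniformly on a segment, which is what \<open>has_field_derivative_limit\<close>
  requires.\<close>

lemma fst_deriv_extend:
  assumes X: "compact X" "X \<subseteq> closure (interior X)"
    and G: "continuous_on (X \<times> X) (\<lambda>(x, y). G x y)" and A: "continuous_on (X \<times> X) (\<lambda>(x, y). A x y)"
    and der: "\<And>x y. x \<in> interior X \<Longrightarrow> y \<in> interior X \<Longrightarrow>
      ((\<lambda>t. G (x + t *\<^sub>R a) y) has_field_derivative A x y) (at 0)"
  shows "fst_deriv X a G A"
  unfolding fst_deriv_def
proof (intro ballI)
  fix x y assume x: "x \<in> interior X" and y: "y \<in> X"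
  have int: "z \<in> X" if "z \<in> interior X" for z using that interior_subset by (rule subsetD[rotated])
  have "y \<in> closure (interior X)" using X(2) y by (rule subsetD)
  then obtain u where u: "\<And>n. u n \<in> interior X" "u \<longlonglongrightarrow> y" unfolding closure_sequential by blast
  obtain r where r: "r > 0" "\<And>s. \<bar>s\<bar> < r \<Longrightarrow> x + s *\<^sub>R a \<in> interior X" by (rule line_in_interior[OF x, where a=a]) blast
  show "((\<lambda>t. G (x + t *\<^sub>R a) y) has_field_derivative A x y) (at 0)"
  proof (rule has_field_derivative_limit[where F=sequentially and f="\<lambda>n s. G (x + s *\<^sub>R a) (u n)"
        and f'="\<lambda>n s. A (x + s *\<^sub>R a) (u n)" and r=r])
    fix e :: real assume e: "e > 0"
    obtain d where d: "d > 0" "\<And>x x' y y'. x \<in> X \<Longrightarrow> x' \<in> X \<Longrightarrow> y \<in> X \<Longrightarrow> y' \<in> X \<Longrightarrow> dist x x' < d \<Longrightarrow> dist y y' < d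
       \<Longrightarrow> \<bar>A x y - A x' y'\<bar> < e" by (rule compact_slices_equicontinuous[OF X(1) A e]) blast
    define d' where "d' = min r (d / (norm a + 1))"
    have p: "norm a + 1 > 0" using norm_ge_zero[of a] by linarith
    have d': "d' > 0" using r d p by (simp add: d'_def)
    have "\<forall>\<^sub>F n in sequentially. dist (u n) y < d" using tendstoD[OF u(2) d(1)] .
    then have "\<forall>\<^sub>F n in sequentially. \<forall>s. \<bar>s\<bar> < d' \<longrightarrow>
      ((\<lambda>s. G (x + s *\<^sub>R a) (u n)) has_field_derivative A (x + s *\<^sub>R a) (u n)) (at s) \<and>
      \<bar>A (x + s *\<^sub>R a) (u n) - A x y\<bar> \<le> e"
    proof eventually_elim
      case (elim n)
      show ?case
      proof (intro allI impI conjI)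
        fix s assume s: "\<bar>s\<bar> < d'"
        then have xs: "x + s *\<^sub>R a \<in> interior X" by (intro r(2)) (simp add: d'_def)
        show "((\<lambda>s. G (x + s *\<^sub>R a) (u n)) has_field_derivative A (x + s *\<^sub>R a) (u n)) (at s)"
          by (rule line_derivative_shift[OF der[OF xs u(1)]])
        have "dist (x + s *\<^sub>R a) x < d" using s d(1) by (intro dist_line_less) (simp_all add: d'_def)
        then show "\<bar>A (x + s *\<^sub>R a) (u n) - A x y\<bar> \<le> e"
          using d(2)[OF int[OF xs] int[OF x] int[OF u(1)] y _ elim] by (simp add: less_imp_le)
      qed
    qed
    then show "\<exists>d>0. \<forall>\<^sub>F n in sequentially. \<forall>s. \<bar>s\<bar> < d \<longrightarrow>
      ((\<lambda>s. G (x + s *\<^sub>R a) (u n)) has_field_derivative A (x + s *\<^sub>R a) (u n)) (at s) \<and>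
      \<bar>A (x + s *\<^sub>R a) (u n) - A x y\<bar> \<le> e" using d' by (intro exI[of _ d'] conjI)
  next
    fix s assume "\<bar>s\<bar> < r"
    then have xs: "x + s *\<^sub>R a \<in> X" by (intro int r(2))
    show "(\<lambda>n. G (x + s *\<^sub>R a) (u n)) \<longlonglongrightarrow> G (x + s *\<^sub>R a) y"
      by (rule continuous_on_tendsto_compose[OF continuous_on_slice2[OF G xs] u(2) y])
        (simp add: int[OF u(1)])
  qed (simp_all add: r(1))
qed

text \<open>\<open>Cmm\<close> is the diagonal case; two separate orders are needed for an induction
  that lowers one of them at a time.\<close>

definition mixed_words :: "nat \<Rightarrow> nat \<Rightarrow> ('b::euclidean_space \<times> 'b) list set" where
  "mixed_words m n = {w \<in> lists Basis. length (filter (\<lambda>b. fst b \<noteq> 0) w) \<le> m \<and>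
                       length (filter (\<lambda>b. snd b \<noteq> 0) w) \<le> n}"

lemma iter_diff2_of_continuous_partials:
  fixes X :: "'b::euclidean_space set"
  assumes X: "compact X" "X \<subseteq> closure (interior X)"
  shows "continuous_partials (mixed_words m n) (X \<times> X) f \<Longrightarrow> iter_diff2 X m n (\<lambda>x y. f (x, y))"
proof (induction "m + n" arbitrary: m n f rule: less_induct)
  case less
  have cf: "continuous_on (X \<times> X) f" using less.prems by (simp add: continuous_partials_def)
  have c: "continuous_on (X \<times> X) (\<lambda>(x, y). f (x, y))" using cf by simp
  show ?case
  proof (rule diff2I[OF c])
    fix m' and a :: 'b assume m: "m = Suc m'" and a: "a \<in> Basis"
    have a0: "a \<noteq> 0" using a nonzero_Basis by auto
    have B: "(a, 0) \<in> (Basis :: ('b \<times> 'b) set)" using a by (simp add: Basis_prod_def)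
    have w: "[(a, 0)] \<in> mixed_words m n" using B a0 m by (simp add: mixed_words_def)
    have W: "{w. w @ [(a, 0)] \<in> mixed_words m n} = mixed_words m' n"
      using B a0 m by (auto simp: mixed_words_def)
    obtain g where g: "continuous_on (X \<times> X) g" "dir_deriv (X \<times> X) (a, 0) f g"
      "continuous_partials (mixed_words m' n) (X \<times> X) g"
      by (rule continuous_partials_step[OF less.prems w, unfolded W])
    have "fst_deriv X a (\<lambda>x y. f (x, y)) (\<lambda>x y. g (x, y))"
    proof (rule fst_deriv_extend[OF X c])
      show "continuous_on (X \<times> X) (\<lambda>(x, y). g (x, y))" using g(1) by simp
      show "((\<lambda>t. f (x + t *\<^sub>R a, y)) has_field_derivative g (x, y)) (at 0)"
        if "x \<in> interior X" "y \<in> interior X" for x y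
        using g(2) that by (simp add: dir_deriv_def interior_Times)
    qed
    moreover have "iter_diff2 X m' n (\<lambda>x y. g (x, y))" by (rule less.hyps[OF _ g(3)]) (simp add: m)
    ultimately show "\<exists>A. fst_deriv X a (\<lambda>x y. f (x, y)) A \<and> iter_diff2 X m' n A"
      by (intro exI[of _ "\<lambda>x y. g (x, y)"] conjI)
  next
    fix n' and a :: 'b assume n: "n = Suc n'" and a: "a \<in> Basis"
    have a0: "a \<noteq> 0" using a nonzero_Basis by auto
    have B: "(0, a) \<in> (Basis :: ('b \<times> 'b) set)" using a by (simp add: Basis_prod_def)
    have w: "[(0, a)] \<in> mixed_words m n" using B a0 n by (simp add: mixed_words_def)
    have W: "{w. w @ [(0, a)] \<in> mixed_words m n} = mixed_words m n'"
      using B a0 n by (auto simp: mixed_words_def)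
    obtain g where g: "continuous_on (X \<times> X) g" "dir_deriv (X \<times> X) (0, a) f g"
      "continuous_partials (mixed_words m n') (X \<times> X) g"
      by (rule continuous_partials_step[OF less.prems w, unfolded W])
    have gc: "continuous_on (X \<times> X) (\<lambda>(x, y). g (x, y))" using g(1) by simp
    have "fst_deriv X a (\<lambda>x y. f (y, x)) (\<lambda>x y. g (y, x))"
    proof (rule fst_deriv_extend[OF X continuous_on_swap2[OF c] continuous_on_swap2[OF gc]])
      show "((\<lambda>t. f (y, x + t *\<^sub>R a)) has_field_derivative g (y, x)) (at 0)"
        if "x \<in> interior X" "y \<in> interior X" for x y
        using g(2) that by (simp add: dir_deriv_def interior_Times)
    qed
    moreover have "iter_diff2 X m n' (\<lambda>x y. g (x, y))" by (rule less.hyps[OF _ g(3)]) (simp add: n)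
    ultimately show "\<exists>B. fst_deriv X a (\<lambda>x y. f (y, x)) (\<lambda>x y. B y x) \<and> iter_diff2 X m n' B"
      by (intro exI[of _ "\<lambda>x y. g (x, y)"] conjI)
  qed
qed

section \<open>Slices of a kernel as a map into C^m\<close>

lemma Cm_le_Suc_eventually:
  fixes X :: "'b::euclidean_space set"
  assumes "\<forall>\<^sub>F i in F. \<forall>x\<in>interior X. \<bar>h i x\<bar> \<le> e"
    and "\<And>a. a \<in> Basis \<Longrightarrow> \<exists>\<psi>. (\<forall>\<^sub>F i in F. dir_deriv X a (h i) (\<psi> i)) \<and> (\<forall>\<^sub>F i in F. Cm_le m X e (\<psi> i))"
  shows "\<forall>\<^sub>F i in F. Cm_le (Suc m) X e (h i)"
proof -
  have "\<forall>\<^sub>F i in F. \<exists>\<psi>. dir_deriv X a (h i) \<psi> \<and> Cm_le m X e \<psi>" if a: "a \<in> Basis" for a :: 'b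
  proof -
    obtain \<psi> where "\<forall>\<^sub>F i in F. dir_deriv X a (h i) (\<psi> i)" "\<forall>\<^sub>F i in F. Cm_le m X e (\<psi> i)"
      using assms(2)[OF a] by (elim exE conjE)
    then show ?thesis by eventually_elim (intro exI conjI)
  qed
  \<comment> \<open>There are only finitely many basis directions, so their eventual statements can
    be combined.\<close>
  then have "\<forall>\<^sub>F i in F. \<forall>a\<in>Basis. \<exists>\<psi>. dir_deriv X a (h i) \<psi> \<and> Cm_le m X e \<psi>"
    by (intro eventually_ball_finite finite_Basis ballI)
  with assms(1) show ?thesis by eventually_elim simp
qed

text \<open>Uniform continuity of the map from \<open>y\<close> to the slice at \<open>y\<close>,
  with values in C^m. It is phrased with the uniformity filter so that the derivatives can be
  treated by the same inductive scheme as other limits.\<close>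

lemma iter_diff2_slices_continuous:
  assumes X: "compact X"
  shows "iter_diff2 X m n G \<Longrightarrow> e > 0 \<Longrightarrow>
    \<forall>\<^sub>F z in inf uniformity (principal (X \<times> X)). Cm_le m X e (\<lambda>x. G x (fst z) - G x (snd z))"
proof (induction m arbitrary: G)
  have base: "\<forall>\<^sub>F z in inf uniformity (principal (X \<times> X)). \<forall>x\<in>interior X. \<bar>G x (fst z) - G x (snd z)\<bar> \<le> e"
    if h: "iter_diff2 X m n G" "e > 0" for m G
  proof -
    obtain d where d: "d > 0" "\<And>x x' y y'. x \<in> X \<Longrightarrow> x' \<in> X \<Longrightarrow> y \<in> X \<Longrightarrow> y' \<in> X \<Longrightarrow> dist x x' < d \<Longrightarrow> dist y y' < d
       \<Longrightarrow> \<bar>G x y - G x' y'\<bar> < e" by (rule compact_slices_equicontinuous[OF X iter_diff2_continuous[OF h(1)] h(2)]) blast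
    have *: "\<bar>G x (fst z) - G x (snd z)\<bar> \<le> e"
      if "z \<in> X \<times> X" "dist (fst z) (snd z) < d" "x \<in> interior X" for x z
    proof -
      have "x \<in> X" using that(3) interior_subset by (rule subsetD[rotated])
      then show ?thesis using d(2)[of x x "fst z" "snd z"] d(1) that(1,2) by (simp add: mem_Times_iff less_imp_le)
    qed
    show ?thesis unfolding eventually_inf_principal eventually_uniformity_metric
    proof (intro exI[of _ d] conjI allI impI ballI d(1))
      fix y y' x assume "dist y y' < d" "(y, y') \<in> X \<times> X" "x \<in> interior X"
      then show "\<bar>G x (fst (y, y')) - G x (snd (y, y'))\<bar> \<le> e" using *[of "(y, y')" x] by simp
    qed
  qed
  {
    case 0
    show ?case unfolding Cm_le.simps by (rule base[OF 0])
  next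
    case (Suc m)
    show ?case
    proof (rule Cm_le_Suc_eventually[OF base[OF Suc.prems]])
      fix a :: 'a assume a: "a \<in> Basis"
      obtain A where A: "fst_deriv X a G A" "iter_diff2 X m n A" by (rule iter_diff2_dx[OF Suc.prems(1) a])
      have "\<forall>\<^sub>F z in inf uniformity (principal (X \<times> X)).
        dir_deriv X a (\<lambda>x. G x (fst z) - G x (snd z)) (\<lambda>x. A x (fst z) - A x (snd z))"
        unfolding eventually_inf_principal
        using A(1) by (intro always_eventually allI impI) (auto simp: dir_deriv_def fst_deriv_def intro!: DERIV_diff)
      then show "\<exists>\<psi>. (\<forall>\<^sub>F z in inf uniformity (principal (X \<times> X)). dir_deriv X a (\<lambda>x. G x (fst z) - G x (snd z)) (\<psi> z)) \<and>
        (\<forall>\<^sub>F z in inf uniformity (principal (X \<times> X)). Cm_le m X e (\<psi> z))"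
        using Suc.IH[OF A(2) Suc.prems(2)] by (intro exI[of _ "\<lambda>z x. A x (fst z) - A x (snd z)"] conjI)
    qed
  }
qed

text \<open>The mean value inequality for \<open>G - B x y * s\<close> along the segment: its
  derivative is small there for all \<open>x\<close> at once, because \<open>B\<close> is uniformly
  continuous.\<close>

lemma difference_quotient_uniform:
  assumes X: "compact X" and B: "continuous_on (X \<times> X) (\<lambda>(x, y). B x y)"
    and der: "fst_deriv X b (\<lambda>y x. G x y) (\<lambda>y x. B x y)" and y: "y \<in> interior X" and e: "e > 0"
  shows "\<forall>\<^sub>F t in at 0. \<forall>x\<in>X. \<bar>(G x (y + t *\<^sub>R b) - G x y) / t - B x y\<bar> \<le> e"
proof -
  have int: "z \<in> X" if "z \<in> interior X" for z using that interior_subset by (rule subsetD[rotated])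
  obtain d where d: "d > 0" "\<And>x x' y y'. x \<in> X \<Longrightarrow> x' \<in> X \<Longrightarrow> y \<in> X \<Longrightarrow> y' \<in> X \<Longrightarrow> dist x x' < d \<Longrightarrow> dist y y' < d
     \<Longrightarrow> \<bar>B x y - B x' y'\<bar> < e" by (rule compact_slices_equicontinuous[OF X B e]) blast
  obtain r where r: "r > 0" "\<And>s. \<bar>s\<bar> < r \<Longrightarrow> y + s *\<^sub>R b \<in> interior X" by (rule line_in_interior[OF y, where a=b]) blast
  define d' where "d' = min r (d / (norm b + 1))"
  have p: "norm b + 1 > 0" using norm_ge_zero[of b] by linarith
  have d': "d' > 0" using r d p by (simp add: d'_def)
  have "\<bar>(G x (y + t *\<^sub>R b) - G x y) / t - B x y\<bar> \<le> e" if t: "t \<noteq> 0" "\<bar>t\<bar> < d'" and x: "x \<in> X" for t x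
  proof -
    have "norm ((G x (y + t *\<^sub>R b) - B x y * t) - (G x (y + 0 *\<^sub>R b) - B x y * 0)) \<le> e * norm (t - 0)"
    proof (rule field_differentiable_bound[where S="{-\<bar>t\<bar>..\<bar>t\<bar>}" and f="\<lambda>s. G x (y + s *\<^sub>R b) - B x y * s"
          and f'="\<lambda>s. B x (y + s *\<^sub>R b) - B x y"])
      fix s assume "s \<in> {-\<bar>t\<bar>..\<bar>t\<bar>}"
      then have s: "\<bar>s\<bar> < d'" using t(2) by auto
      then have ys: "y + s *\<^sub>R b \<in> interior X" by (intro r(2)) (simp add: d'_def)
      have "((\<lambda>t. G x ((y + s *\<^sub>R b) + t *\<^sub>R b)) has_field_derivative B x (y + s *\<^sub>R b)) (at 0)"
        using der ys x by (simp add: fst_deriv_def)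
      then have "((\<lambda>s. G x (y + s *\<^sub>R b)) has_field_derivative B x (y + s *\<^sub>R b)) (at s)"
        by (rule line_derivative_shift)
      from DERIV_diff[OF this DERIV_cmult_Id[of "B x y"]]
      show "((\<lambda>s. G x (y + s *\<^sub>R b) - B x y * s) has_field_derivative B x (y + s *\<^sub>R b) - B x y) (at s within {-\<bar>t\<bar>..\<bar>t\<bar>})"
        by (rule has_field_derivative_at_within)
      have "dist (y + s *\<^sub>R b) y < d" using s d(1) by (intro dist_line_less) (simp_all add: d'_def)
      then show "norm (B x (y + s *\<^sub>R b) - B x y) \<le> e"
        using d(2)[OF x x int[OF ys] int[OF y]] d(1) by (simp add: less_imp_le)
    qed auto
    then have *: "\<bar>G x (y + t *\<^sub>R b) - B x y * t - G x y\<bar> \<le> e * \<bar>t\<bar>" by simp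
    have "(G x (y + t *\<^sub>R b) - G x y) / t - B x y = (G x (y + t *\<^sub>R b) - B x y * t - G x y) / t"
      using t(1) by (simp add: diff_divide_distrib)
    then show ?thesis using * t(1) by (simp add: abs_divide pos_divide_le_eq)
  qed
  then show ?thesis unfolding eventually_at using d' by (intro exI[of _ d'] conjI ballI allI impI) simp_all
qed

lemma fst_deriv_quotient:
  assumes "fst_deriv X a G A" "y \<in> X" "y' \<in> X" "x \<in> interior X"
  shows "((\<lambda>s. (G (x + s *\<^sub>R a) y' - G (x + s *\<^sub>R a) y) / t) has_field_derivative (A x y' - A x y) / t) (at 0)"
  using assms by (intro DERIV_cdivide DERIV_diff) (simp_all add: fst_deriv_def)

text \<open>The \<open>a\<close>-derivatives of the difference quotients in direction \<open>b\<close> converge uniformly.\<close>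

lemma mixed_derivatives_commute:
  assumes X: "compact X" and B': "continuous_on (X \<times> X) (\<lambda>(x, y). B' x y)"
    and G: "fst_deriv X a G A" and A: "fst_deriv X b (\<lambda>y x. A x y) (\<lambda>y x. B' x y)"
    and B: "fst_deriv X b (\<lambda>y x. G x y) (\<lambda>y x. B x y)" and y: "y \<in> interior X"
  shows "dir_deriv X a (\<lambda>x. B x y) (\<lambda>x. B' x y)"
  unfolding dir_deriv_def
proof
  fix x assume x: "x \<in> interior X"
  have int: "z \<in> X" if "z \<in> interior X" for z using that interior_subset by (rule subsetD[rotated])
  obtain r where r: "r > 0" "\<And>s. \<bar>s\<bar> < r \<Longrightarrow> x + s *\<^sub>R a \<in> interior X" by (rule line_in_interior[OF x, where a=a]) blast
  show "((\<lambda>s. B (x + s *\<^sub>R a) y) has_field_derivative B' x y) (at 0)"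
  proof (rule has_field_derivative_limit[where F="at 0" and r=r
        and f="\<lambda>t s. (G (x + s *\<^sub>R a) (y + t *\<^sub>R b) - G (x + s *\<^sub>R a) y) / t"
        and f'="\<lambda>t s. (A (x + s *\<^sub>R a) (y + t *\<^sub>R b) - A (x + s *\<^sub>R a) y) / t"])
    fix e :: real assume e: "e > 0"
    then have e2: "e / 2 > 0" by simp
    obtain d where d: "d > 0" "\<And>x x' y y'. x \<in> X \<Longrightarrow> x' \<in> X \<Longrightarrow> y \<in> X \<Longrightarrow> y' \<in> X \<Longrightarrow> dist x x' < d \<Longrightarrow> dist y y' < d
      \<Longrightarrow> \<bar>B' x y - B' x' y'\<bar> < e / 2" by (rule compact_slices_equicontinuous[OF X B' e2]) blast
    define d' where "d' = min r (d / (norm a + 1))"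
    have p: "norm a + 1 > 0" using norm_ge_zero[of a] by linarith
    have d': "d' > 0" using r d p by (simp add: d'_def)
    have "\<forall>\<^sub>F t in at 0. \<forall>s. \<bar>s\<bar> < d' \<longrightarrow>
      ((\<lambda>s. (G (x + s *\<^sub>R a) (y + t *\<^sub>R b) - G (x + s *\<^sub>R a) y) / t) has_field_derivative
        (A (x + s *\<^sub>R a) (y + t *\<^sub>R b) - A (x + s *\<^sub>R a) y) / t) (at s) \<and>
      \<bar>(A (x + s *\<^sub>R a) (y + t *\<^sub>R b) - A (x + s *\<^sub>R a) y) / t - B' x y\<bar> \<le> e"
      using difference_quotient_uniform[OF X B' A y e2] eventually_at_line_in[OF y, of b]
    proof eventually_elim
      case (elim t)
      show ?case
      proof (intro allI impI conjI)
        fix s assume s: "\<bar>s\<bar> < d'"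
        then have xs: "x + s *\<^sub>R a \<in> interior X" by (intro r(2)) (simp add: d'_def)
        show "((\<lambda>s. (G (x + s *\<^sub>R a) (y + t *\<^sub>R b) - G (x + s *\<^sub>R a) y) / t) has_field_derivative
          (A (x + s *\<^sub>R a) (y + t *\<^sub>R b) - A (x + s *\<^sub>R a) y) / t) (at s)"
          by (rule line_derivative_shift[OF fst_deriv_quotient[OF G int[OF y] elim(2) xs]])
        have "dist (x + s *\<^sub>R a) x < d" using s d(1) by (intro dist_line_less) (simp_all add: d'_def)
        then have "\<bar>B' (x + s *\<^sub>R a) y - B' x y\<bar> < e / 2"
          using d(2)[OF int[OF xs] int[OF x] int[OF y] int[OF y]] d(1) by simp
        moreover have "\<bar>(A (x + s *\<^sub>R a) (y + t *\<^sub>R b) - A (x + s *\<^sub>R a) y) / t - B' (x + s *\<^sub>R a) y\<bar> \<le> e / 2"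
          using elim(1) int[OF xs] by (rule bspec)
        ultimately show "\<bar>(A (x + s *\<^sub>R a) (y + t *\<^sub>R b) - A (x + s *\<^sub>R a) y) / t - B' x y\<bar> \<le> e"
          by linarith
      qed
    qed
    then show "\<exists>d>0. \<forall>\<^sub>F t in at 0. \<forall>s. \<bar>s\<bar> < d \<longrightarrow>
      ((\<lambda>s. (G (x + s *\<^sub>R a) (y + t *\<^sub>R b) - G (x + s *\<^sub>R a) y) / t) has_field_derivative
        (A (x + s *\<^sub>R a) (y + t *\<^sub>R b) - A (x + s *\<^sub>R a) y) / t) (at s) \<and>
      \<bar>(A (x + s *\<^sub>R a) (y + t *\<^sub>R b) - A (x + s *\<^sub>R a) y) / t - B' x y\<bar> \<le> e"
      using d' by (intro exI[of _ d'] conjI)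
  next
    fix s assume "\<bar>s\<bar> < r"
    then have xs: "x + s *\<^sub>R a \<in> X" by (intro int r(2))
    have "((\<lambda>t. G (x + s *\<^sub>R a) (y + t *\<^sub>R b)) has_field_derivative B (x + s *\<^sub>R a) y) (at 0)"
      using B xs y by (simp add: fst_deriv_def)
    then show "((\<lambda>t. (G (x + s *\<^sub>R a) (y + t *\<^sub>R b) - G (x + s *\<^sub>R a) y) / t) \<longlongrightarrow> B (x + s *\<^sub>R a) y) (at 0)"
      by (simp add: DERIV_def)
  qed (simp_all add: r(1))
qed

text \<open>The slice map is differentiable into C^m. An \<open>x\<close>-derivative of the quotient
  is again a difference quotient, of a kernel of lower order, so induction on \<open>m\<close>
  applies once its limit is known to be the \<open>x\<close>-derivative of \<open>B\<close>.\<close>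

lemma iter_diff2_quotient:
  assumes X: "compact X" and y: "y \<in> interior X" and b: "b \<in> Basis" and e: "e > 0"
  shows "iter_diff2 X m (Suc n) G \<Longrightarrow> fst_deriv X b (\<lambda>y x. G x y) (\<lambda>y x. B x y) \<Longrightarrow> continuous_on (X \<times> X) (\<lambda>(x, y). B x y) \<Longrightarrow>
    \<forall>\<^sub>F t in at 0. Cm_le m X e (\<lambda>x. (G x (y + t *\<^sub>R b) - G x y) / t - B x y)"
proof (induction m arbitrary: G B)
  have int: "z \<in> X" if "z \<in> interior X" for z using that interior_subset by (rule subsetD[rotated])
  have base: "\<forall>\<^sub>F t in at 0. \<forall>x\<in>interior X. \<bar>(G x (y + t *\<^sub>R b) - G x y) / t - B x y\<bar> \<le> e"
    if "fst_deriv X b (\<lambda>y x. G x y) (\<lambda>y x. B x y)" "continuous_on (X \<times> X) (\<lambda>(x, y). B x y)" for G B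
    using difference_quotient_uniform[OF X that(2,1) y e] by (rule eventually_mono) (simp add: int)
  {
    case 0
    show ?case unfolding Cm_le.simps by (rule base[OF 0(2,3)])
  next
    case (Suc m)
    show ?case
    proof (rule Cm_le_Suc_eventually[OF base[OF Suc.prems(2,3)]])
      fix a :: 'a assume a: "a \<in> Basis"
      obtain A where A: "fst_deriv X a G A" "iter_diff2 X m (Suc n) A" by (rule iter_diff2_dx[OF Suc.prems(1) a])
      obtain B' where B': "fst_deriv X b (\<lambda>y x. A x y) (\<lambda>y x. B' x y)" "iter_diff2 X m n B'" by (rule iter_diff2_dy[OF A(2) b])
      \<comment> \<open>This is where the mixed derivatives have to commute: \<open>B\<close> is
        only assumed continuous, and its differentiability in \<open>x\<close> comes from the
        derivative taken in the other order.\<close>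
      have dB: "dir_deriv X a (\<lambda>x. B x y) (\<lambda>x. B' x y)"
        by (rule mixed_derivatives_commute[OF X iter_diff2_continuous[OF B'(2)] A(1) B'(1) Suc.prems(2) y])
      have "\<forall>\<^sub>F t in at 0. dir_deriv X a (\<lambda>x. (G x (y + t *\<^sub>R b) - G x y) / t - B x y)
         (\<lambda>x. (A x (y + t *\<^sub>R b) - A x y) / t - B' x y)"
        using eventually_at_line_in[OF y, of b]
      proof eventually_elim
        case (elim t)
        show ?case unfolding dir_deriv_def
        proof
          fix x assume x: "x \<in> interior X"
          have "((\<lambda>t. B (x + t *\<^sub>R a) y) has_field_derivative B' x y) (at 0)" using dB x by (simp add: dir_deriv_def)
          from DERIV_diff[OF fst_deriv_quotient[OF A(1) int[OF y] elim x] this]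
          show "((\<lambda>s. (G (x + s *\<^sub>R a) (y + t *\<^sub>R b) - G (x + s *\<^sub>R a) y) / t - B (x + s *\<^sub>R a) y) has_field_derivative
            (A x (y + t *\<^sub>R b) - A x y) / t - B' x y) (at 0)" .
        qed
      qed
      then show "\<exists>\<psi>. (\<forall>\<^sub>F t in at 0. dir_deriv X a (\<lambda>x. (G x (y + t *\<^sub>R b) - G x y) / t - B x y) (\<psi> t)) \<and>
        (\<forall>\<^sub>F t in at 0. Cm_le m X e (\<psi> t))"
        using Suc.IH[OF A(2) B'(1) iter_diff2_continuous[OF B'(2)]]
        by (intro exI[of _ "\<lambda>t x. (A x (y + t *\<^sub>R b) - A x y) / t - B' x y"] conjI)
    qed
  }
qed


section \<open>Continuous functionals applied to slices\<close>

lemma iter_diff_lincomb: "iter_diff X m \<phi> \<Longrightarrow> iter_diff X m \<psi> \<Longrightarrow> iter_diff X m (\<lambda>x. a * \<phi> x + b * \<psi> x)"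
  unfolding iter_diff_def by (intro iter_diff2_add iter_diff2_scale)

text \<open>An element of the dual of C^m, with continuity at 0 expressed through
  \<open>Cm_le\<close>, the form in which smallness of slices is proved.\<close>

definition Cm_functional :: "'b::euclidean_space set \<Rightarrow> nat \<Rightarrow> (('b \<Rightarrow> real) \<Rightarrow> real) \<Rightarrow> bool" where
  "Cm_functional X m \<Lambda> \<longleftrightarrow>
    (\<forall>\<phi> \<psi> a b. iter_diff X m \<phi> \<longrightarrow> iter_diff X m \<psi> \<longrightarrow> \<Lambda> (\<lambda>x. a * \<phi> x + b * \<psi> x) = a * \<Lambda> \<phi> + b * \<Lambda> \<psi>) \<and>
    (\<forall>e>0. \<exists>d>0. \<forall>\<phi>. iter_diff X m \<phi> \<longrightarrow> Cm_le m X d \<phi> \<longrightarrow> \<bar>\<Lambda> \<phi>\<bar> \<le> e)"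

lemma Cm_functional_linear:
  "Cm_functional X m \<Lambda> \<Longrightarrow> iter_diff X m \<phi> \<Longrightarrow> iter_diff X m \<psi> \<Longrightarrow> \<Lambda> (\<lambda>x. a * \<phi> x + b * \<psi> x) = a * \<Lambda> \<phi> + b * \<Lambda> \<psi>"
  by (simp add: Cm_functional_def)

lemma Cm_functional_continuous:
  assumes "Cm_functional X m \<Lambda>" "e > 0"
  obtains d where "d > 0" "\<And>\<phi>. iter_diff X m \<phi> \<Longrightarrow> Cm_le m X d \<phi> \<Longrightarrow> \<bar>\<Lambda> \<phi>\<bar> \<le> e"
proof -
  have "\<exists>d>0. \<forall>\<phi>. iter_diff X m \<phi> \<longrightarrow> Cm_le m X d \<phi> \<longrightarrow> \<bar>\<Lambda> \<phi>\<bar> \<le> e"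
    using assms by (simp add: Cm_functional_def)
  then obtain d where "d > 0" "\<forall>\<phi>. iter_diff X m \<phi> \<longrightarrow> Cm_le m X d \<phi> \<longrightarrow> \<bar>\<Lambda> \<phi>\<bar> \<le> e" by (elim exE conjE)
  then show ?thesis by (intro that[of d]) simp_all
qed

lemma Cm_functional_diff:
  assumes "Cm_functional X m \<Lambda>" "iter_diff X m \<phi>" "iter_diff X m \<psi>"
  shows "\<Lambda> (\<lambda>x. \<phi> x - \<psi> x) = \<Lambda> \<phi> - \<Lambda> \<psi>"
  using Cm_functional_linear[OF assms, of 1 "-1"] by simp

lemma Cm_functional_lincomb:
  assumes L: "Cm_functional X m \<Lambda>" and M: "Cm_functional X m \<Lambda>'"
  shows "Cm_functional X m (\<lambda>\<phi>. r * \<Lambda> \<phi> + s * \<Lambda>' \<phi>)"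
  unfolding Cm_functional_def
proof (intro conjI allI impI)
  show "r * \<Lambda> (\<lambda>x. a * \<phi> x + b * \<psi> x) + s * \<Lambda>' (\<lambda>x. a * \<phi> x + b * \<psi> x) =
    a * (r * \<Lambda> \<phi> + s * \<Lambda>' \<phi>) + b * (r * \<Lambda> \<psi> + s * \<Lambda>' \<psi>)" if "iter_diff X m \<phi>" "iter_diff X m \<psi>" for \<phi> \<psi> a b
    unfolding Cm_functional_linear[OF L that] Cm_functional_linear[OF M that] by (simp add: algebra_simps)
next
  fix e :: real assume e: "e > 0"
  define e' where "e' = e / (\<bar>r\<bar> + \<bar>s\<bar> + 1)"
  have p: "\<bar>r\<bar> + \<bar>s\<bar> + 1 > 0" by simp
  have e': "e' > 0" using e p by (simp add: e'_def)
  obtain d1 where d1: "d1 > 0" "\<And>\<phi>. iter_diff X m \<phi> \<Longrightarrow> Cm_le m X d1 \<phi> \<Longrightarrow> \<bar>\<Lambda> \<phi>\<bar> \<le> e'"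
    by (rule Cm_functional_continuous[OF L e']) blast
  obtain d2 where d2: "d2 > 0" "\<And>\<phi>. iter_diff X m \<phi> \<Longrightarrow> Cm_le m X d2 \<phi> \<Longrightarrow> \<bar>\<Lambda>' \<phi>\<bar> \<le> e'"
    by (rule Cm_functional_continuous[OF M e']) blast
  have mono: "Cm_le m X a \<phi> \<Longrightarrow> a \<le> b \<Longrightarrow> Cm_le m X b \<phi>" for m a b and \<phi> :: "'a \<Rightarrow> real"
    by (induction m arbitrary: \<phi>) (simp, meson order_trans, simp, meson order_trans)
  have "\<bar>r * \<Lambda> \<phi> + s * \<Lambda>' \<phi>\<bar> \<le> e" if c: "iter_diff X m \<phi>" "Cm_le m X (min d1 d2) \<phi>" for \<phi>
  proof -
    have "\<bar>\<Lambda> \<phi>\<bar> \<le> e'" by (rule d1(2)[OF c(1) mono[OF c(2)]]) simp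
    moreover have "\<bar>\<Lambda>' \<phi>\<bar> \<le> e'" by (rule d2(2)[OF c(1) mono[OF c(2)]]) simp
    ultimately have "\<bar>r * \<Lambda> \<phi>\<bar> \<le> \<bar>r\<bar> * e'" "\<bar>s * \<Lambda>' \<phi>\<bar> \<le> \<bar>s\<bar> * e'"
      by (simp_all add: abs_mult mult_left_mono)
    moreover have "\<bar>r\<bar> * e' + \<bar>s\<bar> * e' + e' = e"
    proof -
      have "(\<bar>r\<bar> + \<bar>s\<bar> + 1) * e' = e" using p unfolding e'_def by simp
      then show ?thesis by (simp add: distrib_right)
    qed
    ultimately show ?thesis using e' abs_triangle_ineq[of "r * \<Lambda> \<phi>" "s * \<Lambda>' \<phi>"] by linarith
  qed
  then show "\<exists>d>0. \<forall>\<phi>. iter_diff X m \<phi> \<longrightarrow> Cm_le m X d \<phi> \<longrightarrow> \<bar>r * \<Lambda> \<phi> + s * \<Lambda>' \<phi>\<bar> \<le> e"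
    using d1(1) d2(1) by (intro exI[of _ "min d1 d2"]) simp
qed

text \<open>Differentiation under the functional: the quotients of slices converge in C^m, and the
  functional is linear and continuous there.\<close>

lemma Cm_functional_slices_dir_deriv:
  assumes X: "compact X" and L: "Cm_functional X m \<Lambda>" and G: "iter_diff2 X m (Suc n) G" and b: "b \<in> Basis"
    and B: "fst_deriv X b (\<lambda>y x. G x y) (\<lambda>y x. B x y)" "iter_diff2 X m n B"
  shows "dir_deriv X b (\<lambda>y. \<Lambda> (\<lambda>x. G x y)) (\<lambda>y. \<Lambda> (\<lambda>x. B x y))"
  unfolding dir_deriv_def
proof
  fix y assume y: "y \<in> interior X"
  then have yX: "y \<in> X" using interior_subset by (rule subsetD[rotated])
  note CG = iter_diff_slice[OF G] and CB = iter_diff_slice[OF B(2) yX]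
  have "((\<lambda>t. (\<Lambda> (\<lambda>x. G x (y + t *\<^sub>R b)) - \<Lambda> (\<lambda>x. G x y)) / t) \<longlongrightarrow> \<Lambda> (\<lambda>x. B x y)) (at 0)"
  proof (rule tendstoI)
    fix e :: real assume e: "e > 0"
    then have e2: "e / 2 > 0" by simp
    obtain d where d: "d > 0" "\<And>\<phi>. iter_diff X m \<phi> \<Longrightarrow> Cm_le m X d \<phi> \<Longrightarrow> \<bar>\<Lambda> \<phi>\<bar> \<le> e / 2"
      by (rule Cm_functional_continuous[OF L e2]) blast
    show "\<forall>\<^sub>F t in at 0. dist ((\<Lambda> (\<lambda>x. G x (y + t *\<^sub>R b)) - \<Lambda> (\<lambda>x. G x y)) / t) (\<Lambda> (\<lambda>x. B x y)) < e"
      using iter_diff2_quotient[OF X y b d(1) G B(1) iter_diff2_continuous[OF B(2)]] eventually_at_line_in[OF y, of b]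
    proof eventually_elim
      case (elim t)
      have 1: "iter_diff X m (\<lambda>x. G x (y + t *\<^sub>R b) - G x y)"
        using iter_diff_lincomb[OF CG[OF elim(2)] CG[OF yX], of 1 "-1"] by simp
      have q: "iter_diff X m (\<lambda>x. (G x (y + t *\<^sub>R b) - G x y) / t - B x y)"
        using iter_diff_lincomb[OF 1 CB, of "1 / t" "-1"] by simp
      have "\<Lambda> (\<lambda>x. (G x (y + t *\<^sub>R b) - G x y) / t - B x y)
         = (\<Lambda> (\<lambda>x. G x (y + t *\<^sub>R b)) - \<Lambda> (\<lambda>x. G x y)) / t - \<Lambda> (\<lambda>x. B x y)"
        using Cm_functional_linear[OF L 1 CB, of "1 / t" "-1"] Cm_functional_diff[OF L CG[OF elim(2)] CG[OF yX]]
        by simp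
      then show ?case using d(2)[OF q elim(1)] e by (simp add: dist_real_def)
    qed
  qed
  then show "((\<lambda>t. \<Lambda> (\<lambda>x. G x (y + t *\<^sub>R b))) has_field_derivative \<Lambda> (\<lambda>x. B x y)) (at 0)"
    by (simp add: DERIV_def)
qed

lemma Cm_functional_slices_continuous:
  assumes X: "compact X" and L: "Cm_functional X m \<Lambda>" and G: "iter_diff2 X m n G"
  shows "continuous_on X (\<lambda>y. \<Lambda> (\<lambda>x. G x y))"
  unfolding continuous_on_iff
proof (intro ballI allI impI)
  fix y and e :: real assume y: "y \<in> X" and e: "e > 0"
  then have e2: "e / 2 > 0" by simp
  obtain d where d: "d > 0" "\<And>\<phi>. iter_diff X m \<phi> \<Longrightarrow> Cm_le m X d \<phi> \<Longrightarrow> \<bar>\<Lambda> \<phi>\<bar> \<le> e / 2"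
    by (rule Cm_functional_continuous[OF L e2]) blast
  obtain d' where d': "d' > 0" "\<And>z. z \<in> X \<times> X \<Longrightarrow> dist (fst z) (snd z) < d' \<Longrightarrow> Cm_le m X d (\<lambda>x. G x (fst z) - G x (snd z))"
    using iter_diff2_slices_continuous[OF X G d(1)] unfolding eventually_inf_principal eventually_uniformity_metric
    by (metis fst_conv snd_conv surj_pair)
  have "dist (\<Lambda> (\<lambda>x. G x y')) (\<Lambda> (\<lambda>x. G x y)) < e" if y': "y' \<in> X" "dist y' y < d'" for y'
  proof -
    have "Cm_le m X d (\<lambda>x. G x y' - G x y)" using d'(2)[of "(y', y)"] y' y by simp
    moreover have "iter_diff X m (\<lambda>x. G x y' - G x y)"
      using iter_diff_lincomb[OF iter_diff_slice[OF G y'(1)] iter_diff_slice[OF G y], of 1 "-1"] by simp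
    ultimately have "\<bar>\<Lambda> (\<lambda>x. G x y' - G x y)\<bar> \<le> e / 2" by (intro d(2))
    then show ?thesis using e Cm_functional_diff[OF L iter_diff_slice[OF G y'(1)] iter_diff_slice[OF G y]] by (simp add: dist_real_def)
  qed
  then show "\<exists>d>0. \<forall>y'\<in>X. dist y' y < d \<longrightarrow> dist (\<Lambda> (\<lambda>x. G x y')) (\<Lambda> (\<lambda>x. G x y)) < e"
    using d'(1) by (intro exI[of _ d'] conjI ballI impI)
qed

text \<open>The source of all smoothness below. With the path derivative as the functional it places
  \<open>H[L]\<close> in C^m; with a weighted integral it shows that kernel integrals of merely
  continuous functions are C^m.\<close>

lemma Cm_functional_slices:
  assumes X: "compact X" and L: "Cm_functional X m \<Lambda>"
  shows "iter_diff2 X m n G \<Longrightarrow> iter_diff X n (\<lambda>y. \<Lambda> (\<lambda>x. G x y))"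
proof (induction n arbitrary: G)
  case 0
  show ?case by (rule iter_diff_I[OF Cm_functional_slices_continuous[OF X L 0]]) simp
next
  case (Suc n)
  show ?case
  proof (rule iter_diff_I[OF Cm_functional_slices_continuous[OF X L Suc.prems]])
    fix n' and b :: 'a assume n: "Suc n = Suc n'" and b: "b \<in> Basis"
    obtain B where B: "fst_deriv X b (\<lambda>y x. G x y) (\<lambda>y x. B x y)" "iter_diff2 X m n B" by (rule iter_diff2_dy[OF Suc.prems b])
    have "iter_diff X n' (\<lambda>y. \<Lambda> (\<lambda>x. B x y))" using Suc.IH[OF B(2)] n by simp
    with Cm_functional_slices_dir_deriv[OF X L Suc.prems b B]
    show "\<exists>\<psi>. dir_deriv X b (\<lambda>y. \<Lambda> (\<lambda>x. G x y)) \<psi> \<and> iter_diff X n' \<psi>" by (intro exI[of _ "\<lambda>y. \<Lambda> (\<lambda>x. B x y)"] conjI)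
  qed
qed

text \<open>Uniform smallness is upgraded to smallness in C^n. A derivative in \<open>y\<close> of
  the functional on the slices of \<open>G\<close> is the functional on the slices of another
  kernel, to which the hypothesis applies as well; this is why it is assumed for all
  kernels.\<close>

lemma Cm_functionals_slices_small:
  assumes X: "compact X" and L: "\<forall>\<^sub>F i in F. Cm_functional X m (\<Lambda> i)" and e: "e > 0"
    and U: "\<And>n G. iter_diff2 X m n G \<Longrightarrow> \<forall>\<^sub>F i in F. \<forall>y\<in>X. \<bar>\<Lambda> i (\<lambda>x. G x y)\<bar> \<le> e"
  shows "iter_diff2 X m n G \<Longrightarrow> \<forall>\<^sub>F i in F. Cm_le n X e (\<lambda>y. \<Lambda> i (\<lambda>x. G x y))"
proof (induction n arbitrary: G)
  have base: "\<forall>\<^sub>F i in F. \<forall>y\<in>interior X. \<bar>\<Lambda> i (\<lambda>x. G x y)\<bar> \<le> e" if "iter_diff2 X m n G" for n G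
    using U[OF that] by (rule eventually_mono) (use interior_subset in blast)
  {
    case 0
    show ?case unfolding Cm_le.simps by (rule base[OF 0])
  next
    case (Suc n)
    show ?case
    proof (rule Cm_le_Suc_eventually[OF base[OF Suc.prems]])
      fix b :: 'a assume b: "b \<in> Basis"
      obtain B where B: "fst_deriv X b (\<lambda>y x. G x y) (\<lambda>y x. B x y)" "iter_diff2 X m n B" by (rule iter_diff2_dy[OF Suc.prems b])
      have "\<forall>\<^sub>F i in F. dir_deriv X b (\<lambda>y. \<Lambda> i (\<lambda>x. G x y)) (\<lambda>y. \<Lambda> i (\<lambda>x. B x y))"
        using L by (rule eventually_mono) (rule Cm_functional_slices_dir_deriv[OF X _ Suc.prems b B])
      then show "\<exists>\<psi>. (\<forall>\<^sub>F i in F. dir_deriv X b (\<lambda>y. \<Lambda> i (\<lambda>x. G x y)) (\<psi> i)) \<and> (\<forall>\<^sub>F i in F. Cm_le n X e (\<psi> i))"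
        using Suc.IH[OF B(2)] by (intro exI[of _ "\<lambda>i y. \<Lambda> i (\<lambda>x. B x y)"] conjI)
    qed
  }
qed

section \<open>Differentiable paths of measures\<close>

lemma perturbation_borel_prob:
  "perturbation X F N \<tau> M \<Longrightarrow> \<bar>t\<bar> < \<tau> \<Longrightarrow> borel_prob X (M t)"
  by (intro borel_prob_radon) (simp add: perturbation_def abs_less_iff)

lemma perturbation_DERIV:
  assumes "perturbation X F N \<tau> M" "\<bar>t\<bar> < \<tau>" "\<phi> \<in> F"
  shows "((\<lambda>s. \<integral>x. \<phi> x \<partial>M s) has_field_derivative path_deriv M t \<phi>) (at t)"
proof -
  have "t \<in> {-\<tau><..<\<tau>}" using assms(2) by auto
  then have "(\<lambda>s. \<integral>x. \<phi> x \<partial>M s) field_differentiable at t"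
    using assms(1,3) by (simp add: perturbation_def)
  then show ?thesis by (simp add: path_deriv_def DERIV_deriv_iff_field_differentiable)
qed

lemma perturbation_linear:
  assumes "perturbation X F N \<tau> M" "\<bar>t\<bar> < \<tau>" "\<phi> \<in> F" "\<psi> \<in> F"
  shows "path_deriv M t (\<lambda>x. a * \<phi> x + b * \<psi> x) = a * path_deriv M t \<phi> + b * path_deriv M t \<psi>"
proof -
  have "t \<in> {-\<tau><..<\<tau>}" using assms(2) by auto
  then show ?thesis using assms(1,3,4) unfolding perturbation_def by blast
qed

lemma perturbation_jointly_continuous:
  assumes "perturbation X F N \<tau> M" "\<tau> > 0" "\<phi> \<in> F" "e > 0"
  obtains d where "d > 0" "\<And>\<psi> s. \<psi> \<in> F \<Longrightarrow> N (\<lambda>x. \<psi> x - \<phi> x) < d \<Longrightarrow> \<bar>s\<bar> < d \<Longrightarrow>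
    \<bar>path_deriv M s \<psi> - path_deriv M 0 \<phi>\<bar> < e"
proof -
  have 0: "(0::real) \<in> {-\<tau><..<\<tau>}" using assms(2) by auto
  have "\<forall>\<phi>\<in>F. \<forall>t\<in>{-\<tau><..<\<tau>}. \<forall>e>0. \<exists>d>0. \<forall>\<psi>\<in>F. \<forall>s\<in>{-\<tau><..<\<tau>}.
        N (\<lambda>x. \<psi> x - \<phi> x) < d \<and> \<bar>s - t\<bar> < d \<longrightarrow> \<bar>path_deriv M s \<psi> - path_deriv M t \<phi>\<bar> < e"
    using assms(1) unfolding perturbation_def by (elim conjE)
  from bspec[OF bspec[OF this assms(3)] 0] assms(4)
  obtain d where d: "d > 0" "\<forall>\<psi>\<in>F. \<forall>s\<in>{-\<tau><..<\<tau>}.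
        N (\<lambda>x. \<psi> x - \<phi> x) < d \<and> \<bar>s - 0\<bar> < d \<longrightarrow> \<bar>path_deriv M s \<psi> - path_deriv M 0 \<phi>\<bar> < e"
    by (elim allE[of _ e]) auto
  show ?thesis
  proof (rule that[of "min d \<tau>"])
    show "min d \<tau> > 0" using d(1) assms(2) by simp
    fix \<psi> and s :: real assume "\<psi> \<in> F" "N (\<lambda>x. \<psi> x - \<phi> x) < min d \<tau>" "\<bar>s\<bar> < min d \<tau>"
    then show "\<bar>path_deriv M s \<psi> - path_deriv M 0 \<phi>\<bar> < e" using d(2) by (simp add: abs_less_iff)
  qed
qed

lemma path_deriv_cong:
  assumes "perturbation X F N \<tau> M" "\<bar>t\<bar> < \<tau>" "\<And>x. x \<in> X \<Longrightarrow> \<phi> x = \<psi> x"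
  shows "path_deriv M t \<phi> = path_deriv M t \<psi>"
  unfolding path_deriv_def
proof (rule deriv_cong_ev[OF _ refl])
  have "\<forall>\<^sub>F s in nhds t. s \<in> {-\<tau><..<\<tau>}" using assms(2) by (intro eventually_nhds_in_open) auto
  then show "\<forall>\<^sub>F s in nhds t. (\<integral>x. \<phi> x \<partial>M s) = (\<integral>x. \<psi> x \<partial>M s)"
  proof eventually_elim
    case (elim s)
    then have "borel_prob X (M s)" by (intro perturbation_borel_prob[OF assms(1)]) auto
    then show ?case by (rule borel_prob_cong) (rule assms(3))
  qed
qed

text \<open>For each \<open>y\<close> the mean value inequality in \<open>t\<close> reduces the
  claim to closeness of the path derivatives at \<open>s\<close> and at 0. Joint continuity gives it
  near one \<open>y\<close>, for all slices close in the norm, and a finite subcover of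
  \<open>X\<close> makes it uniform.\<close>

lemma uniform_path_derivative:
  fixes X :: "'a::metric_space set"
  assumes X: "compact X" and M: "perturbation X F N \<tau> M" and \<tau>: "\<tau> > 0"
    and h: "\<And>y. y \<in> X \<Longrightarrow> h y \<in> F"
    and cont: "\<And>e. e > 0 \<Longrightarrow> \<exists>d>0. \<forall>y\<in>X. \<forall>y'\<in>X. dist y y' < d \<longrightarrow> N (\<lambda>x. h y x - h y' x) < e"
    and N0: "N (\<lambda>x. 0) \<le> 0"
  shows "uniform_limit X (\<lambda>t y. ((\<integral>x. h y x \<partial>M t) - (\<integral>x. h y x \<partial>M 0)) / t) (\<lambda>y. path_deriv M 0 (h y)) (at 0)"
proof (rule uniform_limitI)
  fix e :: real assume e: "e > 0"
  have "\<exists>\<delta> d. \<delta> > 0 \<and> d > 0 \<and> (\<forall>y'\<in>X. \<forall>s. dist y y' < d \<longrightarrow> \<bar>s\<bar> < \<delta> \<longrightarrow>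
      \<bar>path_deriv M s (h y') - path_deriv M 0 (h y')\<bar> < e / 2)" if y: "y \<in> X" for y
  proof -
    obtain \<delta> where \<delta>: "\<delta> > 0" "\<And>\<psi> s. \<psi> \<in> F \<Longrightarrow> N (\<lambda>x. \<psi> x - h y x) < \<delta> \<Longrightarrow> \<bar>s\<bar> < \<delta> \<Longrightarrow>
      \<bar>path_deriv M s \<psi> - path_deriv M 0 (h y)\<bar> < e / 4"
      by (rule perturbation_jointly_continuous[OF M \<tau> h[OF y], of "e / 4"]) (use e in auto)
    obtain d where d: "d > 0" "\<forall>y\<in>X. \<forall>y'\<in>X. dist y y' < d \<longrightarrow> N (\<lambda>x. h y x - h y' x) < \<delta>"
      using cont[OF \<delta>(1)] by (elim exE conjE)
    have "\<bar>path_deriv M s (h y') - path_deriv M 0 (h y')\<bar> < e / 2"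
      if y': "y' \<in> X" "dist y y' < d" and s: "\<bar>s\<bar> < \<delta>" for y' s
    proof -
      have n: "N (\<lambda>x. h y' x - h y x) < \<delta>" using d(2) y y' by (simp add: dist_commute)
      have "\<bar>path_deriv M s (h y') - path_deriv M 0 (h y)\<bar> < e / 4" by (rule \<delta>(2)[OF h[OF y'(1)] n s])
      moreover have "\<bar>path_deriv M 0 (h y') - path_deriv M 0 (h y)\<bar> < e / 4"
        using \<delta>(2)[OF h[OF y'(1)] n, of 0] \<delta>(1) by simp
      ultimately show ?thesis by linarith
    qed
    then show ?thesis using \<delta>(1) d(1) by (intro exI[of _ \<delta>] exI[of _ d] conjI ballI allI impI)
  qed
  then obtain \<delta> d where *: "\<And>y. y \<in> X \<Longrightarrow> \<delta> y > 0 \<and> d y > 0 \<and> (\<forall>y'\<in>X. \<forall>s. dist y y' < d y \<longrightarrow> \<bar>s\<bar> < \<delta> y \<longrightarrow>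
      \<bar>path_deriv M s (h y') - path_deriv M 0 (h y')\<bar> < e / 2)" by metis
  have cov: "X \<subseteq> (\<Union>y\<in>X. ball y (d y))"
  proof
    fix y assume "y \<in> X" then show "y \<in> (\<Union>y\<in>X. ball y (d y))" using * by (intro UN_I[of y]) auto
  qed
  obtain k where k: "k \<subseteq> X" "finite k" "X \<subseteq> (\<Union>y\<in>k. ball y (d y))"
    by (rule compactE_image[OF X _ cov]) auto
  \<comment> \<open>The time \<tau> is inserted so that the path is defined on the whole segment
    used below; it also covers the case of an empty \<open>k\<close>.\<close>
  define r where "r = Min (insert \<tau> (\<delta> ` k))"
  have r: "r > 0" "r \<le> \<tau>" "\<And>y. y \<in> k \<Longrightarrow> r \<le> \<delta> y"
    using k(1,2) * \<tau> by (auto simp: r_def subset_iff)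
  have small: "\<bar>path_deriv M s (h y) - path_deriv M 0 (h y)\<bar> \<le> e / 2" if y: "y \<in> X" and s: "\<bar>s\<bar> < r" for y s
  proof -
    have "y \<in> (\<Union>y\<in>k. ball y (d y))" using k(3) y by (rule subsetD)
    then obtain z where z: "z \<in> k" "dist z y < d z" by auto
    have "\<bar>s\<bar> < \<delta> z" using s r(3)[OF z(1)] by simp
    then have "\<bar>path_deriv M s (h y) - path_deriv M 0 (h y)\<bar> < e / 2"
      using *[of z] z k(1) y by auto
    then show ?thesis by simp
  qed
  have "dist (((\<integral>x. h y x \<partial>M t) - (\<integral>x. h y x \<partial>M 0)) / t) (path_deriv M 0 (h y)) < e"
    if t: "t \<noteq> 0" "\<bar>t\<bar> < r" and y: "y \<in> X" for t y
  proof -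
    define I where "I s = (\<integral>x. h y x \<partial>M s)" for s
    have "norm ((I t - path_deriv M 0 (h y) * t) - (I 0 - path_deriv M 0 (h y) * 0)) \<le> e / 2 * norm (t - 0)"
    proof (rule field_differentiable_bound[where S="{-\<bar>t\<bar>..\<bar>t\<bar>}" and f="\<lambda>s. I s - path_deriv M 0 (h y) * s"
          and f'="\<lambda>s. path_deriv M s (h y) - path_deriv M 0 (h y)"])
      fix s assume "s \<in> {-\<bar>t\<bar>..\<bar>t\<bar>}"
      then have s: "\<bar>s\<bar> < r" using t(2) by auto
      then have "(I has_field_derivative path_deriv M s (h y)) (at s)"
        unfolding I_def using r(2) by (intro perturbation_DERIV[OF M _ h[OF y]]) simp
      from DERIV_diff[OF this DERIV_cmult_Id[of "path_deriv M 0 (h y)"]]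
      show "((\<lambda>s. I s - path_deriv M 0 (h y) * s) has_field_derivative
        path_deriv M s (h y) - path_deriv M 0 (h y)) (at s within {-\<bar>t\<bar>..\<bar>t\<bar>})"
        by (rule has_field_derivative_at_within)
      show "norm (path_deriv M s (h y) - path_deriv M 0 (h y)) \<le> e / 2" using small[OF y s] by simp
    qed auto
    then have b: "\<bar>I t - path_deriv M 0 (h y) * t - I 0\<bar> \<le> e / 2 * \<bar>t\<bar>" by simp
    have "(I t - I 0) / t - path_deriv M 0 (h y) = (I t - path_deriv M 0 (h y) * t - I 0) / t"
      using t(1) by (simp add: diff_divide_distrib)
    then have "\<bar>(I t - I 0) / t - path_deriv M 0 (h y)\<bar> \<le> e / 2"
      using b t(1) by (simp add: abs_divide pos_divide_le_eq)
    then show ?thesis using e by (simp add: I_def dist_real_def)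
  qed
  then show "\<forall>\<^sub>F t in at 0. \<forall>y\<in>X. dist (((\<integral>x. h y x \<partial>M t) - (\<integral>x. h y x \<partial>M 0)) / t) (path_deriv M 0 (h y)) < e"
    unfolding eventually_at using r(1) by (intro exI[of _ r] conjI ballI allI impI) simp_all
qed

section \<open>Uniform Taylor expansion of exponentials\<close>

lemma uniform_limit_cmult:
  fixes q :: "'i \<Rightarrow> 'a \<Rightarrow> real"
  assumes "uniform_limit A q q0 F" "\<And>x. x \<in> A \<Longrightarrow> \<bar>g x\<bar> \<le> B"
  shows "uniform_limit A (\<lambda>t x. g x * q t x) (\<lambda>x. g x * q0 x) F"
proof (rule uniform_limitI)
  fix e :: real assume e: "e > 0"
  have p: "\<bar>B\<bar> + 1 > 0" by simp
  have "\<forall>\<^sub>F t in F. \<forall>x\<in>A. dist (q t x) (q0 x) < e / (\<bar>B\<bar> + 1)"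
    using uniform_limitD[OF assms(1), of "e / (\<bar>B\<bar> + 1)"] e p by simp
  then show "\<forall>\<^sub>F t in F. \<forall>x\<in>A. dist (g x * q t x) (g x * q0 x) < e"
  proof eventually_elim
    case (elim t)
    show ?case
    proof
      fix x assume x: "x \<in> A"
      have "dist (g x * q t x) (g x * q0 x) = \<bar>g x\<bar> * dist (q t x) (q0 x)"
        by (simp add: dist_real_def abs_mult flip: right_diff_distrib)
      also have "\<dots> \<le> (\<bar>B\<bar> + 1) * dist (q t x) (q0 x)" using assms(2)[OF x] by (intro mult_right_mono) auto
      also have "\<dots> < e" using elim x p by (simp add: pos_less_divide_eq mult.commute)
      finally show "dist (g x * q t x) (g x * q0 x) < e" .
    qed
  qed
qed

lemma exp_remainders:
  fixes x :: real
  assumes "\<bar>x\<bar> \<le> 1"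
  shows "\<bar>exp x - 1 - x\<bar> \<le> 3 * \<bar>x\<bar>\<^sup>2" "\<bar>exp x - 1 - x - x\<^sup>2 / 2\<bar> \<le> 3 * \<bar>x\<bar> ^ 3"
proof -
  have b: "exp t \<le> 3" if "\<bar>t\<bar> \<le> \<bar>x\<bar>" for t
  proof -
    have "exp t \<le> exp 1" using that assms by simp
    also have "\<dots> \<le> 3" using exp_le by simp
    finally show ?thesis .
  qed
  obtain t where t: "\<bar>t\<bar> \<le> \<bar>x\<bar>" "exp x = (\<Sum>m<2. x ^ m / fact m) + exp t / fact 2 * x ^ 2"
    using Maclaurin_exp_le[of x 2] by blast
  have "exp x - 1 - x = exp t / 2 * x\<^sup>2" using t(2) by (simp add: numeral_2_eq_2)
  then have "\<bar>exp x - 1 - x\<bar> = \<bar>exp t / 2 * x\<^sup>2\<bar>" by (simp only:)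
  also have "\<dots> = exp t / 2 * \<bar>x\<bar>\<^sup>2" by (simp add: abs_mult)
  also have "\<dots> \<le> 3 * \<bar>x\<bar>\<^sup>2" using b[OF t(1)] by (intro mult_right_mono) auto
  finally show "\<bar>exp x - 1 - x\<bar> \<le> 3 * \<bar>x\<bar>\<^sup>2" .
  obtain s where s: "\<bar>s\<bar> \<le> \<bar>x\<bar>" "exp x = (\<Sum>m<3. x ^ m / fact m) + exp s / fact 3 * x ^ 3"
    using Maclaurin_exp_le[of x 3] by blast
  have "exp x - 1 - x - x\<^sup>2 / 2 = exp s / 6 * x ^ 3"
    using s(2) by (simp add: numeral_3_eq_3 fact_numeral numeral_2_eq_2)
  then have "\<bar>exp x - 1 - x - x\<^sup>2 / 2\<bar> = \<bar>exp s / 6 * x ^ 3\<bar>" by (simp only:)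
  also have "\<dots> = exp s / 6 * \<bar>x\<bar> ^ 3" by (simp add: abs_mult power_abs)
  also have "\<dots> \<le> 3 * \<bar>x\<bar> ^ 3" using b[OF s(1)] by (intro mult_right_mono) auto
  finally show "\<bar>exp x - 1 - x - x\<^sup>2 / 2\<bar> \<le> 3 * \<bar>x\<bar> ^ 3" .
qed

lemma uniform_limit_exp_quotients:
  fixes z :: "'a \<Rightarrow> real"
  assumes z: "\<And>p. p \<in> A \<Longrightarrow> \<bar>z p\<bar> \<le> B"
  shows "uniform_limit A (\<lambda>t p. (exp (t * z p) - 1) / t) z (at 0)"
    and "uniform_limit A (\<lambda>t p. (exp (t * z p) - 1 - t * z p) / t\<^sup>2) (\<lambda>p. (z p)\<^sup>2 / 2) (at 0)"
proof -
  define C where "C = \<bar>B\<bar> + 1"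
  have C: "C \<ge> 1" "\<And>p. p \<in> A \<Longrightarrow> \<bar>z p\<bar> \<le> C" using z by (force simp: C_def)+
  have ev: "\<forall>\<^sub>F t in at 0. t \<noteq> 0 \<and> \<bar>t\<bar> < d" if "d > 0" for d :: real
    unfolding eventually_at using that by (intro exI[of _ d]) auto
  show "uniform_limit A (\<lambda>t p. (exp (t * z p) - 1) / t) z (at 0)"
  proof (rule uniform_limitI)
    fix e :: real assume e: "e > 0"
    \<comment> \<open>The first entry brings the exponent into the range of
      \<open>exp_remainders\<close>; the second makes the remainder, after division by
      \<open>t\<close>, smaller than \<open>e\<close>.\<close>
    define d where "d = min (1 / C) (e / (3 * C\<^sup>2))"
    have d: "d > 0" using C(1) e by (simp add: d_def)
    show "\<forall>\<^sub>F t in at 0. \<forall>p\<in>A. dist ((exp (t * z p) - 1) / t) (z p) < e"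
      using ev[OF d]
    proof eventually_elim
      case (elim t)
      show ?case
      proof
        fix p assume p: "p \<in> A"
        have 1: "\<bar>t * z p\<bar> \<le> \<bar>t\<bar> * C" unfolding abs_mult using C(2)[OF p] by (intro mult_left_mono) auto
        also have "\<dots> < 1" using elim C(1) by (simp add: d_def pos_less_divide_eq)
        finally have "\<bar>exp (t * z p) - 1 - t * z p\<bar> \<le> 3 * \<bar>t * z p\<bar>\<^sup>2" by (intro exp_remainders(1)) simp
        also have "\<dots> \<le> 3 * (\<bar>t\<bar> * C)\<^sup>2" using 1 by (intro mult_left_mono power_mono) auto
        also have "\<dots> = \<bar>t\<bar> * (\<bar>t\<bar> * (3 * C\<^sup>2))" by (simp add: power2_eq_square)
        also have "\<dots> < \<bar>t\<bar> * e"
          using elim C(1) by (intro mult_strict_left_mono) (simp_all add: d_def pos_less_divide_eq)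
        finally have "\<bar>(exp (t * z p) - 1 - t * z p) / t\<bar> < e"
          using elim by (simp add: abs_divide pos_divide_less_eq mult.commute)
        moreover have "(exp (t * z p) - 1) / t - z p = (exp (t * z p) - 1 - t * z p) / t"
          using elim by (simp add: diff_divide_distrib)
        ultimately show "dist ((exp (t * z p) - 1) / t) (z p) < e" by (simp only: dist_real_def)
      qed
    qed
  qed
  show "uniform_limit A (\<lambda>t p. (exp (t * z p) - 1 - t * z p) / t\<^sup>2) (\<lambda>p. (z p)\<^sup>2 / 2) (at 0)"
  proof (rule uniform_limitI)
    fix e :: real assume e: "e > 0"
    define d where "d = min (1 / C) (e / (3 * C ^ 3))"
    have d: "d > 0" using C(1) e by (simp add: d_def)
    show "\<forall>\<^sub>F t in at 0. \<forall>p\<in>A. dist ((exp (t * z p) - 1 - t * z p) / t\<^sup>2) ((z p)\<^sup>2 / 2) < e"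
      using ev[OF d]
    proof eventually_elim
      case (elim t)
      show ?case
      proof
        fix p assume p: "p \<in> A"
        have 1: "\<bar>t * z p\<bar> \<le> \<bar>t\<bar> * C" unfolding abs_mult using C(2)[OF p] by (intro mult_left_mono) auto
        also have "\<dots> < 1" using elim C(1) by (simp add: d_def pos_less_divide_eq)
        finally have "\<bar>exp (t * z p) - 1 - t * z p - (t * z p)\<^sup>2 / 2\<bar> \<le> 3 * \<bar>t * z p\<bar> ^ 3" by (intro exp_remainders(2)) simp
        also have "\<dots> \<le> 3 * (\<bar>t\<bar> * C) ^ 3" using 1 by (intro mult_left_mono power_mono) auto
        also have "\<dots> = t\<^sup>2 * (\<bar>t\<bar> * (3 * C ^ 3))" by (simp add: power2_eq_square power3_eq_cube)
        also have "\<dots> < t\<^sup>2 * e"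
          using elim C(1) by (intro mult_strict_left_mono) (simp_all add: d_def pos_less_divide_eq)
        finally have "\<bar>(exp (t * z p) - 1 - t * z p - (t * z p)\<^sup>2 / 2) / t\<^sup>2\<bar> < e"
          using elim by (simp add: abs_divide pos_divide_less_eq mult.commute)
        moreover have "(exp (t * z p) - 1 - t * z p) / t\<^sup>2 - (z p)\<^sup>2 / 2 = (exp (t * z p) - 1 - t * z p - (t * z p)\<^sup>2 / 2) / t\<^sup>2"
          using elim by (simp add: diff_divide_distrib power_mult_distrib)
        ultimately show "dist ((exp (t * z p) - 1 - t * z p) / t\<^sup>2) ((z p)\<^sup>2 / 2) < e" by (simp only: dist_real_def)
      qed
    qed
  qed
qed

text \<open>
  \<open>S\<close> and \<open>GG\<close> play the roles of \<open>C^m(X)\<close> and \<open>C^(m,m)(X \<times> X)\<close>.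
\<close>

locale sinkhorn_path =
  fixes X :: "'a::metric_space set" and F :: "('a \<Rightarrow> real) set" and N :: "('a \<Rightarrow> real) \<Rightarrow> real"
    and \<tau> :: real and M :: "real \<Rightarrow> 'a measure"
    and S :: "('a \<Rightarrow> real) set" and GG :: "('a \<Rightarrow> 'a \<Rightarrow> real) set"
    and k :: "'a \<Rightarrow> 'a \<Rightarrow> real" and c :: "'a \<Rightarrow> 'a \<Rightarrow> real" and f :: "'a \<Rightarrow> real" and \<epsilon> :: real
  assumes X: "compact X" and path: "perturbation X F N \<tau> M" and \<tau>: "\<tau> > 0" and N0: "N (\<lambda>x. 0) \<le> 0"
    and SF: "S \<subseteq> F" and F_cont: "\<And>\<phi>. \<phi> \<in> F \<Longrightarrow> continuous_on X \<phi>"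
    and S_const: "\<And>r. (\<lambda>x. r) \<in> S"
    and S_add: "\<And>\<phi> \<psi>. \<phi> \<in> S \<Longrightarrow> \<psi> \<in> S \<Longrightarrow> (\<lambda>x. \<phi> x + \<psi> x) \<in> S"
    and S_mult: "\<And>\<phi> \<psi>. \<phi> \<in> S \<Longrightarrow> \<psi> \<in> S \<Longrightarrow> (\<lambda>x. \<phi> x * \<psi> x) \<in> S"
    and GG_cont: "\<And>G. G \<in> GG \<Longrightarrow> continuous_on (X \<times> X) (\<lambda>(x, y). G x y)"
    and GG_add: "\<And>G H. G \<in> GG \<Longrightarrow> H \<in> GG \<Longrightarrow> (\<lambda>x y. G x y + H x y) \<in> GG"
    and GG_mult: "\<And>G H. G \<in> GG \<Longrightarrow> H \<in> GG \<Longrightarrow> (\<lambda>x y. G x y * H x y) \<in> GG"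
    and GG_swap: "\<And>G. G \<in> GG \<Longrightarrow> (\<lambda>x y. G y x) \<in> GG"
    and GG_lift: "\<And>\<phi>. \<phi> \<in> S \<Longrightarrow> (\<lambda>x y. \<phi> x) \<in> GG"
    and GG_slice: "\<And>G y. G \<in> GG \<Longrightarrow> y \<in> X \<Longrightarrow> (\<lambda>x. G x y) \<in> S"
    and GG_slices: "\<And>G e. G \<in> GG \<Longrightarrow> e > 0 \<Longrightarrow>
      \<exists>d>0. \<forall>y\<in>X. \<forall>y'\<in>X. dist y y' < d \<longrightarrow> N (\<lambda>x. G x y - G x y') < e"
    and GG_integral: "\<And>G P \<phi>. G \<in> GG \<Longrightarrow> borel_prob X P \<Longrightarrow> continuous_on X \<phi> \<Longrightarrow> (\<lambda>y. \<integral>x. \<phi> x * G x y \<partial>P) \<in> S"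
    and GG_deriv: "\<And>G. G \<in> GG \<Longrightarrow> (\<lambda>y. path_deriv M 0 (\<lambda>x. G x y)) \<in> S"
    and GG_deriv_lim: "\<And>G e. G \<in> GG \<Longrightarrow> e > 0 \<Longrightarrow> \<forall>\<^sub>F t in at 0.
      N (\<lambda>y. ((\<integral>x. G x y \<partial>M t) - (\<integral>x. G x y \<partial>M 0)) / t - path_deriv M 0 (\<lambda>x. G x y)) < e"
    and k: "k \<in> GG" and k_sym: "\<And>x y. x \<in> X \<Longrightarrow> y \<in> X \<Longrightarrow> k x y = k y x"
    and k_int: "\<And>y. y \<in> X \<Longrightarrow> (\<integral>x. k x y \<partial>M 0) = 1"
    and \<epsilon>: "\<epsilon> > 0" and c: "continuous_on (X \<times> X) (\<lambda>(x, y). c x y)" and f: "continuous_on X f"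
    and k_eq: "k = (\<lambda>x y. exp ((f x + f y - c x y) / \<epsilon>))"
begin

abbreviation \<mu> where "\<mu> \<equiv> M 0"
abbreviation L where "L \<equiv> path_deriv M 0"

definition K where "K \<phi> y = (\<integral>x. \<phi> x * k x y \<partial>\<mu>)"
definition HL where "HL y = L (\<lambda>x. k x y)"

lemma M_prob: "\<bar>t\<bar> < \<tau> \<Longrightarrow> borel_prob X (M t)" by (rule perturbation_borel_prob[OF path])
lemma mu_prob: "borel_prob X \<mu>" using M_prob[of 0] \<tau> by simp

lemma S_cont: "\<phi> \<in> S \<Longrightarrow> continuous_on X \<phi>" using SF F_cont by blast

lemma S_scale: "\<phi> \<in> S \<Longrightarrow> (\<lambda>x. r * \<phi> x) \<in> S" by (rule S_mult[OF S_const])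
lemma S_diff: "\<phi> \<in> S \<Longrightarrow> \<psi> \<in> S \<Longrightarrow> (\<lambda>x. \<phi> x - \<psi> x) \<in> S"
  using S_add[OF _ S_scale[of \<psi> "-1"]] by simp

lemma GG_lift2: "\<phi> \<in> S \<Longrightarrow> (\<lambda>x y. \<phi> y) \<in> GG" using GG_swap[OF GG_lift] .

lemma kc: "continuous_on (X \<times> X) (\<lambda>(x, y). k x y)" by (rule GG_cont[OF k])

lemma ev_small: "d > 0 \<Longrightarrow> \<forall>\<^sub>F t in at 0. t \<noteq> 0 \<and> \<bar>t\<bar> < (d::real)"
  unfolding eventually_at by (intro exI[of _ d]) auto

lemma ev_prob: "\<forall>\<^sub>F t in at 0. t \<noteq> 0 \<and> borel_prob X (M t)"
  using ev_small[OF \<tau>] by eventually_elim (simp add: M_prob)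

lemma K_S: "continuous_on X \<phi> \<Longrightarrow> K \<phi> \<in> S"
  unfolding K_def[abs_def] by (rule GG_integral[OF k mu_prob])

lemma HL_S: "HL \<in> S" unfolding HL_def[abs_def] by (rule GG_deriv[OF k])

lemma L_linear: "\<phi> \<in> S \<Longrightarrow> \<psi> \<in> S \<Longrightarrow> L (\<lambda>x. a * \<phi> x + b * \<psi> x) = a * L \<phi> + b * L \<psi>"
  using \<tau> SF by (intro perturbation_linear[OF path]) auto

lemma L_cong: "(\<And>x. x \<in> X \<Longrightarrow> \<phi> x = \<psi> x) \<Longrightarrow> L \<phi> = L \<psi>"
  using \<tau> by (intro path_deriv_cong[OF path]) auto

lemma uniform_deriv:
  assumes "G \<in> GG"
  shows "uniform_limit X (\<lambda>t y. ((\<integral>x. G x y \<partial>M t) - (\<integral>x. G x y \<partial>\<mu>)) / t) (\<lambda>y. L (\<lambda>x. G x y)) (at 0)"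
  by (rule uniform_path_derivative[OF X path \<tau> _ GG_slices[OF assms] N0])
    (use GG_slice[OF assms] SF in auto)

lemma deriv_lim: "\<phi> \<in> F \<Longrightarrow> ((\<lambda>t. ((\<integral>x. \<phi> x \<partial>M t) - (\<integral>x. \<phi> x \<partial>\<mu>)) / t) \<longlongrightarrow> L \<phi>) (at 0)"
  using perturbation_DERIV[OF path, of 0 \<phi>] \<tau> by (simp add: DERIV_def)

lemma weak_lim: "\<phi> \<in> F \<Longrightarrow> ((\<lambda>t. \<integral>x. \<phi> x \<partial>M t) \<longlongrightarrow> (\<integral>x. \<phi> x \<partial>\<mu>)) (at 0)"
  using DERIV_isCont[OF perturbation_DERIV[OF path, of 0 \<phi>]] \<tau> by (simp add: isCont_def)

text \<open>The difference quotients converge uniformly to a bounded function, so the differences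
  themselves are of order \<open>t\<close>.\<close>

lemma uniform_weak:
  assumes G: "G \<in> GG"
  shows "uniform_limit X (\<lambda>t y. \<integral>x. G x y \<partial>M t) (\<lambda>y. \<integral>x. G x y \<partial>\<mu>) (at 0)"
proof (rule uniform_limitI)
  fix e :: real assume e: "e > 0"
  obtain B where B: "B > 0" "\<And>y. y \<in> X \<Longrightarrow> \<bar>L (\<lambda>x. G x y)\<bar> \<le> B"
    using compact_continuous_bound[OF X S_cont[OF GG_deriv[OF G]]] by blast
  define d where "d = e / (B + 1)"
  have d: "d > 0" using B e by (simp add: d_def)
  have "\<forall>\<^sub>F t in at 0. \<forall>y\<in>X. dist (((\<integral>x. G x y \<partial>M t) - (\<integral>x. G x y \<partial>\<mu>)) / t) (L (\<lambda>x. G x y)) < 1"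
    by (rule uniform_limitD[OF uniform_deriv[OF G]]) simp
  then show "\<forall>\<^sub>F t in at 0. \<forall>y\<in>X. dist (\<integral>x. G x y \<partial>M t) (\<integral>x. G x y \<partial>\<mu>) < e"
    using ev_small[OF d]
  proof eventually_elim
    case (elim t)
    show ?case
    proof
      fix y assume y: "y \<in> X"
      have "\<bar>((\<integral>x. G x y \<partial>M t) - (\<integral>x. G x y \<partial>\<mu>)) / t\<bar> \<le> B + 1"
        using elim(1) B(2)[OF y] y by (force simp: dist_real_def)
      then have "\<bar>(\<integral>x. G x y \<partial>M t) - (\<integral>x. G x y \<partial>\<mu>)\<bar> \<le> (B + 1) * \<bar>t\<bar>"
        using elim(2) by (simp add: abs_divide pos_divide_le_eq)
      also have "\<dots> < e" using elim(2) B(1) by (simp add: d_def pos_less_divide_eq mult.commute)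
      finally show "dist (\<integral>x. G x y \<partial>M t) (\<integral>x. G x y \<partial>\<mu>) < e" by (simp add: dist_real_def)
    qed
  qed
qed

text \<open>In the transport problem between \<open>\<mu>\<close> and \<open>M t\<close> one marginal stays fixed; this predicate
  covers both marginals.\<close>

definition marginal :: "(real \<Rightarrow> 'a measure) \<Rightarrow> bool" where
  "marginal \<alpha> \<longleftrightarrow> \<alpha> = M \<or> \<alpha> = (\<lambda>t. \<mu>)"

lemma marginal_prob: "marginal \<alpha> \<Longrightarrow> \<forall>\<^sub>F t in at 0. t \<noteq> 0 \<and> borel_prob X (\<alpha> t)"
  using ev_prob by (auto simp: marginal_def mu_prob eventually_mono elim!: eventually_mono)

lemma marginal_weak: "marginal \<alpha> \<Longrightarrow> \<phi> \<in> F \<Longrightarrow> ((\<lambda>t. \<integral>x. \<phi> x \<partial>\<alpha> t) \<longlongrightarrow> (\<integral>x. \<phi> x \<partial>\<mu>)) (at 0)"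
  unfolding marginal_def using weak_lim by auto

lemma marginal_uniform_weak: "marginal \<alpha> \<Longrightarrow> G \<in> GG \<Longrightarrow>
  uniform_limit X (\<lambda>t y. \<integral>x. G x y \<partial>\<alpha> t) (\<lambda>y. \<integral>x. G x y \<partial>\<mu>) (at 0)"
  unfolding marginal_def using uniform_weak uniform_limit_const by auto

text \<open>Integrand and measure move together. The error of the integrand is uniformly small under
  any probability measure, which leaves a fixed test function under a weakly converging
  measure.\<close>

lemma integral_uniform_lim:
  assumes \<alpha>: "marginal \<alpha>" and q: "uniform_limit X q q0 (at 0)" and q0: "q0 \<in> S"
    and c: "\<forall>\<^sub>F t in at 0. continuous_on X (q t)"
  shows "((\<lambda>t. \<integral>x. q t x \<partial>\<alpha> t) \<longlongrightarrow> (\<integral>x. q0 x \<partial>\<mu>)) (at 0)"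
proof -
  have "((\<lambda>t. (\<integral>x. q t x \<partial>\<alpha> t) - (\<integral>x. q0 x \<partial>\<alpha> t)) \<longlongrightarrow> 0) (at 0)"
  proof (rule tendstoI)
    fix e :: real assume e: "e > 0"
    have "\<forall>\<^sub>F t in at 0. \<forall>x\<in>X. dist (q t x) (q0 x) < e / 2" using uniform_limitD[OF q, of "e/2"] e by simp
    then show "\<forall>\<^sub>F t in at 0. dist ((\<integral>x. q t x \<partial>\<alpha> t) - (\<integral>x. q0 x \<partial>\<alpha> t)) 0 < e"
      using c marginal_prob[OF \<alpha>]
    proof eventually_elim
      case (elim t)
      note P = conjunct2[OF elim(3)]
      have "\<bar>\<integral>x. q t x - q0 x \<partial>\<alpha> t\<bar> \<le> e / 2"
        by (rule borel_prob_integral_bounds(3)[OF X P continuous_on_diff[OF elim(2) S_cont[OF q0]]])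
          (use elim(1) in \<open>auto simp: dist_real_def intro: less_imp_le\<close>)
      then show ?case using e borel_prob_integrable[OF X P elim(2)] borel_prob_integrable[OF X P S_cont[OF q0]]
        by simp
    qed
  qed
  moreover have "((\<lambda>t. \<integral>x. q0 x \<partial>\<alpha> t) \<longlongrightarrow> (\<integral>x. q0 x \<partial>\<mu>)) (at 0)"
    using marginal_weak[OF \<alpha>] q0 SF by auto
  ultimately have "((\<lambda>t. ((\<integral>x. q t x \<partial>\<alpha> t) - (\<integral>x. q0 x \<partial>\<alpha> t)) + (\<integral>x. q0 x \<partial>\<alpha> t)) \<longlongrightarrow> 0 + (\<integral>x. q0 x \<partial>\<mu>)) (at 0)"
    by (rule tendsto_add)
  then show ?thesis by simp
qed

lemma integral_uniform_lim_param:
  assumes \<alpha>: "marginal \<alpha>" and Q: "uniform_limit (X \<times> X) (\<lambda>t (x, y). Q t x y) (\<lambda>(x, y). G x y) (at 0)" and G: "G \<in> GG"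
    and c: "\<And>t. continuous_on (X \<times> X) (\<lambda>(x, y). Q t x y)"
  shows "uniform_limit X (\<lambda>t y. \<integral>x. Q t x y \<partial>\<alpha> t) (\<lambda>y. \<integral>x. G x y \<partial>\<mu>) (at 0)"
proof -
  have "uniform_limit X (\<lambda>t y. (\<integral>x. Q t x y \<partial>\<alpha> t) - (\<integral>x. G x y \<partial>\<alpha> t)) (\<lambda>y. 0) (at 0)"
  proof (rule uniform_limitI)
    fix e :: real assume e: "e > 0"
    have "\<forall>\<^sub>F t in at 0. \<forall>z\<in>X\<times>X. dist (case z of (x, y) \<Rightarrow> Q t x y) (case z of (x, y) \<Rightarrow> G x y) < e / 2"
      using uniform_limitD[OF Q, of "e/2"] e by simp
    then show "\<forall>\<^sub>F t in at 0. \<forall>y\<in>X. dist ((\<integral>x. Q t x y \<partial>\<alpha> t) - (\<integral>x. G x y \<partial>\<alpha> t)) 0 < e"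
      using marginal_prob[OF \<alpha>]
    proof eventually_elim
      case (elim t)
      note P = conjunct2[OF elim(2)]
      show ?case
      proof
        fix y assume y: "y \<in> X"
        note cc = continuous_on_slice1[OF c[of t] y] continuous_on_slice1[OF GG_cont[OF G] y]
        have "\<bar>\<integral>x. Q t x y - G x y \<partial>\<alpha> t\<bar> \<le> e / 2"
          by (rule borel_prob_integral_bounds(3)[OF X P continuous_on_diff[OF cc]])
            (use elim(1) y in \<open>auto simp: dist_real_def intro: less_imp_le\<close>)
        then show "dist ((\<integral>x. Q t x y \<partial>\<alpha> t) - (\<integral>x. G x y \<partial>\<alpha> t)) 0 < e"
          using e borel_prob_integrable[OF X P cc(1)] borel_prob_integrable[OF X P cc(2)] by simp
      qed
    qed
  qed
  from uniform_limit_add[OF this marginal_uniform_weak[OF \<alpha> G]] show ?thesis by simp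
qed

lemma double_integral_uniform_lim:
  assumes \<alpha>: "marginal \<alpha>" and \<beta>: "marginal \<beta>"
    and Q: "uniform_limit (X \<times> X) (\<lambda>t (x, y). Q t x y) (\<lambda>(x, y). G x y) (at 0)" and G: "G \<in> GG"
    and c: "\<And>t. continuous_on (X \<times> X) (\<lambda>(x, y). Q t x y)"
  shows "((\<lambda>t. \<integral>y. \<integral>x. Q t x y \<partial>\<alpha> t \<partial>\<beta> t) \<longlongrightarrow> (\<integral>y. \<integral>x. G x y \<partial>\<mu> \<partial>\<mu>)) (at 0)"
proof (rule integral_uniform_lim[OF \<beta> integral_uniform_lim_param[OF \<alpha> Q G c]])
  show "(\<lambda>y. \<integral>x. G x y \<partial>\<mu>) \<in> S"
    using GG_integral[OF G mu_prob continuous_on_const, of 1] by simp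
  show "\<forall>\<^sub>F t in at 0. continuous_on X (\<lambda>y. \<integral>x. Q t x y \<partial>\<alpha> t)"
    using marginal_prob[OF \<alpha>] by eventually_elim (rule continuous_on_integral_param[OF X _ c], simp)
qed

text \<open>Before the limit this is Fubini with the symmetry of \<open>k\<close>: the kernel
  quotient integrated against \<phi> is the difference quotient of \<open>K \<phi>\<close> along the
  path. Uniform convergence carries the limit through the integral. The lemma turns inner products
  with \<open>HL\<close> into values of \<open>L\<close>.\<close>

lemma pairing:
  assumes \<phi>: "continuous_on X \<phi>"
  shows "(\<integral>y. \<phi> y * HL y \<partial>\<mu>) = L (K \<phi>)"
proof -
  define q where "q t y = ((\<integral>x. k x y \<partial>M t) - (\<integral>x. k x y \<partial>\<mu>)) / t" for t y
  obtain B where B: "B > 0" "\<And>x. x \<in> X \<Longrightarrow> \<bar>\<phi> x\<bar> \<le> B" using compact_continuous_bound[OF X \<phi>] by blast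
  have u: "uniform_limit X (\<lambda>t y. \<phi> y * q t y) (\<lambda>y. \<phi> y * HL y) (at 0)"
    using uniform_limit_cmult[OF uniform_deriv[OF k] B(2)] by (simp add: q_def HL_def)
  have cq: "continuous_on X (q t)" if "borel_prob X (M t)" for t
    unfolding q_def divide_inverse
    by (intro continuous_on_mult continuous_on_diff continuous_on_const continuous_on_integral_param[OF X that kc]
        continuous_on_integral_param[OF X mu_prob kc])
  have chl: "continuous_on X (\<lambda>y. \<phi> y * HL y)" by (intro continuous_on_mult \<phi> S_cont HL_S)
  have "((\<lambda>t. \<integral>y. \<phi> y * q t y \<partial>\<mu>) \<longlongrightarrow> (\<integral>y. \<phi> y * HL y \<partial>\<mu>)) (at 0)"
  proof (rule tendstoI)
    fix e :: real assume e: "e > 0"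
    have "\<forall>\<^sub>F t in at 0. \<forall>x\<in>X. dist (\<phi> x * q t x) (\<phi> x * HL x) < e / 2" using uniform_limitD[OF u, of "e/2"] e by simp
    then show "\<forall>\<^sub>F t in at 0. dist (\<integral>y. \<phi> y * q t y \<partial>\<mu>) (\<integral>y. \<phi> y * HL y \<partial>\<mu>) < e"
      using ev_prob
    proof eventually_elim
      case (elim t)
      have cc: "continuous_on X (\<lambda>y. \<phi> y * q t y)" using elim(2) by (intro continuous_on_mult \<phi> cq) simp
      have "\<bar>\<integral>x. \<phi> x * q t x - \<phi> x * HL x \<partial>\<mu>\<bar> \<le> e / 2"
        by (rule borel_prob_integral_bounds(3)[OF X mu_prob continuous_on_diff[OF cc chl]])
          (use elim(1) in \<open>auto simp: dist_real_def intro: less_imp_le\<close>)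
      then show ?case using e borel_prob_integrable[OF X mu_prob cc] borel_prob_integrable[OF X mu_prob chl]
        by (simp add: dist_real_def)
    qed
  qed
  moreover have "\<forall>\<^sub>F t in at 0. (\<integral>y. \<phi> y * q t y \<partial>\<mu>) = ((\<integral>x. K \<phi> x \<partial>M t) - (\<integral>x. K \<phi> x \<partial>\<mu>)) / t"
    using ev_prob
  proof eventually_elim
    case (elim t)
    then have P: "borel_prob X (M t)" by simp
    have G: "continuous_on (X \<times> X) (\<lambda>(x, y). \<phi> y * k x y)"
      using continuous_on_snd2[OF \<phi>, of X] kc unfolding case_prod_unfold by (intro continuous_on_mult)
    have *: "(\<integral>y. \<phi> y * (\<integral>x. k x y \<partial>P) \<partial>\<mu>) = (\<integral>x. K \<phi> x \<partial>P)" if P: "borel_prob X P" for P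
    proof -
      have "(\<integral>y. \<phi> y * (\<integral>x. k x y \<partial>P) \<partial>\<mu>) = (\<integral>y. \<integral>x. \<phi> y * k x y \<partial>P \<partial>\<mu>)" by simp
      also have "\<dots> = (\<integral>x. \<integral>y. \<phi> y * k x y \<partial>\<mu> \<partial>P)" by (rule borel_prob_Fubini(2)[OF X P mu_prob G])
      also have "\<dots> = (\<integral>x. K \<phi> x \<partial>P)"
      proof (rule borel_prob_cong[OF P])
        fix x assume x: "x \<in> X"
        show "(\<integral>y. \<phi> y * k x y \<partial>\<mu>) = K \<phi> x" unfolding K_def
          by (rule borel_prob_cong[OF mu_prob]) (simp add: k_sym x)
      qed
      finally show ?thesis .
    qed
    have i: "integrable \<mu> (\<lambda>y. \<phi> y * (\<integral>x. k x y \<partial>P))" if "borel_prob X P" for P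
      by (rule borel_prob_integrable[OF X mu_prob continuous_on_mult[OF \<phi> continuous_on_integral_param[OF X that kc]]])
    have "(\<integral>y. \<phi> y * q t y \<partial>\<mu>) = (\<integral>y. (\<phi> y * (\<integral>x. k x y \<partial>M t) - \<phi> y * (\<integral>x. k x y \<partial>\<mu>)) / t \<partial>\<mu>)"
      by (simp add: q_def right_diff_distrib)
    also have "\<dots> = ((\<integral>y. \<phi> y * (\<integral>x. k x y \<partial>M t) \<partial>\<mu>) - (\<integral>y. \<phi> y * (\<integral>x. k x y \<partial>\<mu>) \<partial>\<mu>)) / t"
      using i[OF P] i[OF mu_prob] by simp
    finally show ?case unfolding *[OF P] *[OF mu_prob] .
  qed
  ultimately have "((\<lambda>t. ((\<integral>x. K \<phi> x \<partial>M t) - (\<integral>x. K \<phi> x \<partial>\<mu>)) / t) \<longlongrightarrow> (\<integral>y. \<phi> y * HL y \<partial>\<mu>)) (at 0)"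
    by (rule Lim_transform_eventually)
  moreover have "((\<lambda>t. ((\<integral>x. K \<phi> x \<partial>M t) - (\<integral>x. K \<phi> x \<partial>\<mu>)) / t) \<longlongrightarrow> L (K \<phi>)) (at 0)"
    using deriv_lim K_S[OF \<phi>] SF by blast
  ultimately show ?thesis by (rule tendsto_unique[rotated]) simp
qed

lemma L_const: "L (\<lambda>x. r) = 0"
proof -
  have "((\<lambda>t. ((\<integral>x. r \<partial>M t) - (\<integral>x. r \<partial>\<mu>)) / t) \<longlongrightarrow> L (\<lambda>x. r)) (at 0)"
    using deriv_lim S_const SF by blast
  moreover have "\<forall>\<^sub>F t in at 0. ((\<integral>x. r \<partial>M t) - (\<integral>x. r \<partial>\<mu>)) / t = 0"
    using ev_prob
  proof eventually_elim
    case (elim t)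
    then show ?case using borel_prob_prob_space[of X "M t"] borel_prob_prob_space[OF mu_prob]
      by (simp add: prob_space.prob_space)
  qed
  ultimately have "((\<lambda>t::real. 0::real) \<longlongrightarrow> L (\<lambda>x. r)) (at 0)" by (rule Lim_transform_eventually)
  then show ?thesis by (simp add: tendsto_const_iff)
qed

text \<open>Self-adjointness of \<open>K\<close> for the inner product of square integrable
  functions, from Fubini and the symmetry of \<open>k\<close>.\<close>

lemma K_symmetric:
  assumes \<phi>: "continuous_on X \<phi>" and \<psi>: "continuous_on X \<psi>"
  shows "(\<integral>y. \<psi> y * K \<phi> y \<partial>\<mu>) = (\<integral>y. \<phi> y * K \<psi> y \<partial>\<mu>)"
proof -
  have G: "continuous_on (X \<times> X) (\<lambda>(x, y). \<psi> y * (\<phi> x * k x y))"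
    using continuous_on_snd2[OF \<psi>, of X] continuous_on_fst2[OF \<phi>, of X] kc unfolding case_prod_unfold
    by (intro continuous_on_mult)
  have "(\<integral>y. \<psi> y * K \<phi> y \<partial>\<mu>) = (\<integral>y. \<integral>x. \<psi> y * (\<phi> x * k x y) \<partial>\<mu> \<partial>\<mu>)" by (simp add: K_def)
  also have "\<dots> = (\<integral>x. \<integral>y. \<psi> y * (\<phi> x * k x y) \<partial>\<mu> \<partial>\<mu>)" by (rule borel_prob_Fubini(2)[OF X mu_prob mu_prob G])
  also have "\<dots> = (\<integral>x. \<phi> x * K \<psi> x \<partial>\<mu>)"
  proof (rule borel_prob_cong[OF mu_prob])
    fix x assume x: "x \<in> X"
    have "(\<integral>y. \<psi> y * (\<phi> x * k x y) \<partial>\<mu>) = (\<integral>y. \<phi> x * (\<psi> y * k y x) \<partial>\<mu>)"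
      by (rule borel_prob_cong[OF mu_prob]) (simp add: k_sym x)
    then show "(\<integral>y. \<psi> y * (\<phi> x * k x y) \<partial>\<mu>) = \<phi> x * K \<psi> x" by (simp add: K_def)
  qed
  finally show ?thesis .
qed

lemma K_one: "y \<in> X \<Longrightarrow> K (\<lambda>x. 1) y = 1" by (simp add: K_def k_int)

lemma integral_K:
  assumes \<phi>: "continuous_on X \<phi>"
  shows "(\<integral>y. K \<phi> y \<partial>\<mu>) = (\<integral>y. \<phi> y \<partial>\<mu>)"
proof -
  have "(\<integral>y. \<phi> y * K (\<lambda>x. 1) y \<partial>\<mu>) = (\<integral>y. \<phi> y \<partial>\<mu>)" by (rule borel_prob_cong[OF mu_prob]) (simp add: K_one)
  then show ?thesis using K_symmetric[OF \<phi> continuous_on_const, of 1] by simp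
qed

lemma integral_HL: "(\<integral>y. HL y \<partial>\<mu>) = 0"
proof -
  have "L (K (\<lambda>x. 1)) = L (\<lambda>x. 1)" by (rule L_cong) (rule K_one)
  then show ?thesis using pairing[OF continuous_on_const, of 1] L_const by simp
qed

end

section \<open>Second-order expansion of the transport cost\<close>

context sinkhorn_path
begin

text \<open>The Gibbs density at \<open>f + \<epsilon> * t * \<phi>\<close> and
  \<open>f + \<epsilon> * t * \<psi>\<close>. The factor \<epsilon> in the perturbation cancels the
  temperature, so the exponent is linear in \<open>t\<close> with no constants.\<close>

definition tilted_kernel :: "('a \<Rightarrow> real) \<Rightarrow> ('a \<Rightarrow> real) \<Rightarrow> real \<Rightarrow> 'a \<Rightarrow> 'a \<Rightarrow> real" where
  "tilted_kernel \<phi> \<psi> t x y = exp (t * (\<phi> x + \<psi> y)) * k x y"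

lemma gibbs_tilted: "gibbs \<epsilon> c (\<lambda>x. f x + \<epsilon> * (t * \<phi> x)) (\<lambda>x. f x + \<epsilon> * (t * \<psi> x)) x y = tilted_kernel \<phi> \<psi> t x y"
proof -
  have "(f x + \<epsilon> * (t * \<phi> x) + (f y + \<epsilon> * (t * \<psi> y)) - c x y) / \<epsilon> = t * (\<phi> x + \<psi> y) + (f x + f y - c x y) / \<epsilon>"
    using \<epsilon> by (simp add: field_simps)
  moreover have "k x y = exp ((f x + f y - c x y) / \<epsilon>)" using fun_cong[OF fun_cong[OF k_eq]] .
  ultimately show ?thesis by (simp only: gibbs_def tilted_kernel_def exp_add)
qed

lemma sum_GG: "\<phi> \<in> S \<Longrightarrow> \<psi> \<in> S \<Longrightarrow> (\<lambda>x y. \<phi> x + \<psi> y) \<in> GG"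
  by (rule GG_add[OF GG_lift GG_lift2])

lemma sum_bound:
  assumes "\<phi> \<in> S" "\<psi> \<in> S"
  obtains B where "B > 0" "\<And>x y. x \<in> X \<Longrightarrow> y \<in> X \<Longrightarrow> \<bar>\<phi> x + \<psi> y\<bar> \<le> B"
  using compact_continuous_bound2[OF X GG_cont[OF sum_GG[OF assms]]] by blast

lemma k_bound: obtains B where "\<And>z. z \<in> X \<times> X \<Longrightarrow> \<bar>k (fst z) (snd z)\<bar> \<le> B"
proof -
  obtain B where B: "\<And>x y. x \<in> X \<Longrightarrow> y \<in> X \<Longrightarrow> \<bar>k x y\<bar> \<le> B"
    using compact_continuous_bound2[OF X kc] by blast
  show ?thesis by (rule that[of B]) (simp add: B mem_Times_iff)
qed

lemma cont_exp_sum: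
  assumes "\<phi> \<in> S" "\<psi> \<in> S"
  shows "continuous_on (X \<times> X) (\<lambda>(x, y). exp (t * (\<phi> x + \<psi> y)))"
  using GG_cont[OF sum_GG[OF assms]] unfolding case_prod_unfold
  by (intro continuous_on_exp continuous_on_mult continuous_on_const)

lemma tilted_kernel_cont: "\<phi> \<in> S \<Longrightarrow> \<psi> \<in> S \<Longrightarrow> continuous_on (X \<times> X) (\<lambda>(x, y). tilted_kernel \<phi> \<psi> t x y)"
  using cont_exp_sum[of \<phi> \<psi> t] kc unfolding tilted_kernel_def case_prod_unfold by (intro continuous_on_mult)

text \<open>With \<open>tilt_remainder\<close>, the two exact Taylor forms of the tilted kernel for
  nonzero \<open>t\<close>: it equals \<open>k\<close> plus \<open>t\<close> times the quotient, and
  also \<open>k\<close> plus the linear term plus t^2 times the remainder. The first serves the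
  marginals, the second the dual values.\<close>

definition tilt_quotient where "tilt_quotient \<phi> \<psi> t x y = (exp (t * (\<phi> x + \<psi> y)) - 1) / t * k x y"
definition tilt_remainder where "tilt_remainder \<phi> \<psi> t x y = (exp (t * (\<phi> x + \<psi> y)) - 1 - t * (\<phi> x + \<psi> y)) / t\<^sup>2 * k x y"

lemma tilt_quotient_cont: "\<phi> \<in> S \<Longrightarrow> \<psi> \<in> S \<Longrightarrow> continuous_on (X \<times> X) (\<lambda>(x, y). tilt_quotient \<phi> \<psi> t x y)"
  using cont_exp_sum[of \<phi> \<psi> t] kc unfolding tilt_quotient_def case_prod_unfold divide_inverse
  by (intro continuous_on_mult continuous_on_diff continuous_on_const)

lemma tilt_remainder_cont: "\<phi> \<in> S \<Longrightarrow> \<psi> \<in> S \<Longrightarrow> continuous_on (X \<times> X) (\<lambda>(x, y). tilt_remainder \<phi> \<psi> t x y)"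
  using cont_exp_sum[of \<phi> \<psi> t] kc GG_cont[OF sum_GG[of \<phi> \<psi>]] unfolding tilt_remainder_def case_prod_unfold divide_inverse
  by (intro continuous_on_mult continuous_on_diff continuous_on_const)

lemma tilt_quotient_lim:
  assumes "\<phi> \<in> S" "\<psi> \<in> S"
  shows "uniform_limit (X \<times> X) (\<lambda>t (x, y). tilt_quotient \<phi> \<psi> t x y) (\<lambda>(x, y). (\<phi> x + \<psi> y) * k x y) (at 0)"
proof -
  obtain B where B: "\<And>x y. x \<in> X \<Longrightarrow> y \<in> X \<Longrightarrow> \<bar>\<phi> x + \<psi> y\<bar> \<le> B" using sum_bound[OF assms] by blast
  obtain C where C: "\<And>z. z \<in> X \<times> X \<Longrightarrow> \<bar>k (fst z) (snd z)\<bar> \<le> C" using k_bound by blast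
  have "uniform_limit (X \<times> X) (\<lambda>t z. (exp (t * (\<phi> (fst z) + \<psi> (snd z))) - 1) / t) (\<lambda>z. \<phi> (fst z) + \<psi> (snd z)) (at 0)"
    by (rule uniform_limit_exp_quotients(1)[of "X \<times> X" _ B]) (use B in auto)
  from uniform_limit_cmult[where g="\<lambda>z. k (fst z) (snd z)" and B=C, OF this C] show ?thesis by (simp add: tilt_quotient_def case_prod_unfold mult.commute)
qed

lemma tilt_remainder_lim:
  assumes "\<phi> \<in> S" "\<psi> \<in> S"
  shows "uniform_limit (X \<times> X) (\<lambda>t (x, y). tilt_remainder \<phi> \<psi> t x y) (\<lambda>(x, y). (\<phi> x + \<psi> y)\<^sup>2 / 2 * k x y) (at 0)"
proof -
  obtain B where B: "\<And>x y. x \<in> X \<Longrightarrow> y \<in> X \<Longrightarrow> \<bar>\<phi> x + \<psi> y\<bar> \<le> B" using sum_bound[OF assms] by blast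
  obtain C where C: "\<And>z. z \<in> X \<times> X \<Longrightarrow> \<bar>k (fst z) (snd z)\<bar> \<le> C" using k_bound by blast
  have "uniform_limit (X \<times> X) (\<lambda>t z. (exp (t * (\<phi> (fst z) + \<psi> (snd z))) - 1 - t * (\<phi> (fst z) + \<psi> (snd z))) / t\<^sup>2)
     (\<lambda>z. (\<phi> (fst z) + \<psi> (snd z))\<^sup>2 / 2) (at 0)"
    by (rule uniform_limit_exp_quotients(2)[of "X \<times> X" _ B]) (use B in auto)
  from uniform_limit_cmult[where g="\<lambda>z. k (fst z) (snd z)" and B=C, OF this C] show ?thesis by (simp add: tilt_remainder_def case_prod_unfold mult.commute)
qed

lemma tilt_quotient_GG: "\<phi> \<in> S \<Longrightarrow> \<psi> \<in> S \<Longrightarrow> (\<lambda>x y. (\<phi> x + \<psi> y) * k x y) \<in> GG"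
  by (rule GG_mult[OF sum_GG k])

lemma tilt_remainder_GG:
  assumes "\<phi> \<in> S" "\<psi> \<in> S"
  shows "(\<lambda>x y. (\<phi> x + \<psi> y)\<^sup>2 / 2 * k x y) \<in> GG"
  using GG_mult[OF GG_mult[OF GG_lift[OF S_const[of "1/2"]] GG_mult[OF sum_GG[OF assms] sum_GG[OF assms]]] k]
  by (simp add: power2_eq_square)

lemma integral_sum_kernel:
  assumes "\<phi> \<in> S" "y \<in> X"
  shows "(\<integral>x. (\<phi> x + r) * k x y \<partial>\<mu>) = K \<phi> y + r"
proof -
  have "integrable \<mu> (\<lambda>x. \<phi> x * k x y)"
    by (intro borel_prob_integrable[OF X mu_prob] continuous_on_mult S_cont assms continuous_on_slice1[OF kc])
  moreover have "integrable \<mu> (\<lambda>x. k x y)"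
    by (intro borel_prob_integrable[OF X mu_prob] continuous_on_slice1[OF kc] assms)
  ultimately show ?thesis by (simp add: distrib_right K_def k_int assms)
qed

text \<open>\<open>H\<close> is the rate at which \<open>k\<close> loses its marginal property along
  the path: \<open>HL\<close> for the moving measure and 0 for the fixed one. Carrying
  \<open>H\<close> along lets one computation serve both transport problems.\<close>

definition first_variation :: "(real \<Rightarrow> 'a measure) \<Rightarrow> ('a \<Rightarrow> real) \<Rightarrow> bool" where
  "first_variation \<alpha> H \<longleftrightarrow> marginal \<alpha> \<and> H \<in> S \<and>
     uniform_limit X (\<lambda>t y. ((\<integral>x. k x y \<partial>\<alpha> t) - 1) / t) H (at 0)"

lemma first_variation_M: "first_variation M HL"
proof -
  have "uniform_limit X (\<lambda>t y. ((\<integral>x. k x y \<partial>M t) - 1) / t) HL (at 0)"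
    using uniform_deriv[OF k]
    by (rule uniform_limit_cong[THEN iffD1, rotated -1]) (auto simp: k_int HL_def)
  then show ?thesis by (simp add: first_variation_def marginal_def HL_S)
qed

lemma first_variation_const: "first_variation (\<lambda>t. \<mu>) (\<lambda>x. 0)"
proof -
  have "uniform_limit X (\<lambda>t y. ((\<integral>x. k x y \<partial>\<mu>) - 1) / t) (\<lambda>x. 0) (at 0)"
    using uniform_limit_const
    by (rule uniform_limit_cong[THEN iffD1, rotated -1]) (auto simp: k_int)
  then show ?thesis by (simp add: first_variation_def marginal_def S_const)
qed

text \<open>The marginal error splits into the effect of the tilt, which has a limit under the
  converging measure, and the rate for \<open>k\<close> itself. Setting the limit to 0 gives the
  linear equations for the trial potentials.\<close>

lemma residual:
  assumes \<alpha>: "first_variation \<alpha> H" and S: "\<phi> \<in> S" "\<psi> \<in> S"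
  shows "uniform_limit X (\<lambda>t y. ((\<integral>x. tilted_kernel \<phi> \<psi> t x y \<partial>\<alpha> t) - 1) / t) (\<lambda>y. K \<phi> y + \<psi> y + H y) (at 0)"
proof -
  have m: "marginal \<alpha>" and H: "uniform_limit X (\<lambda>t y. ((\<integral>x. k x y \<partial>\<alpha> t) - 1) / t) H (at 0)"
    using \<alpha> by (auto simp: first_variation_def)
  have "uniform_limit X (\<lambda>t y. \<integral>x. tilt_quotient \<phi> \<psi> t x y \<partial>\<alpha> t) (\<lambda>y. \<integral>x. (\<phi> x + \<psi> y) * k x y \<partial>\<mu>) (at 0)"
    by (rule integral_uniform_lim_param[OF m tilt_quotient_lim[OF S] tilt_quotient_GG[OF S] tilt_quotient_cont[OF S]])
  from uniform_limit_add[OF this H] show ?thesis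
  proof (rule uniform_limit_cong[THEN iffD1, rotated -1])
    show "\<forall>\<^sub>F t in at 0. \<forall>y\<in>X. (\<integral>x. tilt_quotient \<phi> \<psi> t x y \<partial>\<alpha> t) + ((\<integral>x. k x y \<partial>\<alpha> t) - 1) / t = ((\<integral>x. tilted_kernel \<phi> \<psi> t x y \<partial>\<alpha> t) - 1) / t"
      using marginal_prob[OF m]
    proof eventually_elim
      case (elim t)
      then have P: "borel_prob X (\<alpha> t)" and t: "t \<noteq> 0" by auto
      show ?case
      proof
        fix y assume y: "y \<in> X"
        have R: "tilt_quotient \<phi> \<psi> t x y = (tilted_kernel \<phi> \<psi> t x y - k x y) / t" for x
          by (simp add: tilt_quotient_def tilted_kernel_def left_diff_distrib diff_divide_distrib)
        have "(\<integral>x. tilt_quotient \<phi> \<psi> t x y \<partial>\<alpha> t) = ((\<integral>x. tilted_kernel \<phi> \<psi> t x y \<partial>\<alpha> t) - (\<integral>x. k x y \<partial>\<alpha> t)) / t"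
          unfolding R using borel_prob_integrable[OF X P continuous_on_slice1[OF kc y]]
            borel_prob_integrable[OF X P continuous_on_slice1[OF tilted_kernel_cont[OF S] y]] by simp
        then show "(\<integral>x. tilt_quotient \<phi> \<psi> t x y \<partial>\<alpha> t) + ((\<integral>x. k x y \<partial>\<alpha> t) - 1) / t = ((\<integral>x. tilted_kernel \<phi> \<psi> t x y \<partial>\<alpha> t) - 1) / t"
          by (simp flip: add_divide_distrib)
      qed
    qed
  qed (simp add: integral_sum_kernel[OF S(1)])
qed

lemma tilted_kernel_swap: "x \<in> X \<Longrightarrow> y \<in> X \<Longrightarrow> tilted_kernel \<phi> \<psi> t x y = tilted_kernel \<psi> \<phi> t y x"
  by (simp add: tilted_kernel_def k_sym add.commute)

text \<open>The amount by which the trial potentials improve the dual value over the integrals of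
  \<open>f\<close>, in units of \<epsilon>; see \<open>dual_value_gain\<close>.\<close>

definition gain :: "(real \<Rightarrow> 'a measure) \<Rightarrow> (real \<Rightarrow> 'a measure) \<Rightarrow> ('a \<Rightarrow> real) \<Rightarrow> ('a \<Rightarrow> real) \<Rightarrow> real \<Rightarrow> real" where
  "gain \<alpha> \<beta> \<phi> \<psi> t = t * (\<integral>x. \<phi> x \<partial>\<alpha> t) + t * (\<integral>y. \<psi> y \<partial>\<beta> t) - ((\<integral>y. \<integral>x. tilted_kernel \<phi> \<psi> t x y \<partial>\<alpha> t \<partial>\<beta> t) - 1)"

text \<open>Each linear term is combined with the linear term of the tilted kernel. Their difference
  contains the marginal error of \<open>k\<close>, which is itself of order \<open>t\<close>, so
  everything is visibly of order t^2. The second-order mass error \<kappa> of \<open>k\<close>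
  remains a parameter because it is 0 when one marginal is fixed.\<close>

lemma gain_lim:
  assumes \<alpha>: "first_variation \<alpha> H" and \<beta>: "first_variation \<beta> H'" and S: "\<phi> \<in> S" "\<psi> \<in> S"
    and \<kappa>: "((\<lambda>t. ((\<integral>y. \<integral>x. k x y \<partial>\<alpha> t \<partial>\<beta> t) - 1) / t\<^sup>2) \<longlongrightarrow> \<kappa>) (at 0)"
  shows "((\<lambda>t. gain \<alpha> \<beta> \<phi> \<psi> t / t\<^sup>2) \<longlongrightarrow> - \<kappa> - (\<integral>x. \<phi> x * H' x \<partial>\<mu>) - (\<integral>y. \<psi> y * H y \<partial>\<mu>)
    - (\<integral>y. \<integral>x. (\<phi> x + \<psi> y)\<^sup>2 / 2 * k x y \<partial>\<mu> \<partial>\<mu>)) (at 0)"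
proof -
  have m: "marginal \<alpha>" "marginal \<beta>" and HS: "H \<in> S" "H' \<in> S"
    and H: "uniform_limit X (\<lambda>t y. ((\<integral>x. k x y \<partial>\<alpha> t) - 1) / t) H (at 0)"
    and H': "uniform_limit X (\<lambda>t y. ((\<integral>x. k x y \<partial>\<beta> t) - 1) / t) H' (at 0)"
    using \<alpha> \<beta> by (auto simp: first_variation_def)
  have 1: "((\<lambda>t. \<integral>x. \<xi> x * (((\<integral>y. k y x \<partial>\<gamma>' t) - 1) / t) \<partial>\<gamma> t) \<longlongrightarrow> (\<integral>x. \<xi> x * h x \<partial>\<mu>)) (at 0)"
    if \<gamma>: "marginal \<gamma>" "first_variation \<gamma>' h" and \<xi>: "\<xi> \<in> S" for \<gamma> \<gamma>' h \<xi>
  proof (rule integral_uniform_lim[OF \<gamma>(1)])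
    have \<gamma>': "marginal \<gamma>'" "h \<in> S" "uniform_limit X (\<lambda>t y. ((\<integral>x. k x y \<partial>\<gamma>' t) - 1) / t) h (at 0)"
      using \<gamma>(2) by (auto simp: first_variation_def)
    obtain B where "\<And>x. x \<in> X \<Longrightarrow> \<bar>\<xi> x\<bar> \<le> B" using compact_continuous_bound[OF X S_cont[OF \<xi>]] by blast
    then show "uniform_limit X (\<lambda>t x. \<xi> x * (((\<integral>y. k y x \<partial>\<gamma>' t) - 1) / t)) (\<lambda>x. \<xi> x * h x) (at 0)"
      by (rule uniform_limit_cmult[OF \<gamma>'(3)])
    show "(\<lambda>x. \<xi> x * h x) \<in> S" by (rule S_mult[OF \<xi> \<gamma>'(2)])
    show "\<forall>\<^sub>F t in at 0. continuous_on X (\<lambda>x. \<xi> x * (((\<integral>y. k y x \<partial>\<gamma>' t) - 1) / t))"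
      using marginal_prob[OF \<gamma>'(1)] unfolding divide_inverse
      by eventually_elim (intro continuous_on_mult continuous_on_diff continuous_on_const S_cont \<xi>
        continuous_on_integral_param[OF X _ kc], simp)
  qed
  have 2: "((\<lambda>t. \<integral>y. \<integral>x. tilt_remainder \<phi> \<psi> t x y \<partial>\<alpha> t \<partial>\<beta> t) \<longlongrightarrow> (\<integral>y. \<integral>x. (\<phi> x + \<psi> y)\<^sup>2 / 2 * k x y \<partial>\<mu> \<partial>\<mu>)) (at 0)"
    by (rule double_integral_uniform_lim[OF m tilt_remainder_lim[OF S] tilt_remainder_GG[OF S] tilt_remainder_cont[OF S]])
  have "((\<lambda>t. - (((\<integral>y. \<integral>x. k x y \<partial>\<alpha> t \<partial>\<beta> t) - 1) / t\<^sup>2) - (\<integral>x. \<phi> x * (((\<integral>y. k y x \<partial>\<beta> t) - 1) / t) \<partial>\<alpha> t)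
    - (\<integral>y. \<psi> y * (((\<integral>x. k x y \<partial>\<alpha> t) - 1) / t) \<partial>\<beta> t) - (\<integral>y. \<integral>x. tilt_remainder \<phi> \<psi> t x y \<partial>\<alpha> t \<partial>\<beta> t)) \<longlongrightarrow>
    - \<kappa> - (\<integral>x. \<phi> x * H' x \<partial>\<mu>) - (\<integral>y. \<psi> y * H y \<partial>\<mu>) - (\<integral>y. \<integral>x. (\<phi> x + \<psi> y)\<^sup>2 / 2 * k x y \<partial>\<mu> \<partial>\<mu>)) (at 0)"
    by (intro tendsto_diff tendsto_minus \<kappa> 2 1[OF m(1) \<beta> S(1)] 1[OF m(2) \<alpha> S(2)])
  then show ?thesis
  proof (rule Lim_transform_eventually)
    show "\<forall>\<^sub>F t in at 0. - (((\<integral>y. \<integral>x. k x y \<partial>\<alpha> t \<partial>\<beta> t) - 1) / t\<^sup>2) - (\<integral>x. \<phi> x * (((\<integral>y. k y x \<partial>\<beta> t) - 1) / t) \<partial>\<alpha> t)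
      - (\<integral>y. \<psi> y * (((\<integral>x. k x y \<partial>\<alpha> t) - 1) / t) \<partial>\<beta> t) - (\<integral>y. \<integral>x. tilt_remainder \<phi> \<psi> t x y \<partial>\<alpha> t \<partial>\<beta> t) = gain \<alpha> \<beta> \<phi> \<psi> t / t\<^sup>2"
      using marginal_prob[OF m(1)] marginal_prob[OF m(2)]
    proof eventually_elim
      case (elim t)
      then have P: "borel_prob X (\<alpha> t)" and Q: "borel_prob X (\<beta> t)" and t: "t \<noteq> 0" by auto
      let ?I = "\<lambda>G. \<integral>z. G (fst z) (snd z) \<partial>(\<alpha> t \<Otimes>\<^sub>M \<beta> t)"
      note Fub = borel_prob_Fubini[OF X P Q] and int = borel_prob_integrable_pair'[OF X P Q]
      have c\<phi>: "continuous_on (X \<times> X) (\<lambda>(x, y). \<phi> x * k x y)" and c\<psi>: "continuous_on (X \<times> X) (\<lambda>(x, y). \<psi> y * k x y)"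
        using GG_cont[OF GG_mult[OF GG_lift[OF S(1)] k]] GG_cont[OF GG_mult[OF GG_lift2[OF S(2)] k]] by simp_all
      \<comment> \<open>An identity and not an approximation, so both double integrals can be split
        before any limit is taken.\<close>
      have Eq: "tilted_kernel \<phi> \<psi> t x y = k x y + t * (\<phi> x * k x y) + t * (\<psi> y * k x y) + t\<^sup>2 * tilt_remainder \<phi> \<psi> t x y" for x y
      proof -
        have "t\<^sup>2 * tilt_remainder \<phi> \<psi> t x y = (exp (t * (\<phi> x + \<psi> y)) - 1 - t * (\<phi> x + \<psi> y)) * k x y"
          using t by (simp add: tilt_remainder_def)
        also have "\<dots> = tilted_kernel \<phi> \<psi> t x y - k x y - t * (\<phi> x * k x y) - t * (\<psi> y * k x y)"
          by (simp add: tilted_kernel_def left_diff_distrib distrib_left distrib_right)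
        finally show ?thesis by simp
      qed
      have e1: "?I (tilted_kernel \<phi> \<psi> t) = ?I k + t * ?I (\<lambda>x y. \<phi> x * k x y) + t * ?I (\<lambda>x y. \<psi> y * k x y) + t\<^sup>2 * ?I (tilt_remainder \<phi> \<psi> t)"
        unfolding Eq using int[OF kc] int[OF c\<phi>] int[OF c\<psi>] int[OF tilt_remainder_cont[OF S]] by simp
      have e2: "?I (tilted_kernel \<phi> \<psi> t) = (\<integral>y. \<integral>x. tilted_kernel \<phi> \<psi> t x y \<partial>\<alpha> t \<partial>\<beta> t)" by (rule Fub(1)[OF tilted_kernel_cont[OF S]])
      have e3: "?I k = (\<integral>y. \<integral>x. k x y \<partial>\<alpha> t \<partial>\<beta> t)" by (rule Fub(1)[OF kc])
      have e4: "?I (tilt_remainder \<phi> \<psi> t) = (\<integral>y. \<integral>x. tilt_remainder \<phi> \<psi> t x y \<partial>\<alpha> t \<partial>\<beta> t)" by (rule Fub(1)[OF tilt_remainder_cont[OF S]])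
      have e5: "?I (\<lambda>x y. \<psi> y * k x y) = (\<integral>y. \<psi> y * (\<integral>x. k x y \<partial>\<alpha> t) \<partial>\<beta> t)"
        unfolding Fub(1)[OF c\<psi>] by simp
      have e6: "?I (\<lambda>x y. \<phi> x * k x y) = (\<integral>x. \<phi> x * (\<integral>y. k y x \<partial>\<beta> t) \<partial>\<alpha> t)"
      proof -
        have "?I (\<lambda>x y. \<phi> x * k x y) = (\<integral>x. \<integral>y. \<phi> x * k x y \<partial>\<beta> t \<partial>\<alpha> t)"
          unfolding Fub(1)[OF c\<phi>] by (rule Fub(2)[OF c\<phi>])
        also have "\<dots> = (\<integral>x. \<phi> x * (\<integral>y. k y x \<partial>\<beta> t) \<partial>\<alpha> t)"
        proof (rule borel_prob_cong[OF P])
          fix x assume x: "x \<in> X"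
          have "(\<integral>y. k x y \<partial>\<beta> t) = (\<integral>y. k y x \<partial>\<beta> t)" by (rule borel_prob_cong[OF Q]) (simp add: k_sym x)
          then show "(\<integral>y. \<phi> x * k x y \<partial>\<beta> t) = \<phi> x * (\<integral>y. k y x \<partial>\<beta> t)" by simp
        qed
        finally show ?thesis .
      qed
      have e7: "(\<integral>x. \<xi> x * (((\<integral>y. k y x \<partial>\<gamma>') - 1) / t) \<partial>\<gamma>) = ((\<integral>x. \<xi> x * (\<integral>y. k y x \<partial>\<gamma>') \<partial>\<gamma>) - (\<integral>x. \<xi> x \<partial>\<gamma>)) / t"
        if "borel_prob X \<gamma>" "borel_prob X \<gamma>'" "\<xi> \<in> S" for \<gamma> \<gamma>' \<xi>
      proof -
        have "integrable \<gamma> (\<lambda>x. \<xi> x * (\<integral>y. k y x \<partial>\<gamma>'))"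
          by (intro borel_prob_integrable[OF X that(1)] continuous_on_mult S_cont that continuous_on_integral_param[OF X that(2) kc])
        moreover have "integrable \<gamma> \<xi>" by (intro borel_prob_integrable[OF X that(1)] S_cont that)
        ultimately show ?thesis by (simp add: right_diff_distrib)
      qed
      have "(\<integral>y. \<integral>x. tilted_kernel \<phi> \<psi> t x y \<partial>\<alpha> t \<partial>\<beta> t) = (\<integral>y. \<integral>x. k x y \<partial>\<alpha> t \<partial>\<beta> t)
        + t * (\<integral>x. \<phi> x * (\<integral>y. k y x \<partial>\<beta> t) \<partial>\<alpha> t) + t * (\<integral>y. \<psi> y * (\<integral>x. k x y \<partial>\<alpha> t) \<partial>\<beta> t)
        + t\<^sup>2 * (\<integral>y. \<integral>x. tilt_remainder \<phi> \<psi> t x y \<partial>\<alpha> t \<partial>\<beta> t)"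
        using e1 unfolding e2 e3 e4 e5 e6 .
      moreover have "- ((kk - 1) / t\<^sup>2) - (a - p) / t - (b - q) / t - r = (t * p + t * q - (kk + t * a + t * b + t\<^sup>2 * r - 1)) / t\<^sup>2"
        for kk a b p q r using t by (simp add: field_simps power2_eq_square)
      ultimately show ?case unfolding gain_def e7[OF P Q S(1)] e7[OF Q P S(2)] by simp
    qed
  qed
qed

text \<open>The double integral of \<open>k\<close> is quadratic in the path. One factor is replaced
  by the difference quotient of \<open>k\<close>, which converges to \<open>HL\<close> in the norm
  \<open>N\<close>; what remains is a first difference along the path of a test function that
  depends on \<open>t\<close>.\<close>

lemma second_variation: "((\<lambda>t. ((\<integral>y. \<integral>x. k x y \<partial>M t \<partial>M t) - 1) / t\<^sup>2) \<longlongrightarrow> L HL) (at 0)"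
proof (rule tendstoI)
  fix e :: real assume e: "e > 0"
  have HLF: "HL \<in> F" using HL_S SF by blast
  obtain d where d: "d > 0" "\<And>\<psi> s. \<psi> \<in> F \<Longrightarrow> N (\<lambda>x. \<psi> x - HL x) < d \<Longrightarrow> \<bar>s\<bar> < d \<Longrightarrow>
    \<bar>path_deriv M s \<psi> - L HL\<bar> < e / 2"
    by (rule perturbation_jointly_continuous[OF path \<tau> HLF, of "e / 2"]) (use e in auto)
  have "\<forall>\<^sub>F t in at 0. N (\<lambda>y. ((\<integral>x. k x y \<partial>M t) - (\<integral>x. k x y \<partial>\<mu>)) / t - HL y) < d"
    using GG_deriv_lim[OF k d(1)] by (simp add: HL_def)
  then show "\<forall>\<^sub>F t in at 0. dist (((\<integral>y. \<integral>x. k x y \<partial>M t \<partial>M t) - 1) / t\<^sup>2) (L HL) < e"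
    using ev_small[OF d(1)] ev_small[OF \<tau>]
  proof eventually_elim
    case (elim t)
    have P: "borel_prob X (M t)" by (rule M_prob) (use elim in simp)
    \<comment> \<open>For fixed \<open>t\<close> the test function is frozen and only the time
      \<open>s\<close> of the measure varies. Joint continuity at \<open>HL\<close> and time 0
      bounds the derivative in \<open>s\<close> on the whole segment.\<close>
    define g where "g y = ((\<integral>x. k x y \<partial>M t) - (\<integral>x. k x y \<partial>\<mu>)) / t" for y
    have gS: "g \<in> S"
      using S_scale[OF S_diff[OF GG_integral[OF k P continuous_on_const[of X 1]] GG_integral[OF k mu_prob continuous_on_const[of X 1]]], of "1 / t"]
      by (simp add: g_def[abs_def])
    have gF: "g \<in> F" using gS SF by blast
    define I where "I s = (\<integral>y. g y \<partial>M s)" for s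
    have "norm ((I t - L HL * t) - (I 0 - L HL * 0)) \<le> e / 2 * norm (t - 0)"
    proof (rule field_differentiable_bound[where S="{-\<bar>t\<bar>..\<bar>t\<bar>}" and f="\<lambda>s. I s - L HL * s"
          and f'="\<lambda>s. path_deriv M s g - L HL"])
      fix s assume "s \<in> {-\<bar>t\<bar>..\<bar>t\<bar>}"
      then have s: "\<bar>s\<bar> < d" "\<bar>s\<bar> < \<tau>" using elim by auto
      have "(I has_field_derivative path_deriv M s g) (at s)"
        unfolding I_def by (rule perturbation_DERIV[OF path s(2) gF])
      from DERIV_diff[OF this DERIV_cmult_Id[of "L HL"]]
      show "((\<lambda>s. I s - L HL * s) has_field_derivative path_deriv M s g - L HL) (at s within {-\<bar>t\<bar>..\<bar>t\<bar>})"
        by (rule has_field_derivative_at_within)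
      show "norm (path_deriv M s g - L HL) \<le> e / 2"
        using d(2)[OF gF _ s(1)] elim(1) by (simp add: g_def less_imp_le)
    qed auto
    then have b: "\<bar>I t - L HL * t - I 0\<bar> \<le> e / 2 * \<bar>t\<bar>" by simp
    have ik: "integrable Q (\<lambda>y. \<integral>x. k x y \<partial>P)" if "borel_prob X P" "borel_prob X Q" for P Q
      by (rule borel_prob_integrable[OF X that(2) continuous_on_integral_param[OF X that(1) kc]])
    have one: "(\<integral>y. \<integral>x. k x y \<partial>\<mu> \<partial>Q) = 1" if Q: "borel_prob X Q" for Q
      using borel_prob_cong[OF Q k_int] prob_space.prob_space[OF borel_prob_prob_space[OF Q]] by simp
    have "(\<integral>y. \<integral>x. k x y \<partial>M t \<partial>\<mu>) = (\<integral>x. \<integral>y. k x y \<partial>\<mu> \<partial>M t)"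
      by (rule borel_prob_Fubini(2)[OF X P mu_prob kc])
    also have "\<dots> = (\<integral>x. \<integral>y. k y x \<partial>\<mu> \<partial>M t)"
      by (rule borel_prob_cong[OF P], rule borel_prob_cong[OF mu_prob]) (rule k_sym)
    finally have sw: "(\<integral>y. \<integral>x. k x y \<partial>M t \<partial>\<mu>) = 1" using one[OF P] by simp
    have I: "I s = ((\<integral>y. \<integral>x. k x y \<partial>M t \<partial>M s) - 1) / t" if "\<bar>s\<bar> < \<tau>" for s
      unfolding I_def g_def using ik[OF P M_prob[OF that]] ik[OF mu_prob M_prob[OF that]] one[OF M_prob[OF that]] by simp
    \<comment> \<open>At time 0 the kernel has exact marginals, so only the increment from 0 to
      \<open>t\<close> is left to estimate.\<close>
    have I0: "I 0 = 0" using I[of 0] \<tau> sw by simp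
    have It: "I t = ((\<integral>y. \<integral>x. k x y \<partial>M t \<partial>M t) - 1) / t" by (rule I) (use elim in simp)
    have "((\<integral>y. \<integral>x. k x y \<partial>M t \<partial>M t) - 1) / t\<^sup>2 - L HL = (I t - L HL * t - I 0) / t"
      using elim unfolding It I0 by (simp add: power2_eq_square diff_divide_distrib)
    then have "\<bar>((\<integral>y. \<integral>x. k x y \<partial>M t \<partial>M t) - 1) / t\<^sup>2 - L HL\<bar> \<le> e / 2"
      using b elim by (simp add: abs_divide pos_divide_le_eq)
    then show ?case using e by (simp add: dist_real_def)
  qed
qed

end

section \<open>Two-sided bounds and limits for the transport costs\<close>

context sinkhorn_path
begin

lemma k_pos: "k x y > 0" by (simp add: k_eq)

lemma k_lower: obtains \<delta> where "\<delta> > 0" "\<And>x y. x \<in> X \<Longrightarrow> y \<in> X \<Longrightarrow> \<delta> \<le> k x y"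
proof (cases "X = {}")
  case True
  then show ?thesis by (intro that[of 1]) auto
next
  case False
  then obtain z where z: "z \<in> X \<times> X" "\<And>z'. z' \<in> X \<times> X \<Longrightarrow> (case z of (x, y) \<Rightarrow> k x y) \<le> (case z' of (x, y) \<Rightarrow> k x y)"
    using continuous_attains_inf[OF compact_Times[OF X X] _ kc] by blast
  show ?thesis
  proof (rule that[of "k (fst z) (snd z)"])
    show "k (fst z) (snd z) \<le> k x y" if "x \<in> X" "y \<in> X" for x y
      using z(2)[of "(x, y)"] that by (simp add: case_prod_unfold)
  qed (rule k_pos)
qed

lemma tilted_kernel_lower:
  assumes "\<phi> \<in> S" "\<psi> \<in> S"
  obtains \<delta> d where "\<delta> > 0" "d > 0" "\<And>t x y. \<bar>t\<bar> < d \<Longrightarrow> x \<in> X \<Longrightarrow> y \<in> X \<Longrightarrow> \<delta> \<le> tilted_kernel \<phi> \<psi> t x y"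
proof -
  obtain B where B: "B > 0" "\<And>x y. x \<in> X \<Longrightarrow> y \<in> X \<Longrightarrow> \<bar>\<phi> x + \<psi> y\<bar> \<le> B" by (rule sum_bound[OF assms]) blast
  obtain \<delta> where \<delta>: "\<delta> > 0" "\<And>x y. x \<in> X \<Longrightarrow> y \<in> X \<Longrightarrow> \<delta> \<le> k x y" by (rule k_lower) blast
  show ?thesis
  \<comment> \<open>For these \<open>t\<close> the exponent is at least -1/2 and its exponential at
    least 1/2, so half of the lower bound for \<open>k\<close> survives.\<close>
  proof (rule that[of "\<delta> / 2" "1 / (2 * B)"])
    fix t x y assume t: "\<bar>t\<bar> < 1 / (2 * B)" and xy: "x \<in> X" "y \<in> X"
    have "\<bar>t * (\<phi> x + \<psi> y)\<bar> \<le> \<bar>t\<bar> * B" unfolding abs_mult using B(2)[OF xy] by (intro mult_left_mono) auto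
    also have "\<dots> \<le> 1 / 2" using t B(1) by (simp add: pos_less_divide_eq)
    finally have "1 / 2 \<le> exp (t * (\<phi> x + \<psi> y))"
      using exp_ge_add_one_self[of "t * (\<phi> x + \<psi> y)"] by linarith
    then have "1 / 2 * \<delta> \<le> exp (t * (\<phi> x + \<psi> y)) * k x y" using \<delta>(1) \<delta>(2)[OF xy] by (intro mult_mono) auto
    then show "\<delta> / 2 \<le> tilted_kernel \<phi> \<psi> t x y" by (simp add: tilted_kernel_def)
  qed (use \<delta> B in simp_all)
qed

lemma perturbed_potential_cont: "\<phi> \<in> S \<Longrightarrow> continuous_on X (\<lambda>x. f x + \<epsilon> * (t * \<phi> x))"
  by (intro continuous_on_add f continuous_on_mult continuous_on_const S_cont)

lemma dual_value_gain:
  assumes P: "borel_prob X (\<alpha> t)" and Q: "borel_prob X (\<beta> t)" and S: "\<phi> \<in> S" "\<psi> \<in> S"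
  shows "dual_value \<epsilon> c (\<alpha> t) (\<beta> t) (\<lambda>x. f x + \<epsilon> * (t * \<phi> x)) (\<lambda>x. f x + \<epsilon> * (t * \<psi> x))
    = (\<integral>x. f x \<partial>\<alpha> t) + (\<integral>x. f x \<partial>\<beta> t) + \<epsilon> * gain \<alpha> \<beta> \<phi> \<psi> t"
  unfolding dual_value_def gibbs_tilted borel_prob_Fubini(1)[OF X P Q tilted_kernel_cont[OF S]]
  using borel_prob_integrable[OF X P f] borel_prob_integrable[OF X Q f]
    borel_prob_integrable[OF X P S_cont[OF S(1)]] borel_prob_integrable[OF X Q S_cont[OF S(2)]]
  by (simp add: gain_def algebra_simps)

lemma real_of_ereal_between:
  assumes "ereal a \<le> x" "x \<le> ereal b"
  shows "a \<le> real_of_ereal x" "real_of_ereal x \<le> b"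
  using assms by (cases x; simp)+

text \<open>The marginal errors are at most \<open>e * \<bar>t\<bar>\<close> and enter the duality
  gap squared. After division by t^2 the gap is a multiple of \<open>e\<^sup>2\<close>, independent
  of \<open>t\<close>. The row condition is stated with the potentials exchanged so that
  \<open>residual\<close> provides both conditions.\<close>

lemma OT_bounds:
  assumes P: "borel_prob X (\<alpha> t)" and Q: "borel_prob X (\<beta> t)" and S: "\<phi> \<in> S" "\<psi> \<in> S" and t: "t \<noteq> 0"
    and col: "\<And>y. y \<in> X \<Longrightarrow> \<bar>((\<integral>x. tilted_kernel \<phi> \<psi> t x y \<partial>\<alpha> t) - 1) / t\<bar> \<le> e"
    and row: "\<And>x. x \<in> X \<Longrightarrow> \<bar>((\<integral>y. tilted_kernel \<psi> \<phi> t y x \<partial>\<beta> t) - 1) / t\<bar> \<le> e"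
    and \<delta>: "\<And>x y. x \<in> X \<Longrightarrow> y \<in> X \<Longrightarrow> \<delta> \<le> tilted_kernel \<phi> \<psi> t x y" "3 * (e * \<bar>t\<bar>) < \<delta>"
  defines "V \<equiv> real_of_ereal (OT \<epsilon> c (\<alpha> t) (\<beta> t)) - (\<integral>x. f x \<partial>\<alpha> t) - (\<integral>x. f x \<partial>\<beta> t)"
  shows "\<bar>V / t\<^sup>2 - \<epsilon> * (gain \<alpha> \<beta> \<phi> \<psi> t / t\<^sup>2)\<bar> \<le> \<epsilon> * (9 * e\<^sup>2 / \<delta>)"
proof -
  note pc = perturbed_potential_cont[OF S(1), of t] perturbed_potential_cont[OF S(2), of t]
  have lo: "ereal (dual_value \<epsilon> c (\<alpha> t) (\<beta> t) (\<lambda>x. f x + \<epsilon> * (t * \<phi> x)) (\<lambda>x. f x + \<epsilon> * (t * \<psi> x))) \<le> OT \<epsilon> c (\<alpha> t) (\<beta> t)"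
    by (rule OT_ge_dual_value[OF X P Q c pc \<epsilon>])
  have hi: "OT \<epsilon> c (\<alpha> t) (\<beta> t) \<le> ereal (dual_value \<epsilon> c (\<alpha> t) (\<beta> t) (\<lambda>x. f x + \<epsilon> * (t * \<phi> x)) (\<lambda>x. f x + \<epsilon> * (t * \<psi> x))
     + \<epsilon> * (9 * (e * \<bar>t\<bar>)\<^sup>2 / \<delta>))"
  proof (rule OT_le_dual_value[OF X P Q c pc \<epsilon>])
    fix x assume x: "x \<in> X"
    have "(\<integral>y. tilted_kernel \<phi> \<psi> t x y \<partial>\<beta> t) = (\<integral>y. tilted_kernel \<psi> \<phi> t y x \<partial>\<beta> t)" by (rule borel_prob_cong[OF Q]) (simp add: tilted_kernel_swap[OF x])
    then show "\<bar>(\<integral>y. gibbs \<epsilon> c (\<lambda>x. f x + \<epsilon> * (t * \<phi> x)) (\<lambda>x. f x + \<epsilon> * (t * \<psi> x)) x y \<partial>\<beta> t) - 1\<bar> \<le> e * \<bar>t\<bar>"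
      using row[OF x] t unfolding gibbs_tilted by (simp add: abs_divide pos_divide_le_eq)
  next
    fix y assume y: "y \<in> X"
    show "\<bar>(\<integral>x. gibbs \<epsilon> c (\<lambda>x. f x + \<epsilon> * (t * \<phi> x)) (\<lambda>x. f x + \<epsilon> * (t * \<psi> x)) x y \<partial>\<alpha> t) - 1\<bar> \<le> e * \<bar>t\<bar>"
      using col[OF y] t unfolding gibbs_tilted by (simp add: abs_divide pos_divide_le_eq)
  qed (use \<delta> in \<open>simp_all add: gibbs_tilted\<close>)
  note b = real_of_ereal_between[OF lo hi, unfolded dual_value_gain[where \<alpha>=\<alpha> and \<beta>=\<beta> and t=t, OF P Q S]]
  have "0 \<le> V - \<epsilon> * gain \<alpha> \<beta> \<phi> \<psi> t" "V - \<epsilon> * gain \<alpha> \<beta> \<phi> \<psi> t \<le> \<epsilon> * (9 * (e * \<bar>t\<bar>)\<^sup>2 / \<delta>)"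
    using b unfolding V_def by linarith+
  then have "\<bar>V - \<epsilon> * gain \<alpha> \<beta> \<phi> \<psi> t\<bar> \<le> \<epsilon> * (9 * e\<^sup>2 / \<delta>) * t\<^sup>2" by (simp add: power_mult_distrib)
  then have "\<bar>(V - \<epsilon> * gain \<alpha> \<beta> \<phi> \<psi> t) / t\<^sup>2\<bar> \<le> \<epsilon> * (9 * e\<^sup>2 / \<delta>)" using t by (simp add: abs_divide pos_divide_le_eq)
  then show ?thesis by (simp add: diff_divide_distrib)
qed

text \<open>The hypotheses \<open>r1\<close> and \<open>r2\<close> say that both linearised marginal
  errors vanish. The \<open>e\<close> of \<open>OT_bounds\<close> may then be taken arbitrarily
  small, and cost and dual value have the same second-order limit.\<close>

lemma OT_lim:
  assumes \<alpha>: "first_variation \<alpha> H" and \<beta>: "first_variation \<beta> H'" and S: "\<phi> \<in> S" "\<psi> \<in> S"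
    and r1: "\<And>y. y \<in> X \<Longrightarrow> K \<phi> y + \<psi> y + H y = 0" and r2: "\<And>x. x \<in> X \<Longrightarrow> K \<psi> x + \<phi> x + H' x = 0"
    and g: "((\<lambda>t. gain \<alpha> \<beta> \<phi> \<psi> t / t\<^sup>2) \<longlongrightarrow> \<l>) (at 0)"
  shows "((\<lambda>t. (real_of_ereal (OT \<epsilon> c (\<alpha> t) (\<beta> t)) - (\<integral>x. f x \<partial>\<alpha> t) - (\<integral>x. f x \<partial>\<beta> t)) / t\<^sup>2) \<longlongrightarrow> \<epsilon> * \<l>) (at 0)"
proof -
  have m: "marginal \<alpha>" "marginal \<beta>" using \<alpha> \<beta> by (auto simp: first_variation_def)
  obtain \<delta> d where \<delta>: "\<delta> > 0" "d > 0" "\<And>t x y. \<bar>t\<bar> < d \<Longrightarrow> x \<in> X \<Longrightarrow> y \<in> X \<Longrightarrow> \<delta> \<le> tilted_kernel \<phi> \<psi> t x y"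
    by (rule tilted_kernel_lower[OF S]) blast
  let ?V = "\<lambda>t. real_of_ereal (OT \<epsilon> c (\<alpha> t) (\<beta> t)) - (\<integral>x. f x \<partial>\<alpha> t) - (\<integral>x. f x \<partial>\<beta> t)"
  have "((\<lambda>t. ?V t / t\<^sup>2 - \<epsilon> * (gain \<alpha> \<beta> \<phi> \<psi> t / t\<^sup>2)) \<longlongrightarrow> 0) (at 0)"
  proof (rule tendstoI)
    fix e0 :: real assume e0: "e0 > 0"
    \<comment> \<open>The bound 1 allows \<open>e\<^sup>2\<close> to be replaced by
      \<open>e\<close>; the factor 10 against the 9 of the gap makes the final inequality
      strict.\<close>
    define e where "e = min 1 (e0 * \<delta> / (10 * \<epsilon>))"
    have e: "e > 0" "e \<le> 1" using e0 \<delta>(1) \<epsilon> by (auto simp: e_def)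
    have "\<epsilon> * (9 * e\<^sup>2 / \<delta>) \<le> \<epsilon> * (9 * e / \<delta>)"
      using e \<delta>(1) \<epsilon> by (intro mult_left_mono divide_right_mono) (auto simp: power2_eq_square mult_left_le)
    also have "\<dots> \<le> \<epsilon> * (9 * (e0 * \<delta> / (10 * \<epsilon>)) / \<delta>)"
      using \<delta>(1) \<epsilon> by (intro mult_left_mono divide_right_mono) (auto simp: e_def)
    also have "\<dots> = 9 * e0 / 10" using \<delta>(1) \<epsilon> by simp
    finally have le: "\<epsilon> * (9 * e\<^sup>2 / \<delta>) < e0" using e0 by simp
    \<comment> \<open>With \<open>e\<close> at most 1, the bound \<open>\<delta> / 3\<close> on
      \<open>t\<close> ensures that the corrected Gibbs density is positive.\<close>
    define d' where "d' = min d (\<delta> / 3)"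
    have d': "d' > 0" using \<delta> by (simp add: d'_def)
    show "\<forall>\<^sub>F t in at 0. dist (?V t / t\<^sup>2 - \<epsilon> * (gain \<alpha> \<beta> \<phi> \<psi> t / t\<^sup>2)) 0 < e0"
      using uniform_limitD[OF residual[OF \<alpha> S] e(1)] uniform_limitD[OF residual[OF \<beta> S(2,1)] e(1)]
        marginal_prob[OF m(1)] marginal_prob[OF m(2)] ev_small[OF d']
    proof eventually_elim
      case (elim t)
      have P: "borel_prob X (\<alpha> t)" and Q: "borel_prob X (\<beta> t)" and t: "t \<noteq> 0" using elim(3,4) by auto
      have td: "\<bar>t\<bar> < d" "\<bar>t\<bar> < \<delta> / 3" using elim(5) by (auto simp: d'_def)
      have "\<bar>?V t / t\<^sup>2 - \<epsilon> * (gain \<alpha> \<beta> \<phi> \<psi> t / t\<^sup>2)\<bar> \<le> \<epsilon> * (9 * e\<^sup>2 / \<delta>)"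
      proof (rule OT_bounds[where \<alpha>=\<alpha> and \<beta>=\<beta> and t=t, OF P Q S t])
        show "\<bar>((\<integral>x. tilted_kernel \<phi> \<psi> t x y \<partial>\<alpha> t) - 1) / t\<bar> \<le> e" if y: "y \<in> X" for y
          using bspec[OF elim(1) y] r1[OF y] by (simp add: dist_real_def)
        show "\<bar>((\<integral>y. tilted_kernel \<psi> \<phi> t y x \<partial>\<beta> t) - 1) / t\<bar> \<le> e" if x: "x \<in> X" for x
          using bspec[OF elim(2) x] r2[OF x] by (simp add: dist_real_def)
        show "\<delta> \<le> tilted_kernel \<phi> \<psi> t x y" if "x \<in> X" "y \<in> X" for x y by (rule \<delta>(3)[OF td(1) that])
        have "e * \<bar>t\<bar> \<le> \<bar>t\<bar>" using e by (simp add: mult_left_le_one_le)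
        then show "3 * (e * \<bar>t\<bar>) < \<delta>" using td(2) by linarith
      qed
      then show ?case using le by simp
    qed
  qed
  from tendsto_add[OF this tendsto_mult[OF tendsto_const[of \<epsilon>] g]] show ?thesis by simp
qed

text \<open>Here \<open>k\<close> is itself a coupling density, so both duality bounds hold with
  marginal error 0 and coincide.\<close>

lemma OT_mu: "real_of_ereal (OT \<epsilon> c \<mu> \<mu>) = 2 * (\<integral>x. f x \<partial>\<mu>)"
proof -
  have kg: "gibbs \<epsilon> c f f x y = k x y" for x y by (simp add: gibbs_def k_eq)
  obtain \<delta> where \<delta>: "\<delta> > 0" "\<And>x y. x \<in> X \<Longrightarrow> y \<in> X \<Longrightarrow> \<delta> \<le> k x y" by (rule k_lower) blast
  have "(\<integral>y. \<integral>x. k x y \<partial>\<mu> \<partial>\<mu>) = 1"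
    using borel_prob_cong[OF mu_prob k_int] prob_space.prob_space[OF borel_prob_prob_space[OF mu_prob]] by simp
  then have dv: "dual_value \<epsilon> c \<mu> \<mu> f f = 2 * (\<integral>x. f x \<partial>\<mu>)"
    by (simp add: dual_value_def kg borel_prob_Fubini(1)[OF X mu_prob mu_prob kc])
  have r: "(\<integral>y. k x y \<partial>\<mu>) = 1" if x: "x \<in> X" for x
    using borel_prob_cong[OF mu_prob, of "\<lambda>y. k x y" "\<lambda>y. k y x"] k_sym[OF x] k_int[OF x] by simp
  have lo: "ereal (dual_value \<epsilon> c \<mu> \<mu> f f) \<le> OT \<epsilon> c \<mu> \<mu>"
    by (rule OT_ge_dual_value[OF X mu_prob mu_prob c f f \<epsilon>])
  have hi: "OT \<epsilon> c \<mu> \<mu> \<le> ereal (dual_value \<epsilon> c \<mu> \<mu> f f + \<epsilon> * (9 * 0\<^sup>2 / \<delta>))"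
    by (rule OT_le_dual_value[OF X mu_prob mu_prob c f f \<epsilon>]) (use \<delta> r k_int in \<open>simp_all add: kg\<close>)
  show ?thesis using real_of_ereal_between[OF lo hi] dv by simp
qed

text \<open>In the expanded square, each pure square loses the kernel on integration because
  \<open>k\<close> has both marginals equal to \<mu>; only the mixed product still sees
  \<open>K\<close>.\<close>

lemma cross_term:
  assumes S: "\<phi> \<in> S" "\<psi> \<in> S"
  shows "(\<integral>y. \<integral>x. (\<phi> x + \<psi> y)\<^sup>2 / 2 * k x y \<partial>\<mu> \<partial>\<mu>) =
    ((\<integral>x. \<phi> x * \<phi> x \<partial>\<mu>) + (\<integral>x. \<psi> x * \<psi> x \<partial>\<mu>)) / 2 + (\<integral>y. \<psi> y * K \<phi> y \<partial>\<mu>)"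
proof -
  have SS: "(\<lambda>x. \<phi> x * \<phi> x) \<in> S" "(\<lambda>x. \<psi> x * \<psi> x) \<in> S" using S S_mult by auto
  have KS: "K (\<lambda>x. \<phi> x * \<phi> x) \<in> S" "(\<lambda>y. \<psi> y * K \<phi> y) \<in> S"
    using K_S[OF S_cont[OF SS(1)]] S_mult[OF S(2) K_S[OF S_cont[OF S(1)]]] by auto
  have "(\<integral>x. (\<phi> x + \<psi> y)\<^sup>2 / 2 * k x y \<partial>\<mu>) = (K (\<lambda>x. \<phi> x * \<phi> x) y + \<psi> y * \<psi> y) / 2 + \<psi> y * K \<phi> y"
    if y: "y \<in> X" for y
  proof -
    note kk = continuous_on_slice1[OF kc y]
    have i: "integrable \<mu> (\<lambda>x. \<phi> x * \<phi> x * k x y)" "integrable \<mu> (\<lambda>x. \<phi> x * k x y)" "integrable \<mu> (\<lambda>x. k x y)"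
      by (intro borel_prob_integrable[OF X mu_prob] continuous_on_mult S_cont S kk)+
    have "(\<phi> x + \<psi> y)\<^sup>2 / 2 * k x y = \<phi> x * \<phi> x * k x y / 2 + \<psi> y * \<psi> y / 2 * k x y + \<psi> y * (\<phi> x * k x y)" for x
      by (simp add: power2_eq_square field_simps)
    then show ?thesis using i k_int[OF y] by (simp add: K_def add_divide_distrib)
  qed
  then have "(\<integral>y. \<integral>x. (\<phi> x + \<psi> y)\<^sup>2 / 2 * k x y \<partial>\<mu> \<partial>\<mu>) =
    (\<integral>y. (K (\<lambda>x. \<phi> x * \<phi> x) y + \<psi> y * \<psi> y) / 2 + \<psi> y * K \<phi> y \<partial>\<mu>)"
    by (rule borel_prob_cong[OF mu_prob])
  also have "\<dots> = ((\<integral>y. K (\<lambda>x. \<phi> x * \<phi> x) y \<partial>\<mu>) + (\<integral>x. \<psi> x * \<psi> x \<partial>\<mu>)) / 2 + (\<integral>y. \<psi> y * K \<phi> y \<partial>\<mu>)"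
    using borel_prob_integrable[OF X mu_prob S_cont[OF KS(1)]] borel_prob_integrable[OF X mu_prob S_cont[OF KS(2)]]
      borel_prob_integrable[OF X mu_prob S_cont[OF SS(2)]] by simp
  finally show ?thesis by (simp add: integral_K[OF S_cont[OF SS(1)]])
qed

theorem sinkhorn_limit:
  assumes w: "w \<in> S" and eq: "\<And>y. y \<in> X \<Longrightarrow> w y - K (K w) y = HL y + a"
  shows "((\<lambda>t. sinkhorn_div \<epsilon> c \<mu> (M t) / t\<^sup>2) \<longlongrightarrow> \<epsilon> / 2 * L w) (at 0)"
proof -
  note wc = S_cont[OF w]
  have Kw: "K w \<in> S" by (rule K_S[OF wc])
  have KKw: "K (K w) \<in> S" by (rule K_S[OF S_cont[OF Kw]])
  note int = borel_prob_integrable[OF X mu_prob S_cont]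
  \<comment> \<open>Both \<open>K\<close> and the identity preserve the integral against \<mu>, and
    \<open>HL\<close> has mean 0, so no constant can be left over.\<close>
  have a: "a = 0"
  proof -
    have "(\<integral>y. w y - K (K w) y \<partial>\<mu>) = (\<integral>y. HL y + a \<partial>\<mu>)" by (rule borel_prob_cong[OF mu_prob eq])
    then show ?thesis
      using int[OF w] int[OF KKw] int[OF HL_S] integral_K[OF wc] integral_K[OF S_cont[OF Kw]] integral_HL
        int[OF S_const[of a]] prob_space.prob_space[OF borel_prob_prob_space[OF mu_prob]]
      by simp
  qed
  have eq: "w y - K (K w) y = HL y" if "y \<in> X" for y using eq[OF that] a by simp
  have K_lin: "K (\<lambda>x. r * \<phi> x + s * \<psi> x) y = r * K \<phi> y + s * K \<psi> y" if "\<phi> \<in> S" "\<psi> \<in> S" "y \<in> X" for \<phi> \<psi> r s y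
  proof -
    have "integrable \<mu> (\<lambda>x. \<phi> x * k x y)" "integrable \<mu> (\<lambda>x. \<psi> x * k x y)"
      by (intro borel_prob_integrable[OF X mu_prob] continuous_on_mult S_cont that continuous_on_slice1[OF kc])+
    then show ?thesis by (simp add: K_def distrib_right mult.assoc)
  qed
  define \<phi> where "\<phi> x = - w x" for x
  \<comment> \<open>Since \<open>h + K h = K (K w) - w\<close>, the same \<open>w\<close> also
    solves the symmetric problem, and only one resolvent is needed.\<close>
  define h where "h x = K w x - w x" for x
  have \<phi>S: "\<phi> \<in> S" using S_scale[OF w, of "-1"] by (simp add: \<phi>_def[abs_def])
  have hS: "h \<in> S" using S_diff[OF Kw w] by (simp add: h_def[abs_def])
  have K\<phi>: "K \<phi> y = - K w y" if "y \<in> X" for y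
    using K_lin[OF w w that, of "-1" 0] by (simp add: \<phi>_def[abs_def])
  have Kh: "K h y = K (K w) y - K w y" if "y \<in> X" for y
    using K_lin[OF Kw w that, of 1 "-1"] by (simp add: h_def[abs_def])
  have hHL: "K h y + h y + HL y = 0" if "y \<in> X" for y
    using Kh[OF that] eq[OF that] by (simp add: h_def)
  have pw: "(\<integral>y. w y * HL y \<partial>\<mu>) = L (K w)" by (rule pairing[OF wc])
  have wHL: "(\<integral>y. w y * HL y \<partial>\<mu>) = (\<integral>y. w y * w y \<partial>\<mu>) - (\<integral>y. K w y * K w y \<partial>\<mu>)"
  proof -
    have "(\<integral>y. w y * HL y \<partial>\<mu>) = (\<integral>y. w y * w y - w y * K (K w) y \<partial>\<mu>)"
    proof (rule borel_prob_cong[OF mu_prob])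
      fix y assume "y \<in> X"
      then show "w y * HL y = w y * w y - w y * K (K w) y" by (simp add: eq[symmetric] right_diff_distrib)
    qed
    also have "\<dots> = (\<integral>y. w y * w y \<partial>\<mu>) - (\<integral>y. w y * K (K w) y \<partial>\<mu>)"
      using int[OF S_mult[OF w w]] int[OF S_mult[OF w KKw]] by simp
    also have "(\<integral>y. w y * K (K w) y \<partial>\<mu>) = (\<integral>y. K w y * K w y \<partial>\<mu>)"
      by (rule K_symmetric[OF S_cont[OF Kw] wc])
    finally show ?thesis .
  qed
  \<comment> \<open>The linear pairing contributes \<open>L (K w)\<close>. The quadratic part is
    half the difference of the integrals of w^2 and (K w)^2, which is half of \<open>L (K w)\<close>
    by \<open>wHL\<close> and \<open>pw\<close>.\<close>
  have G1: "((\<lambda>t. gain (\<lambda>t. \<mu>) M \<phi> (K w) t / t\<^sup>2) \<longlongrightarrow> L (K w) / 2) (at 0)"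
  proof -
    have "\<forall>\<^sub>F t in at 0. 0 = ((\<integral>y. \<integral>x. k x y \<partial>\<mu> \<partial>M t) - 1) / t\<^sup>2"
      using ev_prob
    proof eventually_elim
      case (elim t)
      then show ?case
        using borel_prob_cong[of X "M t", OF _ k_int] prob_space.prob_space[OF borel_prob_prob_space[of X "M t"]] by simp
    qed
    then have \<kappa>: "((\<lambda>t. ((\<integral>y. \<integral>x. k x y \<partial>\<mu> \<partial>M t) - 1) / t\<^sup>2) \<longlongrightarrow> 0) (at 0)"
      by (rule Lim_transform_eventually[OF tendsto_const])
    have c1: "(\<integral>x. \<phi> x * HL x \<partial>\<mu>) = - L (K w)" using pw by (simp add: \<phi>_def)
    have c2: "(\<integral>y. K w y * K \<phi> y \<partial>\<mu>) = - (\<integral>y. K w y * K w y \<partial>\<mu>)"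
      using borel_prob_cong[OF mu_prob, of "\<lambda>y. K w y * K \<phi> y" "\<lambda>y. - (K w y * K w y)"] K\<phi> by simp
    have c3: "(\<integral>x. \<phi> x * \<phi> x \<partial>\<mu>) = (\<integral>y. w y * w y \<partial>\<mu>)" by (simp add: \<phi>_def)
    have e: "- 0 - (\<integral>x. \<phi> x * HL x \<partial>\<mu>) - (\<integral>y. K w y * 0 \<partial>\<mu>) - (\<integral>y. \<integral>x. (\<phi> x + K w y)\<^sup>2 / 2 * k x y \<partial>\<mu> \<partial>\<mu>) = L (K w) / 2"
      unfolding cross_term[OF \<phi>S Kw] c1 c2 c3 using wHL pw by (simp add: field_simps)
    show ?thesis using gain_lim[OF first_variation_const first_variation_M \<phi>S Kw \<kappa>] unfolding e .
  qed
  \<comment> \<open>By \<open>hHL\<close> the quadratic part cancels one of the two linear pairings.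
    What remains is \<open>- L HL - L (K h)\<close>, and applying \<open>L\<close> to
    \<open>hHL\<close> identifies it with \<open>L h\<close>.\<close>
  have G2: "((\<lambda>t. gain M M h h t / t\<^sup>2) \<longlongrightarrow> L (K w) - L w) (at 0)"
  proof -
    have p: "(\<integral>x. h x * HL x \<partial>\<mu>) = L (K h)" by (rule pairing[OF S_cont[OF hS]])
    have "(\<integral>x. h x * HL x \<partial>\<mu>) = (\<integral>x. - (h x * K h x) - h x * h x \<partial>\<mu>)"
    proof (rule borel_prob_cong[OF mu_prob])
      fix x assume "x \<in> X"
      then have "HL x = - K h x - h x" using hHL[of x] by linarith
      then show "h x * HL x = - (h x * K h x) - h x * h x" by (simp add: right_diff_distrib)
    qed
    also have "\<dots> = - (\<integral>x. h x * K h x \<partial>\<mu>) - (\<integral>x. h x * h x \<partial>\<mu>)"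
      using int[OF S_mult[OF hS hS]] int[OF S_mult[OF hS K_S[OF S_cont[OF hS]]]] by simp
    finally have q: "(\<integral>x. h x * HL x \<partial>\<mu>) = - (\<integral>x. h x * K h x \<partial>\<mu>) - (\<integral>x. h x * h x \<partial>\<mu>)" .
    have "L (\<lambda>x. (-1) * HL x + (-1) * K h x) = L h"
    proof (rule L_cong)
      fix x assume "x \<in> X"
      then show "- 1 * HL x + - 1 * K h x = h x" using hHL[of x] by simp
    qed
    then have r: "- L HL - L (K h) = L h"
      using L_linear[OF HL_S K_S[OF S_cont[OF hS]], of "-1" "-1"] by simp
    have "L h = L (K w) - L w" using L_linear[OF Kw w, of 1 "-1"] by (simp add: h_def[abs_def])
    then have "- L HL - (\<integral>x. h x * HL x \<partial>\<mu>) - (\<integral>x. h x * HL x \<partial>\<mu>)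
      - (\<integral>y. \<integral>x. (h x + h y)\<^sup>2 / 2 * k x y \<partial>\<mu> \<partial>\<mu>) = L (K w) - L w"
      unfolding cross_term[OF hS hS] using p q r by simp
    then show ?thesis using gain_lim[OF first_variation_M first_variation_M hS hS second_variation] by simp
  qed
  have V1: "((\<lambda>t. (real_of_ereal (OT \<epsilon> c \<mu> (M t)) - (\<integral>x. f x \<partial>\<mu>) - (\<integral>x. f x \<partial>M t)) / t\<^sup>2) \<longlongrightarrow> \<epsilon> * (L (K w) / 2)) (at 0)"
  proof (rule OT_lim[OF first_variation_const first_variation_M \<phi>S Kw _ _ G1])
    show "K \<phi> y + K w y + 0 = 0" if "y \<in> X" for y using K\<phi>[OF that] by simp
    show "K (K w) x + \<phi> x + HL x = 0" if "x \<in> X" for x using eq[OF that] by (simp add: \<phi>_def)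
  qed
  have V2: "((\<lambda>t. (real_of_ereal (OT \<epsilon> c (M t) (M t)) - (\<integral>x. f x \<partial>M t) - (\<integral>x. f x \<partial>M t)) / t\<^sup>2) \<longlongrightarrow> \<epsilon> * (L (K w) - L w)) (at 0)"
    by (rule OT_lim[OF first_variation_M first_variation_M hS hS _ _ G2]) (use hHL in auto)
  have "((\<lambda>t. (real_of_ereal (OT \<epsilon> c \<mu> (M t)) - (\<integral>x. f x \<partial>\<mu>) - (\<integral>x. f x \<partial>M t)) / t\<^sup>2
    - (real_of_ereal (OT \<epsilon> c (M t) (M t)) - (\<integral>x. f x \<partial>M t) - (\<integral>x. f x \<partial>M t)) / t\<^sup>2 / 2)
    \<longlongrightarrow> \<epsilon> * (L (K w) / 2) - \<epsilon> * (L (K w) - L w) / 2) (at 0)"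
    by (intro tendsto_diff V1 tendsto_divide V2 tendsto_const) simp
  \<comment> \<open>The integrals of \<open>f\<close>, which carry everything of order below t^2,
    cancel between the three transport costs.\<close>
  moreover have "(\<lambda>t. (real_of_ereal (OT \<epsilon> c \<mu> (M t)) - (\<integral>x. f x \<partial>\<mu>) - (\<integral>x. f x \<partial>M t)) / t\<^sup>2
    - (real_of_ereal (OT \<epsilon> c (M t) (M t)) - (\<integral>x. f x \<partial>M t) - (\<integral>x. f x \<partial>M t)) / t\<^sup>2 / 2)
    = (\<lambda>t. sinkhorn_div \<epsilon> c \<mu> (M t) / t\<^sup>2)"
    unfolding sinkhorn_div_def OT_mu by (rule ext) (simp add: diff_divide_distrib)
  moreover have "\<epsilon> * (L (K w) / 2) - \<epsilon> * (L (K w) - L w) / 2 = \<epsilon> / 2 * L w" by (simp add: field_simps)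
  ultimately show ?thesis by (simp only:)
qed

end

section \<open>The Hessian form\<close>

context sinkhorn_path
begin

lemma K_shift:
  assumes "\<And>x. x \<in> X \<Longrightarrow> \<phi> x = \<psi> x + b" "continuous_on X \<psi>" "y \<in> X"
  shows "K \<phi> y = K \<psi> y + b"
proof -
  note kk = continuous_on_slice1[OF kc assms(3)]
  have "K \<phi> y = (\<integral>x. \<psi> x * k x y + b * k x y \<partial>\<mu>)"
    unfolding K_def by (rule borel_prob_cong[OF mu_prob]) (simp add: assms(1) distrib_right)
  also have "\<dots> = K \<psi> y + b"
    using borel_prob_integrable[OF X mu_prob continuous_on_mult[OF assms(2) kk]]
      borel_prob_integrable[OF X mu_prob kk] by (simp add: K_def k_int assms(3))
  finally show ?thesis .
qed

lemma equiv_const_rel: "equiv F (const_rel X F)"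
proof (rule equivI)
  show "const_rel X F \<subseteq> F \<times> F" by (auto simp: const_rel_def)
  show "refl_on F (const_rel X F)" by (auto simp: refl_on_def const_rel_def intro: exI[of _ 0])
  show "sym (const_rel X F)"
  proof (rule symI)
    fix \<phi> \<psi> assume "(\<phi>, \<psi>) \<in> const_rel X F"
    then obtain a where a: "\<phi> \<in> F" "\<psi> \<in> F" "\<forall>x\<in>X. \<phi> x = \<psi> x + a" by (auto simp: const_rel_def)
    then have "\<forall>x\<in>X. \<psi> x = \<phi> x + - a" by simp
    then show "(\<psi>, \<phi>) \<in> const_rel X F" using a(1,2) unfolding const_rel_def by blast
  qed
  show "trans (const_rel X F)"
  proof (rule transI)
    fix \<phi> \<psi> \<xi> assume "(\<phi>, \<psi>) \<in> const_rel X F" "(\<psi>, \<xi>) \<in> const_rel X F"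
    then have a: "\<phi> \<in> F" "\<xi> \<in> F" "\<exists>a. \<forall>x\<in>X. \<phi> x = \<psi> x + a" "\<exists>b. \<forall>x\<in>X. \<psi> x = \<xi> x + b"
      by (simp_all add: const_rel_def)
    obtain a where "\<forall>x\<in>X. \<phi> x = \<psi> x + a" using a(3) by blast
    moreover obtain b where "\<forall>x\<in>X. \<psi> x = \<xi> x + b" using a(4) by blast
    ultimately have "\<forall>x\<in>X. \<phi> x = \<xi> x + (b + a)" by simp
    then show "(\<phi>, \<xi>) \<in> const_rel X F" using a(1,2) unfolding const_rel_def by blast
  qed
qed

text \<open>It remains to give the quotient expression its meaning: the operator respects classes,
  it is injective on them so that \<open>the_inv_into\<close> returns the class of \<open>w\<close>,
  and \<open>L\<close> is constant on that class because it vanishes on constants.\<close>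

lemma hessian_limit:
  assumes SF': "S = F" and sp: "f = self_potential X \<epsilon> c \<mu>" and x0: "x0 \<in> X"
  shows "((\<lambda>t. sinkhorn_div \<epsilon> c \<mu> (M t) / t\<^sup>2) \<longlongrightarrow> \<epsilon> / 2 * hessian_form X F \<epsilon> c \<mu> L) (at 0)"
proof -
  have kk: "self_kernel X \<epsilon> c \<mu> = k" unfolding k_eq sp by (intro ext) (simp add: self_kernel_def)
  have Kop: "K_op X \<epsilon> c \<mu> = K" unfolding K_op_def kk by (intro ext) (simp add: K_def)
  have Hop: "H_op X \<epsilon> c \<mu> L = HL" unfolding H_op_def kk by (intro ext) (simp add: HL_def)
  have "\<exists>w a. continuous_on X w \<and> (\<forall>y\<in>X. w y - K (K w) y = HL y + a)"
    unfolding K_def[abs_def]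
    by (rule kernel_resolvent(1)[OF X x0 mu_prob kc _ _ S_cont[OF HL_S]]) (simp_all add: k_pos k_int)
  then obtain w0 a where w0: "continuous_on X w0" "\<And>y. y \<in> X \<Longrightarrow> w0 y - K (K w0) y = HL y + a" by blast
  \<comment> \<open>The resolvent yields only a continuous solution. Rewriting the solution through
    its own equation gains regularity, since \<open>HL\<close> is in \<open>S\<close> and
    \<open>K\<close> maps continuous functions into \<open>S\<close>.\<close>
  define w where "w y = HL y + a + K (K w0) y" for y
  have KK: "K (K \<phi>) \<in> S" if "continuous_on X \<phi>" for \<phi> by (rule K_S[OF S_cont[OF K_S[OF that]]])
  have wS: "w \<in> S" unfolding w_def[abs_def] by (intro S_add HL_S S_const KK w0(1))
  have ww0: "w y = w0 y + 0" if "y \<in> X" for y using w0(2)[OF that] by (simp add: w_def)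
  have "K w y = K w0 y + 0" if "y \<in> X" for y by (rule K_shift[OF ww0 w0(1) that])
  then have "K (K w) y = K (K w0) y + 0" if "y \<in> X" for y by (rule K_shift[OF _ S_cont[OF K_S[OF w0(1)]] that])
  then have weq: "w y - K (K w) y = HL y + a" if "y \<in> X" for y using ww0[OF that] w0(2)[OF that] that by simp
  define T where "T \<phi> y = \<phi> y - K (K \<phi>) y" for \<phi> y
  have TF: "T \<phi> \<in> F" if "\<phi> \<in> F" for \<phi>
    using S_diff[of \<phi> "K (K \<phi>)"] KK[OF F_cont[OF that]] that SF' by (simp add: T_def[abs_def])
  have T_shift: "T \<phi> y = T \<psi> y" if "\<And>x. x \<in> X \<Longrightarrow> \<phi> x = \<psi> x + b" "\<psi> \<in> F" "y \<in> X" for \<phi> \<psi> b y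
  proof -
    have "K \<phi> y = K \<psi> y + b" if "y \<in> X" for y by (rule K_shift[OF \<open>\<And>x. x \<in> X \<Longrightarrow> \<phi> x = \<psi> x + b\<close> F_cont[OF \<open>\<psi> \<in> F\<close>] that])
    then have "K (K \<phi>) y = K (K \<psi>) y + b" by (rule K_shift[OF _ S_cont[OF K_S[OF F_cont[OF that(2)]]] that(3)])
    then show ?thesis using that(1)[OF that(3)] by (simp add: T_def)
  qed
  define r where "r = const_rel X F"
  have eqv: "equiv F r" unfolding r_def by (rule equiv_const_rel)
  have rI: "(\<phi>, \<psi>) \<in> r" if "\<phi> \<in> F" "\<psi> \<in> F" "\<And>x. x \<in> X \<Longrightarrow> \<phi> x = \<psi> x + b" for \<phi> \<psi> b
    using that unfolding r_def const_rel_def by blast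
  have rE: "\<exists>b. \<forall>x\<in>X. \<phi> x = \<psi> x + b" "\<phi> \<in> F" "\<psi> \<in> F" if "(\<phi>, \<psi>) \<in> r" for \<phi> \<psi>
    using that unfolding r_def const_rel_def by blast+
  have qop: "quotient_op X F T (r `` {\<phi>}) = r `` {T \<phi>}" if \<phi>: "\<phi> \<in> F" for \<phi>
  proof -
    have "r `` {T \<psi>} = r `` {T \<phi>}" if "\<psi> \<in> r `` {\<phi>}" for \<psi>
    proof -
      have p: "(\<phi>, \<psi>) \<in> r" using that by simp
      obtain b where b: "\<forall>x\<in>X. \<phi> x = \<psi> x + b" using rE(1)[OF p] by blast
      have "(T \<psi>, T \<phi>) \<in> r"
        using T_shift[of \<phi> \<psi> b] b rE(3)[OF p] by (intro rI[of _ _ 0] TF \<phi> rE(3)[OF p]) simp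
      then show ?thesis by (rule equiv_class_eq[OF eqv])
    qed
    moreover have "\<phi> \<in> r `` {\<phi>}" using equiv_class_self[OF eqv \<phi>] .
    ultimately show ?thesis unfolding quotient_op_def r_def by blast
  qed
  have wF: "w \<in> F" using wS SF' by simp
  have HLF: "HL \<in> F" using HL_S SF' by simp
  have Tw: "r `` {T w} = r `` {HL}"
    by (rule equiv_class_eq[OF eqv rI[OF TF[OF wF] HLF, of a]]) (simp add: T_def weq)
  \<comment> \<open>Equal images mean that the residuals differ by a constant, which is the
    uniqueness half of \<open>kernel_resolvent\<close>.\<close>
  have inj: "inj_on (quotient_op X F T) (F // r)"
  proof (rule inj_onI)
    fix A B assume A: "A \<in> F // r" and B: "B \<in> F // r" and AB: "quotient_op X F T A = quotient_op X F T B"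
    obtain \<phi> where \<phi>: "A = r `` {\<phi>}" "\<phi> \<in> F" using A by (rule quotientE)
    obtain \<psi> where \<psi>: "B = r `` {\<psi>}" "\<psi> \<in> F" using B by (rule quotientE)
    have "r `` {T \<phi>} = r `` {T \<psi>}" using AB \<phi> \<psi> qop by simp
    then have "(T \<phi>, T \<psi>) \<in> r" using eq_equiv_class[OF _ eqv TF[OF \<psi>(2)]] by blast
    then obtain b where b: "\<And>x. x \<in> X \<Longrightarrow> T \<phi> x = T \<psi> x + b" using rE(1) by blast
    have "\<exists>b. \<forall>y\<in>X. \<phi> y = \<psi> y + b"
    proof (rule kernel_resolvent(2)[OF X x0 mu_prob kc _ _ F_cont[OF \<phi>(2)] F_cont[OF \<psi>(2)], of b])
      fix y assume "y \<in> X"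
      from b[OF this] show "\<phi> y - (\<integral>x. (\<integral>x'. \<phi> x' * k x' x \<partial>\<mu>) * k x y \<partial>\<mu>) =
        \<psi> y - (\<integral>x. (\<integral>x'. \<psi> x' * k x' x \<partial>\<mu>) * k x y \<partial>\<mu>) + b"
        unfolding T_def K_def .
    qed (simp_all add: k_pos k_int)
    then obtain b' where "\<forall>y\<in>X. \<phi> y = \<psi> y + b'" by blast
    then have "(\<phi>, \<psi>) \<in> r" using \<phi>(2) \<psi>(2) by (intro rI[of _ _ b']) auto
    then show "A = B" unfolding \<phi>(1) \<psi>(1) by (rule equiv_class_eq[OF eqv])
  qed
  have "the_inv_into (F // r) (quotient_op X F T) (r `` {HL}) = r `` {w}"
    using qop[OF wF] unfolding Tw by (rule the_inv_into_f_eq[OF inj _ quotientI[OF wF]])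
  moreover have "quotient_pairing L (r `` {w}) = L w"
  proof -
    have Lc: "L \<phi> = L w" if "\<phi> \<in> r `` {w}" for \<phi>
    proof -
      have p: "(w, \<phi>) \<in> r" using that by simp
      obtain b where b: "\<forall>x\<in>X. w x = \<phi> x + b" using rE(1)[OF p] by blast
      have "L w = L (\<lambda>x. 1 * \<phi> x + b * 1)" by (rule L_cong) (simp add: b)
      also have "\<dots> = L \<phi> + b * L (\<lambda>x. 1)"
        using L_linear[of \<phi> "\<lambda>x. 1" 1 b] rE(3)[OF p] S_const[of 1] SF' by simp
      finally show ?thesis by (simp add: L_const)
    qed
    have "L w \<in> L ` (r `` {w})" by (rule imageI[OF equiv_class_self[OF eqv wF]])
    moreover have "L ` (r `` {w}) \<subseteq> {L w}" by (rule image_subsetI) (simp only: Lc singletonI)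
    ultimately have "L ` (r `` {w}) = {L w}" by (intro equalityI) (simp_all only: insert_subset empty_subsetI simp_thms)
    then show ?thesis by (simp add: quotient_pairing_def)
  qed
  moreover have "(\<lambda>\<phi> y. \<phi> y - K_op X \<epsilon> c \<mu> (K_op X \<epsilon> c \<mu> \<phi>) y) = T" unfolding Kop by (intro ext) (simp add: T_def)
  ultimately have "hessian_form X F \<epsilon> c \<mu> L = L w" unfolding hessian_form_def Hop r_def by (simp only:)
  then show ?thesis using sinkhorn_limit[OF wS weq] by (simp only:)
qed

end

section \<open>The settings of continuous and of m times differentiable functions\<close>

lemma C0_norm_le: "X \<noteq> {} \<Longrightarrow> (\<And>x. x \<in> X \<Longrightarrow> \<bar>\<phi> x\<bar> \<le> e) \<Longrightarrow> C0_norm X \<phi> \<le> e"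
  unfolding C0_norm_def by (rule cSUP_least)

lemma self_kernel_symmetric:
  "(\<And>x y. x \<in> X \<Longrightarrow> y \<in> X \<Longrightarrow> c x y = c y x) \<Longrightarrow> x \<in> X \<Longrightarrow> y \<in> X \<Longrightarrow> self_kernel X \<epsilon> c \<mu> x y = self_kernel X \<epsilon> c \<mu> y x"
  by (simp add: self_kernel_def add.commute)

lemma continuous_on_self_kernel:
  assumes "continuous_on (X \<times> X) (\<lambda>(x, y). c x y)" "continuous_on X (self_potential X \<epsilon> c \<mu>)"
  shows "continuous_on (X \<times> X) (\<lambda>(x, y). self_kernel X \<epsilon> c \<mu> x y)"
  using continuous_on_gibbs[OF assms(1,2,2), of \<epsilon>] by (simp add: gibbs_def self_kernel_def)

theorem sinkhorn_hessian_C0: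
  fixes X :: "'a::metric_space set"
  assumes X: "compact X" and c: "continuous_on (X \<times> X) (\<lambda>(x, y). c x y)" and \<epsilon>: "\<epsilon> > 0"
    and sym: "\<And>x y. x \<in> X \<Longrightarrow> y \<in> X \<Longrightarrow> c x y = c y x"
    and \<tau>: "\<tau> > 0" and M: "perturbation X (C0 X) (C0_norm X) \<tau> M"
  shows "((\<lambda>t. sinkhorn_div \<epsilon> c (M 0) (M t) / t\<^sup>2) \<longlongrightarrow>
    \<epsilon> / 2 * hessian_form X (C0 X) \<epsilon> c (M 0) (path_deriv M 0)) (at 0)"
proof -
  have P: "borel_prob X (M 0)" using perturbation_borel_prob[OF M, of 0] \<tau> by simp
  have ne: "X \<noteq> {}" using prob_space.not_empty[OF borel_prob_prob_space[OF P]] borel_prob_space[OF P] by simp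
  then obtain x0 where x0: "x0 \<in> X" by blast
  note sp = self_potential[OF X x0 P c \<epsilon>]
  note kc = continuous_on_self_kernel[OF c sp(1)]
  have lip: "\<exists>d>0. \<forall>y\<in>X. \<forall>y'\<in>X. dist y y' < d \<longrightarrow> C0_norm X (\<lambda>x. G x y - G x y') < e"
    if G: "continuous_on (X \<times> X) (\<lambda>(x, y). G x y)" and e: "e > 0" for G :: "'a \<Rightarrow> 'a \<Rightarrow> real" and e
  proof -
    have e2: "e / 2 > 0" using e by simp
    obtain d where d: "d > 0" "\<And>x x' y y'. x \<in> X \<Longrightarrow> x' \<in> X \<Longrightarrow> y \<in> X \<Longrightarrow> y' \<in> X \<Longrightarrow> dist x x' < d \<Longrightarrow> dist y y' < d
       \<Longrightarrow> \<bar>G x y - G x' y'\<bar> < e / 2" by (rule compact_slices_equicontinuous[OF X G e2]) blast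
    have "C0_norm X (\<lambda>x. G x y - G x y') < e" if "y \<in> X" "y' \<in> X" "dist y y' < d" for y y'
    proof -
      have "C0_norm X (\<lambda>x. G x y - G x y') \<le> e / 2"
        using d(2)[OF _ _ that(1,2) _ that(3)] d(1) by (intro C0_norm_le ne) (simp add: less_imp_le)
      then show ?thesis using e by simp
    qed
    then show ?thesis using d(1) by blast
  qed
  have N0: "C0_norm X (\<lambda>x. 0) \<le> 0" by (rule C0_norm_le[OF ne]) simp
  have ud: "uniform_limit X (\<lambda>t y. ((\<integral>x. G x y \<partial>M t) - (\<integral>x. G x y \<partial>M 0)) / t) (\<lambda>y. path_deriv M 0 (\<lambda>x. G x y)) (at 0)"
    if G: "continuous_on (X \<times> X) (\<lambda>(x, y). G x y)" for G
    by (rule uniform_path_derivative[OF X M \<tau> _ lip[OF G] N0]) (simp add: C0_def continuous_on_slice1[OF G])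
  interpret sinkhorn_path X "C0 X" "C0_norm X" \<tau> M "C0 X" "{G. continuous_on (X \<times> X) (\<lambda>(x, y). G x y)}"
    "self_kernel X \<epsilon> c (M 0)" c "self_potential X \<epsilon> c (M 0)" \<epsilon>
  proof
    fix G :: "'a \<Rightarrow> 'a \<Rightarrow> real" assume "G \<in> {G. continuous_on (X \<times> X) (\<lambda>(x, y). G x y)}"
    then have G: "continuous_on (X \<times> X) (\<lambda>(x, y). G x y)" by simp
    show "continuous_on (X \<times> X) (\<lambda>(x, y). G x y)" by (rule G)
    show "(\<lambda>x y. G y x) \<in> {G. continuous_on (X \<times> X) (\<lambda>(x, y). G x y)}" using continuous_on_swap2[OF G] by simp
    show "(\<lambda>x. G x y) \<in> C0 X" if "y \<in> X" for y using continuous_on_slice1[OF G that] by (simp add: C0_def)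
    show "\<exists>d>0. \<forall>y\<in>X. \<forall>y'\<in>X. dist y y' < d \<longrightarrow> C0_norm X (\<lambda>x. G x y - G x y') < e" if "e > 0" for e by (rule lip[OF G that])
    show "(\<lambda>y. \<integral>x. \<phi> x * G x y \<partial>P) \<in> C0 X" if "borel_prob X P" "continuous_on X \<phi>" for P \<phi>
      using continuous_on_kernel_integral[OF X that(1) G that(2)] by (simp add: C0_def)
    \<comment> \<open>The path derivative on slices is a uniform limit of these continuous
      quotients, hence continuous.\<close>
    have cq: "\<forall>\<^sub>F t in at 0. continuous_on X (\<lambda>y. ((\<integral>x. G x y \<partial>M t) - (\<integral>x. G x y \<partial>M 0)) / t)"
      unfolding eventually_at
    proof (intro exI[of _ \<tau>] conjI \<tau> ballI impI)
      fix t :: real assume "t \<noteq> 0 \<and> dist t 0 < \<tau>"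
      then have Pt: "borel_prob X (M t)" by (intro perturbation_borel_prob[OF M]) simp
      show "continuous_on X (\<lambda>y. ((\<integral>x. G x y \<partial>M t) - (\<integral>x. G x y \<partial>M 0)) / t)" unfolding divide_inverse
        by (intro continuous_on_mult continuous_on_diff continuous_on_const continuous_on_integral_param[OF X Pt G]
            continuous_on_integral_param[OF X P G])
    qed
    show "(\<lambda>y. path_deriv M 0 (\<lambda>x. G x y)) \<in> C0 X"
      using uniform_limit_theorem[OF cq ud[OF G]] by (simp add: C0_def)
    show "\<forall>\<^sub>F t in at 0. C0_norm X (\<lambda>y. ((\<integral>x. G x y \<partial>M t) - (\<integral>x. G x y \<partial>M 0)) / t - path_deriv M 0 (\<lambda>x. G x y)) < e"
      if e: "e > 0" for e
    proof -
      have "e / 2 > 0" using e by simp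
      from uniform_limitD[OF ud[OF G] this] show ?thesis
      proof eventually_elim
        case (elim t)
        have "C0_norm X (\<lambda>y. ((\<integral>x. G x y \<partial>M t) - (\<integral>x. G x y \<partial>M 0)) / t - path_deriv M 0 (\<lambda>x. G x y)) \<le> e / 2"
          using elim by (intro C0_norm_le ne) (simp add: dist_real_def less_imp_le)
        then show ?case using e by simp
      qed
    qed
  next
    fix G H :: "'a \<Rightarrow> 'a \<Rightarrow> real"
    assume G: "G \<in> {G. continuous_on (X \<times> X) (\<lambda>(x, y). G x y)}" and H: "H \<in> {G. continuous_on (X \<times> X) (\<lambda>(x, y). G x y)}"
    then have GH: "continuous_on (X \<times> X) (\<lambda>z. G (fst z) (snd z))" "continuous_on (X \<times> X) (\<lambda>z. H (fst z) (snd z))"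
      by (simp_all add: case_prod_unfold)
    show "(\<lambda>x y. G x y + H x y) \<in> {G. continuous_on (X \<times> X) (\<lambda>(x, y). G x y)}"
      using continuous_on_add[OF GH] by (simp add: case_prod_unfold)
    show "(\<lambda>x y. G x y * H x y) \<in> {G. continuous_on (X \<times> X) (\<lambda>(x, y). G x y)}"
      using continuous_on_mult[OF GH] by (simp add: case_prod_unfold)
  next
    show "self_kernel X \<epsilon> c (M 0) = (\<lambda>x y. exp ((self_potential X \<epsilon> c (M 0) x + self_potential X \<epsilon> c (M 0) y - c x y) / \<epsilon>))"
      by (intro ext) (simp add: self_kernel_def)
    show "self_kernel X \<epsilon> c (M 0) x y = self_kernel X \<epsilon> c (M 0) y x" if "x \<in> X" "y \<in> X" for x y
      by (rule self_kernel_symmetric[OF sym that])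
    show "(\<integral>x. self_kernel X \<epsilon> c (M 0) x y \<partial>M 0) = 1" if "y \<in> X" for y by (rule sp(2)[OF that])
    show "self_kernel X \<epsilon> c (M 0) \<in> {G. continuous_on (X \<times> X) (\<lambda>(x, y). G x y)}" using kc by simp
    show "(\<lambda>x y. \<phi> x) \<in> {G. continuous_on (X \<times> X) (\<lambda>(x, y). G x y)}" if "\<phi> \<in> C0 X" for \<phi>
      using continuous_on_fst2[of X \<phi> X] that by (simp add: C0_def)
    show "(\<lambda>x. \<phi> x + \<psi> x) \<in> C0 X" "(\<lambda>x. \<phi> x * \<psi> x) \<in> C0 X" if "\<phi> \<in> C0 X" "\<psi> \<in> C0 X" for \<phi> \<psi>
      using that by (simp_all add: C0_def continuous_on_add continuous_on_mult)
  qed (use X M \<tau> N0 \<epsilon> c sp(1) in \<open>simp_all add: C0_def\<close>)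
  show ?thesis by (rule hessian_limit[OF refl refl x0])
qed

lemma iter_diff_of_continuous_partials:
  fixes X :: "'b::euclidean_space set"
  shows "continuous_partials {w \<in> lists Basis. length w \<le> m} X \<phi> \<Longrightarrow> iter_diff X m \<phi>"
proof (induction m arbitrary: \<phi>)
  case 0
  show ?case by (rule iter_diff_I) (use 0 in \<open>simp_all add: continuous_partials_def\<close>)
next
  case (Suc m)
  show ?case
  proof (rule iter_diff_I)
    show "continuous_on X \<phi>" using Suc.prems by (simp add: continuous_partials_def)
    fix m' and a :: 'b assume m: "Suc m = Suc m'" and a: "a \<in> Basis"
    have w: "[a] \<in> {w \<in> lists Basis. length w \<le> Suc m}" using a by simp
    have W: "{w. w @ [a] \<in> {w \<in> lists Basis. length w \<le> Suc m}} = {w \<in> lists Basis. length w \<le> m}"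
      using a by auto
    obtain g where g: "dir_deriv X a \<phi> g" "continuous_partials {w \<in> lists Basis. length w \<le> m} X g"
      by (rule continuous_partials_step[OF Suc.prems w, unfolded W])
    show "\<exists>\<psi>. dir_deriv X a \<phi> \<psi> \<and> iter_diff X m' \<psi>" using g(1) Suc.IH[OF g(2)] m by (intro exI[of _ g]) simp
  qed
qed

lemma Cm_iff_iter_diff:
  assumes "X \<noteq> {}"
  shows "\<phi> \<in> Cm m X \<longleftrightarrow> iter_diff X m \<phi>"
proof
  assume "\<phi> \<in> Cm m X"
  then show "iter_diff X m \<phi>" unfolding Cm_def by (intro iter_diff_of_continuous_partials) simp
qed (rule iter_diff_in_Cm[OF _ assms])

lemma Cm_le_bound_closure:
  fixes X :: "'b::euclidean_space set" and \<phi> :: "'b \<Rightarrow> real"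
  assumes X: "compact X" "X \<subseteq> closure (interior X)" and \<phi>: "continuous_on X \<phi>" "Cm_le m X e \<phi>" and x: "x \<in> X"
  shows "\<bar>\<phi> x\<bar> \<le> e"
proof -
  have cl: "closure (interior X) = X"
    using X interior_subset closure_minimal[OF interior_subset compact_imp_closed[OF X(1)]] by (intro equalityI)
  have "norm (\<phi> x) \<le> e"
    by (rule continuous_on_closure_norm_le[of "interior X"]) (use cl \<phi>(1) x Cm_le_bound[OF \<phi>(2)] in simp_all)
  then show ?thesis by simp
qed

text \<open>The weight \<open>g\<close> is only required to be continuous. Together with
  \<open>Cm_functional_slices\<close> this is the smoothing property of integral operators with a
  C^(m,m) kernel.\<close>

lemma Cm_functional_integral:
  fixes X :: "'b::euclidean_space set"
  assumes X: "compact X" "X \<subseteq> closure (interior X)" and P: "borel_prob X P" and g: "continuous_on X g"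
  shows "Cm_functional X m (\<lambda>\<phi>. \<integral>x. g x * \<phi> x \<partial>P)"
  unfolding Cm_functional_def
proof (intro conjI allI impI)
  fix \<phi> \<psi> a b assume c: "iter_diff X m \<phi>" "iter_diff X m \<psi>"
  have i: "integrable P (\<lambda>x. g x * \<phi> x)" "integrable P (\<lambda>x. g x * \<psi> x)"
    by (rule borel_prob_integrable[OF X(1) P continuous_on_mult[OF g iter_diff_continuous[OF c(1)]]],
        rule borel_prob_integrable[OF X(1) P continuous_on_mult[OF g iter_diff_continuous[OF c(2)]]])
  have "g x * (a * \<phi> x + b * \<psi> x) = a * (g x * \<phi> x) + b * (g x * \<psi> x)" for x by (simp add: algebra_simps)
  then show "(\<integral>x. g x * (a * \<phi> x + b * \<psi> x) \<partial>P) = a * (\<integral>x. g x * \<phi> x \<partial>P) + b * (\<integral>x. g x * \<psi> x \<partial>P)"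
    using i by simp
next
  fix e :: real assume e: "e > 0"
  obtain B where B: "B > 0" "\<And>x. x \<in> X \<Longrightarrow> \<bar>g x\<bar> \<le> B" using compact_continuous_bound[OF X(1) g] by blast
  have "\<bar>\<integral>x. g x * \<phi> x \<partial>P\<bar> \<le> e" if \<phi>: "iter_diff X m \<phi>" "Cm_le m X (e / B) \<phi>" for \<phi>
  proof (rule borel_prob_integral_bounds(3)[OF X(1) P continuous_on_mult[OF g iter_diff_continuous[OF \<phi>(1)]]])
    fix x assume x: "x \<in> X"
    have "\<bar>g x * \<phi> x\<bar> \<le> B * (e / B)" unfolding abs_mult
      using B(2)[OF x] Cm_le_bound_closure[OF X iter_diff_continuous[OF \<phi>(1)] \<phi>(2) x] by (intro mult_mono) auto
    then show "\<bar>g x * \<phi> x\<bar> \<le> e" using B(1) by simp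
  qed
  then show "\<exists>d>0. \<forall>\<phi>. iter_diff X m \<phi> \<longrightarrow> Cm_le m X d \<phi> \<longrightarrow> \<bar>\<integral>x. g x * \<phi> x \<partial>P\<bar> \<le> e"
    using e B(1) by (intro exI[of _ "e / B"]) simp
qed

lemma Cm_functional_path_deriv:
  fixes X :: "'b::euclidean_space set"
  assumes ne: "interior X \<noteq> {}" and M: "perturbation X (Cm m X) (Cm_norm m X) \<tau> M" and \<tau>: "\<tau> > 0"
  shows "Cm_functional X m (path_deriv M 0)"
proof -
  have X0: "X \<noteq> {}" using ne interior_subset by blast
  have lin: "path_deriv M 0 (\<lambda>x. a * \<phi> x + b * \<psi> x) = a * path_deriv M 0 \<phi> + b * path_deriv M 0 \<psi>"
    if "iter_diff X m \<phi>" "iter_diff X m \<psi>" for \<phi> \<psi> a b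
    by (rule perturbation_linear[OF M]) (use \<tau> that X0 in \<open>simp_all add: Cm_iff_iter_diff\<close>)
  have z: "iter_diff X m (\<lambda>x. 0)" unfolding iter_diff_def by (rule iter_diff2_const)
  have L0: "path_deriv M 0 (\<lambda>x. 0) = 0" using lin[OF z z, of 0 0] by simp
  have "\<exists>d>0. \<forall>\<phi>. iter_diff X m \<phi> \<longrightarrow> Cm_le m X d \<phi> \<longrightarrow> \<bar>path_deriv M 0 \<phi>\<bar> \<le> e" if e: "e > 0" for e
  proof -
    have zF: "(\<lambda>x. 0) \<in> Cm m X" using z X0 by (simp add: Cm_iff_iter_diff)
    obtain d where d: "d > 0" "\<And>\<psi> s. \<psi> \<in> Cm m X \<Longrightarrow> Cm_norm m X (\<lambda>x. \<psi> x - 0) < d \<Longrightarrow> \<bar>s\<bar> < d \<Longrightarrow>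
      \<bar>path_deriv M s \<psi> - path_deriv M 0 (\<lambda>x. 0)\<bar> < e"
      by (rule perturbation_jointly_continuous[OF M \<tau> zF e]) blast
    \<comment> \<open>Half of \<open>d\<close> is used because \<open>Cm_le\<close> yields only a
      weak inequality for the norm.\<close>
    have "\<bar>path_deriv M 0 \<phi>\<bar> \<le> e" if \<phi>: "iter_diff X m \<phi>" "Cm_le m X (d / 2) \<phi>" for \<phi>
    proof -
      have "Cm_norm m X \<phi> < d" using Cm_le_norm[OF \<phi>(2) ne] d(1) by simp
      then show ?thesis using d(2)[of \<phi> 0] d(1) \<phi>(1) X0 L0 by (simp add: Cm_iff_iter_diff)
    qed
    then show ?thesis using d(1) by (intro exI[of _ "d / 2"]) simp
  qed
  then show ?thesis using lin by (simp add: Cm_functional_def)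
qed

lemma Cm_norm_slices:
  fixes X :: "'b::euclidean_space set"
  assumes X: "compact X" and ne: "interior X \<noteq> {}" and G: "iter_diff2 X m n G" and e: "e > 0"
  shows "\<exists>d>0. \<forall>y\<in>X. \<forall>y'\<in>X. dist y y' < d \<longrightarrow> Cm_norm m X (\<lambda>x. G x y - G x y') < e"
proof -
  have e2: "e / 2 > 0" using e by simp
  obtain d where d: "d > 0" "\<forall>y y'. dist y y' < d \<longrightarrow> (y, y') \<in> X \<times> X \<longrightarrow>
      Cm_le m X (e / 2) (\<lambda>x. G x (fst (y, y')) - G x (snd (y, y')))"
    using iter_diff2_slices_continuous[OF X G e2] unfolding eventually_inf_principal eventually_uniformity_metric by blast
  have "Cm_norm m X (\<lambda>x. G x y - G x y') < e" if "y \<in> X" "y' \<in> X" "dist y y' < d" for y y'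
  proof -
    have "Cm_le m X (e / 2) (\<lambda>x. G x y - G x y')" using d(2) that by simp
    then show ?thesis using Cm_le_norm[OF _ ne] e by fastforce
  qed
  then show ?thesis using d(1) by blast
qed

text \<open>A bootstrap through the defining equation. With \<open>a = exp (f / \<epsilon>)\<close>
  for the self-potential \<open>f\<close>, it reads
  \<open>a y = 1 / (\<integral>x. a x * \<kappa> x y \<partial>\<mu>)\<close>. The right side is C^m
  as soon as \<open>a\<close> is continuous, because the smoothness sits in the kernel
  \<kappa>.\<close>

lemma iter_diff2_self_kernel:
  fixes X :: "'b::euclidean_space set"
  assumes X: "compact X" "X \<subseteq> closure (interior X)" "x0 \<in> X" and P: "borel_prob X \<mu>" and \<epsilon>: "\<epsilon> > 0"
    and c: "iter_diff2 X m m c"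
  shows "iter_diff2 X m m (self_kernel X \<epsilon> c \<mu>)"
proof -
  have ne: "X \<noteq> {}" using X(3) by blast
  define a where "a x = exp (self_potential X \<epsilon> c \<mu> x / \<epsilon>)" for x
  define \<kappa> where "\<kappa> x y = exp ((- 1 / \<epsilon>) * c x y)" for x y
  have kk: "self_kernel X \<epsilon> c \<mu> x y = a x * a y * \<kappa> x y" for x y
  proof -
    have "(u + v - z) / \<epsilon> = u / \<epsilon> + v / \<epsilon> + (- 1 / \<epsilon>) * z" for u v z :: real
      by (simp add: add_divide_distrib diff_divide_distrib)
    then show ?thesis by (simp only: self_kernel_def a_def \<kappa>_def exp_add)
  qed
  note sp = self_potential[OF X(1,3) P iter_diff2_continuous[OF c] \<epsilon>]
  have ca: "continuous_on X a" unfolding a_def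
    by (intro continuous_on_exp continuous_on_divide sp(1) continuous_on_const) (use \<epsilon> in auto)
  have d\<kappa>: "iter_diff2 X m m \<kappa>" unfolding \<kappa>_def[abs_def] by (rule iter_diff2_exp[OF iter_diff2_scale[OF c]])
  have I: "iter_diff X m (\<lambda>y. \<integral>x. a x * \<kappa> x y \<partial>\<mu>)"
    by (rule Cm_functional_slices[OF X(1) Cm_functional_integral[OF X(1,2) P ca] d\<kappa>])
  have aI: "a y * (\<integral>x. a x * \<kappa> x y \<partial>\<mu>) = 1" if "y \<in> X" for y
  proof -
    have "(\<integral>x. self_kernel X \<epsilon> c \<mu> x y \<partial>\<mu>) = (\<integral>x. a y * (a x * \<kappa> x y) \<partial>\<mu>)"
      by (rule borel_prob_cong[OF P]) (simp add: kk)
    then show ?thesis using sp(2)[OF that] by simp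
  qed
  have nz: "(\<integral>x. a x * \<kappa> x y \<partial>\<mu>) \<noteq> 0" if "y \<in> X" for y using aI[OF that] by auto
  have ay: "inverse (\<integral>x. a x * \<kappa> x y \<partial>\<mu>) = a y" if "y \<in> X" for y
    using aI[OF that] by (metis inverse_unique mult.commute)
  have "iter_diff2 X m 0 (\<lambda>y _. inverse (\<integral>x. a x * \<kappa> x y \<partial>\<mu>))"
    by (rule iter_diff2_inverse[OF I[unfolded iter_diff_def]]) (rule nz)
  then have CRa: "iter_diff X m a" unfolding iter_diff_def by (rule iter_diff2_cong) (rule ay)
  have "iter_diff2 X m m (\<lambda>x y. a x * a y * \<kappa> x y)"
    by (rule iter_diff2_mult[OF iter_diff2_mult[OF iter_diff_lift[OF CRa ne] iter_diff2_swap[OF iter_diff_lift[OF CRa ne]]] d\<kappa>])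
  then show "iter_diff2 X m m (self_kernel X \<epsilon> c \<mu>)" by (rule iter_diff2_cong) (rule kk[symmetric])
qed

theorem sinkhorn_hessian_Cm:
  fixes X :: "'b::euclidean_space set"
  assumes X: "compact X" "X \<subseteq> closure (interior X)" and c: "iter_diff2 X m m c" and \<epsilon>: "\<epsilon> > 0"
    and sym: "\<And>x y. x \<in> X \<Longrightarrow> y \<in> X \<Longrightarrow> c x y = c y x"
    and \<tau>: "\<tau> > 0" and M: "perturbation X (Cm m X) (Cm_norm m X) \<tau> M"
  shows "((\<lambda>t. sinkhorn_div \<epsilon> c (M 0) (M t) / t\<^sup>2) \<longlongrightarrow>
    \<epsilon> / 2 * hessian_form X (Cm m X) \<epsilon> c (M 0) (path_deriv M 0)) (at 0)"
proof -
  have P: "borel_prob X (M 0)" using perturbation_borel_prob[OF M, of 0] \<tau> by simp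
  have ne: "X \<noteq> {}" using prob_space.not_empty[OF borel_prob_prob_space[OF P]] borel_prob_space[OF P] by simp
  then obtain x0 where x0: "x0 \<in> X" by blast
  have nei: "interior X \<noteq> {}" using X(2) ne by auto
  note cc = iter_diff2_continuous[OF c]
  note sp = self_potential[OF X(1) x0 P cc \<epsilon>]
  note Cm_iter_diff = Cm_iff_iter_diff[OF ne]
  note L = Cm_functional_path_deriv[OF nei M \<tau>]
  have N0: "Cm_norm m X (\<lambda>x. 0) \<le> 0"
  proof (rule Cm_le_norm[OF _ nei])
    show "Cm_le m X 0 (\<lambda>x. 0)" by (induction m) (auto simp: dir_deriv_def intro!: exI[of _ "\<lambda>x. 0"])
  qed
  have ud: "uniform_limit X (\<lambda>t y. ((\<integral>x. G x y \<partial>M t) - (\<integral>x. G x y \<partial>M 0)) / t) (\<lambda>y. path_deriv M 0 (\<lambda>x. G x y)) (at 0)"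
    if G: "iter_diff2 X m n G" for G n
    by (rule uniform_path_derivative[OF X(1) M \<tau> _ Cm_norm_slices[OF X(1) nei G] N0])
      (simp add: Cm_iter_diff iter_diff_slice[OF G])
  have \<Lambda>: "Cm_functional X m (\<lambda>\<phi>. ((\<integral>x. \<phi> x \<partial>M t) - (\<integral>x. \<phi> x \<partial>M 0)) / t - path_deriv M 0 \<phi>)" if t: "\<bar>t\<bar> < \<tau>" for t
  proof -
    have 1: "Cm_functional X m (\<lambda>\<phi>. \<integral>x. 1 * \<phi> x \<partial>M s)" if "\<bar>s\<bar> < \<tau>" for s
      by (rule Cm_functional_integral[OF X perturbation_borel_prob[OF M that] continuous_on_const])
    \<comment> \<open>The quotient minus its limit is written as an explicit linear combination of
      two integrals and the path derivative, each of them a continuous functional.\<close>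
    have "Cm_functional X m (\<lambda>\<phi>. 1 * ((1 / t) * (\<integral>x. 1 * \<phi> x \<partial>M t) + (- 1 / t) * (\<integral>x. 1 * \<phi> x \<partial>M 0)) + (- 1) * path_deriv M 0 \<phi>)"
      using \<tau> by (intro Cm_functional_lincomb 1 L t) simp
    then show ?thesis by (simp add: diff_divide_distrib)
  qed
  interpret sinkhorn_path X "Cm m X" "Cm_norm m X" \<tau> M "Cm m X" "{G. iter_diff2 X m m G}"
    "self_kernel X \<epsilon> c (M 0)" c "self_potential X \<epsilon> c (M 0)" \<epsilon>
  proof
    fix G :: "'b \<Rightarrow> 'b \<Rightarrow> real" assume "G \<in> {G. iter_diff2 X m m G}"
    then have G: "iter_diff2 X m m G" by simp
    show "continuous_on (X \<times> X) (\<lambda>(x, y). G x y)" by (rule iter_diff2_continuous[OF G])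
    show "(\<lambda>x y. G y x) \<in> {G. iter_diff2 X m m G}" using iter_diff2_swap[OF G] by simp
    show "(\<lambda>x. G x y) \<in> Cm m X" if "y \<in> X" for y using iter_diff_slice[OF G that] by (simp add: Cm_iter_diff)
    show "\<exists>d>0. \<forall>y\<in>X. \<forall>y'\<in>X. dist y y' < d \<longrightarrow> Cm_norm m X (\<lambda>x. G x y - G x y') < e" if "e > 0" for e
      by (rule Cm_norm_slices[OF X(1) nei G that])
    show "(\<lambda>y. \<integral>x. \<phi> x * G x y \<partial>P) \<in> Cm m X" if "borel_prob X P" "continuous_on X \<phi>" for P \<phi>
      using Cm_functional_slices[OF X(1) Cm_functional_integral[OF X that] G] by (simp add: Cm_iter_diff)
    show "(\<lambda>y. path_deriv M 0 (\<lambda>x. G x y)) \<in> Cm m X"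
      using Cm_functional_slices[OF X(1) L G] by (simp add: Cm_iter_diff)
    show "\<forall>\<^sub>F t in at 0. Cm_norm m X (\<lambda>y. ((\<integral>x. G x y \<partial>M t) - (\<integral>x. G x y \<partial>M 0)) / t - path_deriv M 0 (\<lambda>x. G x y)) < e"
      if e: "e > 0" for e
    proof -
      have e2: "e / 2 > 0" using e by simp
      \<comment> \<open>Uniform convergence of the quotients is known for every kernel, in
        particular for the \<open>y\<close>-derivatives of \<open>G\<close>, and so becomes
        convergence in C^m.\<close>
      have "\<forall>\<^sub>F t in at 0. Cm_le m X (e / 2) (\<lambda>y. ((\<integral>x. G x y \<partial>M t) - (\<integral>x. G x y \<partial>M 0)) / t - path_deriv M 0 (\<lambda>x. G x y))"
      proof (rule Cm_functionals_slices_small[OF X(1) _ e2 _ G,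
            where \<Lambda>="\<lambda>t \<phi>. ((\<integral>x. \<phi> x \<partial>M t) - (\<integral>x. \<phi> x \<partial>M 0)) / t - path_deriv M 0 \<phi>"])
        show "\<forall>\<^sub>F t in at 0. Cm_functional X m (\<lambda>\<phi>. ((\<integral>x. \<phi> x \<partial>M t) - (\<integral>x. \<phi> x \<partial>M 0)) / t - path_deriv M 0 \<phi>)"
          unfolding eventually_at by (intro exI[of _ \<tau>] conjI \<tau> ballI impI \<Lambda>) simp
        fix n H assume H: "iter_diff2 X m n H"
        show "\<forall>\<^sub>F t in at 0. \<forall>y\<in>X. \<bar>((\<integral>x. H x y \<partial>M t) - (\<integral>x. H x y \<partial>M 0)) / t - path_deriv M 0 (\<lambda>x. H x y)\<bar> \<le> e / 2"
          using uniform_limitD[OF ud[OF H] e2] by (rule eventually_mono) (simp add: dist_real_def less_imp_le)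
      qed
      then show ?thesis
      proof (rule eventually_mono)
        fix t assume "Cm_le m X (e / 2) (\<lambda>y. ((\<integral>x. G x y \<partial>M t) - (\<integral>x. G x y \<partial>M 0)) / t - path_deriv M 0 (\<lambda>x. G x y))"
        from Cm_le_norm[OF this nei] e2
        show "Cm_norm m X (\<lambda>y. ((\<integral>x. G x y \<partial>M t) - (\<integral>x. G x y \<partial>M 0)) / t - path_deriv M 0 (\<lambda>x. G x y)) < e" by linarith
      qed
    qed
  next
    fix G H :: "'b \<Rightarrow> 'b \<Rightarrow> real"
    assume "G \<in> {G. iter_diff2 X m m G}" "H \<in> {G. iter_diff2 X m m G}"
    then have GH: "iter_diff2 X m m G" "iter_diff2 X m m H" by simp_all
    show "(\<lambda>x y. G x y + H x y) \<in> {G. iter_diff2 X m m G}" using iter_diff2_add[OF GH] by simp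
    show "(\<lambda>x y. G x y * H x y) \<in> {G. iter_diff2 X m m G}" using iter_diff2_mult[OF GH] by simp
  next
    show "self_kernel X \<epsilon> c (M 0) = (\<lambda>x y. exp ((self_potential X \<epsilon> c (M 0) x + self_potential X \<epsilon> c (M 0) y - c x y) / \<epsilon>))"
      by (intro ext) (simp add: self_kernel_def)
    show "self_kernel X \<epsilon> c (M 0) x y = self_kernel X \<epsilon> c (M 0) y x" if "x \<in> X" "y \<in> X" for x y
      by (rule self_kernel_symmetric[OF sym that])
    show "(\<integral>x. self_kernel X \<epsilon> c (M 0) x y \<partial>M 0) = 1" if "y \<in> X" for y by (rule sp(2)[OF that])
    show "self_kernel X \<epsilon> c (M 0) \<in> {G. iter_diff2 X m m G}" using iter_diff2_self_kernel[OF X x0 P \<epsilon> c] by simp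
    show "(\<lambda>x y. \<phi> x) \<in> {G. iter_diff2 X m m G}" if "\<phi> \<in> Cm m X" for \<phi>
      using iter_diff_lift[of X m \<phi> m] that ne by (simp add: Cm_iter_diff)
    show "continuous_on X \<phi>" if "\<phi> \<in> Cm m X" for \<phi> using that iter_diff_continuous by (simp add: Cm_iter_diff)
    show "(\<lambda>x. r) \<in> Cm m X" for r unfolding Cm_iter_diff iter_diff_def by (rule iter_diff2_const)
    show "(\<lambda>x. \<phi> x + \<psi> x) \<in> Cm m X" "(\<lambda>x. \<phi> x * \<psi> x) \<in> Cm m X" if "\<phi> \<in> Cm m X" "\<psi> \<in> Cm m X" for \<phi> \<psi>
      using that unfolding Cm_iter_diff iter_diff_def by (rule iter_diff2_add, rule iter_diff2_mult)
  qed (use X M \<tau> N0 \<epsilon> cc sp(1) in simp_all)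
  show ?thesis by (rule hessian_limit[OF refl refl x0])
qed

theorem theorem3p5:
  "(\<forall>(X :: 'a::metric_space set) c (\<epsilon>::real) \<mu> M (\<tau>::real).
      compact X \<and> continuous_on (X \<times> X) (\<lambda>(x, y). c x y) \<and>
      \<epsilon> > 0 \<and> admissible_cost X \<epsilon> c \<and>
      \<mu> \<in> radon_probs X \<and> \<tau> > 0 \<and> perturbation X (C0 X) (C0_norm X) \<tau> M \<and> M 0 = \<mu> \<longrightarrow>
      ((\<lambda>t. sinkhorn_div \<epsilon> c \<mu> (M t) / t\<^sup>2) \<longlongrightarrow>
        \<epsilon> / 2 * hessian_form X (C0 X) \<epsilon> c \<mu> (path_deriv M 0)) (at 0))
   \<and>
   (\<forall>(m::nat) (X :: 'b::euclidean_space set) U c (\<epsilon>::real) \<mu> M (\<tau>::real).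
      m \<ge> 1 \<and> open U \<and> bounded U \<and> X = closure U \<and> (\<lambda>(x, y). c x y) \<in> Cmm m X \<and>
      \<epsilon> > 0 \<and> admissible_cost X \<epsilon> c \<and>
      \<mu> \<in> radon_probs X \<and> \<tau> > 0 \<and> perturbation X (Cm m X) (Cm_norm m X) \<tau> M \<and> M 0 = \<mu> \<longrightarrow>
      ((\<lambda>t. sinkhorn_div \<epsilon> c \<mu> (M t) / t\<^sup>2) \<longlongrightarrow>
        \<epsilon> / 2 * hessian_form X (Cm m X) \<epsilon> c \<mu> (path_deriv M 0)) (at 0))"
proof (intro conjI allI impI; elim conjE)
  fix X :: "'a set" and c \<mu> and \<epsilon> \<tau> :: real and M
  assume h: "compact X" "continuous_on (X \<times> X) (\<lambda>(x, y). c x y)" "\<epsilon> > 0" "admissible_cost X \<epsilon> c" "\<tau> > 0"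
    "perturbation X (C0 X) (C0_norm X) \<tau> M" "M 0 = \<mu>"
  have "c x y = c y x" if "x \<in> X" "y \<in> X" for x y using h(4) that by (simp add: admissible_cost_def)
  from sinkhorn_hessian_C0[OF h(1-3) this h(5,6)]
  show "((\<lambda>t. sinkhorn_div \<epsilon> c \<mu> (M t) / t\<^sup>2) \<longlongrightarrow>
        \<epsilon> / 2 * hessian_form X (C0 X) \<epsilon> c \<mu> (path_deriv M 0)) (at 0)" by (simp add: h(7))
next
  fix m and X U :: "'b set" and c \<mu> and \<epsilon> \<tau> :: real and M
  assume h: "open U" "bounded U" "X = closure U" "(\<lambda>(x, y). c x y) \<in> Cmm m X" "\<epsilon> > 0" "admissible_cost X \<epsilon> c" "\<tau> > 0"
    "perturbation X (Cm m X) (Cm_norm m X) \<tau> M" "M 0 = \<mu>"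
  have X: "compact X" using h(2,3) by (simp add: compact_closure)
  \<comment> \<open>The open set lies in the interior of its closure, so \<open>X\<close> is the
    closure of its own interior; this density is what lets interior derivatives determine everything
    on \<open>X\<close>.\<close>
  have "U \<subseteq> interior X" using h(1,3) by (simp add: interior_maximal closure_subset)
  then have X2: "X \<subseteq> closure (interior X)" using h(3) closure_mono by blast
  have "continuous_partials (mixed_words m m) (X \<times> X) (\<lambda>(x, y). c x y)"
    using h(4) unfolding Cmm_def mixed_words_def by simp
  from iter_diff2_of_continuous_partials[OF X X2 this] have c: "iter_diff2 X m m c" by simp
  have "c x y = c y x" if "x \<in> X" "y \<in> X" for x y using h(6) that by (simp add: admissible_cost_def)
  from sinkhorn_hessian_Cm[OF X X2 c h(5) this h(7,8)]
  show "((\<lambda>t. sinkhorn_div \<epsilon> c \<mu> (M t) / t\<^sup>2) \<longlongrightarrow>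
        \<epsilon> / 2 * hessian_form X (Cm m X) \<epsilon> c \<mu> (path_deriv M 0)) (at 0)" by (simp add: h(9))
qed

end
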